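(* Let $\pi(\mathrm{d}x)=f(x)\,\mathrm{d}x$ be a probability measure on $\mathbb{R}$ with $f=e^{\phi}$, where $\phi:\mathbb{R}\to\mathbb{R}$ is continuous and everywhere differentiable, has finite Fisher information $\mathcal{I}=\int_{\mathbb{R}}|\phi'(x)|^2f(x)\,\mathrm{d}x<\infty$, and satisfies condition (H). Fix $\tau>0$. Then the forms $\Phi_n$ converge to $\Phi$ in the sense of Mosco, i.e. (M1) for all $h,h_1,h_2,\ldots\in H$ with $h_n\to h$ weakly in $H$, $\liminf_{n\to\infty}\Phi_n(h_n)\ge\Phi(h)$; and (M2) for every $h\in H$ there exist $h_1,h_2,\ldots\in H$ with $h_n\to h$ strongly in $H$ and $\limsup_{n\to\infty}\Phi_n(h_n)\le\Phi(h)$.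
   Context: Condition (H): there exist constants $k>0$, $0<\gamma<1$, $\alpha>1$ such that $|\phi'(x+v)-\phi'(x)|<k\max\{|v|^\gamma,|v|^\alpha\}$ for all $x,v\in\mathbb{R}$. Setting: $\mathbb{R}^\infty$ carries the product topology and Borel $\sigma$-algebra, with probability measure $\pi^{\otimes\infty}$; $H=L^2(\mathbb{R}^\infty,\pi^{\otimes\infty})$. Let $\mathbf{X}=(X_1,X_2,\ldots)$ be i.i.d. with law $\pi$, $\mathbf{W}=(W_1,W_2,\ldots)$ i.i.d. standard normal, $U\sim\mathrm{Uniform}(0,1)$, all independent. Write $X_{1:n}=(X_1,\dots,X_n)$, etc., and for a vector $y_{1:n}$ set $f(y_{1:n})=\prod_{i=1}^n f(y_i)$. Define $a(X_{1:n},W_{1:n})=1\wedge \frac{f(X_{1:n}+\frac{\tau}{\sqrt n}W_{1:n})}{f(X_{1:n})}$, $A_n=\mathbf 1(U<a(X_{1:n},W_{1:n}))$, $\mathbf{X}^{(n)}(0)=\mathbf X$ and $\mathbf{X}^{(n)}(1)=(X_1+A_n\frac{\tau}{\sqrt n}W_1,\dots,X_n+A_n\frac{\tau}{\sqrt n}W_n,X_{n+1},X_{n+2},\dots)$ (one step of the Metropolis–Hastings random walk on the first $n$ coordinates with $\mathcal N(0,\tau^2/n)$ proposals). For $h\in H$ define $\Phi_n(h)=\frac n2\mathbb{E}[(h(\mathbf X^{(n)}(1))-h(\mathbf X^{(n)}(0)))^2]$. Let $C^\infty_{0,N}(\mathbb{R}^\infty)$ denote smooth compactly supported functions depending only on the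 first $N$ coordinates, and let $S=W^{1,2}(\mathbb{R}^\infty,\pi^{\otimes\infty})$ be the closure of $\bigcup_{N}C^\infty_{0,N}(\mathbb{R}^\infty)$ in $H$ under the norm $\|h\|_S^2=\int(|h|^2+\sum_{i=1}^N|\partial_i h|^2)\,\mathrm d\pi^{\otimes N}$ (for $h$ depending on the first $N$ coordinates); for $h\in S$, $\nabla h:\mathbb{R}^\infty\to\ell^2$ is the continuous extension of the gradient (a.e. unique, with $\langle\nabla h,e^{(i)}\rangle=\partial_ih$). Let $c(\tau)=\mathbb{E}[1\wedge\exp(Z)]$ with $Z\sim\mathcal N(-\tfrac{\tau^2}{2}\mathcal I,\tau^2\mathcal I)$, equivalently $c(\tau)=2F(-\tfrac12\tau\sqrt{\mathcal I})$ with $F$ the standard normal distribution function. Define $\Phi(h)=\frac12\tau^2c(\tau)\,\mathbb{E}[\|\nabla h(\mathbf X)\|_{\ell^2}^2]$ for $h\in S$ and $\Phi(h)=\infty$ for $h\in H\setminus S$.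
   Formalization: Condition (H) is required only for v ≠ 0, because at v = 0 the strict inequality as written reads 0 < 0 and no φ could satisfy it. *)

theory Defs
  imports "HOL-Probability.Probability"
begin

definition target :: "(real \<Rightarrow> real) \<Rightarrow> real measure" where
  "target \<phi> = density lborel (\<lambda>x. ennreal (exp (\<phi> x)))"

definition fisher_info :: "(real \<Rightarrow> real) \<Rightarrow> real" where
  "fisher_info \<phi> = (\<integral>x. (deriv \<phi> x)\<^sup>2 * exp (\<phi> x) \<partial>lborel)"

text \<open>Condition (H); the strict inequality is only meaningful for v \<noteq> 0.\<close>
definition condH :: "(real \<Rightarrow> real) \<Rightarrow> bool" where
  "condH \<phi> \<longleftrightarrow> (\<exists>k \<gamma> \<alpha>. k > 0 \<and> 0 < \<gamma> \<and> \<gamma> < 1 \<and> \<alpha> > 1 \<and>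
     (\<forall>x v. v \<noteq> 0 \<longrightarrow>
        \<bar>deriv \<phi> (x + v) - deriv \<phi> x\<bar> < k * max (\<bar>v\<bar> powr \<gamma>) (\<bar>v\<bar> powr \<alpha>)))"

definition prod_target :: "(real \<Rightarrow> real) \<Rightarrow> (nat \<Rightarrow> real) measure" where
  "prod_target \<phi> = (\<Pi>\<^sub>M i\<in>UNIV. target \<phi>)"

definition std_gauss :: "real measure" where
  "std_gauss = density lborel (\<lambda>x. ennreal (std_normal_density x))"

definition normal_cdf :: "real \<Rightarrow> real" where
  "normal_cdf x = measure std_gauss {..x}"

definition c_tau :: "(real \<Rightarrow> real) \<Rightarrow> real \<Rightarrow> real" where
  "c_tau \<phi> \<tau> = 2 * normal_cdf (- (1/2) * \<tau> * sqrt (fisher_info \<phi>))"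

definition inH :: "(real \<Rightarrow> real) \<Rightarrow> ((nat \<Rightarrow> real) \<Rightarrow> real) \<Rightarrow> bool" where
  "inH \<phi> h \<longleftrightarrow> h \<in> borel_measurable (prod_target \<phi>) \<and>
      (\<integral>\<^sup>+x. ennreal ((h x)\<^sup>2) \<partial>prod_target \<phi>) < \<infinity>"

definition weak_conv ::
  "(real \<Rightarrow> real) \<Rightarrow> (nat \<Rightarrow> (nat \<Rightarrow> real) \<Rightarrow> real) \<Rightarrow> ((nat \<Rightarrow> real) \<Rightarrow> real) \<Rightarrow> bool" where
  "weak_conv \<phi> hs h \<longleftrightarrow> (\<forall>g. inH \<phi> g \<longrightarrow>
      (\<lambda>n. \<integral>x. hs n x * g x \<partial>prod_target \<phi>) \<longlonglongrightarrow> (\<integral>x. h x * g x \<partial>prod_target \<phi>))"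

definition strong_conv ::
  "(real \<Rightarrow> real) \<Rightarrow> (nat \<Rightarrow> (nat \<Rightarrow> real) \<Rightarrow> real) \<Rightarrow> ((nat \<Rightarrow> real) \<Rightarrow> real) \<Rightarrow> bool" where
  "strong_conv \<phi> hs h \<longleftrightarrow>
      (\<lambda>n. \<integral>\<^sup>+x. ennreal ((hs n x - h x)\<^sup>2) \<partial>prod_target \<phi>) \<longlonglongrightarrow> 0"

definition proposal :: "real \<Rightarrow> nat \<Rightarrow> (nat \<Rightarrow> real) \<Rightarrow> (nat \<Rightarrow> real) \<Rightarrow> (nat \<Rightarrow> real)" where
  "proposal \<tau> n x w = (\<lambda>i. if i < n then x i + \<tau> / sqrt (real n) * w i else x i)"

definition accept_prob ::
  "(real \<Rightarrow> real) \<Rightarrow> real \<Rightarrow> nat \<Rightarrow> (nat \<Rightarrow> real) \<Rightarrow> (nat \<Rightarrow> real) \<Rightarrow> real" where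
  "accept_prob \<phi> \<tau> n x w =
     min 1 ((\<Prod>i<n. exp (\<phi> (proposal \<tau> n x w i))) / (\<Prod>i<n. exp (\<phi> (x i))))"

definition mh_step ::
  "(real \<Rightarrow> real) \<Rightarrow> real \<Rightarrow> nat \<Rightarrow> (nat \<Rightarrow> real) \<Rightarrow> (nat \<Rightarrow> real) \<Rightarrow> real \<Rightarrow> (nat \<Rightarrow> real)" where
  "mh_step \<phi> \<tau> n x w u =
     (if u < accept_prob \<phi> \<tau> n x w then proposal \<tau> n x w else x)"

definition sample_space :: "(real \<Rightarrow> real) \<Rightarrow> ((nat \<Rightarrow> real) \<times> (nat \<Rightarrow> real) \<times> real) measure" where
  "sample_space \<phi> = prod_target \<phi> \<Otimes>\<^sub>M ((\<Pi>\<^sub>M i\<in>UNIV. std_gauss) \<Otimes>\<^sub>M uniform_measure lborel {0<..<1})"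

definition Phi_n ::
  "(real \<Rightarrow> real) \<Rightarrow> real \<Rightarrow> nat \<Rightarrow> ((nat \<Rightarrow> real) \<Rightarrow> real) \<Rightarrow> ennreal" where
  "Phi_n \<phi> \<tau> n h = ennreal (real n / 2) *
     (\<integral>\<^sup>+\<omega>. ennreal ((h (mh_step \<phi> \<tau> n (fst \<omega>) (fst (snd \<omega>)) (snd (snd \<omega>))) - h (fst \<omega>))\<^sup>2)
        \<partial>sample_space \<phi>)"

definition partial :: "nat \<Rightarrow> ((nat \<Rightarrow> real) \<Rightarrow> real) \<Rightarrow> (nat \<Rightarrow> real) \<Rightarrow> real" where
  "partial i h x = deriv (\<lambda>t. h (x(i := t))) (x i)"

definition depends_first :: "nat \<Rightarrow> ((nat \<Rightarrow> real) \<Rightarrow> real) \<Rightarrow> bool" where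
  "depends_first N h \<longleftrightarrow> (\<forall>x y. (\<forall>i<N. x i = y i) \<longrightarrow> h x = h y)"

coinductive smoothN :: "nat \<Rightarrow> ((nat \<Rightarrow> real) \<Rightarrow> real) \<Rightarrow> bool" for N where
  "depends_first N h \<Longrightarrow> continuous_on UNIV h \<Longrightarrow>
   (\<forall>i<N. (\<forall>x. ((\<lambda>t. h (x(i := t))) has_real_derivative partial i h x) (at (x i)))
            \<and> smoothN N (partial i h)) \<Longrightarrow> smoothN N h"

definition C0inf :: "nat \<Rightarrow> ((nat \<Rightarrow> real) \<Rightarrow> real) set" where
  "C0inf N = {h. smoothN N h \<and> (\<exists>R. \<forall>x. h x \<noteq> 0 \<longrightarrow> (\<forall>i<N. \<bar>x i\<bar> \<le> R))}"

definition is_grad ::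
  "(real \<Rightarrow> real) \<Rightarrow> ((nat \<Rightarrow> real) \<Rightarrow> real) \<Rightarrow> ((nat \<Rightarrow> real) \<Rightarrow> nat \<Rightarrow> real) \<Rightarrow> bool" where
  "is_grad \<phi> h G \<longleftrightarrow> inH \<phi> h \<and> (\<forall>i. (\<lambda>x. G x i) \<in> borel_measurable (prod_target \<phi>)) \<and>
     (\<exists>hs Ns. (\<forall>k. hs k \<in> C0inf (Ns k)) \<and>
        (\<lambda>k. \<integral>\<^sup>+x. ennreal ((hs k x - h x)\<^sup>2) \<partial>prod_target \<phi>) \<longlonglongrightarrow> 0 \<and>
        (\<lambda>k. \<integral>\<^sup>+x. (\<Sum>i. ennreal ((partial i (hs k) x - G x i)\<^sup>2)) \<partial>prod_target \<phi>) \<longlonglongrightarrow> 0)"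

definition inS :: "(real \<Rightarrow> real) \<Rightarrow> ((nat \<Rightarrow> real) \<Rightarrow> real) \<Rightarrow> bool" where
  "inS \<phi> h \<longleftrightarrow> (\<exists>G. is_grad \<phi> h G)"

definition grad_energy :: "(real \<Rightarrow> real) \<Rightarrow> ((nat \<Rightarrow> real) \<Rightarrow> real) \<Rightarrow> ennreal" where
  "grad_energy \<phi> h = (\<integral>\<^sup>+x. (\<Sum>i. ennreal (((SOME G. is_grad \<phi> h G) x i)\<^sup>2)) \<partial>prod_target \<phi>)"

definition Phi_lim :: "(real \<Rightarrow> real) \<Rightarrow> real \<Rightarrow> ((nat \<Rightarrow> real) \<Rightarrow> real) \<Rightarrow> ennreal" where
  "Phi_lim \<phi> \<tau> h = (if inS \<phi> h then ennreal (1/2 * \<tau>\<^sup>2 * c_tau \<phi> \<tau>) * grad_energy \<phi> h else \<infinity>)"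

end

theory Submission
  imports Defs
begin

text \<open>
  For test fields \<open>\<xi>\<^sub>1, \<dots>, \<xi>\<^sub>M\<close> the form \<open>\<Phi>\<^sub>n(h)\<close> dominates the pairing of the scaled increments of h with
  \<open>\<tau> \<Sum>\<^sub>i \<xi>\<^sub>i(X) W\<^sub>i\<close>, minus half the square of the latter. Reversibility moves the increment onto the
  fields; by a central limit theorem for the log acceptance ratio the resulting functions converge in
  \<open>L\<^sup>2\<close> to \<open>c(\<tau>)\<close> times the adjoint fields \<open>\<partial>\<^sub>i \<xi>\<^sub>i + \<phi>'(x\<^sub>i) \<xi>\<^sub>i\<close>, so weak convergence of \<open>h\<^sub>n\<close> suffices to
  pass to the limit. If the lower limit is finite, scaling the fields and the Riesz representation give a
  weak gradient of h, and mollifying with kernels whose Schur norms stay bounded as the number of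
  coordinates grows shows that h lies in the Sobolev space; taking the fields close to the gradient
  gives the sharp constant. For the upper bound, \<open>\<Phi>\<^sub>n(u) \<rightarrow> \<Phi>(u)\<close> for smooth cylinder functions u, and a
  diagonal sequence does the rest.
\<close>

section \<open>Square integrable functions\<close>

text \<open>Under (H) the derivative of \<phi> has only a Hoelder type modulus, so the mean of the
  log acceptance ratio cannot be read off a second order Taylor expansion. Detailed balance in a
  single coordinate exhibits this mean as a second order quantity; n times it tends to
  -\<sigma>^2/2.

  The constant c enters in two ways. It is the limiting mean acceptance probability, and, since Z
  has mean minus half its variance, the mean slope of 1 \<and> exp at Z is exactly c/2. The slope
  produces the drift term, which is met once at each end of a move. Derivative and drift thus carry
  the same factor c, and the limit is c times an adjoint for the target law. The kink of 1 \<and>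
  exp is treated by Lipschitz cutoffs at a scale e, where n goes to infinity before e goes to 0.

  The limit space is a closure of smooth functions, so a weak gradient must be approximated by them.
  Mollifying one coordinate costs a factor exp(1/(N+1)) in one of the two Schur bounds, hence N
  coordinates cost at most e; the cutoff radius grows after N is fixed, which removes the
  commutators.\<close>

definition sqi :: "'a measure => ('a => real) set" where
  "sqi M = {f \<in> borel_measurable M. integrable M (%x. (f x)^2)}"

text \<open>The Bochner integral of a non-integrable square is 0, so this measures size only on
  \<open>sqi\<close>; the norm inequalities below therefore assume membership.\<close>

definition l2 :: "'a measure => ('a => real) => real" where
  "l2 M f = sqrt (LINT x|M. (f x)^2)"

lemma sqiI: "f \<in> borel_measurable M ==> integrable M (%x. (f x)^2) ==> f \<in> sqi M"
  by (simp add: sqi_def)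

lemma sqi_meas[measurable_dest]: "f \<in> sqi M ==> f \<in> borel_measurable M"
  and sqi_int: "f \<in> sqi M ==> integrable M (%x. (f x)^2)"
  by (auto simp: sqi_def)

lemma sqi_mult_integrable:
  assumes f: "f \<in> sqi M" and g: "g \<in> sqi M"
  shows "integrable M (%x. f x * g x)"
proof (rule Bochner_Integration.integrable_bound)
  show "integrable M (%x. (f x)^2 + (g x)^2)"
    using sqi_int[OF f] sqi_int[OF g] by simp
  show "(%x. f x * g x) \<in> borel_measurable M"
    using sqi_meas[OF f] sqi_meas[OF g] by simp
  have "abs (a * b) <= a\<^sup>2 + b\<^sup>2" for a b :: real
  proof -
    have "2 * abs (a * b) <= a\<^sup>2 + b\<^sup>2"
      using zero_le_power2[of "abs a - abs b"] by (simp add: power2_diff abs_mult)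
    then show ?thesis by simp
  qed
  then show "AE x in M. norm (f x * g x) <= norm ((f x)^2 + (g x)^2)"
    by (intro AE_I2) auto
qed

lemma sqi_scale: "f \<in> sqi M ==> (%x. c * f x) \<in> sqi M"
  by (auto simp: sqi_def power_mult_distrib)

lemma sqi_add:
  assumes f: "f \<in> sqi M" and g: "g \<in> sqi M"
  shows "(%x. f x + g x) \<in> sqi M"
proof (rule sqiI)
  show "(%x. f x + g x) \<in> borel_measurable M"
    using sqi_meas[OF f] sqi_meas[OF g] by simp
  have "integrable M (%x. (f x)^2 + (g x)^2 + 2 * (f x * g x))"
    using sqi_int[OF f] sqi_int[OF g] sqi_mult_integrable[OF f g] by simp
  then show "integrable M (%x. (f x + g x)^2)"
    by (simp add: power2_sum mult_ac)
qed

lemma sqi_diff: "f \<in> sqi M ==> g \<in> sqi M ==> (%x. f x - g x) \<in> sqi M"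
  using sqi_add[of f M "%x. (-1) * g x"] sqi_scale[of g M "-1"] by simp

lemma sqi_zero: "(%x. 0) \<in> sqi M"
  by (simp add: sqi_def)

lemma sqi_sum: "(!!i. i \<in> I ==> f i \<in> sqi M) ==> (%x. \<Sum>i\<in>I. f i x) \<in> sqi M"
  by (induction I rule: infinite_finite_induct) (auto intro: sqi_zero sqi_add)

lemma sqi_bounded_mult:
  assumes f: "f \<in> sqi M" and g: "g \<in> borel_measurable M" and b: "!!x. abs (g x) <= C"
  shows "(%x. g x * f x) \<in> sqi M"
proof (rule sqiI)
  show "(%x. g x * f x) \<in> borel_measurable M"
    using g sqi_meas[OF f] by simp
  show "integrable M (%x. (g x * f x)^2)"
  proof (rule Bochner_Integration.integrable_bound[where f = "%x. C\<^sup>2 * (f x)^2"])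
    show "integrable M (%x. C\<^sup>2 * (f x)^2)" using sqi_int[OF f] by simp
    show "(%x. (g x * f x)^2) \<in> borel_measurable M" using g sqi_meas[OF f] by simp
    have "(g x)^2 <= C\<^sup>2" for x
      using b[of x] by (metis abs_ge_zero power2_abs power_mono)
    then show "AE x in M. norm ((g x * f x)^2) <= norm (C\<^sup>2 * (f x)^2)"
      by (intro AE_I2) (simp add: power_mult_distrib mult_right_mono)
  qed
qed

lemma (in finite_measure) sqi_bounded:
  assumes "f \<in> borel_measurable M" "!!x. abs (f x) <= C"
  shows "f \<in> sqi M"
proof -
  have "(%x. 1) \<in> sqi M" by (simp add: sqi_def)
  from sqi_bounded_mult[OF this assms] show ?thesis by simp
qed

lemma (in finite_measure) sqi_integrable: "f \<in> sqi M ==> integrable M f"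
proof -
  assume f: "f \<in> sqi M"
  have "(%x. 1) \<in> sqi M" by (rule sqi_bounded[where C=1]) auto
  from sqi_mult_integrable[OF f this] show "integrable M f" by simp
qed

lemma l2_nonneg[simp]: "0 <= l2 M f"
  by (simp add: l2_def)

lemma l2_sq: "(l2 M f)^2 = (LINT x|M. (f x)^2)"
  by (simp add: l2_def)

lemma l2_scale: "l2 M (%x. c * f x) = abs c * l2 M f"
  by (simp add: l2_def power_mult_distrib real_sqrt_mult)

lemma l2_minus_commute: "l2 M (%x. f x - g x) = l2 M (%x. g x - f x)"
  by (simp add: l2_def power2_commute)

lemma l2_expand:
  assumes f: "f \<in> sqi M" and g: "g \<in> sqi M"
  shows "(LINT x|M. (a * f x + b * g x)^2)
    = a\<^sup>2 * (LINT x|M. (f x)^2) + 2 * a * b * (LINT x|M. f x * g x) + b\<^sup>2 * (LINT x|M. (g x)^2)"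
proof -
  have "(LINT x|M. (a * f x + b * g x)^2)
    = (LINT x|M. a\<^sup>2 * (f x)^2 + 2 * a * b * (f x * g x) + b\<^sup>2 * (g x)^2)"
    by (intro Bochner_Integration.integral_cong refl) (simp add: power2_eq_square algebra_simps)
  also have "... = a\<^sup>2 * (LINT x|M. (f x)^2) + 2 * a * b * (LINT x|M. f x * g x) + b\<^sup>2 * (LINT x|M. (g x)^2)"
    using sqi_int[OF f] sqi_int[OF g] sqi_mult_integrable[OF f g] by simp
  finally show ?thesis .
qed

text \<open>The quadratic form with coefficients A, B, C is nonnegative. For C > 0 the choice a = C,
  b = -B gives the discriminant inequality; for C = 0 the form is affine in b, which forces B =
  0.\<close>

lemma l2_Cauchy_Schwarz:
  assumes f: "f \<in> sqi M" and g: "g \<in> sqi M"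
  shows "abs (\<integral>x. f x * g x \<partial>M) <= l2 M f * l2 M g"
proof -
  let ?A = "\<integral>x. (f x)^2 \<partial>M" and ?B = "\<integral>x. f x * g x \<partial>M" and ?C = "\<integral>x. (g x)^2 \<partial>M"
  have nn: "0 <= a\<^sup>2 * ?A + 2 * a * b * ?B + b\<^sup>2 * ?C" for a b
    unfolding l2_expand[OF f g, symmetric] by simp
  have C0: "0 <= ?C" and A0: "0 <= ?A" by auto
  have "?B\<^sup>2 <= ?A * ?C"
  proof (cases "?C = 0")
    case False
    have "0 <= ?C\<^sup>2 * ?A + 2 * ?C * (- ?B) * ?B + (- ?B)^2 * ?C"
      using nn[of ?C "- ?B"] .
    also have "... = ?C * (?A * ?C - ?B\<^sup>2)"
      by (simp add: power2_eq_square algebra_simps)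
    finally show ?thesis
      using False C0 by (simp add: zero_le_mult_iff)
  next
    case True
    have "?B = 0"
    proof (rule ccontr)
      assume "?B \<noteq> 0"
      have "0 <= 1\<^sup>2 * ?A + 2 * 1 * (- (?A + 1) / (2 * ?B)) * ?B + (- (?A + 1) / (2 * ?B))^2 * ?C"
        by (rule nn)
      then show False using \<open>?B \<noteq> 0\<close> True by (simp add: field_simps)
    qed
    then show ?thesis using True by simp
  qed
  then have "sqrt (?B\<^sup>2) <= sqrt (?A * ?C)" by (rule real_sqrt_le_mono)
  then show ?thesis by (simp only: l2_def real_sqrt_mult[symmetric] real_sqrt_abs)
qed

lemma l2_triangle:
  assumes f: "f \<in> sqi M" and g: "g \<in> sqi M"
  shows "l2 M (%x. f x + g x) <= l2 M f + l2 M g"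
proof -
  have "(l2 M (%x. f x + g x))^2 = (l2 M f)^2 + 2 * (LINT x|M. f x * g x) + (l2 M g)^2"
    using l2_expand[OF f g, of 1 1] by (simp add: l2_sq)
  also have "... <= (l2 M f)^2 + 2 * (l2 M f * l2 M g) + (l2 M g)^2"
    using l2_Cauchy_Schwarz[OF f g] by simp
  also have "... = (l2 M f + l2 M g)^2" by (simp add: power2_sum)
  finally show ?thesis by (rule power2_le_imp_le) simp
qed

lemma l2_triangle_diff:
  assumes "f \<in> sqi M" "g \<in> sqi M" "h \<in> sqi M"
  shows "l2 M (%x. f x - h x) <= l2 M (%x. f x - g x) + l2 M (%x. g x - h x)"
  using l2_triangle[OF sqi_diff[OF assms(1,2)] sqi_diff[OF assms(2,3)]] by simp

lemma sqi_iff_nn_integral: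
  "f \<in> sqi M \<longleftrightarrow> f \<in> borel_measurable M \<and> (\<integral>\<^sup>+x. ennreal ((f x)^2) \<partial>M) < \<infinity>"
proof -
  have "integrable M (%x. (f x)^2) \<longleftrightarrow> (\<integral>\<^sup>+x. ennreal ((f x)^2) \<partial>M) < \<infinity>" if "f \<in> borel_measurable M"
    using that by (simp add: integrable_iff_bounded)
  then show ?thesis by (auto simp: sqi_def)
qed

lemma nn_integral_sq_eq: "f \<in> sqi M ==> (\<integral>\<^sup>+x. ennreal ((f x)^2) \<partial>M) = ennreal ((l2 M f)^2)"
  unfolding l2_sq by (intro nn_integral_eq_integral sqi_int) auto

section \<open>Limits in L2: completeness, Riesz representation, uniform boundedness\<close>

lemma l2_tendsto_inner:
  assumes F: "!!k. F k \<in> sqi M" and G: "G \<in> sqi M" and v: "v \<in> sqi M"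
    and lim: "(%k. l2 M (%x. F k x - G x)) \<longlonglongrightarrow> 0"
  shows "(%k. \<integral>x. F k x * v x \<partial>M) \<longlonglongrightarrow> (LINT x|M. G x * v x)"
proof (rule Lim_null[THEN iffD2], rule Lim_null_comparison[OF always_eventually, OF allI])
  fix k
  have "(LINT x|M. F k x * v x) - (LINT x|M. G x * v x) = (LINT x|M. (F k x - G x) * v x)"
    using sqi_mult_integrable[OF F v] sqi_mult_integrable[OF G v] by (simp add: left_diff_distrib)
  also have "abs ... <= l2 M (%x. F k x - G x) * l2 M v"
    by (rule l2_Cauchy_Schwarz[OF sqi_diff[OF F G] v])
  finally show "norm ((LINT x|M. F k x * v x) - (LINT x|M. G x * v x)) <= l2 M (%x. F k x - G x) * l2 M v"
    by simp
next
  show "(%k. l2 M (%x. F k x - G x) * l2 M v) \<longlonglongrightarrow> 0"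
    using tendsto_mult_right[OF lim, of "l2 M v"] by simp
qed

text \<open>Riesz--Fischer with a rate. Steps that shrink geometrically in norm are summable almost
  everywhere, and Fatou's lemma carries the bound on telescoping sums over to the distance from the
  limit. The 2 is the geometric sum for a ratio of at most 1/2.\<close>

lemma l2_complete:
  assumes F: "!!k. F k \<in> sqi M"
    and d: "!!k. l2 M (%x. F (Suc k) x - F k x) <= c * r ^ k"
    and r: "0 < r" "r <= 1/2"
  shows "\<exists>G \<in> sqi M. \<forall>k. l2 M (%x. F k x - G x) <= 2 * c * r ^ k"
proof -
  have [measurable]: "F k \<in> borel_measurable M" for k using F by (simp add: sqi_def)
  define D where "D k x = F (Suc k) x - F k x" for k x
  have Dsqi: "D k \<in> sqi M" for k
    unfolding D_def by (intro sqi_diff F)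
  have [measurable]: "D k \<in> borel_measurable M" for k using Dsqi by (simp add: sqi_def)
  have c0: "0 <= c" using order.trans[OF l2_nonneg d[of 0]] by simp
  have rk: "(r ^ k)^2 <= (1/4) ^ k" for k
  proof -
    have "(r ^ k)^2 = (r\<^sup>2) ^ k" by (simp add: power_mult[symmetric] mult.commute)
    also have "... <= (1/4) ^ k"
      using r mult_mono[of r "1/2" r "1/2"] by (intro power_mono) (auto simp: power2_eq_square)
    finally show ?thesis .
  qed
  \<comment> \<open>The weight \<open>2 ^ k\<close> still leaves a convergent series because
    \<open>r\<^sup>2 <= 1/4\<close>. Where the weighted sum is finite, the k-th step is at most a
    multiple of \<open>sqrt (1/2) ^ k\<close>, which is summable.\<close>
  have Dn: "(\<integral>\<^sup>+x. ennreal (2 ^ k * (D k x)^2) \<partial>M) <= ennreal (c\<^sup>2 * (1/2) ^ k)" for k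
  proof -
    have "(\<integral>\<^sup>+x. ennreal (2 ^ k * (D k x)^2) \<partial>M) = ennreal (2 ^ k) * (\<integral>\<^sup>+x. ennreal ((D k x)^2) \<partial>M)"
      by (subst nn_integral_cmult[symmetric]) (auto simp: ennreal_mult)
    also have "... = ennreal (2 ^ k * (l2 M (D k))^2)"
      by (simp add: nn_integral_sq_eq[OF Dsqi] ennreal_mult)
    also have "... <= ennreal (2 ^ k * (c\<^sup>2 * (1/4) ^ k))"
    proof (intro ennreal_leI mult_left_mono)
      have "(l2 M (D k))^2 <= (c * r ^ k)^2"
        using d[of k] unfolding D_def by (intro power_mono) auto
      also have "... <= c\<^sup>2 * (1/4) ^ k"
        using rk[of k] by (simp add: power_mult_distrib mult_left_mono)
      finally show "(l2 M (D k))^2 <= c\<^sup>2 * (1/4) ^ k" .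
    qed simp
    also have "2 ^ k * (c\<^sup>2 * (1/4::real) ^ k) = c\<^sup>2 * (1/2) ^ k"
    proof -
      have e2: "2 * (1/4) = (1/2::real)" by simp
      have e: "(2::real) ^ k * (1/4) ^ k = (1/2) ^ k" by (subst power_mult_distrib[symmetric], subst e2, rule refl)
      show ?thesis by (subst mult.left_commute, subst e, rule refl)
    qed
    finally show ?thesis .
  qed
  have "(\<integral>\<^sup>+x. (\<Sum>k. ennreal (2 ^ k * (D k x)^2)) \<partial>M) = (\<Sum>k. \<integral>\<^sup>+x. ennreal (2 ^ k * (D k x)^2) \<partial>M)"
    by (intro nn_integral_suminf) auto
  also have "... <= (\<Sum>k. ennreal (c\<^sup>2 * (1/2) ^ k))"
    by (intro suminf_le Dn) auto
  also have "... < \<infinity>"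
  proof -
    have "summable (%k. c\<^sup>2 * (1/2::real) ^ k)" by (intro summable_mult summable_geometric) simp
    then have "(\<Sum>k. ennreal (c\<^sup>2 * (1/2) ^ k)) \<noteq> \<top>" by (rule ennreal_suminf_neq_top) simp
    then show ?thesis by (simp only: top.not_eq_extremum infinity_ennreal_def)
  qed
  finally have "AE x in M. (\<Sum>k. ennreal (2 ^ k * (D k x)^2)) \<noteq> \<infinity>"
    by (intro nn_integral_PInf_AE) auto
  then have conv: "AE x in M. convergent (%k. F k x)"
  proof eventually_elim
    case (elim x)
    have "\<exists>B. \<forall>k. 2 ^ k * (D k x)^2 <= B"
    proof -
      obtain B where B: "(\<Sum>k. ennreal (2 ^ k * (D k x)^2)) = ennreal B" "0 <= B"
      proof -
        have "\<exists>B. z = ennreal B \<and> 0 <= B" if "z \<noteq> \<infinity>" for z :: ennreal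
          using that by (cases z) auto
        from this[OF elim] show ?thesis using that by blast
      qed
      have "ennreal (2 ^ k * (D k x)^2) <= ennreal B" for k
      proof -
        have "sum f {k} <= suminf f" for f :: "nat => ennreal" by (rule sum_le_suminf) auto
        then have "f k <= suminf f" for f :: "nat => ennreal" by simp
        then show ?thesis unfolding B(1)[symmetric] .
      qed
      then show ?thesis using B(2) by (auto simp: ennreal_le_iff)
    qed
    then obtain B where B: "!!k. 2 ^ k * (D k x)^2 <= B" by auto
    have "abs (D k x) <= sqrt B * (sqrt (1/2)) ^ k" for k
    proof -
      have "(D k x)^2 <= B * (1/2) ^ k" using B[of k] by (simp add: field_simps)
      then have "sqrt ((D k x)^2) <= sqrt (B * (1/2) ^ k)" by (rule real_sqrt_le_mono)
      then show ?thesis by (simp only: real_sqrt_abs) (simp only: real_sqrt_mult real_sqrt_power)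
    qed
    then have Dle: "norm (D k x) <= sqrt B * (sqrt (1/2)) ^ k" for k
      by (simp only: real_norm_def)
    have "norm (sqrt (1/2)) < 1" by (simp add: real_sqrt_divide)
    then have "summable (%k. sqrt B * (sqrt (1/2)) ^ k)"
      by (intro summable_mult summable_geometric)
    then have "summable (%k. D k x)"
      by (rule summable_comparison_test'[where N=0]) (rule Dle)
    then have "convergent (%n. \<Sum>k<n. D k x)" by (simp add: summable_iff_convergent)
    moreover have "(\<Sum>k<n. D k x) = F n x - F 0 x" for n
      unfolding D_def by (rule sum_lessThan_telescope)
    ultimately have "convergent (%n. F n x - F 0 x)" by simp
    from convergent_add[OF this convergent_const[of "F 0 x"]] show ?case by simp
  qed
  define G where "G x = lim (%k. F k x)" for x
  have [measurable]: "G \<in> borel_measurable M" unfolding G_def by measurable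
  have GA: "AE x in M. (%k. F k x) \<longlonglongrightarrow> G x"
    using conv by eventually_elim (simp add: G_def convergent_LIMSEQ_iff)
  have step: "l2 M (%x. F (k + j) x - F k x) <= c * r ^ k * (\<Sum>i<j. r ^ i)" for k j
  proof (induction j)
    case 0 then show ?case by (simp add: l2_def)
  next
    case (Suc j)
    have "l2 M (%x. F (k + Suc j) x - F k x)
      <= l2 M (%x. F (k + Suc j) x - F (k + j) x) + l2 M (%x. F (k + j) x - F k x)"
      by (rule l2_triangle_diff[OF F F F])
    also have "... <= c * r ^ (k + j) + c * r ^ k * (\<Sum>i<j. r ^ i)"
      using Suc d[of "k + j"] by simp
    finally show ?case by (simp add: power_add algebra_simps)
  qed
  have geo: "(\<Sum>i<j. r ^ i) <= 2" for j
  proof -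
    have "(\<Sum>i<j. r ^ i) <= (\<Sum>i<j. (1/2) ^ i)"
      using r by (intro sum_mono power_mono) auto
    also have "... = 2 - 2 * (1/2) ^ j" by (subst geometric_sum) (auto simp: field_simps)
    also have "... <= 2" by simp
    finally show ?thesis .
  qed
  have bnd: "(\<integral>\<^sup>+x. ennreal ((F k x - G x)^2) \<partial>M) <= ennreal ((2 * c * r ^ k)^2)" for k
  proof -
    have "(\<integral>\<^sup>+x. ennreal ((F k x - G x)^2) \<partial>M)
       = (\<integral>\<^sup>+x. liminf (%j. ennreal ((F (k + j) x - F k x)^2)) \<partial>M)"
    proof (rule nn_integral_cong_AE)
      show "AE x in M. ennreal ((F k x - G x)^2) = liminf (%j. ennreal ((F (k + j) x - F k x)^2))"
        using GA
      proof eventually_elim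
        case (elim x)
        have "(%j. F (k + j) x) \<longlonglongrightarrow> G x"
          using LIMSEQ_ignore_initial_segment[OF elim, of k] by (simp add: add.commute)
        then have "(%j. ennreal ((F (k + j) x - F k x)^2)) \<longlonglongrightarrow> ennreal ((G x - F k x)^2)"
          by (intro tendsto_ennrealI tendsto_intros)
        then show ?case
          unfolding power2_commute[of "F k x"] by (rule lim_imp_Liminf[OF sequentially_bot, symmetric])
      qed
    qed
    also have "... <= liminf (%j. \<integral>\<^sup>+x. ennreal ((F (k + j) x - F k x)^2) \<partial>M)"
      by (intro nn_integral_liminf) auto
    also have "... <= liminf (%j. ennreal ((2 * c * r ^ k)^2))"
    proof (intro Liminf_mono always_eventually allI)
      fix j
      have "l2 M (%x. F (k + j) x - F k x) <= c * r ^ k * 2"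
        using step[of k j] geo[of j] c0 r
        by (meson mult_left_mono mult_nonneg_nonneg order.trans zero_le_power less_imp_le)
      then show "(\<integral>\<^sup>+x. ennreal ((F (k + j) x - F k x)^2) \<partial>M) <= ennreal ((2 * c * r ^ k)^2)"
        unfolding nn_integral_sq_eq[OF sqi_diff[OF F F]]
        by (intro ennreal_leI power_mono) (auto simp: mult_ac)
    qed
    finally show ?thesis by (simp add: Liminf_const)
  qed
  have FG: "(%x. F k x - G x) \<in> sqi M" for k
    unfolding sqi_iff_nn_integral using le_less_trans[OF bnd[of k]] by simp
  have "(%x. F 0 x - (F 0 x - G x)) \<in> sqi M"
    by (rule sqi_diff[OF F FG])
  then have "G \<in> sqi M" by simp
  moreover have "l2 M (%x. F k x - G x) <= 2 * c * r ^ k" for k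
  proof -
    have "(l2 M (%x. F k x - G x))^2 <= (2 * c * r ^ k)^2"
      using bnd[of k] by (simp add: nn_integral_sq_eq[OF FG] ennreal_le_iff)
    then show ?thesis by (rule power2_le_imp_le) (use c0 r in auto)
  qed
  ultimately show ?thesis by blast
qed

lemma power_commutes_2: "(a ^ k)^2 = (a\<^sup>2) ^ k" for a :: real
  by (simp add: power_mult[symmetric] mult.commute)

text \<open>V is a linear space that need not be closed, so the representer is the limit of a
  maximising sequence of the concave functional l v - |v|^2/2. The conclusion keeps that sequence of
  elements of V: inserting it later yields the energy bound of the weak gradient.\<close>

lemma l2_riesz:
  assumes V: "V \<subseteq> sqi M" "v0 \<in> V"
    and lin: "!!a b u v. u \<in> V ==> v \<in> V ==> (%x. a * u x + b * v x) \<in> V"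
    and llin: "!!a b u v. u \<in> V ==> v \<in> V ==> l (%x. a * u x + b * v x) = a * l u + b * l v"
    and bnd: "!!v. v \<in> V ==> abs (l v) <= C * l2 M v"
  shows "\<exists>G \<in> sqi M. (\<exists>v. (\<forall>k. v k \<in> V) \<and> (%k. l2 M (%x. v k x - G x)) \<longlonglongrightarrow> 0)
    \<and> (\<forall>v\<in>V. l v = (LINT x|M. G x * v x))"
proof -
  define J where "J v = l v - (l2 M v)\<^sup>2 / 2" for v
  have Jle: "J v <= C\<^sup>2 / 2" if "v \<in> V" for v
  proof -
    have "J v <= C * l2 M v - (l2 M v)\<^sup>2 / 2"
      using bnd[OF that] by (simp add: J_def)
    also have "... <= C\<^sup>2 / 2"
      using zero_le_power2[of "C - l2 M v"] by (simp add: power2_diff)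
    finally show ?thesis .
  qed
  define s where "s = Sup (J ` V)"
  have bdd: "bdd_above (J ` V)" using Jle by (rule bdd_aboveI2)
  have Js: "J v <= s" if "v \<in> V" for v
    unfolding s_def using that bdd by (intro cSup_upper) auto
  \<comment> \<open>With this tolerance the parallelogram identity bounds the squared distance of
    consecutive near-maximisers by \<open>8 * e k = ((1/2) ^ k)\<^sup>2\<close>, the rate required
    by \<open>l2_complete\<close>.\<close>
  define e where "e k = (1/8) * (1/4::real) ^ k" for k
  have "\<exists>v\<in>V. s - e k < J v" for k
  proof -
    have "0 < e k" by (simp add: e_def)
    then have "s - e k < Sup (J ` V)" by (simp add: s_def)
    then show ?thesis using less_cSup_iff[of "J ` V" "s - e k"] bdd V(2) by auto
  qed
  then obtain v where v: "!!k. v k \<in> V" "!!k. s - e k < J (v k)" by metis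
  have vs: "v k \<in> sqi M" for k using v(1) V by auto
  have emono: "e (Suc k) <= e k" for k by (simp add: e_def)
  have d: "l2 M (%x. v (Suc k) x - v k x) <= 1 * (1/2) ^ k" for k
  proof -
    let ?u = "v (Suc k)" and ?w = "v k"
    have m: "(%x. (1/2) * ?u x + (1/2) * ?w x) \<in> V" by (intro lin v)
    have "J (%x. (1/2) * ?u x + (1/2) * ?w x) = (1/2) * J ?u + (1/2) * J ?w + (1/8) * (l2 M (%x. ?u x - ?w x))^2"
      using l2_expand[OF vs vs, of "1/2" "Suc k" "1/2" k] l2_expand[OF vs vs, of 1 "Suc k" "-1" k]
      unfolding J_def llin[OF v(1) v(1)] l2_sq by (simp add: power2_eq_square field_simps)
    with Js[OF m] have "(l2 M (%x. ?u x - ?w x))^2 <= 8 * e k"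
      using v(2)[of k] v(2)[of "Suc k"] emono[of k] by simp
    also have "... = ((1/2) ^ k)^2" 
    proof -
      have "((1/2::real) ^ k)^2 = ((1/2)^2) ^ k" by (rule power_commutes_2)
      then show ?thesis by (simp add: e_def power2_eq_square)
    qed
    finally have "l2 M (%x. ?u x - ?w x) <= (1/2) ^ k" by (rule power2_le_imp_le) simp
    then show ?thesis by simp
  qed
  from l2_complete[of v M 1 "1/2", OF vs d] obtain G where G: "G \<in> sqi M"
    and Gd: "!!k. l2 M (%x. v k x - G x) <= 2 * (1/2) ^ k" by auto
  have lim: "(%k. l2 M (%x. v k x - G x)) \<longlonglongrightarrow> 0"
  proof (rule Lim_null_comparison)
    show "\<forall>\<^sub>F k in sequentially. norm (l2 M (%x. v k x - G x)) <= 2 * (1/2) ^ k"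
      using Gd by auto
    show "(%k. 2 * (1/2::real) ^ k) \<longlonglongrightarrow> 0"
      by (intro tendsto_mult_right_zero LIMSEQ_power_zero) auto
  qed
  have e0: "e \<longlonglongrightarrow> 0"
    unfolding e_def by (intro tendsto_mult_right_zero LIMSEQ_power_zero) auto
  have "l u = (LINT x|M. G x * u x)" if u: "u \<in> V" for u
  proof -
    have us: "u \<in> sqi M" using u V by auto
    define q where "q = l u - (LINT x|M. G x * u x)"
    \<comment> \<open>First variation at the supremum: perturbing \<open>v k\<close> by t times u
      gains at most \<open>e k\<close>, and k goes to infinity. A linear function of t that is
      dominated by a multiple of \<open>t\<^sup>2\<close> vanishes.\<close>
    have key: "t * q <= t\<^sup>2 * (l2 M u)^2 / 2" for t
    proof -
      have "t * (l u - (LINT x|M. v k x * u x)) - t\<^sup>2 * (l2 M u)^2 / 2 <= e k" for k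
      proof -
        have "J (%x. 1 * v k x + t * u x) <= s" by (intro Js lin v u)
        moreover have "J (%x. 1 * v k x + t * u x) = J (v k) + t * (l u - (LINT x|M. v k x * u x)) - t\<^sup>2 * (l2 M u)^2 / 2"
          unfolding J_def llin[OF v(1) u] l2_sq l2_expand[OF vs us] by (simp add: field_simps)
        ultimately show ?thesis using v(2)[of k] by simp
      qed
      moreover have "(%k. t * (l u - (LINT x|M. v k x * u x)) - t\<^sup>2 * (l2 M u)^2 / 2)
         \<longlonglongrightarrow> t * q - t\<^sup>2 * (l2 M u)^2 / 2"
        unfolding q_def by (intro tendsto_intros l2_tendsto_inner vs G us lim)
      ultimately have "t * q - t\<^sup>2 * (l2 M u)^2 / 2 <= 0"
        by (intro LIMSEQ_le[OF _ e0]) auto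
      then show ?thesis by simp
    qed
    have "q = 0"
    proof (rule ccontr)
      assume "q \<noteq> 0"
      define L where "L = (l2 M u)^2"
      have L0: "0 <= L" by (simp add: L_def)
      have "q / (L + 1) * q <= (q / (L + 1))^2 * L / 2" using key[of "q / (L + 1)"] by (simp add: L_def)
      also have "... = q\<^sup>2 / (L + 1) * (L / (2 * (L + 1)))"
        using L0 by (simp add: power2_eq_square field_simps)
      also have "... < q\<^sup>2 / (L + 1) * 1"
        using L0 \<open>q \<noteq> 0\<close> by (intro mult_strict_left_mono) (auto simp: field_simps)
      finally show False by (simp add: power2_eq_square)
    qed
    then show ?thesis by (simp add: q_def)
  qed
  with G lim v(1) show ?thesis by blast
qed

text \<open>Gliding hump: the sign of each term \<open>8\<^sup>-\<^sup>k H\<^sub>k / \<parallel>H\<^sub>k\<parallel>\<close> of the test function is chosen so that it does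
  not cancel against the partial sum already built.\<close>

lemma l2_uniform_boundedness:
  assumes h: "!!n. h n \<in> sqi M"
    and bd: "!!g. g \<in> sqi M ==> Bseq (%n. \<integral>x. h n x * g x \<partial>M)"
  shows "\<exists>B. \<forall>n. l2 M (h n) <= B"
proof (rule ccontr)
  assume "\<not> ?thesis"
  \<comment> \<open>Weights (1/8)^(k+1) against norms above 16^k leave growth of order 2^k. All
    later terms change the k-th pairing by at most a quarter of its own contribution, hence the
    factor 3/4 below.\<close>
  then have "\<forall>k. \<exists>n. 16 ^ k < l2 M (h n)" by (auto simp: not_le)
  then obtain N where N: "!!k. 16 ^ k < l2 M (h (N k))" by metis
  define H where "H k = h (N k)" for k
  have Hs: "H k \<in> sqi M" for k by (simp add: H_def h)
  have Hp: "0 < l2 M (H k)" for k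
    using less_trans[OF _ N[of k], of 0] by (simp add: H_def)
  define y where "y k x = (1/8) ^ Suc k / l2 M (H k) * H k x" for k x
  define st where "st k F = (if abs (\<integral>x. H k x * (F x + y k x) \<partial>M) \<ge> (1/8) ^ Suc k * l2 M (H k)
     then (%x. F x + y k x) else (%x. F x - y k x))" for k and F :: "'a => real"
  define X where "X = rec_nat (%x. 0) st"
  have X0: "X 0 = (%x. 0)" and XS: "X (Suc k) = st k (X k)" for k by (auto simp: X_def)
  have ys: "y k \<in> sqi M" for k unfolding y_def by (intro sqi_scale Hs)
  have yn: "l2 M (y k) = (1/8) ^ Suc k" for k
    unfolding y_def l2_scale using Hp[of k] by simp
  have yn': "l2 M (%x. - y k x) = (1/8) ^ Suc k" for k
    using l2_scale[of M "-1" "y k"] yn[of k] by simp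
  have Xs: "X k \<in> sqi M" for k
    by (induction k) (auto simp: X0 XS st_def sqi_zero intro!: sqi_add sqi_diff ys)
  have d: "l2 M (%x. X (Suc k) x - X k x) <= (1/8) * (1/8) ^ k" for k
    using yn[of k] yn'[of k] by (simp add: XS st_def)
  have low: "(1/8) ^ Suc k * l2 M (H k) <= abs (\<integral>x. H k x * X (Suc k) x \<partial>M)" for k
  proof -
    let ?p = "\<integral>x. H k x * X k x \<partial>M" and ?q = "\<integral>x. H k x * y k x \<partial>M"
    have iX: "integrable M (%x. H k x * X k x)" and iy: "integrable M (%x. H k x * y k x)"
      by (intro sqi_mult_integrable Hs Xs ys)+
    have p: "(LINT x|M. H k x * (X k x + y k x)) = ?p + ?q"
      using iX iy by (simp add: distrib_left)
    have m: "(LINT x|M. H k x * (X k x - y k x)) = ?p - ?q"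
      using iX iy by (simp add: right_diff_distrib)
    have "?q = (LINT x|M. (1/8) ^ Suc k / l2 M (H k) * (H k x)^2)"
      by (intro Bochner_Integration.integral_cong refl) (simp add: y_def power2_eq_square)
    also have "... = (1/8) ^ Suc k / l2 M (H k) * (l2 M (H k))^2"
      unfolding l2_sq by simp
    also have "... = (1/8) ^ Suc k * l2 M (H k)"
      using Hp[of k] by (simp add: power2_eq_square)
    finally have q: "?q = (1/8) ^ Suc k * l2 M (H k)" .
    then have q0: "0 <= ?q" by (simp only: q) simp
    show ?thesis unfolding XS st_def p m q[symmetric] using q0 by (auto simp: m p)
  qed
  from l2_complete[of X M "1/8" "1/8", OF Xs d] obtain G where G: "G \<in> sqi M"
    and Gd: "!!k. l2 M (%x. X k x - G x) <= 2 * (1/8) * (1/8) ^ k" by auto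
  have big: "(3/32) * 2 ^ k <= abs (\<integral>x. H k x * G x \<partial>M)" for k
  proof -
    have "(LINT x|M. H k x * (X (Suc k) x - G x)) = (LINT x|M. H k x * X (Suc k) x) - (LINT x|M. H k x * G x)"
      using sqi_mult_integrable[OF Hs Xs, of k "Suc k"] sqi_mult_integrable[OF Hs G, of k]
      by (simp add: right_diff_distrib)
    moreover have "abs (\<integral>x. H k x * (X (Suc k) x - G x) \<partial>M) <= l2 M (H k) * l2 M (%x. X (Suc k) x - G x)"
      by (intro l2_Cauchy_Schwarz sqi_diff Hs Xs G)
    moreover have "l2 M (H k) * l2 M (%x. X (Suc k) x - G x) <= l2 M (H k) * (1/4 * (1/8) ^ Suc k)"
      using Gd[of "Suc k"] by (intro mult_left_mono) auto
    ultimately have "3/4 * ((1/8) ^ Suc k * l2 M (H k)) <= abs (\<integral>x. H k x * G x \<partial>M)"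
      using low[of k] by (simp add: abs_if mult_ac split: if_splits)
    moreover have "3/4 * ((1/8) ^ Suc k * 16 ^ k) <= 3/4 * ((1/8) ^ Suc k * l2 M (H k))"
      using N[of k] by (simp add: H_def less_imp_le)
    moreover have "3/4 * ((1/8) ^ Suc k * 16 ^ k) = (3/32) * (2::real) ^ k"
    proof -
      have e2: "(1/8) * 16 = (2::real)" by simp
      have e: "(1/8) ^ k * (16::real) ^ k = 2 ^ k" by (subst power_mult_distrib[symmetric], subst e2, rule refl)
      have "3/4 * ((1/8) ^ Suc k * 16 ^ k) = 3/32 * ((1/8) ^ k * (16::real) ^ k)" by simp
      then show ?thesis by (simp only: e)
    qed
    ultimately show ?thesis by linarith
  qed
  obtain B where B: "!!n. abs (\<integral>x. h n x * G x \<partial>M) <= B"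
    using bd[OF G] by (auto simp: Bseq_def)
  obtain k where "B * (32/3) < 2 ^ k" using real_arch_pow[of 2 "B * (32/3)"] by auto
  with big[of k] B[of "N k"] show False by (simp add: H_def)
qed

text \<open>The mean value inequality bounds every difference quotient by the integrable B, so
  dominated convergence applies along each null sequence of increments.\<close>

lemma deriv_under_integral:
  fixes F F' :: "real => 'a => real"
  assumes int: "!!t. integrable M (F t)"
    and meas: "!!t. F' t \<in> borel_measurable M"
    and der: "!!t y. ((%t. F t y) has_real_derivative F' t y) (at t)"
    and bnd: "!!t y. abs (F' t y) <= B y" and B: "integrable M B"
  shows "((%t. \<integral>y. F t y \<partial>M) has_real_derivative (LINT y|M. F' t y)) (at t)"
proof -
  have meas': "F t \<in> borel_measurable M" for t using int by (rule borel_measurable_integrable)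
  have lip: "abs ((F (t + h) y - F t y) / h) <= B y" if "h \<noteq> 0" for h y
  proof -
    have "norm (F (t + h) y - F t y) <= B y * norm (t + h - t)"
      by (rule field_differentiable_bound[where S=UNIV and f'="%t. F' t y"]) (use der bnd in auto)
    then show ?thesis using that by (simp add: field_simps)
  qed
  have "((%h. ((LINT y|M. F (t + h) y) - (LINT y|M. F t y)) / h) \<longlongrightarrow> (LINT y|M. F' t y)) (at 0)"
  proof (subst tendsto_at_iff_sequentially, intro allI impI, unfold comp_def)
    fix X :: "nat => real"
    assume X: "\<forall>i. X i \<in> UNIV - {0}" "X \<longlonglongrightarrow> 0"
    have "(%i. \<integral>y. (F (t + X i) y - F t y) / X i \<partial>M) \<longlonglongrightarrow> (LINT y|M. F' t y)"
    proof (rule integral_dominated_convergence[where w=B])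
      show "AE y in M. (%i. (F (t + X i) y - F t y) / X i) \<longlonglongrightarrow> F' t y"
      proof (rule AE_I2)
        fix y
        have "((%h. (F (t + h) y - F t y) / h) \<longlongrightarrow> F' t y) (at 0)"
          using der[of y t] by (simp add: DERIV_def)
        then show "(%i. (F (t + X i) y - F t y) / X i) \<longlonglongrightarrow> F' t y"
          using X unfolding tendsto_at_iff_sequentially comp_def by blast
      qed
      show "AE y in M. norm ((F (t + X i) y - F t y) / X i) <= B y" for i
        using lip X(1) by auto
    qed (use B meas meas' in auto)
    moreover have "(LINT y|M. (F (t + X i) y - F t y) / X i) = ((LINT y|M. F (t + X i) y) - (LINT y|M. F t y)) / X i" for i
      using Bochner_Integration.integral_diff[OF int int, of "t + X i" t] by simp
    ultimately show "(%i. ((LINT y|M. F (t + X i) y) - (LINT y|M. F t y)) / X i) \<longlonglongrightarrow> (LINT y|M. F' t y)"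
      by (simp only:)
  qed
  then show ?thesis by (simp add: DERIV_def)
qed

section \<open>Infinite products of a law on the reals\<close>

text \<open>For error bounds with an auxiliary parameter k, such as a truncation level or a
  smoothing scale, whose own error can be made small only after n has gone to infinity.\<close>

lemma tendsto_zero_double:
  fixes a :: "nat => real"
  assumes a0: "!!n. 0 <= a n" and ab: "!!k. \<forall>\<^sub>F n in sequentially. a n <= b k n"
    and b: "!!k. b k \<longlonglongrightarrow> \<beta> k" and \<beta>: "(\<beta> :: nat => real) \<longlonglongrightarrow> 0"
  shows "a \<longlonglongrightarrow> 0"
proof (rule LIMSEQ_I)
  fix e :: real assume e: "0 < e"
  obtain k where k: "\<beta> k < e / 2"
  proof -
    have "\<forall>\<^sub>F k in sequentially. \<beta> k < e / 2" using order_tendstoD(2)[OF \<beta>, of "e/2"] e by simp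
    then show ?thesis using that by (auto simp: eventually_sequentially)
  qed
  have "\<forall>\<^sub>F n in sequentially. b k n < e" using order_tendstoD(2)[OF b[of k], of e] k e by simp
  with ab[of k] have "\<forall>\<^sub>F n in sequentially. norm (a n - 0) < e"
    by eventually_elim (use a0 in auto)
  then show "\<exists>no. \<forall>n\<ge>no. norm (a n - 0) < e" by (simp add: eventually_sequentially)
qed

lemma (in prob_space) L1_le_l2:
  assumes f: "f \<in> sqi M"
  shows "(LINT x|M. abs (f x)) <= l2 M f"
proof -
  have one: "(%x. 1) \<in> sqi M" by (rule sqi_bounded[where C=1]) auto
  have af: "(%x. abs (f x)) \<in> sqi M" using f by (auto simp: sqi_def)
  have "abs (\<integral>x. abs (f x) * 1 \<partial>M) <= l2 M (%x. abs (f x)) * l2 M (%x. 1)"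
    by (rule l2_Cauchy_Schwarz[OF af one])
  then show ?thesis by (simp add: l2_def prob_space)
qed

lemma (in prob_space) orthogonal_sum_sq:
  fixes z :: "'i => 'a => real"
  assumes "finite J" "!!j. j \<in> J ==> z j \<in> sqi M"
    and "!!i j. i \<in> J ==> j \<in> J ==> i \<noteq> j ==> (LINT x|M. z i x * z j x) = 0"
  shows "(LINT x|M. (\<Sum>j\<in>J. z j x)^2) = (\<Sum>j\<in>J. \<integral>x. (z j x)^2 \<partial>M)"
  using assms
proof (induction J)
  case (insert j J)
  have s: "(%x. \<Sum>j\<in>J. z j x) \<in> sqi M" using insert.prems by (intro sqi_sum) auto
  have zj: "z j \<in> sqi M" using insert.prems by auto
  have "(LINT x|M. z j x * (\<Sum>i\<in>J. z i x)) = (\<Sum>i\<in>J. \<integral>x. z j x * z i x \<partial>M)"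
    unfolding sum_distrib_left using insert.prems by (intro Bochner_Integration.integral_sum sqi_mult_integrable) auto
  also have "... = 0" using insert.prems insert.hyps by (intro sum.neutral) auto
  finally have "(LINT x|M. (1 * z j x + 1 * (\<Sum>i\<in>J. z i x))^2) = (LINT x|M. (z j x)^2) + (LINT x|M. (\<Sum>j\<in>J. z j x)^2)"
    unfolding l2_expand[OF zj s] by simp
  then show ?case using insert by simp
qed simp

locale seq_prob = prob_space M for M :: "real measure" +
  assumes sets_M[measurable_cong, simp]: "sets M = sets borel"
begin

definition Q :: "(nat => real) measure" where "Q = (\<Pi>\<^sub>M i\<in>UNIV. M)"

text \<open>Splices two sequences along A. Two independent copies pushed through \<open>mg A\<close>
  have the product law again, and this is the form in which independence of disjoint coordinate
  blocks is used.\<close>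

definition mg :: "nat set => (nat => real) => (nat => real) => nat => real" where
  "mg A x y = (%i. if i \<in> A then x i else y i)"

lemma space_M[simp]: "space M = UNIV"
  using sets_eq_imp_space_eq[OF sets_M] by simp

lemma space_Q[simp]: "space Q = UNIV"
  by (simp add: Q_def space_PiM)

lemma sets_Q[measurable_cong]: "sets Q = sets (\<Pi>\<^sub>M i\<in>UNIV. borel)"
  unfolding Q_def by (rule sets_PiM_cong) auto

lemma sets_Q_borel: "sets Q = sets borel"
  by (simp add: sets_Q sets_PiM_equal_borel)

sublocale PP: product_prob_space "%_. M" "UNIV :: nat set"
  by unfold_locales

sublocale Q: prob_space Q
  unfolding Q_def by (rule prob_space_PiM) unfold_locales

sublocale QQ: pair_prob_space Q Q
  by unfold_locales

lemma measurable_coord[measurable]: "(%x. x i) \<in> borel_measurable Q"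
  by (subst measurable_cong_sets[OF sets_Q refl]) (rule measurable_component_singleton, simp)

lemma measurable_mg[measurable]: "(%(x, y). mg A x y) \<in> measurable (Q \<Otimes>\<^sub>M Q) Q"
proof (subst measurable_cong_sets[OF refl sets_Q], rule measurable_PiM_single')
  fix i
  show "(%\<omega>. (case \<omega> of (x, y) => mg A x y) i) \<in> borel_measurable (Q \<Otimes>\<^sub>M Q)"
    by (cases "i \<in> A") (auto simp: mg_def split_beta')
qed auto

lemma emeasure_cyl:
  assumes "finite J" "!!i. i \<in> J ==> A i \<in> sets borel"
  shows "emeasure Q {x. \<forall>i\<in>J. x i \<in> A i} = (\<Prod>i\<in>J. emeasure M (A i))"
  using PP.emeasure_PiM_Collect[of J A] assms by (simp add: Q_def space_PiM)

lemma cyl_sets: "finite J ==> (!!i. i \<in> J ==> A i \<in> sets borel) ==> {x. \<forall>i\<in>J. x i \<in> A i} \<in> sets Q"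
proof -
  assume J: "finite J" "!!i. i \<in> J ==> A i \<in> sets borel"
  have "{x \<in> space Q. \<forall>i\<in>J. x i \<in> A i} \<in> sets Q"
    using J by (intro sets.sets_Collect_finite_All measurable_sets_borel) (auto intro!: measurable_sets[OF measurable_coord, unfolded vimage_def, simplified] simp: Int_def)
  then show ?thesis by simp
qed

lemma distr_mg: "distr (Q \<Otimes>\<^sub>M Q) Q (%(x, y). mg A x y) = Q"
proof -
  have "distr (Q \<Otimes>\<^sub>M Q) Q (%(x, y). mg A x y) = (\<Pi>\<^sub>M i\<in>UNIV. M)"
  proof (rule PP.PiM_eq)
    show "sets (distr (Q \<Otimes>\<^sub>M Q) Q (%(x, y). mg A x y)) = sets (\<Pi>\<^sub>M i\<in>UNIV. M)"
      by (simp add: Q_def)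
    fix J F assume J: "finite J" "J \<subseteq> (UNIV :: nat set)" and F: "!!j. j \<in> J ==> F j \<in> sets M"
    have e: "prod_emb UNIV (%_. M) J (Pi\<^sub>E J F) = {x. \<forall>i\<in>J. x i \<in> F i}"
      by (auto simp: prod_emb_def space_PiM PiE_iff restrict_def)
    have F': "!!j. j \<in> J ==> F j \<in> sets borel" using F by simp
    have m: "{x. \<forall>i\<in>J. x i \<in> F i} \<in> sets Q"
      using J F' by (intro cyl_sets) auto
    have "emeasure (distr (Q \<Otimes>\<^sub>M Q) Q (%(x, y). mg A x y)) {x. \<forall>i\<in>J. x i \<in> F i}
      = emeasure (Q \<Otimes>\<^sub>M Q) ((%(x, y). mg A x y) -` {x. \<forall>i\<in>J. x i \<in> F i} \<inter> space (Q \<Otimes>\<^sub>M Q))"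
      by (rule emeasure_distr[OF measurable_mg m])
    also have "(%(x, y). mg A x y) -` {x. \<forall>i\<in>J. x i \<in> F i} \<inter> space (Q \<Otimes>\<^sub>M Q)
      = {x. \<forall>i\<in>J \<inter> A. x i \<in> F i} \<times> {x. \<forall>i\<in>J - A. x i \<in> F i}"
      by (auto simp: mg_def space_pair_measure split: if_splits)
    also have "emeasure (Q \<Otimes>\<^sub>M Q) ... = emeasure Q {x. \<forall>i\<in>J \<inter> A. x i \<in> F i} * emeasure Q {x. \<forall>i\<in>J - A. x i \<in> F i}"
      using J F' by (intro Q.emeasure_pair_measure_Times cyl_sets) auto
    also have "... = (\<Prod>i\<in>J \<inter> A. emeasure M (F i)) * (\<Prod>i\<in>J - A. emeasure M (F i))"
      using J F' by (subst (1 2) emeasure_cyl) auto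
    also have "... = (\<Prod>i\<in>J. emeasure M (F i))"
      using J by (subst prod.union_disjoint[symmetric]) (auto simp: Int_Diff_Un)
    finally show "emeasure (distr (Q \<Otimes>\<^sub>M Q) Q (%(x, y). mg A x y)) (prod_emb UNIV (%_. M) J (Pi\<^sub>E J F))
      = (\<Prod>j\<in>J. emeasure M (F j))" unfolding e .
  qed
  then show ?thesis by (simp add: Q_def)
qed

definition dep :: "nat set => ((nat => real) => 'b) => bool" where
  "dep A F \<longleftrightarrow> (\<forall>x y. (\<forall>i\<in>A. x i = y i) --> F x = F y)"

lemma depD: "dep A F ==> (!!i. i \<in> A ==> x i = y i) ==> F x = F y"
  by (auto simp: dep_def)

text \<open>Once Q is written as the law of \<open>mg A x y\<close>, F sees only the first copy and
  G only the second, and Fubini factorises the integral.\<close>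

lemma indep_integral:
  fixes F G :: "(nat => real) => real"
  assumes F: "integrable Q F" "dep A F" and G: "integrable Q G" "dep B G" and disj: "A \<inter> B = {}"
  shows "integrable Q (%x. F x * G x)" "(LINT x|Q. F x * G x) = (LINT x|Q. F x) * (LINT x|Q. G x)"
proof -
  have [measurable]: "F \<in> borel_measurable Q" "G \<in> borel_measurable Q"
    using F G by auto
  have e1: "F (mg A x y) = F x" for x y by (rule depD[OF F(2)]) (simp add: mg_def)
  have e2: "G (mg A x y) = G y" for x y by (rule depD[OF G(2)]) (use disj in \<open>auto simp: mg_def\<close>)
  have int: "integrable (Q \<Otimes>\<^sub>M Q) (%(x, y). F x * G y)"
  proof (rule QQ.Fubini_integrable)
    show "(%(x, y). F x * G y) \<in> borel_measurable (Q \<Otimes>\<^sub>M Q)" by measurable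
    show "integrable Q (%x. \<integral>y. norm (case (x, y) of (x, y) => F x * G y) \<partial>Q)"
      using F G by (simp add: abs_mult)
    show "AE x in Q. integrable Q (%y. case (x, y) of (x, y) => F x * G y)"
      using G by simp
  qed
  have int': "integrable (Q \<Otimes>\<^sub>M Q) (%z. (%x. F x * G x) (case z of (x, y) => mg A x y))"
    using int by (simp add: split_beta' e1 e2)
  show "integrable Q (%x. F x * G x)"
    by (subst distr_mg[of A, symmetric], subst integrable_distr_eq) (use int' in auto)
  have "(LINT x|Q. F x * G x) = (\<integral>x. F x * G x \<partial>distr (Q \<Otimes>\<^sub>M Q) Q (%(x, y). mg A x y))"
    by (simp only: distr_mg)
  also have "... = (LINT z|(Q \<Otimes>\<^sub>M Q). (%(x, y). F x * G y) z)"
    by (subst integral_distr) (auto simp: split_beta' e1 e2)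
  also have "... = (LINT x|Q. (LINT y|Q. F x * G y))"
    using QQ.integral_fst'[OF int] by simp
  also have "... = (LINT x|Q. F x) * (LINT x|Q. G x)" by simp
  finally show "(LINT x|Q. F x * G x) = (LINT x|Q. F x) * (LINT x|Q. G x)" .
qed

lemma distr_coord: "distr Q M (%x. x i) = M"
  using PP.PiM_component[of i] by (simp add: Q_def)

lemma integrable_coord: "b \<in> borel_measurable borel ==> integrable Q (%x. b (x i)) \<longleftrightarrow> integrable M (b :: real => real)"
  by (subst (2) distr_coord[of i, symmetric], subst integrable_distr_eq)
     (auto simp: measurable_cong_sets[OF sets_M refl])

lemma integral_coord: "b \<in> borel_measurable borel ==> (LINT x|Q. b (x i)) = (LINT t|M. (b :: real => real) t)"
  by (subst (2) distr_coord[of i, symmetric], subst integral_distr)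
     (auto simp: measurable_cong_sets[OF sets_M refl])

lemma prod_expect:
  fixes b :: "nat => real => real"
  assumes "finite J" "!!j. j \<in> J ==> integrable M (b j)"
  shows "integrable Q (%x. \<Prod>j\<in>J. b j (x j)) \<and> (LINT x|Q. (\<Prod>j\<in>J. b j (x j))) = (\<Prod>j\<in>J. \<integral>t. b j t \<partial>M)"
  using assms
proof (induction J)
  case empty then show ?case by (simp add: Q.prob_space[simplified])
next
  case (insert j J)
  have bm: "b j \<in> borel_measurable borel"
    using borel_measurable_integrable[OF insert.prems[of j]] by simp
  have d1: "dep {j} (%x. b j (x j))" by (simp add: dep_def)
  have d2: "dep J (%x. \<Prod>j\<in>J. b j (x j))" by (auto simp: dep_def intro!: prod.cong)
  have i1: "integrable Q (%x. b j (x j))" using integrable_coord[OF bm] insert by simp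
  from indep_integral[OF i1 d1 _ d2] insert show ?case
    by (simp add: integral_coord[OF bm])
qed

section \<open>Resampling a single coordinate\<close>

lemma measurable_upd[measurable]: "(%(t, x). x(i := t)) \<in> measurable (M \<Otimes>\<^sub>M Q) Q"
proof (subst measurable_cong_sets[OF refl sets_Q], rule measurable_PiM_single')
  fix j
  show "(%\<omega>. (case \<omega> of (t, x) => x(i := t)) j) \<in> borel_measurable (M \<Otimes>\<^sub>M Q)"
    by (cases "j = i") (auto simp: split_beta')
qed auto

lemma distr_upd: "distr (M \<Otimes>\<^sub>M Q) Q (%(t, x). x(i := t)) = Q"
  using distr_pair_PiM_eq_PiM[of UNIV "%_. M" i] prob_space_axioms
  by (simp add: Q_def insert_absorb)

sublocale MQ: pair_prob_space M Q
  by unfold_locales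

lemma integrable_upd:
  fixes F :: "(nat => real) => real"
  assumes F: "integrable Q F"
  shows "integrable (M \<Otimes>\<^sub>M Q) (%(t, x). F (x(i := t)))"
proof -
  have "integrable (distr (M \<Otimes>\<^sub>M Q) Q (%(t, x). x(i := t))) F"
    using F by (simp only: distr_upd)
  then show ?thesis
    by (subst (asm) integrable_distr_eq) (use F in \<open>auto simp: split_beta'\<close>)
qed

lemma integral_upd:
  fixes F :: "(nat => real) => real"
  assumes F: "integrable Q F"
  shows "(LINT x|Q. F x) = (LINT x|Q. (LINT t|M. F (x(i := t))))"
proof -
  have "(LINT x|Q. F x) = (\<integral>x. F x \<partial>distr (M \<Otimes>\<^sub>M Q) Q (%(t, x). x(i := t)))"
    by (simp only: distr_upd)
  also have "... = (LINT z|(M \<Otimes>\<^sub>M Q). (%(t, x). F (x(i := t))) z)"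
    by (subst integral_distr) (use F in \<open>auto simp: split_beta'\<close>)
  also have "... = (LINT x|Q. (LINT t|M. F (x(i := t))))"
    using MQ.integral_snd[OF integrable_upd[OF F, of i]] by simp
  finally show ?thesis .
qed

lemma nn_integral_upd:
  assumes F: "F \<in> borel_measurable Q"
  shows "(\<integral>\<^sup>+x. F x \<partial>Q) = (\<integral>\<^sup>+t. (\<integral>\<^sup>+x. F (x(i := t)) \<partial>Q) \<partial>M)"
proof -
  have "(\<integral>\<^sup>+x. F x \<partial>Q) = (\<integral>\<^sup>+x. F x \<partial>distr (M \<Otimes>\<^sub>M Q) Q (%(t, x). x(i := t)))"
    by (simp only: distr_upd)
  also have "... = (\<integral>\<^sup>+z. (%(t, x). F (x(i := t))) z \<partial>(M \<Otimes>\<^sub>M Q))"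
    by (subst nn_integral_distr) (use F in \<open>auto simp: split_beta'\<close>)
  also have "... = (\<integral>\<^sup>+t. (\<integral>\<^sup>+x. F (x(i := t)) \<partial>Q) \<partial>M)"
    by (subst Q.nn_integral_fst[symmetric]) (use F in \<open>auto simp: split_beta'\<close>)
  finally show ?thesis .
qed

lemma coord_raw: "f \<in> measurable N Q ==> (%z. f z i) \<in> borel_measurable N"
  using measurable_compose[OF _ measurable_coord] by simp

lemma coord_dest[measurable_dest]:
  "f \<in> measurable N Q ==> g \<in> measurable L N ==> (%z. f (g z) i) \<in> borel_measurable L"
  by (rule coord_raw) (rule measurable_compose)

lemma fst_coord[measurable]: "(%z. fst z i) \<in> borel_measurable (Q \<Otimes>\<^sub>M N)"
  and snd_coord[measurable]: "(%z. snd z i) \<in> borel_measurable (N \<Otimes>\<^sub>M Q)"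
  by (auto intro: coord_raw)

lemma upd_raw[measurable (raw)]:
  "f \<in> measurable N Q ==> h \<in> borel_measurable N ==> (%z. (f z)(i := h z)) \<in> measurable N Q"
  using measurable_compose[OF measurable_Pair measurable_upd, of h N f i]
  by (simp add: measurable_cong_sets[OF refl sets_M])

lemma measurable_into_Q:
  assumes "!!i. (%z. f z i) \<in> borel_measurable N"
  shows "f \<in> measurable N Q"
  by (subst measurable_cong_sets[OF refl sets_Q], rule measurable_PiM_single') (use assms in auto)

text \<open>The application is to the square of \<open>d\<close>, for which finite Fisher
  information gives a first moment and nothing more. Truncation at level K leaves uncorrelated
  bounded terms with error of order K / sqrt n, and the rest is controlled by its first moment. The
  finite set J of omitted coordinates costs order 1/n.\<close>

lemma weak_law:
  fixes u :: "real => real"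
  assumes u: "integrable M u" and J: "finite J"
  shows "(%n. \<integral>x. abs ((\<Sum>j\<in>{..<n} - J. u (x j)) / real n - (LINT t|M. u t)) \<partial>Q) \<longlonglongrightarrow> 0"
proof -
  have um[measurable]: "u \<in> borel_measurable borel"
    using borel_measurable_integrable[OF u] by (simp add: measurable_cong_sets[OF sets_M refl])
  define u1 where "u1 K t = (if abs (u t) <= K then u t else 0)" for K t
  define u2 where "u2 K t = u t - u1 K t" for K t
  have [measurable]: "u1 K \<in> borel_measurable borel" "u2 K \<in> borel_measurable borel" for K
    unfolding u2_def u1_def by measurable
  have u1M: "integrable M (u1 K)" for K
    by (rule Bochner_Integration.integrable_bound[OF u]) (auto simp: u1_def measurable_cong_sets[OF sets_M refl])
  have u2M: "integrable M (u2 K)" for K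
    unfolding u2_def using u u1M by simp
  have u2Q: "integrable Q (%x. u2 K (x j))" for K j using u2M by (simp add: integrable_coord)
  let ?E = "\<integral>t. u t \<partial>M"
  define z where "z K j x = u1 K (x j) - (LINT t|M. u1 K t)" for K j and x :: "nat => real"
  have zQ: "integrable Q (z K j)" for K j
    unfolding z_def using u1M by (simp add: integrable_coord)
  have z0: "(LINT x|Q. z K j x) = 0" for K j
    unfolding z_def using u1M by (simp add: integrable_coord integral_coord Q.prob_space[simplified])
  have zb: "abs (z (real K) j x) <= 2 * real K" for K j x
  proof -
    have "abs (\<integral>t. u1 (real K) t \<partial>M) <= (LINT t|M. abs (u1 (real K) t))" by (rule integral_abs_bound)
    also have "... <= (LINT t|M. real K)"
    proof (rule integral_mono)
      show "abs (u1 (real K) t) <= real K" for t by (simp add: u1_def)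
    qed (use u1M[of "real K"] in auto)
    also have "... = real K" by (simp add: prob_space[simplified])
    finally show ?thesis by (auto simp: z_def u1_def abs_if split: if_splits)
  qed
  have zs: "z (real K) j \<in> sqi Q" for K j
    by (rule Q.sqi_bounded[OF borel_measurable_integrable[OF zQ] zb])
  have orth: "(LINT x|Q. z K i x * z K j x) = 0" if "i \<noteq> j" for K i j
  proof -
    have "(LINT x|Q. z K i x * z K j x) = (LINT x|Q. z K i x) * (LINT x|Q. z K j x)"
      using that by (intro indep_integral(2)[where A="{i}" and B="{j}"] zQ) (auto simp: dep_def z_def)
    then show ?thesis by (simp add: z0)
  qed
  \<comment> \<open>Truncated part, omitted coordinates, and the tail counted twice: once in the sum
    and once in the mean.\<close>
  define b where "b K n = 2 * real K * (1 / sqrt (real n)) + real (card J) * (1 / real n) * (LINT t|M. abs (u t))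
     + 2 * (LINT t|M. abs (u2 (real K) t))" for K n :: nat
  have main: "(LINT x|Q. abs ((\<Sum>j\<in>{..<n} - J. u (x j)) / real n - ?E)) <= b K n" if n: "n > 0" for n K
  proof -
    let ?I = "{..<n} - J" let ?e1 = "\<integral>t. u1 (real K) t \<partial>M" let ?e2 = "\<integral>t. u2 (real K) t \<partial>M"
    have cI: "card ?I <= n" using card_mono[of "{..<n}" ?I] by simp
    have cI2: "real n - real (card ?I) <= real (card J)"
    proof -
      have "n - card J <= card ?I" using diff_card_le_card_Diff[OF J, of "{..<n}"] by simp
      then show ?thesis by linarith
    qed
    have Ee: "?E = ?e1 + ?e2" unfolding u2_def using u u1M by simp
    have e1le: "abs ?e1 <= (LINT t|M. abs (u t))"
    proof -
      have "abs ?e1 <= (LINT t|M. abs (u1 (real K) t))" by (rule integral_abs_bound)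
      also have "... <= (LINT t|M. abs (u t))" 
      proof (rule integral_mono)
        show "abs (u1 (real K) t) <= abs (u t)" for t by (simp add: u1_def)
      qed (use u1M[of "real K"] u in auto)
      finally show ?thesis .
    qed
    have e2le: "abs ?e2 <= (LINT t|M. abs (u2 (real K) t))" by (rule integral_abs_bound)
    have pt: "abs ((\<Sum>j\<in>?I. u (x j)) / real n - ?E) <= abs (\<Sum>j\<in>?I. z (real K) j x) / real n + (\<Sum>j\<in>?I. abs (u2 (real K) (x j))) / real n
       + (real (card J) * (1 / real n) * (LINT t|M. abs (u t)) + (LINT t|M. abs (u2 (real K) t)))" for x
    proof -
      have "(\<Sum>j\<in>?I. u (x j)) = (\<Sum>j\<in>?I. z (real K) j x) + (\<Sum>j\<in>?I. u2 (real K) (x j)) + real (card ?I) * ?e1"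
        by (simp add: z_def u2_def sum_subtractf)
      then have eq: "(\<Sum>j\<in>?I. u (x j)) / real n - ?E = (\<Sum>j\<in>?I. z (real K) j x) / real n + (\<Sum>j\<in>?I. u2 (real K) (x j)) / real n
         + (real (card ?I) / real n - 1) * ?e1 - ?e2"
        using n unfolding Ee by (simp add: add_divide_distrib algebra_simps)
      have e1: "abs ((real (card ?I) / real n - 1) * ?e1) <= real (card J) * (1 / real n) * (LINT t|M. abs (u t))"
        unfolding abs_mult
      proof (intro mult_mono e1le)
        show "abs (real (card ?I) / real n - 1) <= real (card J) * (1 / real n)"
        proof -
          have "abs (real (card ?I) / real n - 1) = (real n - real (card ?I)) / real n"
            using n cI by (simp add: abs_if field_simps)
          also have "... <= real (card J) / real n" by (intro divide_right_mono cI2) simp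
          finally show ?thesis by simp
        qed
      qed auto
      have e2: "abs (\<Sum>j\<in>?I. u2 (real K) (x j)) / real n <= (\<Sum>j\<in>?I. abs (u2 (real K) (x j))) / real n"
        by (intro divide_right_mono sum_abs) simp
      have tri: "abs (a / real n + b / real n + c - e) <= abs a / real n + abs b / real n + abs c + abs e" for a b c e
        using abs_triangle_ineq4[of "a / real n + b / real n + c" e] abs_triangle_ineq[of "a / real n + b / real n" c]
          abs_triangle_ineq[of "a / real n" "b / real n"] by (simp add: abs_divide)
      have gen: "y <= S + T + (A + B)" if "y <= S + t + a + b" "t <= T" "a <= A" "b <= B" for y S t a b T A B :: real
        using that by linarith
      show ?thesis
        unfolding eq by (rule gen[OF tri e2 e1 e2le])
    qed
    have i1: "integrable Q (%x. abs (\<Sum>j\<in>?I. z (real K) j x) / real n)"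
      using zQ by auto
    have i2: "integrable Q (%x. (\<Sum>j\<in>?I. abs (u2 (real K) (x j))) / real n)"
      using u2Q by auto
    have i3: "integrable Q (%x. abs ((\<Sum>j\<in>?I. u (x j)) / real n - ?E))"
      using u by (auto simp: integrable_coord)
    have "(LINT x|Q. abs ((\<Sum>j\<in>?I. u (x j)) / real n - ?E)) <= (LINT x|Q. abs (\<Sum>j\<in>?I. z (real K) j x) / real n + (\<Sum>j\<in>?I. abs (u2 (real K) (x j))) / real n
       + (real (card J) * (1 / real n) * (LINT t|M. abs (u t)) + (LINT t|M. abs (u2 (real K) t))))"
      using i1 i2 i3 pt by (intro integral_mono) auto
    also have "... = (LINT x|Q. abs (\<Sum>j\<in>?I. z (real K) j x)) / real n + (\<Sum>j\<in>?I. (LINT x|Q. abs (u2 (real K) (x j)))) / real n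
       + (real (card J) * (1 / real n) * (LINT t|M. abs (u t)) + (LINT t|M. abs (u2 (real K) t)))"
      using i1 i2 u2Q zQ by (simp add: Q.prob_space[simplified])
    also have "(LINT x|Q. abs (\<Sum>j\<in>?I. z (real K) j x)) / real n <= 2 * real K * (1 / sqrt (real n))"
    proof -
      have "(LINT x|Q. abs (\<Sum>j\<in>?I. z (real K) j x)) <= l2 Q (%x. \<Sum>j\<in>?I. z (real K) j x)"
        by (intro Q.L1_le_l2 sqi_sum zs)
      also have "... <= sqrt (real n * (2 * real K)^2)"
        unfolding l2_def
      proof (intro real_sqrt_le_mono)
        have "(LINT x|Q. (\<Sum>j\<in>?I. z (real K) j x)^2) = (\<Sum>j\<in>?I. \<integral>x. (z (real K) j x)^2 \<partial>Q)"
          by (intro Q.orthogonal_sum_sq zs orth) auto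
        also have "... <= (\<Sum>j\<in>?I. (2 * real K)^2)"
        proof (rule sum_mono)
          fix j
          have "(LINT x|Q. (z (real K) j x)^2) <= (LINT x|Q. (2 * real K)^2)"
          proof (rule integral_mono)
            show "(z (real K) j x)^2 <= (2 * real K)^2" for x
              using power_mono[OF zb[of K j x], of 2] by (simp only: power2_abs abs_ge_zero)
          qed (use sqi_int[OF zs] in auto)
          then show "(LINT x|Q. (z (real K) j x)^2) <= (2 * real K)^2" by (simp add: Q.prob_space[simplified])
        qed
        also have "... <= real n * (2 * real K)^2" using cI by (simp add: mult_right_mono)
        finally show "(LINT x|Q. (\<Sum>j\<in>?I. z (real K) j x)^2) <= real n * (2 * real K)^2" .
      qed
      also have "... = sqrt (real n) * (2 * real K)" by (simp add: real_sqrt_mult)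
      finally have "(LINT x|Q. abs (\<Sum>j\<in>?I. z (real K) j x)) / real n <= sqrt (real n) * (2 * real K) / real n"
        by (rule divide_right_mono) simp
      also have "sqrt (real n) * (2 * real K) / real n = 2 * real K * (1 / sqrt (real n))"
        using n by (simp add: field_simps)
      finally show ?thesis .
    qed
    also have "(\<Sum>j\<in>?I. (LINT x|Q. abs (u2 (real K) (x j)))) / real n <= (LINT t|M. abs (u2 (real K) t))"
    proof -
      have "(\<Sum>j\<in>?I. (LINT x|Q. abs (u2 (real K) (x j)))) = real (card ?I) * (LINT t|M. abs (u2 (real K) t))"
        using integral_coord[of "%t. abs (u2 (real K) t)"] by simp
      also have "... <= real n * (LINT t|M. abs (u2 (real K) t))"
        using cI by (intro mult_right_mono) auto
      finally show ?thesis using n by (simp add: field_simps)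
    qed
    finally show ?thesis by (simp add: b_def)
  qed
  have lim2: "(%K. \<integral>t. abs (u2 (real K) t) \<partial>M) \<longlonglongrightarrow> (LINT t|M. 0)"
  proof (rule integral_dominated_convergence[where w="%t. abs (u t)"])
    show "AE t in M. (%K. abs (u2 (real K) t)) \<longlonglongrightarrow> 0"
    proof (rule AE_I2, rule tendsto_eventually)
      fix t
      obtain K0 :: nat where "abs (u t) <= real K0" using real_arch_simple by blast
      then show "\<forall>\<^sub>F K in sequentially. abs (u2 (real K) t) = 0"
        by (auto simp: u2_def u1_def eventually_sequentially intro!: exI[of _ K0])
    qed
  qed (use u in \<open>auto simp: u2_def u1_def measurable_cong_sets[OF sets_M refl]\<close>)
  have "b K \<longlonglongrightarrow> 2 * real K * 0 + real (card J) * 0 * (LINT t|M. abs (u t)) + 2 * (LINT t|M. abs (u2 (real K) t))" for K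
  proof -
    have l1: "(%n. 1 / real n) \<longlonglongrightarrow> 0" by (rule lim_1_over_n)
    have "(%n. sqrt (1 / real n)) \<longlonglongrightarrow> sqrt 0" by (intro tendsto_real_sqrt l1)
    then have l2: "(%n. 1 / sqrt (real n)) \<longlonglongrightarrow> 0" by (simp add: real_sqrt_divide)
    show ?thesis unfolding b_def by (intro tendsto_add tendsto_mult tendsto_const l1 l2)
  qed
  then have bl: "b K \<longlonglongrightarrow> 2 * (LINT t|M. abs (u2 (real K) t))" for K by simp
  show ?thesis
  proof (rule tendsto_zero_double[OF _ _ bl])
    show "\<forall>\<^sub>F n in sequentially. (LINT x|Q. abs ((\<Sum>j\<in>{..<n} - J. u (x j)) / real n - ?E)) <= b K n" for K
      using main by (auto simp: eventually_sequentially intro!: exI[of _ 1])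
    show "(%K. 2 * (LINT t|M. abs (u2 (real K) t))) \<longlonglongrightarrow> 0"
      using tendsto_mult_right[OF lim2, of 2] by simp
  qed auto
qed

end

section \<open>The standard Gaussian sequence\<close>

lemma std_gauss_prob: "prob_space std_gauss"
  unfolding std_gauss_def by (rule prob_space_normal_density) simp

interpretation Gauss: seq_prob std_gauss
  using std_gauss_prob by (intro seq_prob.intro) (auto simp: seq_prob_axioms_def std_gauss_def)

lemma gauss_integrable_iff:
  "f \<in> borel_measurable borel ==> integrable std_gauss f \<longleftrightarrow> integrable lborel (%x. std_normal_density x * f x)"
  for f :: "real => real"
  unfolding std_gauss_def by (subst integrable_density) auto

lemma gauss_integral:
  "f \<in> borel_measurable borel ==> (LINT z|std_gauss. f z) = (LINT x|lborel. std_normal_density x * f x)"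
  for f :: "real => real"
  unfolding std_gauss_def by (subst integral_density) auto

lemma gauss_abs_moment: "integrable std_gauss (%z. abs z ^ k)"
  by (subst gauss_integrable_iff) (auto intro: integrable_std_normal_moment_abs)

lemma gauss_moment: "integrable std_gauss (%z. z ^ k)"
  by (subst gauss_integrable_iff) (auto intro: integrable_std_normal_moment)

lemma gauss_mean: "(LINT z|std_gauss. z) = 0"
  using integral_std_normal_moment_odd[of 0] by (subst gauss_integral) auto

lemma gauss_second_moment: "(LINT z|std_gauss. z\<^sup>2) = 1"
  using integral_std_normal_moment_even[of 1] by (subst gauss_integral) auto

lemma gauss_symmetric: "distr std_gauss std_gauss uminus = std_gauss"
proof -
  have "distr (density lborel std_normal_density) lborel uminus = density lborel std_normal_density"
  proof -
    have "density (distr lborel borel uminus) (%x. ennreal (std_normal_density x))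
       = distr (density lborel (%x. ennreal (std_normal_density (- x)))) borel uminus"
      by (rule density_distr) auto
    then show ?thesis by (simp add: lborel_distr_uminus normal_density_def cong: distr_cong)
  qed
  then show ?thesis unfolding std_gauss_def by (simp cong: distr_cong)
qed

lemma gauss_abs_mean_le: "(LINT z|std_gauss. abs z) <= 1"
proof -
  have "(%z. z) \<in> sqi std_gauss" using gauss_moment[of 2] by (auto simp: sqi_def measurable_cong_sets[OF Gauss.sets_M refl])
  from Gauss.L1_le_l2[OF this] show ?thesis by (simp add: l2_def gauss_second_moment)
qed

lemma gauss_distributed_scale:
  assumes "distributed M lborel X std_normal_density" "prob_space M" "a \<noteq> 0"
  shows "distributed M lborel (%w. a * X w) (normal_density 0 (abs a))"
  using prob_space.normal_density_affine[OF assms(2,1), of a 0] assms(3) by simp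

text \<open>A finite combination of independent standard normals is normal with variance the sum of
  squares. Zero coefficients are dropped first, because the summands have to be nondegenerate; if
  nothing remains, both sides are evaluations at 0.\<close>

lemma gauss_sum:
  assumes J: "finite J" and [measurable]: "\<psi> \<in> borel_measurable borel"
  shows "(LINT w|Gauss.Q. (\<psi> :: real => real) (\<Sum>j\<in>J. a j * w j)) = (LINT z|std_gauss. \<psi> (sqrt (\<Sum>j\<in>J. (a j)^2) * z))"
proof -
  define J' where "J' = {j\<in>J. a j \<noteq> 0}"
  have J': "finite J'" using J by (simp add: J'_def)
  have s1: "(\<Sum>j\<in>J. a j * w j) = (\<Sum>j\<in>J'. a j * w j)" for w :: "nat => real"
    unfolding J'_def using J by (intro sum.mono_neutral_right) auto
  have s2: "(\<Sum>j\<in>J. (a j)^2) = (\<Sum>j\<in>J'. (a j)^2)"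
    unfolding J'_def using J by (intro sum.mono_neutral_right) auto
  show ?thesis
  proof (cases "J' = {}")
    case True
    then show ?thesis by (simp add: s1 s2 Gauss.Q.prob_space[simplified] Gauss.prob_space[simplified])
  next
    case False
    have iv: "Gauss.Q.indep_vars (%_. std_gauss) (%j w. w j) (UNIV :: nat set)"
    proof (subst Gauss.Q.indep_vars_iff_distr_eq_PiM)
      show "distr Gauss.Q (\<Pi>\<^sub>M i\<in>UNIV. std_gauss) (%x. \<lambda>i\<in>UNIV. x i) = (\<Pi>\<^sub>M i\<in>UNIV. distr Gauss.Q std_gauss (%w. w i))"
        by (simp add: Gauss.distr_coord Gauss.Q_def[symmetric] restrict_UNIV distr_id2)
    qed (auto simp: measurable_cong_sets[OF refl Gauss.sets_M])
    have iv2: "Gauss.Q.indep_vars (%_. borel) (%j w. a j * w j) J'"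
      using Gauss.Q.indep_vars_compose2[OF Gauss.Q.indep_vars_subset[OF iv, of J'], of "%j t. a j * t" "%_. borel"]
      by (simp add: measurable_cong_sets[OF Gauss.sets_M refl])
    have dc: "distributed Gauss.Q lborel (%w. w j) std_normal_density" for j
      unfolding distributed_def
    proof (intro conjI)
      have "distr Gauss.Q lborel (%w. w j) = distr Gauss.Q std_gauss (%w. w j)" by (rule distr_cong) auto
      then show "distr Gauss.Q lborel (%w. w j) = density lborel (%x. ennreal (std_normal_density x))"
        by (simp add: Gauss.distr_coord std_gauss_def[symmetric])
    qed auto
    have d1: "distributed Gauss.Q lborel (%w. \<Sum>j\<in>J'. a j * w j) (normal_density (\<Sum>j\<in>J'. 0) (sqrt (\<Sum>j\<in>J'. (abs (a j))^2)))"
      by (rule Gauss.Q.sum_indep_normal[OF J' False iv2])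
         (auto simp: J'_def intro!: gauss_distributed_scale dc Gauss.Q.prob_space_axioms)
    have pos: "0 < sqrt (\<Sum>j\<in>J'. (a j)^2)"
      using False J' by (auto simp: J'_def intro!: sum_pos)
    have dz: "distributed std_gauss lborel (%z. z) std_normal_density"
      unfolding distributed_def by (auto simp: std_gauss_def intro!: distr_id2)
    have d2: "distributed std_gauss lborel (%z. sqrt (\<Sum>j\<in>J'. (a j)^2) * z) (normal_density 0 (abs (sqrt (\<Sum>j\<in>J'. (a j)^2))))"
      using pos by (intro gauss_distributed_scale dz std_gauss_prob) simp
    have "(LINT w|Gauss.Q. \<psi> (\<Sum>j\<in>J'. a j * w j)) = (LINT x|lborel. normal_density 0 (sqrt (\<Sum>j\<in>J'. (a j)^2)) x * \<psi> x)"
      using d1 by (intro distributed_integral[symmetric]) auto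
    also have "... = (LINT z|std_gauss. \<psi> (sqrt (\<Sum>j\<in>J'. (a j)^2) * z))"
      using d2 pos by (intro distributed_integral) auto
    finally show ?thesis by (simp add: s1 s2)
  qed
qed

text \<open>Both laws are realised on the same z, so changing the standard deviation moves the
  argument by (s - t) z, and the first absolute moment of z is at most 1.\<close>

lemma gauss_lipschitz:
  fixes \<psi> :: "real => real"
  assumes [measurable]: "\<psi> \<in> borel_measurable borel" and b: "!!s. abs (\<psi> s) <= 1"
    and lip: "!!s t. abs (\<psi> s - \<psi> t) <= L * abs (s - t)" and L: "0 <= L"
  shows "abs ((LINT z|std_gauss. \<psi> (s * z + m)) - (LINT z|std_gauss. \<psi> (t * z + m))) <= L * abs (s - t)"
proof -
  have [simp]: "f \<in> borel_measurable std_gauss \<longleftrightarrow> f \<in> borel_measurable borel" for f :: "real => real"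
    by (simp add: measurable_cong_sets[OF Gauss.sets_M refl])
  have i: "integrable std_gauss (%z. \<psi> (s * z + m))" for s
    by (rule Gauss.integrable_const_bound[where B=1]) (auto simp: b)
  have "abs ((LINT z|std_gauss. \<psi> (s * z + m)) - (LINT z|std_gauss. \<psi> (t * z + m)))
     = abs (\<integral>z. \<psi> (s * z + m) - \<psi> (t * z + m) \<partial>std_gauss)"
    using i by simp
  also have "... <= (LINT z|std_gauss. abs (\<psi> (s * z + m) - \<psi> (t * z + m)))" by (rule integral_abs_bound)
  also have "... <= (LINT z|std_gauss. L * abs (s - t) * abs z)"
  proof (rule integral_mono)
    show "integrable std_gauss (%z. L * abs (s - t) * abs z)" using gauss_abs_moment[of 1] by simp
    show "abs (\<psi> (s * z + m) - \<psi> (t * z + m)) <= L * abs (s - t) * abs z" for z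
      using lip[of "s * z + m" "t * z + m"] by (simp add: left_diff_distrib[symmetric] abs_mult)
  qed (use i in simp)
  also have "... = L * abs (s - t) * (LINT z|std_gauss. abs z)" by simp
  also have "... <= L * abs (s - t) * 1"
    using gauss_abs_mean_le L by (intro mult_left_mono) auto
  finally show ?thesis by simp
qed

section \<open>The target law and reversibility of the random walk\<close>

locale mh =
  fixes \<phi> :: "real => real" and \<tau> :: real
  assumes phi_cont: "continuous_on UNIV \<phi>"
    and phi_diff: "\<forall>x. \<phi> differentiable (at x)"
    and phi_prob: "prob_space (target \<phi>)"
    and phi_fisher: "integrable lborel (%x. (deriv \<phi> x)^2 * exp (\<phi> x))"
    and phi_H: "condH \<phi>"
    and tau_pos: "\<tau> > 0"
begin

sublocale T: seq_prob "target \<phi>"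
  using phi_prob by (intro seq_prob.intro) (auto simp: seq_prob_axioms_def target_def)

abbreviation "P \<equiv> T.Q"
abbreviation "\<Gamma> \<equiv> Gauss.Q"
abbreviation "PG \<equiv> T.Q \<Otimes>\<^sub>M Gauss.Q"
abbreviation "M2 \<equiv> target \<phi> \<Otimes>\<^sub>M std_gauss"

lemma P_eq: "prod_target \<phi> = P"
  by (simp add: prod_target_def T.Q_def)

definition d :: "real => real" where "d = deriv \<phi>"
definition \<I> :: real where "\<I> = fisher_info \<phi>"
definition \<sigma> :: real where "\<sigma> = \<tau> * sqrt \<I>"
text \<open>Mean of the limiting log acceptance ratio Z. Minus half the variance is the value for
  which E exp Z = 1, in accordance with detailed balance.\<close>

definition mu :: real where "mu = - \<sigma>\<^sup>2 / 2"

lemma phi_meas[measurable]: "\<phi> \<in> borel_measurable borel"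
  using phi_cont by (rule borel_measurable_continuous_onI)

lemma d_deriv: "(\<phi> has_real_derivative d x) (at x)"
  unfolding d_def using phi_diff DERIV_deriv_iff_real_differentiable by blast

lemma d_cont: "continuous_on UNIV d"
proof -
  obtain k \<gamma> \<alpha> where k: "k > 0" and g: "0 < \<gamma>" and a: "\<alpha> > (1::real)"
    and h: "!!x v. v \<noteq> 0 ==> abs (d (x + v) - d x) < k * max (abs v powr \<gamma>) (abs v powr \<alpha>)"
    using phi_H unfolding condH_def d_def by blast
  have "((%v. d (x + v)) \<longlongrightarrow> d x) (at 0)" for x
  proof (rule Lim_transform_bound[where f="%v. d (x + v) - d x" and g="%v. k * (abs v powr \<gamma> + abs v powr \<alpha>)", THEN LIM_zero_cancel])
    show "\<forall>\<^sub>F v in at 0. norm (d (x + v) - d x) <= norm (k * (abs v powr \<gamma> + abs v powr \<alpha>))"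
      unfolding eventually_at
    proof (intro exI[of _ 1] conjI ballI impI)
      fix v :: real assume v: "v \<noteq> 0 \<and> dist v 0 < 1"
      have "abs (d (x + v) - d x) <= k * max (abs v powr \<gamma>) (abs v powr \<alpha>)" using h[of v x] v by simp
      also have "... <= k * (abs v powr \<gamma> + abs v powr \<alpha>)" using k by (intro mult_left_mono) auto
      finally show "norm (d (x + v) - d x) <= norm (k * (abs v powr \<gamma> + abs v powr \<alpha>))" by simp
    qed simp
    have "((%v::real. k * (abs v powr \<gamma> + abs v powr \<alpha>)) \<longlongrightarrow> k * (0 + 0)) (at 0)"
    proof (intro tendsto_intros)
      have t: "((%v::real. abs v) \<longlongrightarrow> 0) (at 0)" by (intro tendsto_rabs_zero tendsto_ident_at)
      show "((%v::real. abs v powr \<gamma>) \<longlongrightarrow> 0) (at 0)" "((%v::real. abs v powr \<alpha>) \<longlongrightarrow> 0) (at 0)"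
        using g a by (auto intro!: tendsto_zero_powrI[OF t, of "%_. \<gamma>" \<gamma>] tendsto_zero_powrI[OF t, of "%_. \<alpha>" \<alpha>])
    qed
    then show "((%v::real. k * (abs v powr \<gamma> + abs v powr \<alpha>)) \<longlongrightarrow> 0) (at 0)" by simp
  qed
  then have "isCont d x" for x by (simp add: isCont_iff)
  then show ?thesis by (simp add: continuous_on_eq_continuous_at)
qed

lemma d_meas[measurable]: "d \<in> borel_measurable borel"
  using d_cont by (rule borel_measurable_continuous_onI)

lemma target_integrable_iff:
  "h \<in> borel_measurable borel ==> integrable (target \<phi>) h \<longleftrightarrow> integrable lborel (%x. exp (\<phi> x) * h x)"
  for h :: "real => real"
  unfolding target_def by (subst integrable_density) auto

lemma target_integral:
  "h \<in> borel_measurable borel ==> (LINT x|target \<phi>. h x) = (LINT x|lborel. exp (\<phi> x) * h x)"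
  for h :: "real => real"
  unfolding target_def by (subst integral_density) auto

lemma meas_target[simp]: "h \<in> borel_measurable (target \<phi>) \<longleftrightarrow> h \<in> borel_measurable borel" for h :: "real => 'c::topological_space"
  by (simp add: measurable_cong_sets[OF T.sets_M refl])

lemma meas_gauss[simp]: "h \<in> borel_measurable std_gauss \<longleftrightarrow> h \<in> borel_measurable borel" for h :: "real => 'c::topological_space"
  by (simp add: measurable_cong_sets[OF Gauss.sets_M refl])

lemma d_sqi: "d \<in> sqi (target \<phi>)"
  using phi_fisher by (intro sqiI) (auto simp: target_integrable_iff d_def[symmetric] mult.commute)

lemma d_sq_integral: "(LINT x|target \<phi>. (d x)^2) = \<I>"
  by (subst target_integral) (auto simp: \<I>_def fisher_info_def d_def[symmetric] mult.commute)

text \<open>If the Fisher information vanished, the continuous function \<open>d\<close> would be 0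
  everywhere, \<phi> would be constant and the target a multiple of Lebesgue measure, which has
  infinite mass. Positivity makes the limit law nondegenerate.\<close>

lemma I_pos: "0 < \<I>"
proof (rule ccontr)
  assume "\<not> 0 < \<I>"
  then have "(LINT x|lborel. (d x)^2 * exp (\<phi> x)) = 0"
  proof -
    have "0 <= (LINT x|lborel. (d x)^2 * exp (\<phi> x))" by (rule Bochner_Integration.integral_nonneg) simp
    moreover have "\<I> = (LINT x|lborel. (d x)^2 * exp (\<phi> x))" by (simp add: \<I>_def fisher_info_def d_def)
    ultimately show ?thesis using \<open>\<not> 0 < \<I>\<close> by linarith
  qed
  then have ae: "AE x in lborel. d x = 0"
    using phi_fisher by (subst (asm) integral_nonneg_eq_0_iff_AE) (auto simp: d_def)
  have d0: "d x = 0" for x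
  proof (rule ccontr)
    assume "d x \<noteq> 0"
    have o: "open {x. d x \<noteq> 0}"
      using continuous_open_vimage[OF open_Compl[OF closed_singleton[of 0]], of d] d_cont
      by (auto simp: vimage_def continuous_on_eq_continuous_at)
    have "{x. d x \<noteq> 0} \<in> null_sets lborel"
      by (rule AE_iff_null_sets[THEN iffD2]) (use o ae in auto)
    moreover have "{x. d x \<noteq> 0} \<notin> null_sets lborel"
    proof
      assume "{x. d x \<noteq> 0} \<in> null_sets lborel"
      then have "emeasure lborel {x. d x \<noteq> 0} = 0" by auto
      moreover obtain e where e: "e > 0" "ball x e \<subseteq> {x. d x \<noteq> 0}"
        using o \<open>d x \<noteq> 0\<close> by (auto simp: open_contains_ball)
      have "emeasure lborel {x - e/2 .. x + e/2} <= emeasure lborel {x. d x \<noteq> 0}"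
        using e o by (intro emeasure_mono) (auto simp: subset_eq dist_real_def abs_if split: if_splits)
      ultimately show False using e by simp
    qed
    ultimately show False by simp
  qed
  have c: "\<phi> x = \<phi> 0" for x
    using DERIV_isconst_all[of \<phi> x 0] d_deriv d0 by metis
  have "(%x. ennreal (exp (\<phi> x))) = (%x. ennreal (exp (\<phi> 0)))"
    by (rule ext) (metis c)
  then have "target \<phi> = density lborel (%x. ennreal (exp (\<phi> 0)))"
    unfolding target_def by (rule arg_cong)
  then have "emeasure (target \<phi>) UNIV = ennreal (exp (\<phi> 0)) * emeasure lborel (UNIV :: real set)"
    by (simp add: emeasure_density)
  then have "emeasure (target \<phi>) UNIV = \<infinity>"
    by (simp add: ennreal_mult_top emeasure_lborel_UNIV)
  then show False using T.emeasure_space_1 by simp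
qed

lemma sigma_pos: "0 < \<sigma>"
  using I_pos tau_pos by (simp add: \<sigma>_def)

lemma sigma_sq: "\<sigma>\<^sup>2 = \<tau>\<^sup>2 * \<I>"
  using I_pos by (simp add: \<sigma>_def power_mult_distrib)

section \<open>Detailed balance for the proposal and for the acceptance rule\<close>

definition D :: "real => real => real => real" where
  "D s t w = \<phi> (t + s * w) - \<phi> t"

definition pr :: "real => nat => (nat => real) => (nat => real) => (nat => real)" where
  "pr s n x w = (%i. if i < n then x i + s * w i else x i)"

definition flip :: "nat => (nat => real) => (nat => real)" where
  "flip n w = (%i. if i < n then - w i else w i)"

text \<open>The reverse of a proposed move starts at the proposal and uses the negated noise; this
  map exchanges a move with its reverse and is an involution.\<close>

definition \<theta> :: "real => nat => (nat => real) \<times> (nat => real) => (nat => real) \<times> (nat => real)" where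
  "\<theta> s n = (%(x, w). (pr s n x w, flip n w))"

definition acc :: "real => nat => (nat => real) => (nat => real) => real" where
  "acc s n x w = min 1 (exp (\<Sum>j<n. D s (x j) (w j)))"

lemma D_meas[measurable]: "(%(t, w). D s t w) \<in> borel_measurable (borel \<Otimes>\<^sub>M borel)"
  unfolding D_def by measurable

lemma D_raw[measurable (raw)]:
  assumes "f \<in> borel_measurable N" "g \<in> borel_measurable N"
  shows "(%z. D s (f z) (g z)) \<in> borel_measurable N"
  unfolding D_def using assms by measurable

lemma pr_raw[measurable (raw)]:
  assumes "f \<in> measurable N P" "g \<in> measurable N \<Gamma>"
  shows "(%z. pr s n (f z) (g z)) \<in> measurable N P"
  by (rule T.measurable_into_Q) (use assms in \<open>simp add: pr_def\<close>)

lemma flip_raw[measurable (raw)]: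
  assumes "g \<in> measurable N \<Gamma>"
  shows "(%z. flip n (g z)) \<in> measurable N \<Gamma>"
  by (rule Gauss.measurable_into_Q) (use assms in \<open>simp add: flip_def\<close>)

lemma theta_meas[measurable]: "\<theta> s n \<in> measurable PG PG"
  unfolding \<theta>_def by measurable

lemma acc_raw[measurable (raw)]:
  assumes "f \<in> measurable N P" "g \<in> measurable N \<Gamma>"
  shows "(%z. acc s n (f z) (g z)) \<in> borel_measurable N"
  unfolding acc_def using assms by measurable

sublocale PG: pair_prob_space P \<Gamma>
  by unfold_locales

sublocale M2: pair_prob_space "target \<phi>" std_gauss
  by unfold_locales

sublocale PM: pair_prob_space P std_gauss
  by unfold_locales

lemma gauss_nn_flip:
  "h \<in> borel_measurable borel ==> (\<integral>\<^sup>+w. h (- w) \<partial>std_gauss) = (\<integral>\<^sup>+w. h w \<partial>std_gauss)"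
  by (subst (2) gauss_symmetric[symmetric], subst nn_integral_distr) auto

text \<open>The factor \<open>exp (D s t w)\<close> replaces the density at t by the density at t +
  s w; translation invariance of Lebesgue measure moves the point back, and the symmetric Gaussian
  law absorbs the sign of w.\<close>

lemma reversal_1:
  assumes F[measurable]: "(%(t, w). F t w) \<in> borel_measurable (borel \<Otimes>\<^sub>M borel)"
  shows "(\<integral>\<^sup>+t. \<integral>\<^sup>+w. F (t + s * w) (- w) * ennreal (exp (D s t w)) \<partial>std_gauss \<partial>target \<phi>)
    = (\<integral>\<^sup>+t. \<integral>\<^sup>+w. F t w \<partial>std_gauss \<partial>target \<phi>)"
proof -
  have Fr[measurable (raw)]: "f \<in> borel_measurable N ==> g \<in> borel_measurable N ==> (%z. F (f z) (g z)) \<in> borel_measurable N"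
    for f g and N :: "'z measure"
    using measurable_compose[OF measurable_Pair F, of f N g] by simp
  have "(\<integral>\<^sup>+t. \<integral>\<^sup>+w. F (t + s * w) (- w) * ennreal (exp (D s t w)) \<partial>std_gauss \<partial>target \<phi>)
     = (\<integral>\<^sup>+w. \<integral>\<^sup>+t. F (t + s * w) (- w) * ennreal (exp (D s t w)) \<partial>target \<phi> \<partial>std_gauss)"
    by (rule M2.Fubini'[symmetric]) measurable
  also have "... = (\<integral>\<^sup>+w. \<integral>\<^sup>+t. F t (- w) \<partial>target \<phi> \<partial>std_gauss)"
  proof (rule nn_integral_cong)
    fix w
    have "(\<integral>\<^sup>+t. F (t + s * w) (- w) * ennreal (exp (D s t w)) \<partial>target \<phi>)
      = (\<integral>\<^sup>+t. ennreal (exp (\<phi> t)) * (F (t + s * w) (- w) * ennreal (exp (D s t w))) \<partial>lborel)"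
      unfolding target_def by (subst nn_integral_density) auto
    also have "... = (\<integral>\<^sup>+t. ennreal (exp (\<phi> (s * w + 1 * t))) * F (s * w + 1 * t) (- w) \<partial>lborel)"
    proof (rule nn_integral_cong)
      fix t
      have "ennreal (exp (\<phi> t)) * ennreal (exp (D s t w)) = ennreal (exp (\<phi> (s * w + 1 * t)))"
        by (simp add: ennreal_mult[symmetric] exp_add[symmetric] D_def add.commute)
      then show "ennreal (exp (\<phi> t)) * (F (t + s * w) (- w) * ennreal (exp (D s t w)))
        = ennreal (exp (\<phi> (s * w + 1 * t))) * F (s * w + 1 * t) (- w)"
        by (simp add: add.commute mult.assoc[symmetric] mult.commute[of "F _ _"])
    qed
    also have "... = (\<integral>\<^sup>+t. ennreal (exp (\<phi> t)) * F t (- w) \<partial>lborel)"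
      by (subst (2) nn_integral_real_affine[where c=1 and t="s * w"]) auto
    also have "... = (\<integral>\<^sup>+t. F t (- w) \<partial>target \<phi>)"
      unfolding target_def by (subst nn_integral_density) auto
    finally show "(\<integral>\<^sup>+t. F (t + s * w) (- w) * ennreal (exp (D s t w)) \<partial>target \<phi>) = (\<integral>\<^sup>+t. F t (- w) \<partial>target \<phi>)" .
  qed
  also have "... = (\<integral>\<^sup>+w. \<integral>\<^sup>+t. F t w \<partial>target \<phi> \<partial>std_gauss)"
    by (rule gauss_nn_flip[where h="%w. \<integral>\<^sup>+t. F t w \<partial>target \<phi>"]) measurable
  also have "... = (\<integral>\<^sup>+t. \<integral>\<^sup>+w. F t w \<partial>std_gauss \<partial>target \<phi>)"
    by (rule M2.Fubini') measurable
  finally show ?thesis .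
qed

text \<open>Separates coordinate i of position and noise from all the others, so that the
  one-coordinate identity can be applied to the outer two integrals.\<close>

lemma PG_nn_upd:
  assumes H[measurable]: "H \<in> borel_measurable PG"
  shows "(\<integral>\<^sup>+z. H z \<partial>PG) = (\<integral>\<^sup>+t. \<integral>\<^sup>+u. (\<integral>\<^sup>+x. \<integral>\<^sup>+w. H (x(i := t), w(i := u)) \<partial>\<Gamma> \<partial>P) \<partial>std_gauss \<partial>target \<phi>)"
proof -
  have "(\<integral>\<^sup>+z. H z \<partial>PG) = (\<integral>\<^sup>+x. \<integral>\<^sup>+w. H (x, w) \<partial>\<Gamma> \<partial>P)"
    by (rule Gauss.Q.nn_integral_fst[symmetric]) measurable
  also have "... = (\<integral>\<^sup>+x. \<integral>\<^sup>+u. \<integral>\<^sup>+w. H (x, w(i := u)) \<partial>\<Gamma> \<partial>std_gauss \<partial>P)"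
    by (intro nn_integral_cong Gauss.nn_integral_upd) measurable
  also have "... = (\<integral>\<^sup>+t. \<integral>\<^sup>+x. \<integral>\<^sup>+u. \<integral>\<^sup>+w. H (x(i := t), w(i := u)) \<partial>\<Gamma> \<partial>std_gauss \<partial>P \<partial>target \<phi>)"
    by (intro T.nn_integral_upd) measurable
  also have "... = (\<integral>\<^sup>+t. \<integral>\<^sup>+u. (\<integral>\<^sup>+x. \<integral>\<^sup>+w. H (x(i := t), w(i := u)) \<partial>\<Gamma> \<partial>P) \<partial>std_gauss \<partial>target \<phi>)"
    by (intro nn_integral_cong PM.Fubini'[symmetric]) measurable
  finally show ?thesis .
qed

lemma reversal_coord:
  assumes G[measurable]: "G \<in> borel_measurable PG"
  shows "(\<integral>\<^sup>+(x, w). G (x(i := x i + s * w i), w(i := - w i)) * ennreal (exp (D s (x i) (w i))) \<partial>PG) = (\<integral>\<^sup>+z. G z \<partial>PG)"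
proof -
  define F where "F t u = (\<integral>\<^sup>+x. \<integral>\<^sup>+w. G (x(i := t), w(i := u)) \<partial>\<Gamma> \<partial>P)" for t u
  have Fm: "(%(t, u). F t u) \<in> borel_measurable (borel \<Otimes>\<^sub>M borel)"
    unfolding F_def by measurable
  have "(\<integral>\<^sup>+(x, w). G (x(i := x i + s * w i), w(i := - w i)) * ennreal (exp (D s (x i) (w i))) \<partial>PG)
    = (\<integral>\<^sup>+t. \<integral>\<^sup>+u. (\<integral>\<^sup>+x. \<integral>\<^sup>+w. G (x(i := t + s * u), w(i := - u)) * ennreal (exp (D s t u)) \<partial>\<Gamma> \<partial>P) \<partial>std_gauss \<partial>target \<phi>)"
    by (subst PG_nn_upd[where i=i]) auto
  also have "... = (\<integral>\<^sup>+t. \<integral>\<^sup>+u. F (t + s * u) (- u) * ennreal (exp (D s t u)) \<partial>std_gauss \<partial>target \<phi>)"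
    unfolding F_def by (intro nn_integral_cong) (simp add: nn_integral_multc)
  also have "... = (\<integral>\<^sup>+t. \<integral>\<^sup>+u. F t u \<partial>std_gauss \<partial>target \<phi>)"
    by (rule reversal_1[OF Fm])
  also have "... = (\<integral>\<^sup>+z. G z \<partial>PG)"
    unfolding F_def by (rule PG_nn_upd[OF G, symmetric])
  finally show ?thesis .
qed

text \<open>Induction on the number of moved coordinates: the map for the first n coordinates leaves
  coordinate n alone, so that coordinate can be peeled off by \<open>reversal_coord\<close>.\<close>

lemma reversal:
  assumes G: "G \<in> borel_measurable PG"
  shows "(\<integral>\<^sup>+z. G (\<theta> s n z) * ennreal (exp (\<Sum>j<n. D s (fst z j) (snd z j))) \<partial>PG) = (\<integral>\<^sup>+z. G z \<partial>PG)"
proof (induction n)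
  case 0
  then show ?case by (simp add: \<theta>_def pr_def flip_def split_beta')
next
  case (Suc n)
  note [measurable] = G
  let ?H = "%z. G (\<theta> s n z) * ennreal (exp (\<Sum>j<n. D s (fst z j) (snd z j)))"
  have "(\<integral>\<^sup>+z. G (\<theta> s (Suc n) z) * ennreal (exp (\<Sum>j<Suc n. D s (fst z j) (snd z j))) \<partial>PG)
     = (\<integral>\<^sup>+(x, w). ?H (x(n := x n + s * w n), w(n := - w n)) * ennreal (exp (D s (x n) (w n))) \<partial>PG)"
  proof (rule nn_integral_cong, clarify)
    fix x w :: "nat => real"
    have "\<theta> s n (x(n := x n + s * w n), w(n := - w n)) = \<theta> s (Suc n) (x, w)"
      by (auto simp: \<theta>_def pr_def flip_def fun_eq_iff less_Suc_eq)
    moreover have "(\<Sum>j<n. D s ((x(n := x n + s * w n)) j) ((w(n := - w n)) j)) = (\<Sum>j<n. D s (x j) (w j))"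
      by (intro sum.cong) auto
    moreover have "ennreal (exp (\<Sum>j<Suc n. D s (x j) (w j))) = ennreal (exp (\<Sum>j<n. D s (x j) (w j))) * ennreal (exp (D s (x n) (w n)))"
      by (simp only: sum.lessThan_Suc exp_add) (rule ennreal_mult, auto)
    ultimately show "G (\<theta> s (Suc n) (x, w)) * ennreal (exp (\<Sum>j<Suc n. D s (fst (x, w) j) (snd (x, w) j)))
       = ?H (x(n := x n + s * w n), w(n := - w n)) * ennreal (exp (D s (x n) (w n)))"
      by (simp only: fst_conv snd_conv mult.assoc)
  qed
  also have "... = (\<integral>\<^sup>+z. ?H z \<partial>PG)"
    by (rule reversal_coord) measurable
  finally show ?case using Suc by simp
qed

lemma D_theta: "j < n ==> D s (fst (\<theta> s n z) j) (snd (\<theta> s n z) j) = - D s (fst z j) (snd z j)"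
  by (cases z) (simp add: \<theta>_def pr_def flip_def D_def)

lemma theta_invol: "\<theta> s n (\<theta> s n z) = z"
  by (cases z) (auto simp: \<theta>_def pr_def flip_def fun_eq_iff)

lemma mult_swap_ennreal: "a * e = b ==> a * g * e = b * g" for a b e g :: ennreal
  by (auto simp: mult_ac)

text \<open>The Metropolis rule satisfies \<open>min 1 (exp (- E)) * exp E = min 1 (exp E)\<close>,
  so weighting by \<open>acc\<close> turns the change of measure in \<open>reversal\<close> into
  invariance.\<close>

lemma reversal_acc_nn:
  assumes G[measurable]: "G \<in> borel_measurable PG"
  shows "(\<integral>\<^sup>+z. ennreal (acc s n (fst z) (snd z)) * G (\<theta> s n z) \<partial>PG) = (\<integral>\<^sup>+z. ennreal (acc s n (fst z) (snd z)) * G z \<partial>PG)"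
proof -
  have "(\<integral>\<^sup>+z. ennreal (acc s n (fst z) (snd z)) * G z \<partial>PG)
    = (\<integral>\<^sup>+z. ennreal (acc s n (fst (\<theta> s n z)) (snd (\<theta> s n z))) * G (\<theta> s n z) * ennreal (exp (\<Sum>j<n. D s (fst z j) (snd z j))) \<partial>PG)"
    by (subst reversal) auto
  also have "... = (\<integral>\<^sup>+z. ennreal (acc s n (fst z) (snd z)) * G (\<theta> s n z) \<partial>PG)"
  proof (rule nn_integral_cong)
    fix z
    let ?E = "\<Sum>j<n. D s (fst z j) (snd z j)"
    have "acc s n (fst (\<theta> s n z)) (snd (\<theta> s n z)) = min 1 (exp (- ?E))"
      unfolding acc_def by (simp add: D_theta sum_negf)
    moreover have "min 1 (exp (- ?E)) * exp ?E = min 1 (exp ?E)"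
      by (auto simp: min_def exp_minus field_simps)
    ultimately have "ennreal (acc s n (fst (\<theta> s n z)) (snd (\<theta> s n z))) * ennreal (exp ?E) = ennreal (acc s n (fst z) (snd z))"
      by (simp add: ennreal_mult[symmetric] acc_def)
    then show "ennreal (acc s n (fst (\<theta> s n z)) (snd (\<theta> s n z))) * G (\<theta> s n z) * ennreal (exp ?E) = ennreal (acc s n (fst z) (snd z)) * G (\<theta> s n z)"
      by (rule mult_swap_ennreal)
  qed
  finally show ?thesis by simp
qed

lemma acc_bounds: "0 <= acc s n x w" "acc s n x w <= 1" "abs (acc s n x w) <= 1"
  by (auto simp: acc_def)

text \<open>Invariance of a measure, rather than of integrals, so that it transfers to signed
  integrands and to integrability.\<close>

lemma distr_theta:
  "distr (density PG (%z. ennreal (acc s n (fst z) (snd z)))) PG (\<theta> s n) = density PG (%z. ennreal (acc s n (fst z) (snd z)))"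
  (is "distr ?N PG _ = ?N")
proof (rule measure_eqI)
  fix A assume "A \<in> sets (distr ?N PG (\<theta> s n))"
  then have A[measurable]: "A \<in> sets PG" by simp
  have [measurable]: "\<theta> s n -` A \<inter> space PG \<in> sets PG" by measurable
  have "emeasure (distr ?N PG (\<theta> s n)) A = emeasure ?N (\<theta> s n -` A \<inter> space PG)"
    by (subst emeasure_distr) auto
  also have "... = (\<integral>\<^sup>+z. ennreal (acc s n (fst z) (snd z)) * indicator (\<theta> s n -` A \<inter> space PG) z \<partial>PG)"
    by (subst emeasure_density) auto
  also have "... = (\<integral>\<^sup>+z. ennreal (acc s n (fst z) (snd z)) * indicator A (\<theta> s n z) \<partial>PG)"
    by (intro nn_integral_cong) (auto split: split_indicator)
  also have "... = (\<integral>\<^sup>+z. ennreal (acc s n (fst z) (snd z)) * indicator A z \<partial>PG)"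
    by (rule reversal_acc_nn) auto
  also have "... = emeasure ?N A" by (subst emeasure_density) auto
  finally show "emeasure (distr ?N PG (\<theta> s n)) A = emeasure ?N A" .
qed simp

lemma reversal_integral:
  fixes G :: "(nat => real) \<times> (nat => real) => real"
  assumes G[measurable]: "G \<in> borel_measurable PG"
  shows "(LINT z|PG. acc s n (fst z) (snd z) * G (\<theta> s n z)) = (LINT z|PG. acc s n (fst z) (snd z) * G z)"
    and "integrable PG (%z. acc s n (fst z) (snd z) * G (\<theta> s n z)) \<longleftrightarrow> integrable PG (%z. acc s n (fst z) (snd z) * G z)"
proof -
  let ?N = "density PG (%z. ennreal (acc s n (fst z) (snd z)))"
  have e: "integral\<^sup>L ?N H = (LINT z|PG. acc s n (fst z) (snd z) * H z)"
     and i: "integrable ?N H \<longleftrightarrow> integrable PG (%z. acc s n (fst z) (snd z) * H z)"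
    if [measurable]: "H \<in> borel_measurable PG" for H :: "_ => real"
    by (subst integral_density integrable_density; auto simp: acc_bounds)+
  have "integral\<^sup>L ?N G = integral\<^sup>L (distr ?N PG (\<theta> s n)) G" by (simp only: distr_theta)
  also have "... = integral\<^sup>L ?N (%z. G (\<theta> s n z))" by (subst integral_distr) auto
  finally show "(LINT z|PG. acc s n (fst z) (snd z) * G (\<theta> s n z)) = (LINT z|PG. acc s n (fst z) (snd z) * G z)"
    by (simp add: e)
  have "integrable ?N G \<longleftrightarrow> integrable (distr ?N PG (\<theta> s n)) G" by (simp only: distr_theta)
  also have "... \<longleftrightarrow> integrable ?N (%z. G (\<theta> s n z))" by (subst integrable_distr_eq) auto
  finally show "integrable PG (%z. acc s n (fst z) (snd z) * G (\<theta> s n z)) \<longleftrightarrow> integrable PG (%z. acc s n (fst z) (snd z) * G z)"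
    by (simp add: i)
qed

section \<open>Marginal law of one position together with its noise\<close>

lemma distr_pair_coord: "distr PG M2 (%z. (fst z j, snd z j)) = M2"
proof -
  have "M2 = distr P (target \<phi>) (%x. x j) \<Otimes>\<^sub>M distr \<Gamma> std_gauss (%w. w j)"
    by (simp only: T.distr_coord Gauss.distr_coord)
  also have "... = distr PG M2 (%(x, w). (x j, w j))"
  proof (rule pair_measure_distr)
    show "sigma_finite_measure (distr \<Gamma> std_gauss (%w. w j))"
      unfolding Gauss.distr_coord by unfold_locales
  qed auto
  finally show ?thesis by (simp add: split_beta')
qed

lemma pair_coord_meas: "(%z. (fst z j, snd z j)) \<in> measurable PG M2"
  by (rule measurable_Pair) (simp_all add: measurable_cong_sets[OF refl T.sets_M] measurable_cong_sets[OF refl Gauss.sets_M])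

lemma integral_pair_coord:
  fixes h :: "real \<times> real => real"
  assumes h: "h \<in> borel_measurable M2"
  shows "(LINT z|PG. h (fst z j, snd z j)) = integral\<^sup>L M2 h"
    and "integrable PG (%z. h (fst z j, snd z j)) \<longleftrightarrow> integrable M2 h"
proof -
  show "(LINT z|PG. h (fst z j, snd z j)) = integral\<^sup>L M2 h"
    by (subst distr_pair_coord[of j, symmetric], subst integral_distr[OF pair_coord_meas]) (use h in auto)
  show "integrable PG (%z. h (fst z j, snd z j)) \<longleftrightarrow> integrable M2 h"
    by (subst distr_pair_coord[of j, symmetric], subst integrable_distr_eq[OF pair_coord_meas]) (use h in auto)
qed

end

section \<open>First and second moments of the log acceptance ratio\<close>

lemma (in pair_sigma_finite) integrable_times:
  fixes h :: "'a => real" and g :: "'b => real"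
  assumes h: "integrable M1 h" and g: "integrable M2 g"
  shows "integrable (M1 \<Otimes>\<^sub>M M2) (%z. h (fst z) * g (snd z))"
    and "(LINT z|(M1 \<Otimes>\<^sub>M M2). h (fst z) * g (snd z)) = (LINT x|M1. h x) * (LINT y|M2. g y)"
proof -
  note [measurable] = borel_measurable_integrable[OF h] borel_measurable_integrable[OF g]
  show i: "integrable (M1 \<Otimes>\<^sub>M M2) (%z. h (fst z) * g (snd z))"
  proof (rule Fubini_integrable)
    show "integrable M1 (%x. \<integral>y. norm (h (fst (x, y)) * g (snd (x, y))) \<partial>M2)"
      using h by (simp add: abs_mult)
  qed (use g in auto)
  show "(LINT z|(M1 \<Otimes>\<^sub>M M2). h (fst z) * g (snd z)) = (LINT x|M1. h x) * (LINT y|M2. g y)"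
    using integral_fst'[OF i] by simp
qed

lemma gauss_flip:
  "h \<in> borel_measurable borel ==> (LINT w|std_gauss. h (- w)) = (LINT w|std_gauss. (h w :: real))"
  by (subst (2) gauss_symmetric[symmetric], subst integral_distr) (auto simp: measurable_cong_sets[OF Gauss.sets_M refl])

text \<open>The second bound compares \<open>exp x\<close> with \<open>inverse (1 - x)\<close>,
  because \<open>(1 + x + x\<^sup>2) * (1 - x) = 1 - x ^ 3\<close> is at least 1 for x <= 0.\<close>

lemma one_minus_exp_bounds:
  fixes x :: real
  assumes "x <= 0"
  shows "abs (1 - exp x) <= abs x" "abs (1 - exp x + x) <= x\<^sup>2"
proof -
  have a: "1 + x <= exp x" by (rule exp_ge_add_one_self)
  have e1: "exp x <= 1" using assms by simp
  from a e1 assms show 1: "abs (1 - exp x) <= abs x" by linarith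
  have "exp x <= 1 + x + x\<^sup>2"
  proof -
    have "1 - x <= exp (- x)" using exp_ge_add_one_self[of "-x"] by simp
    then have "exp x <= inverse (1 - x)" using assms by (simp add: exp_minus le_imp_inverse_le inverse_le_imp_le)
    also have "... <= 1 + x + x\<^sup>2"
    proof -
      have "1 <= (1 + x + x\<^sup>2) * (1 - x)"
      proof -
        have "(1 + x + x\<^sup>2) * (1 - x) = 1 - x ^ 3" by (simp add: power2_eq_square power3_eq_cube algebra_simps)
        moreover have "x ^ 3 <= 0" using assms by (simp add: power3_eq_cube mult_nonpos_nonpos mult_nonneg_nonpos)
        ultimately show ?thesis by simp
      qed
      then show ?thesis using assms by (simp add: inverse_eq_divide pos_divide_le_eq)
    qed
    finally show ?thesis .
  qed
  then show "abs (1 - exp x + x) <= x\<^sup>2" using a by linarith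
qed

text \<open>A quantitative form of (H) at the proposal scale: the decay in n is separated from a
  polynomial in the noise, and the latter has all Gaussian moments.\<close>

locale mh_rate = mh +
  fixes K :: real and p :: nat and \<kappa> :: "nat => real"
  assumes K0: "0 <= K" and kappa_lim: "\<kappa> \<longlonglongrightarrow> 0" and kappa0: "!!n. 0 <= \<kappa> n" and kappa1: "!!n. \<kappa> n <= 1"
    and rate: "!!n s t w. 1 <= n ==> abs s <= \<tau> / sqrt (real n) ==> abs (d (t + s * w) - d t) <= \<kappa> n * (K * (1 + abs w ^ p))"

lemma (in mh) rate_exists: "\<exists>K p \<kappa>. mh_rate \<phi> \<tau> K p \<kappa>"
proof -
  obtain k \<gamma> \<alpha> where k: "k > 0" and g: "0 < \<gamma>" "\<gamma> < 1" and a: "\<alpha> > (1::real)"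
    and h: "!!x v. v \<noteq> 0 ==> abs (d (x + v) - d x) < k * max (abs v powr \<gamma>) (abs v powr \<alpha>)"
    using phi_H unfolding condH_def d_def by blast
  \<comment> \<open>An integer power above \<alpha> dominates, up to the constant 1, both powers
    that occur in (H). The rate keeps the power \<gamma> of \<open>1 / sqrt (real n)\<close>, the
    slower of the two decays.\<close>
  define p where "p = nat \<lceil>\<alpha>\<rceil>"
  define \<kappa> where "\<kappa> n = (if n = 0 then 0 else (1 / sqrt (real n)) powr \<gamma>)" for n :: nat
  define K where "K = 2 * k * (1 + \<tau> ^ p)"
  have pa: "\<alpha> <= real p" unfolding p_def by linarith
  have pw: "y powr e <= 1 + y ^ p" if "0 <= y" "0 < e" "e <= \<alpha>" for y e :: real
  proof (cases "y <= 1")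
    case True
    have "y powr e <= 1" using True that by (simp add: powr_le1)
    then show ?thesis using that by (simp add: add_increasing2)
  next
    case False
    then have "y powr e <= y powr real p" using that pa by (intro powr_mono) auto
    also have "... = y ^ p" using False by (intro powr_realpow) simp
    finally show ?thesis by simp
  qed
  have "mh_rate \<phi> \<tau> K p \<kappa>"
  proof
    show "0 <= K" using k tau_pos by (simp add: K_def)
    show "0 <= \<kappa> n" for n by (simp add: \<kappa>_def)
    show "\<kappa> n <= 1" for n using g by (auto simp: \<kappa>_def intro!: powr_le1)
    show "\<kappa> \<longlonglongrightarrow> 0"
    proof (rule Lim_transform_eventually)
      have "(%n. sqrt (1 / real n)) \<longlonglongrightarrow> sqrt 0" by (intro tendsto_real_sqrt lim_1_over_n)
      then have "(%n. 1 / sqrt (real n)) \<longlonglongrightarrow> 0" by (simp add: real_sqrt_divide)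
      then show "(%n. (1 / sqrt (real n)) powr \<gamma>) \<longlonglongrightarrow> 0"
        by (rule tendsto_zero_powrI[OF _ tendsto_const _ g(1)]) simp
      show "\<forall>\<^sub>F n in sequentially. (1 / sqrt (real n)) powr \<gamma> = \<kappa> n"
        by (auto simp: \<kappa>_def eventually_sequentially intro!: exI[of _ 1])
    qed
    fix n :: nat and s t w :: real
    assume n: "1 <= n" and s: "abs s <= \<tau> / sqrt (real n)"
    show "abs (d (t + s * w) - d t) <= \<kappa> n * (K * (1 + abs w ^ p))"
    proof (cases "s * w = 0")
      case True
      have "0 <= \<kappa> n * (K * (1 + abs w ^ p))"
        using k tau_pos by (intro mult_nonneg_nonneg add_nonneg_nonneg) (auto simp: K_def \<kappa>_def)
      then show ?thesis by (simp only: True add_0_right diff_self abs_zero)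
    next
      case False
      let ?y = "\<tau> * abs w" let ?r = "1 / sqrt (real n)"
      have y0: "0 <= ?y" using tau_pos by simp
      have r01: "0 < ?r" "?r <= 1" using n by auto
      have sw: "abs (s * w) <= ?r * ?y"
        using mult_right_mono[OF s, of "abs w"] by (simp add: abs_mult)
      have b: "abs (s * w) powr e <= ?r powr \<gamma> * (1 + ?y ^ p)" if e: "\<gamma> <= e" "e <= \<alpha>" for e
      proof -
        have "abs (s * w) powr e <= (?r * ?y) powr e" using sw e g by (intro powr_mono2) auto
        also have "... = ?r powr e * ?y powr e" by (rule powr_mult)
        also have "... <= ?r powr \<gamma> * (1 + ?y ^ p)"
          using r01 e g y0 by (intro mult_mono pw powr_mono') auto
        finally show ?thesis .
      qed
      have "abs (d (t + s * w) - d t) <= k * max (abs (s * w) powr \<gamma>) (abs (s * w) powr \<alpha>)"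
        using h[OF False, of t] by simp
      also have "... <= k * (?r powr \<gamma> * (1 + ?y ^ p))"
        using b[of \<gamma>] b[of \<alpha>] g a k by (intro mult_left_mono) auto
      also have "... = \<kappa> n * (k * (1 + ?y ^ p))" using n by (simp add: \<kappa>_def)
      also have "... <= \<kappa> n * (K * (1 + abs w ^ p))"
      proof (intro mult_left_mono)
        have "1 + ?y ^ p <= (1 + \<tau> ^ p) * (1 + abs w ^ p)"
          using tau_pos by (simp add: power_mult_distrib algebra_simps)
        also have "... <= 2 * (1 + \<tau> ^ p) * (1 + abs w ^ p)"
          using tau_pos by (intro mult_right_mono) auto
        finally show "k * (1 + ?y ^ p) <= K * (1 + abs w ^ p)"
          using k by (simp add: K_def mult.assoc mult.left_commute)
      qed (simp add: \<kappa>_def)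
      finally show ?thesis .
    qed
  qed
  then show ?thesis by blast
qed

context mh_rate begin

section \<open>Size and mean of the log density ratio of one coordinate\<close>

definition st :: "nat => real" where "st n = \<tau> / sqrt (real n)"
definition B :: "real => real" where "B w = K * (1 + abs w ^ p)"
definition r :: "nat => real => real => real" where "r n t w = D (st n) t w - st n * d t * w"

lemma st_nonneg[simp]: "0 <= st n" using tau_pos by (simp add: st_def)
lemma st_sq: "n \<ge> 1 ==> real n * (st n)^2 = \<tau>\<^sup>2" by (simp add: st_def power_divide)
lemma sqrt_st: "n \<ge> 1 ==> sqrt (real n) * st n = \<tau>" by (simp add: st_def)
lemma B_nonneg[simp]: "0 <= B w" using K0 by (simp add: B_def)
lemma B_meas[measurable]: "B \<in> borel_measurable borel" unfolding B_def by measurable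

lemma st_lim: "st \<longlonglongrightarrow> 0"
proof -
  have "(%n. \<tau> * sqrt (1 / real n)) \<longlonglongrightarrow> \<tau> * sqrt 0"
    by (intro tendsto_mult tendsto_const tendsto_real_sqrt lim_1_over_n)
  then show ?thesis unfolding st_def by (simp add: real_sqrt_divide)
qed

text \<open>Mean value inequality along the segment: the function \<open>?g\<close> has derivative
  \<open>(d (t + u * w) - d t) * w\<close>, so the modulus of continuity of \<open>d\<close> is all
  that enters.\<close>

lemma r_bound: 
  assumes n: "n \<ge> 1"
  shows "abs (r n t w) <= st n * abs w * (\<kappa> n * B w)"
proof -
  let ?g = "%u. \<phi> (t + u * w) - u * (d t * w)"
  have "norm (?g (st n) - ?g 0) <= (abs w * (\<kappa> n * B w)) * norm (st n - 0)"
  proof (rule field_differentiable_bound[where S="{0..st n}" and f'="%u. (d (t + u * w) - d t) * w"])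
    fix u assume u: "u \<in> {0..st n}"
    have "(\<phi> has_real_derivative d (t + u * w)) (at (t + u * w))" by (rule d_deriv)
    then have "((%u. \<phi> (t + u * w)) has_real_derivative d (t + u * w) * w) (at u)"
      by (rule DERIV_chain2) (auto intro!: derivative_eq_intros)
    then have "(?g has_real_derivative d (t + u * w) * w - d t * w) (at u)"
      by (rule DERIV_diff) (auto intro!: derivative_eq_intros)
    then show "(?g has_field_derivative (d (t + u * w) - d t) * w) (at u within {0..st n})"
      by (simp add: left_diff_distrib has_field_derivative_at_within)
    have "abs (d (t + u * w) - d t) <= \<kappa> n * B w"
      unfolding B_def using u by (intro rate n) (auto simp: st_def)
    then show "norm ((d (t + u * w) - d t) * w) <= abs w * (\<kappa> n * B w)"
      by (simp add: abs_mult mult_left_mono mult.commute)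
  qed auto
  then show ?thesis by (simp add: r_def D_def mult_ac)
qed

lemma D_bound:
  assumes n: "n \<ge> 1"
  shows "abs (D (st n) t w) <= st n * abs w * (abs (d t) + B w)"
proof -
  have "abs (D (st n) t w) <= abs (r n t w) + abs (st n * d t * w)"
    unfolding r_def using abs_triangle_ineq[of "D (st n) t w - st n * d t * w" "st n * d t * w"] by simp
  also have "... <= st n * abs w * (1 * B w) + st n * abs w * abs (d t)"
  proof (rule add_mono)
    have "abs (r n t w) <= st n * abs w * (\<kappa> n * B w)" by (rule r_bound[OF n])
    also have "... <= st n * abs w * (1 * B w)"
      using kappa1[of n] kappa0[of n] by (intro mult_left_mono mult_right_mono) auto
    finally show "abs (r n t w) <= st n * abs w * (1 * B w)" .
    show "abs (st n * d t * w) <= st n * abs w * abs (d t)" by (simp add: abs_mult mult_ac)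
  qed
  finally show ?thesis by (simp add: distrib_left)
qed

lemma gauss_poly: "integrable std_gauss (%w. abs w ^ a * B w ^ b)"
proof -
  have "(1 + y ^ p) ^ b = (\<Sum>k\<le>b. real (b choose k) * y ^ (p * (b - k)))" for y :: real
    by (subst binomial_ring) (simp add: power_mult)
  then have "(%w::real. abs w ^ a * B w ^ b) = (%w. \<Sum>k\<le>b. K ^ b * real (b choose k) * abs w ^ (a + p * (b - k)))"
    by (simp add: B_def power_mult_distrib power_add sum_distrib_left mult_ac fun_eq_iff)
  then show ?thesis by (simp add: gauss_abs_moment)
qed

lemma gauss_poly_even: "integrable std_gauss (%w. w\<^sup>2 * B w ^ b)"
  using gauss_poly[of 2 b] by simp

lemma D_pair_meas[measurable]: "(%z. D s (fst z) (snd z)) \<in> borel_measurable M2"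
  by measurable

lemma d_int: "integrable (target \<phi>) d" "integrable (target \<phi>) (%t. abs (d t))"
  using T.sqi_integrable[OF d_sqi] by auto

text \<open>Finite Fisher information controls the square of \<open>d\<close>, the noise has all
  moments, and independence of position and noise lets the mixed products separate.\<close>

lemma D_dom_integrable: "integrable M2 (%z. (snd z)^2 * (abs (d (fst z)) + B (snd z))^2)"
proof -
  have "integrable M2 (%z. (d (fst z))^2 * (snd z)^2 + 2 * (abs (d (fst z)) * ((snd z)^2 * B (snd z))) + 1 * ((snd z)^2 * (B (snd z))^2))"
    using gauss_poly_even[of 1] gauss_poly_even[of 2] gauss_moment[of 2] sqi_int[OF d_sqi] d_int(2)
    by (intro Bochner_Integration.integrable_add integrable_mult_right M2.integrable_times(1)[where h="%t. (d t)^2" and g="%w. w\<^sup>2"]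
      M2.integrable_times(1)[where h="%t. abs (d t)" and g="%w. w\<^sup>2 * B w"] M2.integrable_times(1)[where h="%t. 1" and g="%w. w\<^sup>2 * (B w)^2"]) auto
  then show ?thesis by (simp add: power2_sum algebra_simps)
qed

lemma D_sq_bound:
  assumes n: "n \<ge> 1"
  shows "real n * (D (st n) t w)^2 <= \<tau>\<^sup>2 * (w\<^sup>2 * (abs (d t) + B w)^2)"
proof -
  have "(D (st n) t w)^2 <= (st n * abs w * (abs (d t) + B w))^2"
    using power_mono[OF D_bound[OF n, of t w], of 2] by simp
  then have "real n * (D (st n) t w)^2 <= real n * (st n * abs w * (abs (d t) + B w))^2"
    by (intro mult_left_mono) auto
  also have "... = (real n * (st n)^2) * (w\<^sup>2 * (abs (d t) + B w)^2)" by (simp add: power_mult_distrib mult_ac)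
  finally show ?thesis by (simp only: st_sq[OF n])
qed

lemma D_sqi: "n \<ge> 1 ==> (%z. D (st n) (fst z) (snd z)) \<in> sqi M2"
proof (rule sqiI)
  assume n: "n \<ge> 1"
  show "integrable M2 (%z. (D (st n) (fst z) (snd z))^2)"
  proof (rule Bochner_Integration.integrable_bound)
    show "integrable M2 (%z. \<tau>\<^sup>2 * ((snd z)^2 * (abs (d (fst z)) + B (snd z))^2))"
      by (intro integrable_mult_right D_dom_integrable)
    show "AE z in M2. norm ((D (st n) (fst z) (snd z))^2) <= norm (\<tau>\<^sup>2 * ((snd z)^2 * (abs (d (fst z)) + B (snd z))^2))"
    proof (rule AE_I2)
      fix z :: "real \<times> real"
      have "1 * (D (st n) (fst z) (snd z))^2 <= real n * (D (st n) (fst z) (snd z))^2"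
        using n by (intro mult_right_mono) auto
      also have "... <= \<tau>\<^sup>2 * ((snd z)^2 * (abs (d (fst z)) + B (snd z))^2)" by (rule D_sq_bound[OF n])
      finally show "norm ((D (st n) (fst z) (snd z))^2) <= norm (\<tau>\<^sup>2 * ((snd z)^2 * (abs (d (fst z)) + B (snd z))^2))" by simp
    qed
  qed measurable
qed measurable

lemma D_int: "n \<ge> 1 ==> integrable M2 (%z. D (st n) (fst z) (snd z))"
  by (rule M2.sqi_integrable[OF D_sqi])

text \<open>Reversibility maps the event \<open>D > 0\<close> to \<open>D < 0\<close>; this replaces the mean of \<open>D\<close>,
  which is of first order, by an expression of second order.\<close>

lemma D_mean:
  assumes n: "n \<ge> 1"
  shows "(LINT z|M2. D (st n) (fst z) (snd z))
    = (LINT z|M2. min (D (st n) (fst z) (snd z)) 0 * (1 - exp (min (D (st n) (fst z) (snd z)) 0)))"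
proof -
  let ?D = "%z. D (st n) (fst z) (snd z)"
  let ?f = "%z. max 0 (?D z)" and ?g = "%z. max 0 (- ?D z) * exp (?D z)"
  have fi: "integrable M2 ?f" and mi: "integrable M2 (%z. max 0 (- ?D z))"
    by (rule Bochner_Integration.integrable_max[OF integrable_zero D_int[OF n]],
        rule Bochner_Integration.integrable_max[OF integrable_zero integrable_minus[OF D_int[OF n]]])
  have gi: "integrable M2 ?g"
  proof (rule Bochner_Integration.integrable_bound[OF D_int[OF n]])
    have "max 0 (- y) * exp y <= abs y" for y :: real
    proof -
      have "max 0 (- y) * exp y <= max 0 (- y) * 1"
        by (cases "0 <= y") (auto intro!: mult_left_mono)
      then show ?thesis by simp
    qed
    then show "AE z in M2. norm (?g z) <= norm (?D z)" by (intro AE_I2) simp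
  qed measurable
  have Dm: "D (st n) (t + st n * w) (- w) = - D (st n) t w" for t w by (simp add: D_def)
  have "(\<integral>\<^sup>+z. ennreal (?f z) \<partial>M2) = (\<integral>\<^sup>+t. \<integral>\<^sup>+w. ennreal (max 0 (D (st n) t w)) \<partial>std_gauss \<partial>target \<phi>)"
    by (subst Gauss.nn_integral_fst[symmetric]) auto
  also have "... = (\<integral>\<^sup>+t. \<integral>\<^sup>+w. ennreal (max 0 (D (st n) (t + st n * w) (- w))) * ennreal (exp (D (st n) t w)) \<partial>std_gauss \<partial>target \<phi>)"
    by (rule reversal_1[symmetric]) measurable
  also have "... = (\<integral>\<^sup>+t. \<integral>\<^sup>+w. ennreal (?g (t, w)) \<partial>std_gauss \<partial>target \<phi>)"
    by (simp add: Dm ennreal_mult)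
  also have "... = (\<integral>\<^sup>+z. ennreal (?g z) \<partial>M2)"
    by (rule Gauss.nn_integral_fst) measurable
  finally have e: "integral\<^sup>L M2 ?f = integral\<^sup>L M2 ?g"
  proof -
    assume eq: "(\<integral>\<^sup>+z. ennreal (?f z) \<partial>M2) = (\<integral>\<^sup>+z. ennreal (?g z) \<partial>M2)"
    have A: "(\<integral>\<^sup>+z. ennreal (?f z) \<partial>M2) = ennreal (integral\<^sup>L M2 ?f)" by (rule nn_integral_eq_integral[OF fi]) simp
    have B: "(\<integral>\<^sup>+z. ennreal (?g z) \<partial>M2) = ennreal (integral\<^sup>L M2 ?g)" by (rule nn_integral_eq_integral[OF gi]) simp
    have "0 <= integral\<^sup>L M2 ?f" "0 <= integral\<^sup>L M2 ?g" by (auto intro!: Bochner_Integration.integral_nonneg)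
    then show ?thesis using eq unfolding A B by (simp only: ennreal_inj)
  qed
  have "(LINT z|M2. ?D z) = (LINT z|M2. ?f z - max 0 (- ?D z))"
    by (intro Bochner_Integration.integral_cong) auto
  also have "... = (LINT z|M2. ?g z) - (LINT z|M2. max 0 (- ?D z))" using fi mi e by simp
  also have "... = (LINT z|M2. ?g z - max 0 (- ?D z))" using gi mi by simp
  also have "... = (LINT z|M2. min (?D z) 0 * (1 - exp (min (?D z) 0)))"
    by (intro Bochner_Integration.integral_cong) (auto simp: min_def max_def algebra_simps)
  finally show ?thesis .
qed

lemma sqrt_D_lim: "(%n. sqrt (real n) * D (st n) t w) \<longlonglongrightarrow> \<tau> * d t * w"
proof (rule Lim_null[THEN iffD2], rule Lim_null_comparison)
  show "\<forall>\<^sub>F n in sequentially. norm (sqrt (real n) * D (st n) t w - \<tau> * d t * w) <= \<tau> * abs w * B w * \<kappa> n"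
  proof (rule eventually_sequentiallyI[of 1])
    fix n :: nat assume n: "1 <= n"
    have "sqrt (real n) * D (st n) t w - \<tau> * d t * w = sqrt (real n) * r n t w"
      by (simp add: r_def right_diff_distrib mult.assoc[symmetric] sqrt_st[OF n])
    then have "norm (sqrt (real n) * D (st n) t w - \<tau> * d t * w) = sqrt (real n) * abs (r n t w)"
      by (simp add: abs_mult)
    also have "... <= sqrt (real n) * (st n * abs w * (\<kappa> n * B w))"
      by (intro mult_left_mono r_bound n) simp
    also have "... = (sqrt (real n) * st n) * abs w * B w * \<kappa> n" by (simp add: mult_ac)
    finally show "norm (sqrt (real n) * D (st n) t w - \<tau> * d t * w) <= \<tau> * abs w * B w * \<kappa> n"
      by (simp only: sqrt_st[OF n])
  qed
  show "(%n. \<tau> * abs w * B w * \<kappa> n) \<longlonglongrightarrow> 0"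
    using tendsto_mult[OF tendsto_const kappa_lim, of "\<tau> * abs w * B w"] by simp
qed

lemma D_lim: "(%n. D (st n) t w) \<longlonglongrightarrow> 0"
proof (rule Lim_transform_eventually)
  have "(%n. sqrt (real n) * D (st n) t w * (st n / \<tau>)) \<longlonglongrightarrow> \<tau> * d t * w * (0 / \<tau>)"
    using tau_pos by (intro tendsto_mult tendsto_divide sqrt_D_lim st_lim tendsto_const) simp
  then show "(%n. sqrt (real n) * D (st n) t w * (st n / \<tau>)) \<longlonglongrightarrow> 0" by simp
  show "\<forall>\<^sub>F n in sequentially. sqrt (real n) * D (st n) t w * (st n / \<tau>) = D (st n) t w"
    using tau_pos by (auto simp: st_def eventually_sequentially intro!: exI[of _ 1])
qed

text \<open>By the symmetry of w, the negative half of \<open>(\<tau> * d t * w)\<^sup>2\<close>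
  carries half of its mean.\<close>

lemma half_square_mean: "(LINT z|M2. (min (\<tau> * d (fst z) * snd z) 0)^2) = \<sigma>\<^sup>2 / 2"
proof -
  have dom: "integrable M2 (%z. \<tau>\<^sup>2 * ((d (fst z))^2 * (snd z)^2))"
    by (intro integrable_mult_right M2.integrable_times(1)[where h="%t. (d t)^2" and g="%w. w\<^sup>2"] sqi_int[OF d_sqi] gauss_moment)
  have i: "integrable M2 (%z. (min (\<tau> * d (fst z) * snd z) 0)^2)"
    by (rule Bochner_Integration.integrable_bound[OF dom]) (auto simp: min_def power_mult_distrib)
  have inner: "(LINT w|std_gauss. (min (\<tau> * d t * w) 0)^2) = \<tau>\<^sup>2 / 2 * (d t)^2" for t
  proof -
    let ?h = "%w. (min (\<tau> * d t * w) 0)^2"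
    have hb: "integrable std_gauss ?h"
      by (rule Bochner_Integration.integrable_bound[where f="%w. (\<tau> * d t)^2 * w\<^sup>2"])
         (auto simp: min_def power_mult_distrib intro: gauss_moment)
    have hb': "integrable std_gauss (%w. ?h (- w))"
      by (rule Bochner_Integration.integrable_bound[where f="%w. (\<tau> * d t)^2 * w\<^sup>2"])
         (auto simp: min_def power_mult_distrib intro: gauss_moment)
    have "2 * (LINT w|std_gauss. ?h w) = (LINT w|std_gauss. ?h w) + (LINT w|std_gauss. ?h (- w))"
      using gauss_flip[of ?h] by simp
    also have "... = (LINT w|std_gauss. ?h w + ?h (- w))" using hb hb' by simp
    also have "... = (LINT w|std_gauss. (\<tau> * d t)^2 * w\<^sup>2)"
      by (intro Bochner_Integration.integral_cong) (auto simp: min_def power_mult_distrib)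
    also have "... = (\<tau> * d t)^2" by (simp add: gauss_second_moment)
    finally show ?thesis by (simp add: power_mult_distrib)
  qed
  have "(LINT z|M2. (min (\<tau> * d (fst z) * snd z) 0)^2) = (LINT t|target \<phi>. \<tau>\<^sup>2 / 2 * (d t)^2)"
    using M2.integral_fst'[OF i] by (simp add: inner)
  also have "... = \<sigma>\<^sup>2 / 2" by (simp add: d_sq_integral sigma_sq)
  finally show ?thesis .
qed

text \<open>By \<open>D_mean\<close> the mean is that of q(D), and q(y) behaves like minus the
  square of the negative part of y. Multiplied by n it converges pointwise with an integrable
  majorant, and the limit integrates to -\<sigma>^2/2.\<close>

lemma n_D_mean_lim: "(%n. real n * (LINT z|M2. D (st n) (fst z) (snd z))) \<longlonglongrightarrow> mu"
proof -
  define q where "q y = min y 0 * (1 - exp (min y 0))" for y :: real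
  have [measurable]: "q \<in> borel_measurable borel" unfolding q_def by measurable
  have qb: "abs (q y) <= y\<^sup>2" for y
  proof -
    have "abs (q y) <= abs (min y 0) * abs (min y 0)"
      unfolding q_def abs_mult by (intro mult_left_mono one_minus_exp_bounds) auto
    also have "... <= y\<^sup>2" by (auto simp: min_def power2_eq_square)
    finally show ?thesis .
  qed
  \<comment> \<open>The shift by one keeps all indices at least 1, where the bounds on
    \<open>D\<close> hold.\<close>
  have "(%n. \<integral>z. real (Suc n) * q (D (st (Suc n)) (fst z) (snd z)) \<partial>M2) \<longlonglongrightarrow> (LINT z|M2. - (min (\<tau> * d (fst z) * snd z) 0)\<^sup>2)"
  proof (rule integral_dominated_convergence[where w="%z. \<tau>\<^sup>2 * ((snd z)^2 * (abs (d (fst z)) + B (snd z))^2)"])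
    show "integrable M2 (%z. \<tau>\<^sup>2 * ((snd z)^2 * (abs (d (fst z)) + B (snd z))^2))"
      by (intro integrable_mult_right D_dom_integrable)
    show "AE z in M2. norm (real (Suc n) * q (D (st (Suc n)) (fst z) (snd z))) <= \<tau>\<^sup>2 * ((snd z)^2 * (abs (d (fst z)) + B (snd z))^2)" for n
    proof (rule AE_I2)
      fix z :: "real \<times> real"
      have "norm (real (Suc n) * q (D (st (Suc n)) (fst z) (snd z))) = real (Suc n) * abs (q (D (st (Suc n)) (fst z) (snd z)))"
        by (simp add: abs_mult)
      also have "... <= real (Suc n) * (D (st (Suc n)) (fst z) (snd z))^2" by (intro mult_left_mono qb) simp
      also have "... <= \<tau>\<^sup>2 * ((snd z)^2 * (abs (d (fst z)) + B (snd z))^2)" by (rule D_sq_bound) simp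
      finally show "norm (real (Suc n) * q (D (st (Suc n)) (fst z) (snd z))) <= \<tau>\<^sup>2 * ((snd z)^2 * (abs (d (fst z)) + B (snd z))^2)" .
    qed
    show "AE z in M2. (%n. real (Suc n) * q (D (st (Suc n)) (fst z) (snd z))) \<longlonglongrightarrow> - (min (\<tau> * d (fst z) * snd z) 0)\<^sup>2"
    proof (rule AE_I2)
      fix z :: "real \<times> real"
      define e where "e n = min (D (st n) (fst z) (snd z)) 0" for n
      have e1: "(%n. sqrt (real n) * e n) \<longlonglongrightarrow> min (\<tau> * d (fst z) * snd z) 0"
      proof -
        have "sqrt (real n) * e n = min (sqrt (real n) * D (st n) (fst z) (snd z)) 0" for n
        proof (cases "n = 0")
          case False then show ?thesis by (auto simp: e_def min_def mult_le_0_iff zero_le_mult_iff)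
        qed simp
        then show ?thesis by (auto intro!: tendsto_min sqrt_D_lim)
      qed
      have e0: "e \<longlonglongrightarrow> 0"
        unfolding e_def using tendsto_min[OF D_lim[of "fst z" "snd z"] tendsto_const[of 0]] by simp
      have "(%n. (sqrt (real n) * e n)^2 * abs (e n)) \<longlonglongrightarrow> (min (\<tau> * d (fst z) * snd z) 0)^2 * abs 0"
        by (intro tendsto_mult tendsto_power e1 tendsto_rabs e0)
      then have l0: "(%n. (sqrt (real n) * e n)^2 * abs (e n)) \<longlonglongrightarrow> 0" by simp
      have "(%n. real n * q (D (st n) (fst z) (snd z)) + (sqrt (real n) * e n)^2) \<longlonglongrightarrow> 0"
      proof (rule Lim_null_comparison[OF always_eventually l0], rule allI)
        fix n
        have "real n * q (D (st n) (fst z) (snd z)) + (sqrt (real n) * e n)^2 = real n * e n * (1 - exp (e n) + e n)"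
          by (simp add: q_def e_def[symmetric] power_mult_distrib algebra_simps power2_eq_square)
        also have "norm ... = real n * abs (e n) * abs (1 - exp (e n) + e n)" by (simp add: abs_mult)
        also have "... <= real n * abs (e n) * (e n)^2"
        proof -
          have en: "e n <= 0" by (simp add: e_def)
          show ?thesis by (rule mult_left_mono[OF one_minus_exp_bounds(2)[OF en]]) simp
        qed
        finally show "norm (real n * q (D (st n) (fst z) (snd z)) + (sqrt (real n) * e n)^2) <= (sqrt (real n) * e n)^2 * abs (e n)"
          by (simp add: power_mult_distrib mult_ac)
      qed
      from tendsto_diff[OF this tendsto_power[OF e1, of 2]]
      have "(%n. real n * q (D (st n) (fst z) (snd z))) \<longlonglongrightarrow> - (min (\<tau> * d (fst z) * snd z) 0)\<^sup>2" by simp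
      then show "(%n. real (Suc n) * q (D (st (Suc n)) (fst z) (snd z))) \<longlonglongrightarrow> - (min (\<tau> * d (fst z) * snd z) 0)\<^sup>2"
        by (rule LIMSEQ_Suc)
    qed
  qed measurable
  also have "(LINT z|M2. - (min (\<tau> * d (fst z) * snd z) 0)\<^sup>2) = mu" by (simp add: half_square_mean mu_def)
  also have "(%n. \<integral>z. real (Suc n) * q (D (st (Suc n)) (fst z) (snd z)) \<partial>M2) = (%n. real (Suc n) * (LINT z|M2. D (st (Suc n)) (fst z) (snd z)))"
    by (rule ext, subst D_mean) (auto simp: q_def)
  finally show ?thesis by (rule LIMSEQ_imp_Suc)
qed

end

section \<open>Central limit theorem for the log acceptance ratio\<close>

definition gg :: "real => real" where "gg s = exp (min s 0)"
text \<open>Slope of \<open>gg\<close> away from its kink at 0.\<close>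

definition qi :: "real => real" where "qi s = (if s < 0 then exp s else 0)"
text \<open>For e > 0 a Lipschitz minorant of \<open>qi\<close> that agrees with it outside (-e, 0).
  The slope itself jumps at 0, whereas \<open>clt\<close> treats Lipschitz functions.\<close>

definition qde :: "real => real => real" where "qde e s = min (exp (min s 0)) (max 0 (- s / e))"
text \<open>For e > 0 a Lipschitz cutoff, 1 for |s| <= e and 0 for |s| >= 2e; its mean bounds the
  probability of lying near the kink.\<close>

definition pde :: "real => real => real" where "pde e s = max 0 (min 1 (2 - abs s / e))"

lemma gg_meas[measurable]: "gg \<in> borel_measurable borel"
  and qi_meas[measurable]: "qi \<in> borel_measurable borel"
  and qde_meas[measurable]: "qde e \<in> borel_measurable borel"
  and pde_meas[measurable]: "pde e \<in> borel_measurable borel"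
  unfolding gg_def qi_def qde_def pde_def by measurable

lemma gg_bounds: "0 <= gg s" "gg s <= 1" "abs (gg s) <= 1"
  by (auto simp: gg_def)

lemma qde_bounds: "0 <= qde e s" "qde e s <= 1" "abs (qde e s) <= 1"
proof -
  have "exp (min s 0) <= 1" by simp
  then show 1: "qde e s <= 1" unfolding qde_def by linarith
  show 0: "0 <= qde e s" unfolding qde_def by simp
  show "abs (qde e s) <= 1" using 0 1 by simp
qed

lemma pde_bounds: "0 <= pde e s" "pde e s <= 1" "abs (pde e s) <= 1"
  by (auto simp: pde_def)

lemma gg_lip: "abs (gg s - gg t) <= abs (s - t)"
proof -
  have *: "abs (gg s - gg t) <= abs (s - t)" if "t <= s" for s t
  proof -
    have a: "min t 0 <= min s 0" using that by auto
    have "gg s - gg t = exp (min s 0) * (1 - exp (min t 0 - min s 0))"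
      by (simp add: gg_def right_diff_distrib exp_add[symmetric])
    then have "abs (gg s - gg t) <= 1 * abs (1 - exp (min t 0 - min s 0))"
      by (simp only: abs_mult) (intro mult_right_mono, auto)
    also have "... <= abs (min t 0 - min s 0)"
      unfolding mult_1 using a by (intro one_minus_exp_bounds) simp
    also have "... <= abs (s - t)" using that by linarith
    finally show ?thesis .
  qed
  show ?thesis using *[of s t] *[of t s] by (cases "t <= s") auto
qed

lemma min_lip: "abs (a - a') <= L ==> abs (b - b') <= L ==> abs (min a b - min a' b') <= (L :: real)"
  by linarith

lemma qde_lip: assumes "0 < e" shows "abs (qde e s - qde e t) <= (1 + 1 / e) * abs (s - t)"
  unfolding qde_def
proof (rule min_lip)
  have "0 <= 1 / e * abs (s - t)" using assms by simp
  then show "abs (exp (min s 0) - exp (min t 0)) <= (1 + 1 / e) * abs (s - t)"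
    using gg_lip[of s t] unfolding gg_def distrib_right by linarith
  have "abs (max 0 (- s / e) - max 0 (- t / e)) <= abs (- s / e - - t / e)" by linarith
  also have "- s / e - - t / e = (t - s) / e" by (simp add: diff_divide_distrib)
  also have "abs ((t - s) / e) = 1 / e * abs (s - t)" using assms by (simp add: abs_minus_commute)
  also have "... <= (1 + 1 / e) * abs (s - t)" by (intro mult_right_mono) auto
  finally show "abs (max 0 (- s / e) - max 0 (- t / e)) <= (1 + 1 / e) * abs (s - t)" .
qed

lemma pde_lip: assumes "0 < e" shows "abs (pde e s - pde e t) <= (1 / e) * abs (s - t)"
proof -
  have "abs (pde e s - pde e t) <= abs (abs s / e - abs t / e)" unfolding pde_def by linarith
  also have "abs s / e - abs t / e = (abs s - abs t) / e" by (simp add: diff_divide_distrib)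
  also have "abs ((abs s - abs t) / e) = (1 / e) * abs (abs s - abs t)" using assms by simp
  also have "... <= (1 / e) * abs (s - t)" using assms by (intro mult_left_mono) auto
  finally show ?thesis .
qed

lemma exp_second_order:
  fixes s h :: real
  assumes "s <= 0" "s + h <= 0"
  shows "abs (exp (s + h) - exp s - exp s * h) <= h\<^sup>2"
proof -
  have es: "0 <= exp s" "exp s <= 1" using assms by auto
  have eq: "exp (s + h) - exp s - exp s * h = exp s * (exp h - 1 - h)" by (simp add: exp_add algebra_simps)
  have nn: "0 <= exp h - 1 - h" using exp_ge_add_one_self[of h] by linarith
  show ?thesis
  proof (cases "h <= 0")
    case True
    have "abs (exp s * (exp h - 1 - h)) <= 1 * abs (exp h - 1 - h)"
      unfolding abs_mult using es by (intro mult_right_mono) auto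
    also have "1 * abs (exp h - 1 - h) = abs (1 - exp h + h)" by (simp add: abs_if)
    also have "... <= h\<^sup>2" by (rule one_minus_exp_bounds(2)[OF True])
    finally show ?thesis unfolding eq .
  next
    case False
    \<comment> \<open>For h > 0 the assumption s + h <= 0 gives \<open>exp s <= exp (- h)\<close>,
      which compensates the growth of \<open>exp h\<close>.\<close>
    have "exp s * (exp h - 1 - h) <= exp (- h) * (exp h - 1 - h)"
      using nn assms by (intro mult_right_mono) auto
    also have "... = 1 - exp (- h) - h * exp (- h)" by (simp add: right_diff_distrib exp_add[symmetric] mult.commute)
    also have "... <= h - h * (1 - h)"
      using exp_ge_add_one_self[of "-h"] False mult_left_mono[of "1 - h" "exp (-h)" h] by linarith
    also have "... = h\<^sup>2" by (simp add: power2_eq_square right_diff_distrib)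
    finally show ?thesis unfolding eq using nn es by simp
  qed
qed

text \<open>Near the kink the crude bound 2|h| meets \<open>pde e s = 1\<close>. A step longer than
  e satisfies |h| <= h^2/e. Otherwise s and s + h lie on the same side of 0, where \<open>gg\<close>
  is constant or exponential.\<close>

lemma gg_expansion:
  assumes e: "0 < e" "e <= 1"
  shows "abs (gg (s + h) - gg s - qde e s * h) <= 2 * abs h * pde e s + 2 * h\<^sup>2 / e"
proof -
  have crude: "abs (gg (s + h) - gg s - qde e s * h) <= 2 * abs h"
  proof -
    have "abs (qde e s * h) <= 1 * abs h"
      unfolding abs_mult by (intro mult_right_mono qde_bounds) simp
    then show ?thesis using gg_lip[of "s + h" s] by simp
  qed
  have n1: "0 <= 2 * abs h * pde e s" and n2: "0 <= 2 * h\<^sup>2 / e"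
    using pde_bounds e by auto
  consider "abs s <= e" | "abs h > e" | "s > e" "abs h <= e" | "s < - e" "abs h <= e" by linarith
  then show ?thesis
  proof cases
    case 1
    then have "pde e s = 1" using e by (simp add: pde_def field_simps)
    then show ?thesis using crude n2 by simp
  next
    case 2
    have "abs h * e <= abs h * abs h" using 2 by (intro mult_left_mono) auto
    then have "abs h <= h\<^sup>2 / e" using e by (simp add: field_simps power2_eq_square)
    then show ?thesis using crude n1 by simp
  next
    case 3
    then have "gg (s + h) = 1" "gg s = 1" using e by (auto simp: gg_def min_def)
    moreover have "- s / e <= 0" using 3 e by simp
    then have "qde e s = 0" by (simp add: qde_def)
    ultimately show ?thesis using n1 n2 by simp
  next
    case 4
    have s0: "s <= 0" "s + h <= 0" using 4 e by auto
    have "1 <= - s / e" using 4 e by (simp add: field_simps)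
    moreover have "exp s <= 1" using s0 by simp
    ultimately have "max 0 (- s / e) = - s / e" "min s 0 = s" "min (exp s) (- s / e) = exp s"
      using s0 by linarith+
    then have q: "qde e s = exp s" by (simp only: qde_def)
    have "abs (gg (s + h) - gg s - qde e s * h) <= h\<^sup>2"
      using exp_second_order[OF s0] s0 by (simp add: q gg_def min_def)
    also have "... <= 2 * h\<^sup>2 / e"
    proof -
      have "e * h\<^sup>2 <= 2 * h\<^sup>2" using e by (intro mult_right_mono) auto
      then show ?thesis using e by (simp add: field_simps)
    qed
    finally show ?thesis using n1 by simp
  qed
qed

context mh_rate begin

section \<open>Averages under the limit law of the log acceptance ratio\<close>

definition EZ :: "(real => real) => real" where "EZ \<psi> = (LINT z|std_gauss. \<psi> (\<sigma> * z + mu))"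

definition cc :: real where "cc = c_tau \<phi> \<tau>"

lemma cdf_eq: "cc = 2 * measure std_gauss {..- (\<sigma> / 2)}"
  by (simp add: cc_def c_tau_def normal_cdf_def \<sigma>_def \<I>_def)

text \<open>Exponential tilting: as \<open>mu = - \<sigma>\<^sup>2 / 2\<close>, the factor
  exp(\<sigma> x + mu) shifts the Gaussian density by \<sigma>, and the event of a negative ratio
  becomes x < -\<sigma>/2.\<close>

lemma EZ_qi: "EZ qi = cc / 2"
proof -
  have "EZ qi = (LINT x|lborel. std_normal_density x * qi (\<sigma> * x + mu))"
    unfolding EZ_def by (rule gauss_integral) measurable
  also have "... = (LINT x|lborel. std_normal_density (x - \<sigma>) * indicator {..<\<sigma>/2} x)"
  proof (intro Bochner_Integration.integral_cong refl)
    fix x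
    have "\<sigma> * x + mu < 0 \<longleftrightarrow> x < \<sigma> / 2"
      using sigma_pos by (simp add: mu_def power2_eq_square field_simps)
    moreover have "std_normal_density x * exp (\<sigma> * x + mu) = std_normal_density (x - \<sigma>)"
      by (simp add: std_normal_density_def mu_def exp_add[symmetric] power2_eq_square field_simps)
    ultimately show "std_normal_density x * qi (\<sigma> * x + mu) = std_normal_density (x - \<sigma>) * indicator {..<\<sigma>/2} x"
      by (simp add: qi_def)
  qed
  also have "... = (LINT x|lborel. std_normal_density x * indicator {..<- (\<sigma>/2)} x)"
    by (subst lborel_integral_real_affine[where c=1 and t=\<sigma>])
       (auto intro!: Bochner_Integration.integral_cong split: split_indicator)
  also have "... = (LINT x|std_gauss. indicator {..<- (\<sigma>/2)} x)"
    by (rule gauss_integral[symmetric]) measurable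
  also have "... = measure std_gauss {..<- (\<sigma>/2)}" by simp
  also have "... = measure std_gauss {..- (\<sigma>/2)}"
  proof (rule Gauss.finite_measure_eq_AE)
    have "AE x in lborel. x \<noteq> - (\<sigma>/2)" by (rule AE_lborel_singleton)
    then have "AE x in std_gauss. x \<noteq> - (\<sigma>/2)"
      unfolding std_gauss_def by (subst AE_density) auto
    then show "AE x in std_gauss. x \<in> {..<- (\<sigma>/2)} \<longleftrightarrow> x \<in> {..- (\<sigma>/2)}" by eventually_elim auto
  qed auto
  finally show ?thesis by (simp add: cdf_eq)
qed

lemma gauss_int_bounded: "\<psi> \<in> borel_measurable borel ==> (!!s. abs (\<psi> s) <= C) ==> integrable std_gauss \<psi>" for \<psi> :: "real => real"
  by (rule Gauss.integrable_const_bound[where B=C]) auto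

text \<open>The negative ratios contribute \<open>cc / 2\<close> by \<open>EZ_qi\<close>, and by
  symmetry the probability of a nonnegative ratio is the same number. So \<open>cc\<close>, defined
  through the normal distribution function, is E[1 \<and> exp Z].\<close>

lemma EZ_gg: "EZ gg = cc"
proof -
  have i: "integrable std_gauss (%z. qi (\<sigma> * z + mu))"
    by (rule gauss_int_bounded[where C=1]) (auto simp: qi_def)
  have "EZ gg = (LINT z|std_gauss. qi (\<sigma> * z + mu) + indicator {\<sigma>/2..} z)"
    unfolding EZ_def
  proof (intro Bochner_Integration.integral_cong refl)
    fix z
    have "\<sigma> * z + mu < 0 \<longleftrightarrow> z < \<sigma> / 2"
      using sigma_pos by (simp add: mu_def power2_eq_square field_simps)
    then show "gg (\<sigma> * z + mu) = qi (\<sigma> * z + mu) + indicator {\<sigma>/2..} z"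
      by (auto simp: gg_def qi_def min_def split: split_indicator)
  qed
  also have "... = cc / 2 + measure std_gauss {\<sigma>/2..}"
    using i EZ_qi unfolding EZ_def by (subst Bochner_Integration.integral_add) (auto simp: Gauss.emeasure_eq_measure)
  also have "measure std_gauss {\<sigma>/2..} = measure (distr std_gauss std_gauss uminus) {\<sigma>/2..}"
    by (simp only: gauss_symmetric)
  also have "... = measure std_gauss {..- (\<sigma>/2)}"
    by (subst measure_distr) (auto simp: vimage_def intro!: arg_cong[where f="measure std_gauss"])
  finally show ?thesis by (simp add: cdf_eq)
qed

lemma cc_pos: "0 < cc"
proof -
  have "0 < EZ gg"
    unfolding EZ_def
  proof (rule Gauss.expectation_greater)
    show "integrable std_gauss (%z. gg (\<sigma> * z + mu))"
      by (rule gauss_int_bounded[where C=1]) (auto simp: gg_bounds)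
  qed (auto simp: gg_def)
  then show ?thesis by (simp add: EZ_gg)
qed

lemma EZ_qde_lim: "(%k. EZ (qde (1 / real (Suc k)))) \<longlonglongrightarrow> cc / 2"
  unfolding EZ_qi[symmetric] EZ_def
proof (rule integral_dominated_convergence[where w="%_. 1"])
  show "AE z in std_gauss. (%k. qde (1 / real (Suc k)) (\<sigma> * z + mu)) \<longlonglongrightarrow> qi (\<sigma> * z + mu)"
  proof (rule AE_I2, rule tendsto_eventually)
    fix z
    let ?s = "\<sigma> * z + mu"
    show "\<forall>\<^sub>F k in sequentially. qde (1 / real (Suc k)) ?s = qi ?s"
    proof (cases "?s < 0")
      case True
      obtain N :: nat where N: "1 / (- ?s) <= real N" using real_arch_simple by blast
      show ?thesis
      proof (rule eventually_sequentiallyI[of N])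
        fix k assume "N <= k"
        then have "1 / (- ?s) <= real (Suc k)" using N by linarith
        then have "1 <= - ?s / (1 / real (Suc k))" using True by (simp add: field_simps)
        moreover have "exp ?s <= 1" using True by simp
        ultimately have "max 0 (- ?s / (1 / real (Suc k))) = - ?s / (1 / real (Suc k))" "min ?s 0 = ?s"
          "min (exp ?s) (- ?s / (1 / real (Suc k))) = exp ?s"
          using True by linarith+
        then show "qde (1 / real (Suc k)) ?s = qi ?s"
          using True by (simp only: qde_def qi_def if_True)
      qed
    next
      case False
      then have "- ?s / (1 / real (Suc k)) <= 0" for k by (intro divide_nonpos_pos) auto
      then have "max 0 (- ?s / (1 / real (Suc k))) = 0" for k by (rule max_absorb1)
      moreover have "min (exp (min ?s 0)) 0 = 0" by simp
      ultimately show ?thesis using False by (intro always_eventually allI) (simp only: qde_def qi_def if_False)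
    qed
  qed
qed (auto simp: qde_bounds)

text \<open>The limit law has no atom at 0 because \<sigma> > 0, so the kink carries no
  mass.\<close>

lemma EZ_pde_lim: "(%k. EZ (pde (1 / real (Suc k)))) \<longlonglongrightarrow> 0"
proof -
  have "(%k. EZ (pde (1 / real (Suc k)))) \<longlonglongrightarrow> (LINT z|std_gauss. 0)"
    unfolding EZ_def
  proof (rule integral_dominated_convergence[where w="%_. 1"])
    have "AE x in lborel. x \<noteq> - mu / \<sigma>" by (rule AE_lborel_singleton)
    then have "AE x in std_gauss. x \<noteq> - mu / \<sigma>"
      unfolding std_gauss_def by (subst AE_density) auto
    then show "AE z in std_gauss. (%k. pde (1 / real (Suc k)) (\<sigma> * z + mu)) \<longlonglongrightarrow> 0"
    proof eventually_elim
      case (elim z)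
      let ?s = "\<sigma> * z + mu"
      have s: "?s \<noteq> 0"
      proof
        assume "?s = 0"
        then have "\<sigma> * z = - mu" by simp
        then show False using elim sigma_pos by (simp add: field_simps)
      qed
      obtain N :: nat where N: "2 / abs ?s <= real N" using real_arch_simple by blast
      show ?case
      proof (rule tendsto_eventually, rule eventually_sequentiallyI[of N])
        fix k assume "N <= k"
        then have "2 / abs ?s <= real (Suc k)" using N by linarith
        then have "2 <= abs ?s * real (Suc k)" using s by (simp add: field_simps)
        then show "pde (1 / real (Suc k)) ?s = 0" by (simp add: pde_def)
      qed
    qed
  qed (auto simp: pde_bounds)
  then show ?thesis by simp
qed

section \<open>Taylor remainders, conditional variance and convergence of averages\<close>

definition S :: "nat => nat set => (nat => real) => (nat => real) => real" where
  "S n J x w = (\<Sum>j\<in>{..<n} - J. D (st n) (x j) (w j))"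

lemma S_raw[measurable (raw)]:
  assumes [measurable]: "f \<in> measurable N P" "g \<in> measurable N \<Gamma>"
  shows "(%z. S n J (f z) (g z)) \<in> borel_measurable N"
  unfolding S_def by measurable

lemma r_meas[measurable]: "(%z. r n (fst z) (snd z)) \<in> borel_measurable M2"
  unfolding r_def by measurable

lemma r_sq_bound:
  assumes n: "n \<ge> 1"
  shows "real n * (r n t w)^2 <= \<tau>\<^sup>2 * (\<kappa> n)^2 * (w\<^sup>2 * (B w)^2)"
proof -
  have "real n * (r n t w)^2 <= real n * (st n * abs w * (\<kappa> n * B w))^2"
    using power_mono[OF r_bound[OF n, of t w], of 2] by (intro mult_left_mono) auto
  also have "... = (real n * (st n)^2) * (\<kappa> n)^2 * (w\<^sup>2 * (B w)^2)" by (simp add: power_mult_distrib mult_ac)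
  finally show ?thesis by (simp only: st_sq[OF n])
qed

definition C2 :: real where "C2 = (LINT w|std_gauss. w\<^sup>2 * (B w)^2)"

lemma w2B2_M2: "integrable M2 (%z. (snd z)^2 * (B (snd z))^2)" "(LINT z|M2. (snd z)^2 * (B (snd z))^2) = C2"
  using M2.integrable_times[of "%t. 1" "%w. w\<^sup>2 * (B w)^2"] gauss_poly_even[of 2]
  by (auto simp: C2_def T.prob_space[simplified])

lemma r_sqi: "n \<ge> 1 ==> (%z. r n (fst z) (snd z)) \<in> sqi M2"
  and r_sq_int: "n \<ge> 1 ==> real n * (LINT z|M2. (r n (fst z) (snd z))^2) <= \<tau>\<^sup>2 * (\<kappa> n)^2 * C2"
proof -
  assume n: "n \<ge> 1"
  let ?d = "%z. \<tau>\<^sup>2 * (\<kappa> n)^2 * ((snd z)^2 * (B (snd z))^2)"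
  have di: "integrable M2 ?d" using w2B2_M2(1) by simp
  have i: "integrable M2 (%z. real n * (r n (fst z) (snd z))^2)"
    by (rule Bochner_Integration.integrable_bound[OF di]) (use r_sq_bound[OF n] in auto)
  then have i': "integrable M2 (%z. (r n (fst z) (snd z))^2)"
    using n by (subst (asm) integrable_mult_left_iff) auto
  then show "(%z. r n (fst z) (snd z)) \<in> sqi M2" by (intro sqiI) auto
  have "real n * (LINT z|M2. (r n (fst z) (snd z))^2) = (LINT z|M2. real n * (r n (fst z) (snd z))^2)" by simp
  also have "... <= (LINT z|M2. ?d z)"
    by (intro integral_mono i di r_sq_bound n)
  also have "... = \<tau>\<^sup>2 * (\<kappa> n)^2 * C2" using w2B2_M2(2) by simp
  finally show "real n * (LINT z|M2. (r n (fst z) (snd z))^2) <= \<tau>\<^sup>2 * (\<kappa> n)^2 * C2" .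
qed

text \<open>The linear term of \<open>D\<close> has mean 0, so this is also the mean of
  \<open>D\<close>, by \<open>em_eq\<close>.\<close>

definition em :: "nat => real" where "em n = (LINT z|M2. r n (fst z) (snd z))"

lemma em_eq: "n \<ge> 1 ==> em n = (LINT z|M2. D (st n) (fst z) (snd z))"
proof -
  assume n: "n \<ge> 1"
  have i: "integrable M2 (%z. st n * (d (fst z) * snd z))" "(LINT z|M2. d (fst z) * snd z) = 0"
    using M2.integrable_times[OF d_int(1), of "%w. w"] gauss_moment[of 1] by (auto simp: gauss_mean)
  then show ?thesis using D_int[OF n] unfolding em_def r_def by (simp add: mult.assoc)
qed

lemma r_gauss_int: "n \<ge> 1 ==> integrable std_gauss (r n t)"
proof (rule Bochner_Integration.integrable_bound)
  show "integrable std_gauss (%w. st n * \<kappa> n * (abs w ^ 1 * B w ^ 1))"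
    by (intro integrable_mult_right gauss_poly)
  show "r n t \<in> borel_measurable std_gauss" unfolding r_def by simp
  assume n: "n \<ge> 1"
  show "AE w in std_gauss. norm (r n t w) <= norm (st n * \<kappa> n * (abs w ^ 1 * B w ^ 1))"
    using r_bound[OF n] kappa0[of n] by (intro AE_I2) (simp add: abs_mult mult_ac)
qed

definition zz :: "nat => nat => (nat => real) \<times> (nat => real) => real" where
  "zz n j z = r n (fst z j) (snd z j) - em n"

lemma rz_meas[measurable]: "(%z. r n (fst z j) (snd z j)) \<in> borel_measurable PG"
  unfolding r_def by measurable

lemma r_PG_sqi: "n \<ge> 1 ==> (%z. r n (fst z j) (snd z j)) \<in> sqi PG"
  using integral_pair_coord(2)[of "%z. (r n (fst z) (snd z))^2" j] sqi_int[OF r_sqi, of n]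
  by (intro sqiI) auto

lemma zz_sqi: "n \<ge> 1 ==> zz n j \<in> sqi PG"
  unfolding zz_def by (intro sqi_diff r_PG_sqi PG.sqi_bounded[where C="abs (em n)"]) auto

text \<open>Given x the noise coordinates i and j are independent, which leaves the product of two
  conditional means. These depend on \<open>x i\<close> and \<open>x j\<close> separately and are
  centred.\<close>

lemma zz_orth:
  assumes n: "n \<ge> 1" and ij: "i \<noteq> j"
  shows "(LINT z|PG. zz n i z * zz n j z) = 0"
proof -
  define Z where "Z t = (LINT w|std_gauss. r n t w - em n)" for t
  have ri: "integrable M2 (%z. r n (fst z) (snd z) - em n)"
    using M2.sqi_integrable[OF r_sqi[OF n]] by simp
  have Zi: "integrable (target \<phi>) Z"
    using M2.integrable_fst'[OF ri] by (simp add: Z_def[abs_def])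
  have Zm[measurable]: "Z \<in> borel_measurable borel"
    using borel_measurable_integrable[OF Zi] by simp
  have Z0: "(LINT t|target \<phi>. Z t) = 0"
  proof -
    have "(LINT t|target \<phi>. Z t) = (LINT z|M2. r n (fst z) (snd z) - em n)"
      using M2.integral_fst'[OF ri] by (simp add: Z_def)
    also have "... = 0" using M2.sqi_integrable[OF r_sqi[OF n]] by (simp add: em_def M2.prob_space[simplified])
    finally show ?thesis .
  qed
  have rm: "(%w. r n t w) \<in> borel_measurable borel" for t unfolding r_def by measurable
  have inner: "(LINT w|\<Gamma>. zz n i (x, w) * zz n j (x, w)) = Z (x i) * Z (x j)" for x
  proof -
    have c: "integrable \<Gamma> (%w. zz n k (x, w))" "(LINT w|\<Gamma>. zz n k (x, w)) = Z (x k)" for k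
      using Gauss.integrable_coord[of "%w. r n (x k) w - em n" k] Gauss.integral_coord[of "%w. r n (x k) w - em n" k] r_gauss_int[OF n, of "x k"] rm
      by (auto simp: zz_def Z_def)
    show ?thesis
      unfolding c(2)[symmetric] using ij
      by (intro Gauss.indep_integral(2)[where A="{i}" and B="{j}"] c) (auto simp: Gauss.dep_def zz_def)
  qed
  have "(LINT z|PG. zz n i z * zz n j z) = (LINT x|P. (LINT w|\<Gamma>. zz n i (x, w) * zz n j (x, w)))"
    by (rule PG.integral_fst'[symmetric]) (intro sqi_mult_integrable zz_sqi n)
  also have "... = (LINT x|P. Z (x i) * Z (x j))" by (simp only: inner)
  also have "... = (LINT x|P. Z (x i)) * (LINT x|P. Z (x j))"
    using ij Zi by (intro T.indep_integral(2)[where A="{i}" and B="{j}"]) (auto simp: T.dep_def T.integrable_coord)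
  finally show ?thesis by (simp add: T.integral_coord Z0)
qed

definition RR :: "nat => nat set => (nat => real) \<times> (nat => real) => real" where
  "RR n J z = (\<Sum>j\<in>{..<n} - J. r n (fst z j) (snd z j))"

lemma RR_meas[measurable]: "RR n J \<in> borel_measurable PG"
  unfolding RR_def by measurable

lemma RR_int: "n \<ge> 1 ==> integrable PG (RR n J)"
  unfolding RR_def by (intro Bochner_Integration.integrable_sum PG.sqi_integrable r_PG_sqi)

text \<open>The centred remainders are uncorrelated, so the variance of their sum is at most n times
  a second moment of order \<kappa>(n)^2 / n. In the limit the remainders contribute a deterministic
  drift, their total mean.\<close>

lemma RR_L1:
  assumes n: "n \<ge> 1"
  shows "(LINT z|PG. abs (RR n J z - mu)) <= sqrt (\<tau>\<^sup>2 * (\<kappa> n)^2 * C2) + abs (real (card ({..<n} - J)) * em n - mu)"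
proof -
  let ?I = "{..<n} - J" let ?m = "real (card ({..<n} - J)) * em n"
  have eq: "RR n J z - ?m = (\<Sum>j\<in>?I. zz n j z)" for z
    by (simp add: RR_def zz_def sum_subtractf)
  have s: "(%z. RR n J z - ?m) \<in> sqi PG" unfolding eq by (intro sqi_sum zz_sqi n)
  have cI: "card ?I <= n" using card_mono[of "{..<n}" ?I] by simp
  have "(LINT z|PG. abs (RR n J z - ?m)) <= l2 PG (%z. RR n J z - ?m)" by (rule PG.L1_le_l2[OF s])
  also have "... <= sqrt (\<tau>\<^sup>2 * (\<kappa> n)^2 * C2)"
    unfolding l2_def eq
  proof (rule real_sqrt_le_mono)
    have "(LINT z|PG. (\<Sum>j\<in>?I. zz n j z)^2) = (\<Sum>j\<in>?I. \<integral>z. (zz n j z)^2 \<partial>PG)"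
      by (intro PG.orthogonal_sum_sq zz_sqi n zz_orth) auto
    also have "... <= (\<Sum>j\<in>?I. \<integral>z. (r n (fst z) (snd z))^2 \<partial>M2)"
    proof (rule sum_mono)
      fix j
      let ?r = "%z :: (nat => real) \<times> (nat => real). r n (fst z j) (snd z j)"
      have m: "(LINT z|PG. ?r z) = em n"
        using integral_pair_coord(1)[of "%z. r n (fst z) (snd z)" j] by (simp add: em_def)
      have sq: "(LINT z|PG. (?r z)^2) = (LINT z|M2. (r n (fst z) (snd z))^2)"
        using integral_pair_coord(1)[of "%z. (r n (fst z) (snd z))^2" j] by simp
      have "(LINT z|PG. (zz n j z)^2) = (LINT z|PG. (?r z)^2 - 2 * em n * ?r z + (em n)^2)"
        by (intro Bochner_Integration.integral_cong refl) (simp add: zz_def power2_diff mult_ac)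
      also have "... = (LINT z|PG. (?r z)^2) - 2 * em n * em n + (em n)^2"
        using sqi_int[OF r_PG_sqi[OF n]] PG.sqi_integrable[OF r_PG_sqi[OF n]] m by (simp add: PG.prob_space[simplified])
      also have "... <= (LINT z|PG. (?r z)^2)" by (simp add: power2_eq_square)
      finally show "(LINT z|PG. (zz n j z)^2) <= (LINT z|M2. (r n (fst z) (snd z))^2)" by (simp only: sq)
    qed
    also have "... = real (card ?I) * (LINT z|M2. (r n (fst z) (snd z))^2)" by simp
    also have "... <= real n * (LINT z|M2. (r n (fst z) (snd z))^2)"
      using cI by (intro mult_right_mono) auto
    also have "... <= \<tau>\<^sup>2 * (\<kappa> n)^2 * C2" by (rule r_sq_int[OF n])
    finally show "(LINT z|PG. (\<Sum>j\<in>?I. zz n j z)^2) <= \<tau>\<^sup>2 * (\<kappa> n)^2 * C2" .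
  qed
  finally have b: "(LINT z|PG. abs (RR n J z - ?m)) <= sqrt (\<tau>\<^sup>2 * (\<kappa> n)^2 * C2)" .
  have "(LINT z|PG. abs (RR n J z - mu)) <= (LINT z|PG. abs (RR n J z - ?m) + abs (?m - mu))"
    using RR_int[OF n, of J] by (intro integral_mono) auto
  also have "... = (LINT z|PG. abs (RR n J z - ?m)) + abs (?m - mu)"
    using RR_int[OF n, of J] by (simp add: PG.prob_space[simplified])
  finally show ?thesis using b by linarith
qed

lemma RR_lim: "finite J ==> (%n. \<integral>z. abs (RR n J z - mu) \<partial>PG) \<longlonglongrightarrow> 0"
proof (rule Lim_null_comparison)
  assume J: "finite J"
  show "\<forall>\<^sub>F n in sequentially. norm (LINT z|PG. abs (RR n J z - mu)) <= sqrt (\<tau>\<^sup>2 * (\<kappa> n)^2 * C2) + abs (real (card ({..<n} - J)) * em n - mu)"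
    using RR_L1 by (auto simp: eventually_sequentially intro!: exI[of _ 1])
  have nem: "(%n. real n * em n) \<longlonglongrightarrow> mu"
    by (rule Lim_transform_eventually[OF n_D_mean_lim]) (auto simp: eventually_sequentially em_eq intro!: exI[of _ 1])
  have em0: "em \<longlonglongrightarrow> 0"
  proof (rule Lim_transform_eventually)
    have "(%n. (real n * em n) * (1 / real n)) \<longlonglongrightarrow> mu * 0" by (intro tendsto_mult nem lim_1_over_n)
    then show "(%n. (real n * em n) * (1 / real n)) \<longlonglongrightarrow> 0" by simp
  qed (auto simp: eventually_sequentially intro!: exI[of _ 1])
  \<comment> \<open>Omitting J changes the total mean by at most \<open>card J\<close> single means,
    and a single mean tends to 0.\<close>
  have "(%n. (real n - real (card ({..<n} - J))) * em n) \<longlonglongrightarrow> 0"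
  proof (rule Lim_null_comparison[OF always_eventually], rule allI)
    show "(%n. real (card J) * abs (em n)) \<longlonglongrightarrow> 0"
      using tendsto_mult[OF tendsto_const tendsto_rabs[OF em0], of "real (card J)"] by simp
    fix n
    have "n - card J <= card ({..<n} - J)" using diff_card_le_card_Diff[OF J, of "{..<n}"] by simp
    moreover have "card ({..<n} - J) <= n" using card_mono[of "{..<n}" "{..<n} - J"] by simp
    ultimately have "abs (real n - real (card ({..<n} - J))) <= real (card J)" by linarith
    then show "norm ((real n - real (card ({..<n} - J))) * em n) <= real (card J) * abs (em n)"
      by (simp add: abs_mult mult_right_mono)
  qed
  from tendsto_diff[OF nem this] have "(%n. real (card ({..<n} - J)) * em n) \<longlonglongrightarrow> mu"
    by (simp add: left_diff_distrib)
  from tendsto_diff[OF this tendsto_const[of mu]] have "(%n. abs (real (card ({..<n} - J)) * em n - mu)) \<longlonglongrightarrow> abs (mu - mu)"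
    by (rule tendsto_rabs)
  moreover have "(%n. sqrt (\<tau>\<^sup>2 * (\<kappa> n)^2 * C2)) \<longlonglongrightarrow> sqrt (\<tau>\<^sup>2 * 0\<^sup>2 * C2)"
    by (intro tendsto_real_sqrt tendsto_mult tendsto_const tendsto_power kappa_lim)
  ultimately have "(%n. sqrt (\<tau>\<^sup>2 * (\<kappa> n)^2 * C2) + abs (real (card ({..<n} - J)) * em n - mu)) \<longlonglongrightarrow> sqrt (\<tau>\<^sup>2 * 0\<^sup>2 * C2) + abs (mu - mu)"
    by (intro tendsto_add)
  then show "(%n. sqrt (\<tau>\<^sup>2 * (\<kappa> n)^2 * C2) + abs (real (card ({..<n} - J)) * em n - mu)) \<longlonglongrightarrow> 0" by simp
qed

text \<open>The two errors in \<open>clt\<close>: deviation of the remainder sum from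
  \<open>mu\<close>, and deviation of the conditional variance of the linear part from
  \<open>\<sigma>\<^sup>2\<close>.\<close>

definition \<delta> :: "nat set => nat => real" where
  "\<delta> J n = (LINT z|PG. abs (RR n J z - mu))
     + sqrt (LINT x|P. \<tau>\<^sup>2 * abs ((\<Sum>j\<in>{..<n} - J. (d (x j))^2) / real n - \<I>))"

lemma delta_lim: "finite J ==> \<delta> J \<longlonglongrightarrow> 0"
proof -
  assume J: "finite J"
  have "(%n. \<integral>x. abs ((\<Sum>j\<in>{..<n} - J. (d (x j))^2) / real n - \<I>) \<partial>P) \<longlonglongrightarrow> 0"
    using T.weak_law[OF sqi_int[OF d_sqi] J] by (simp add: d_sq_integral)
  then have "(%n. (LINT z|PG. abs (RR n J z - mu)) + sqrt (\<tau>\<^sup>2 * (LINT x|P. abs ((\<Sum>j\<in>{..<n} - J. (d (x j))^2) / real n - \<I>)))) \<longlonglongrightarrow> 0 + sqrt (\<tau>\<^sup>2 * 0)"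
    by (intro tendsto_add RR_lim J tendsto_real_sqrt tendsto_mult tendsto_const)
  then show ?thesis unfolding \<delta>_def[abs_def] by simp
qed

lemma sqrt_diff_bound: "0 <= a ==> 0 <= b ==> abs (sqrt a - sqrt b) <= sqrt (abs (a - b))"
proof -
  have *: "sqrt a - sqrt b <= sqrt (a - b)" if "0 <= b" "b <= a" for a b :: real
    using sqrt_add_le_add_sqrt[of b "a - b"] that by simp
  assume "0 <= a" "0 <= b"
  then show ?thesis using *[of b a] *[of a b] by (cases "b <= a") (auto simp: abs_if)
qed

text \<open>Given x, the linear part of the log ratio is exactly Gaussian in w. Hence only its
  conditional variance has to converge, and that is the weak law for the square of \<open>d\<close>.
  The bound is linear in L and so serves \<open>gg\<close>, \<open>qde\<close> and
  \<open>pde\<close> alike; leaving out J keeps the noise in J free for other factors.\<close>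

lemma clt:
  assumes n: "n \<ge> 1" and J: "finite J" and [measurable]: "\<psi> \<in> borel_measurable borel"
    and b: "!!s. abs (\<psi> s) <= 1" and lip: "!!s t. abs (\<psi> s - \<psi> t) <= L * abs (s - t)" and L: "0 <= L"
  shows "(LINT x|P. abs ((LINT w|\<Gamma>. \<psi> (S n J x w)) - EZ \<psi>)) <= L * \<delta> J n"
proof -
  let ?I = "{..<n} - J"
  define A where "A x = (\<Sum>j\<in>?I. (st n * d (x j))^2)" for x :: "nat => real"
  define TT where "TT x w = (\<Sum>j\<in>?I. st n * d (x j) * w j)" for x w :: "nat => real"
  have A0: "0 <= A x" for x unfolding A_def by (intro sum_nonneg) simp
  have ST: "S n J x w = RR n J (x, w) + TT x w" for x w
    by (simp add: S_def RR_def TT_def r_def sum_subtractf)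
  have RRx: "integrable \<Gamma> (%w. RR n J (x, w))" for x
    unfolding RR_def using r_gauss_int[OF n] 
    by (intro Bochner_Integration.integrable_sum) (simp add: Gauss.integrable_coord[of "r n _"] borel_measurable_integrable[OF r_gauss_int[OF n], simplified])
  have iS: "integrable \<Gamma> (%w. \<psi> (S n J x w))" for x
    by (rule Gauss.Q.integrable_const_bound[where B=1]) (auto simp: b)
  have TTm: "(%w. TT x w) \<in> borel_measurable \<Gamma>" for x unfolding TT_def by measurable
  have iT: "integrable \<Gamma> (%w. \<psi> (TT x w + mu))" for x
    using TTm[of x] by (intro Gauss.Q.integrable_const_bound[where B=1]) (auto simp: b)
  have pt: "abs ((LINT w|\<Gamma>. \<psi> (S n J x w)) - EZ \<psi>) <= L * (LINT w|\<Gamma>. abs (RR n J (x, w) - mu)) + L * sqrt (abs (A x - \<sigma>\<^sup>2))" for x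
  proof -
    have "abs ((LINT w|\<Gamma>. \<psi> (S n J x w)) - (LINT w|\<Gamma>. \<psi> (TT x w + mu))) = abs (\<integral>w. \<psi> (S n J x w) - \<psi> (TT x w + mu) \<partial>\<Gamma>)"
      using iS iT by simp
    also have "... <= (LINT w|\<Gamma>. abs (\<psi> (S n J x w) - \<psi> (TT x w + mu)))" by (rule integral_abs_bound)
    also have "... <= (LINT w|\<Gamma>. L * abs (RR n J (x, w) - mu))"
    proof (rule integral_mono)
      show "abs (\<psi> (S n J x w) - \<psi> (TT x w + mu)) <= L * abs (RR n J (x, w) - mu)" for w
        using lip[of "S n J x w" "TT x w + mu"] by (simp add: ST)
    qed (use iS iT RRx in auto)
    finally have 1: "abs ((LINT w|\<Gamma>. \<psi> (S n J x w)) - (LINT w|\<Gamma>. \<psi> (TT x w + mu))) <= L * (LINT w|\<Gamma>. abs (RR n J (x, w) - mu))"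
      by simp
    have "(LINT w|\<Gamma>. \<psi> (TT x w + mu)) = (LINT z|std_gauss. \<psi> (sqrt (A x) * z + mu))"
      unfolding TT_def A_def using gauss_sum[of ?I "%s. \<psi> (s + mu)" "%j. st n * d (x j)"] by simp
    then have "abs ((LINT w|\<Gamma>. \<psi> (TT x w + mu)) - EZ \<psi>) <= L * abs (sqrt (A x) - \<sigma>)"
      unfolding EZ_def using gauss_lipschitz[OF _ b lip L, of "sqrt (A x)" mu \<sigma>] by simp
    also have "... <= L * sqrt (abs (A x - \<sigma>\<^sup>2))"
      using sqrt_diff_bound[OF A0[of x], of "\<sigma>\<^sup>2"] sigma_pos by (intro mult_left_mono L) simp
    finally show ?thesis using 1 by linarith
  qed
  have Aeq: "abs (A x - \<sigma>\<^sup>2) = \<tau>\<^sup>2 * abs ((\<Sum>j\<in>?I. (d (x j))^2) / real n - \<I>)" for x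
  proof -
    have "A x = \<tau>\<^sup>2 * ((\<Sum>j\<in>?I. (d (x j))^2) / real n)"
      using n by (simp add: A_def power_mult_distrib sum_distrib_left sum_divide_distrib st_def power_divide)
    then have "A x - \<sigma>\<^sup>2 = \<tau>\<^sup>2 * ((\<Sum>j\<in>?I. (d (x j))^2) / real n - \<I>)"
      by (simp add: sigma_sq right_diff_distrib)
    then show ?thesis by (simp add: abs_mult)
  qed
  have dsq: "integrable P (%x. (d (x j))^2)" for j
    using sqi_int[OF d_sqi] T.integrable_coord[of "%t. (d t)^2" j] by simp
  have Ai: "integrable P (%x. abs (A x - \<sigma>\<^sup>2))"
    unfolding Aeq using dsq by simp
  have Am[measurable]: "A \<in> borel_measurable P" unfolding A_def by measurable
  have sA: "(%x. sqrt (abs (A x - \<sigma>\<^sup>2))) \<in> sqi P"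
    using Ai by (intro sqiI) auto
  have i1: "integrable P (%x. \<integral>w. abs (RR n J (x, w) - mu) \<partial>\<Gamma>)"
    using PG.integrable_fst'[of "%z. abs (RR n J z - mu)"] RR_int[OF n, of J] by simp
  have "(LINT x|P. abs ((LINT w|\<Gamma>. \<psi> (S n J x w)) - EZ \<psi>)) <= (LINT x|P. L * (LINT w|\<Gamma>. abs (RR n J (x, w) - mu)) + L * sqrt (abs (A x - \<sigma>\<^sup>2)))"
  proof (rule integral_mono)
    show i2: "integrable P (%x. L * (LINT w|\<Gamma>. abs (RR n J (x, w) - mu)) + L * sqrt (abs (A x - \<sigma>\<^sup>2)))"
      using i1 T.Q.sqi_integrable[OF sA] by simp
    show "integrable P (%x. abs ((LINT w|\<Gamma>. \<psi> (S n J x w)) - EZ \<psi>))"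
      by (rule Bochner_Integration.integrable_bound[OF i2]) (use pt in \<open>auto intro!: order.trans[OF pt]\<close>)
  qed (rule pt)
  also have "... = L * (LINT x|P. (LINT w|\<Gamma>. abs (RR n J (x, w) - mu))) + L * (LINT x|P. sqrt (abs (A x - \<sigma>\<^sup>2)))"
    using i1 T.Q.sqi_integrable[OF sA] by simp
  also have "(LINT x|P. (LINT w|\<Gamma>. abs (RR n J (x, w) - mu))) = (LINT z|PG. abs (RR n J z - mu))"
    using PG.integral_fst'[of "%z. abs (RR n J z - mu)"] RR_int[OF n, of J] by simp
  also have "L * (LINT x|P. sqrt (abs (A x - \<sigma>\<^sup>2))) <= L * sqrt (LINT x|P. abs (A x - \<sigma>\<^sup>2))"
    using T.Q.L1_le_l2[OF sA] by (intro mult_left_mono L) (simp add: l2_def)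
  finally show ?thesis by (simp add: \<delta>_def Aeq distrib_left)
qed

end

section \<open>Test functions and averages against the acceptance probability\<close>

lemma tendsto_seq_componentwise:
  fixes f :: "'b => nat => real"
  assumes "!!i. ((%c. f c i) \<longlongrightarrow> l i) F"
  shows "(f \<longlongrightarrow> l) F"
proof -
  have "limitin (product_topology (%i. euclidean) UNIV) f l F"
    unfolding limitin_componentwise using assms by (auto simp: limitin_canonical_iff)
  then show ?thesis by (simp add: euclidean_product_topology limitin_canonical_iff)
qed

lemma depends_firstD: "depends_first N h ==> (!!i. i < N ==> x i = y i) ==> h x = h y"
  unfolding depends_first_def by blast

text \<open>Compact support is needed only in direction i, where it makes the unbounded factor
  \<open>d (x i)\<close> of the adjoint harmless.\<close>

definition testf :: "nat => ((nat => real) => real) => bool" where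
  "testf i \<xi> \<longleftrightarrow> continuous_on UNIV \<xi> \<and> (\<forall>j. continuous_on UNIV (partial j \<xi>)) \<and>
     (\<forall>j x. ((%t. \<xi> (x(j := t))) has_real_derivative partial j \<xi> x) (at (x j))) \<and>
     (\<exists>N C R. depends_first N \<xi> \<and> (\<forall>x. abs (\<xi> x) <= C) \<and> (\<forall>j x. abs (partial j \<xi> x) <= C) \<and> (\<forall>x. abs (x i) > R --> \<xi> x = 0))"

text \<open>The part of \<open>testf\<close> without the support condition, with dimension and bound
  made explicit; \<open>testf_iff\<close> puts the two together.\<close>

definition C1b :: "((nat => real) => real) => nat => real => bool" where
  "C1b \<xi> N C \<longleftrightarrow> continuous_on UNIV \<xi> \<and> (\<forall>j. continuous_on UNIV (partial j \<xi>)) \<and>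
     (\<forall>j x. ((%t. \<xi> (x(j := t))) has_real_derivative partial j \<xi> x) (at (x j))) \<and>
     depends_first N \<xi> \<and> (\<forall>x. abs (\<xi> x) <= C) \<and> (\<forall>j x. abs (partial j \<xi> x) <= C)"

lemma testf_iff: "testf i \<xi> \<longleftrightarrow> (\<exists>N C R. C1b \<xi> N C \<and> (\<forall>x. abs (x i) > R --> \<xi> x = 0))"
  unfolding testf_def C1b_def by blast

lemma C1b_at:
  assumes "C1b \<xi> N C"
  shows "((%t. \<xi> (x(j := t))) has_real_derivative partial j \<xi> (x(j := s))) (at s)"
proof -
  have "((%t. \<xi> ((x(j := s))(j := t))) has_real_derivative partial j \<xi> (x(j := s))) (at ((x(j := s)) j))"
    using assms unfolding C1b_def by blast
  then show ?thesis by simp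
qed

lemma partial_beyond: "depends_first N h ==> N <= j ==> partial j h x = 0"
  and deriv_beyond: "depends_first N h ==> N <= j ==> ((%t. h (x(j := t))) has_real_derivative 0) (at (x j))"
proof -
  assume a: "depends_first N h" "N <= j"
  have "h (x(j := t)) = h x" for t by (rule depends_firstD[OF a(1)]) (use a(2) in auto)
  then show "partial j h x = 0" "((%t. h (x(j := t))) has_real_derivative 0) (at (x j))"
    by (simp_all add: partial_def)
qed

text \<open>The limits of the fields are first obtained in L1, while pairing with a weakly
  convergent sequence takes place in L2; eventual uniform bounds bridge the gap.\<close>

lemma l2_from_L1:
  fixes f :: "nat => 'a => real"
  assumes M: "finite_measure M" and m: "!!n. f n \<in> borel_measurable M"
    and b: "!!n x. n \<ge> n0 ==> abs (f n x) <= C" and l: "(%n. \<integral>x. abs (f n x) \<partial>M) \<longlonglongrightarrow> 0"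
  shows "(%n. l2 M (f n)) \<longlonglongrightarrow> 0"
proof -
  interpret finite_measure M by fact
  have C0: "0 <= C" using order.trans[OF abs_ge_zero b[OF order_refl, of undefined]] .
  have "(%n. \<integral>x. (f n x)^2 \<partial>M) \<longlonglongrightarrow> 0"
  proof (rule Lim_null_comparison)
    show "(%n. C * (LINT x|M. abs (f n x))) \<longlonglongrightarrow> 0"
      using tendsto_mult[OF tendsto_const l, of C] by simp
    show "\<forall>\<^sub>F n in sequentially. norm (LINT x|M. (f n x)^2) <= C * (LINT x|M. abs (f n x))"
    proof (rule eventually_sequentiallyI[of n0])
      fix n assume n: "n0 <= n"
      have "f n \<in> sqi M" by (rule sqi_bounded[OF m b[OF n]])
      then have i: "integrable M (%x. (f n x)^2)" "integrable M (f n)" by (auto intro: sqi_int sqi_integrable)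
      have "(LINT x|M. (f n x)^2) <= (LINT x|M. C * abs (f n x))"
      proof (rule integral_mono)
        show "(f n x)^2 <= C * abs (f n x)" for x
          using mult_right_mono[OF b[OF n, of x], of "abs (f n x)"] by (simp add: power2_eq_square abs_mult[symmetric])
      qed (use i in auto)
      then show "norm (LINT x|M. (f n x)^2) <= C * (LINT x|M. abs (f n x))" by simp
    qed
  qed
  from tendsto_real_sqrt[OF this] show ?thesis by (simp add: l2_def)
qed

text \<open>A class closed under sums and products, so that integrability of polynomial expressions
  in the noise becomes automatic.\<close>

definition allmom :: "'a measure => ('a => real) => bool" where
  "allmom M F \<longleftrightarrow> F \<in> borel_measurable M \<and> (\<forall>m::nat. integrable M (%x. abs (F x) ^ m))"

lemma allmom_meas: "allmom M F ==> F \<in> borel_measurable M" by (simp add: allmom_def)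

lemma allmom_int: assumes "allmom M F" shows "integrable M F"
proof -
  have "integrable M (%x. abs (F x) ^ 1)" using assms unfolding allmom_def by blast
  then show ?thesis using assms by (simp add: allmom_def integrable_abs_iff)
qed

lemma allmom_abs: "allmom M F ==> allmom M (%x. abs (F x))"
  unfolding allmom_def by (auto intro: borel_measurable_abs)

lemma allmom_const: "finite_measure M ==> allmom M (%x. c)"
  by (simp add: allmom_def finite_measure.emeasure_finite finite_measure.integrable_const)

lemma allmom_mult:
  assumes F: "allmom M F" and G: "allmom M G"
  shows "allmom M (%x. F x * G x)"
  unfolding allmom_def
proof (intro conjI allI)
  note [measurable] = allmom_meas[OF F] allmom_meas[OF G]
  show "(%x. F x * G x) \<in> borel_measurable M" by measurable
  fix m :: nat
  have "integrable M (%x. abs (F x) ^ (2 * m) + abs (G x) ^ (2 * m))"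
    using F G unfolding allmom_def by (intro Bochner_Integration.integrable_add) blast+
  then show "integrable M (%x. abs (F x * G x) ^ m)"
  proof (rule Bochner_Integration.integrable_bound)
    have "a * b <= a\<^sup>2 + b\<^sup>2" if "0 <= a" "0 <= b" for a b :: real
      using sum_squares_bound[of a b] mult_nonneg_nonneg[OF that] by linarith
    then show "AE x in M. norm (abs (F x * G x) ^ m) <= norm (abs (F x) ^ (2 * m) + abs (G x) ^ (2 * m))"
      by (intro AE_I2) (simp add: abs_mult power_mult_distrib power_even_eq)
  qed measurable
qed

lemma allmom_add:
  assumes F: "allmom M F" and G: "allmom M G"
  shows "allmom M (%x. F x + G x)"
  unfolding allmom_def
proof (intro conjI allI)
  note [measurable] = allmom_meas[OF F] allmom_meas[OF G]
  show "(%x. F x + G x) \<in> borel_measurable M" by measurable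
  fix m :: nat
  have "integrable M (%x. 2 ^ m * (abs (F x) ^ m + abs (G x) ^ m))"
    using F G unfolding allmom_def by (intro integrable_mult_right Bochner_Integration.integrable_add) blast+
  then show "integrable M (%x. abs (F x + G x) ^ m)"
  proof (rule Bochner_Integration.integrable_bound)
    have "abs (a + b) ^ m <= 2 ^ m * (abs a ^ m + abs b ^ m)" for a b :: real
    proof -
      have "abs (a + b) <= 2 * max (abs a) (abs b)" by linarith
      then have "abs (a + b) ^ m <= (2 * max (abs a) (abs b)) ^ m" by (intro power_mono) auto
      also have "... = 2 ^ m * (max (abs a) (abs b)) ^ m" by (rule power_mult_distrib)
      also have "... <= 2 ^ m * (abs a ^ m + abs b ^ m)" by (intro mult_left_mono) (auto simp: max_def)
      finally show ?thesis .
    qed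
    then show "AE x in M. norm (abs (F x + G x) ^ m) <= norm (2 ^ m * (abs (F x) ^ m + abs (G x) ^ m))"
      by (intro AE_I2) simp
  qed measurable
qed

lemma allmom_sum: "finite_measure M ==> (!!i. i \<in> I ==> allmom M (f i)) ==> allmom M (%x. \<Sum>i\<in>I. f i x)"
  by (induction I rule: infinite_finite_induct) (auto intro: allmom_add allmom_const)

context mh_rate begin

lemma fm_\<Gamma>: "finite_measure \<Gamma>" by unfold_locales

lemma allmom_coord: "allmom \<Gamma> (%w. w k)"
  using Gauss.integrable_coord[of "%t. abs t ^ _" k] gauss_abs_moment by (auto simp: allmom_def)

lemma allmom_B: "allmom \<Gamma> (%w. B (w k))"
proof -
  have "integrable \<Gamma> (%w. abs (B (w k)) ^ m)" for m
    using Gauss.integrable_coord[of "%t. B t ^ m" k] gauss_poly[of 0 m] by simp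
  then show ?thesis by (auto simp: allmom_def)
qed

lemmas allmom_intros = allmom_abs allmom_coord allmom_B allmom_add allmom_mult allmom_const[OF fm_\<Gamma>] allmom_sum[OF fm_\<Gamma>]

lemma st_pos: "n \<ge> 1 ==> 0 < st n" using tau_pos by (simp add: st_def)

section \<open>Decoupling finitely many coordinates from the acceptance probability\<close>

definition A :: "nat => (nat => real) => (nat => real) => real" where "A n x w = acc (st n) n x w"

lemma A_eq: "A n x w = gg (S n {} x w)"
proof -
  have "min 1 (exp y) = exp (min y 0)" for y :: real by (auto simp: min_def)
  then show ?thesis by (simp add: A_def acc_def gg_def S_def)
qed

lemma A_raw[measurable (raw)]:
  assumes "f \<in> measurable N P" "g \<in> measurable N \<Gamma>"
  shows "(%z. A n (f z) (g z)) \<in> borel_measurable N"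
  unfolding A_def using assms by measurable

lemma A_bounds: "0 <= A n x w" "A n x w <= 1" "abs (A n x w) <= 1"
  by (auto simp: A_def acc_bounds)

definition DJ :: "nat => nat set => (nat => real) => (nat => real) => real" where
  "DJ n J x w = (\<Sum>j\<in>J. D (st n) (x j) (w j))"

lemma S_split: "J \<subseteq> {..<n} ==> S n {} x w = S n J x w + DJ n J x w"
  unfolding S_def DJ_def using sum.subset_diff[of J "{..<n}" "%j. D (st n) (x j) (w j)"] by simp

text \<open>By \<open>DJ_bound\<close> a majorant of the log ratio over J divided by the step
  size.\<close>

definition UJ :: "nat set => (nat => real) => (nat => real) => real" where
  "UJ J x w = (\<Sum>j\<in>J. abs (w j) * (abs (d (x j)) + B (w j)))"

lemma UJ_nonneg: "0 <= UJ J x w" unfolding UJ_def by (intro sum_nonneg) simp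

lemma DJ_bound: "n \<ge> 1 ==> abs (DJ n J x w) <= st n * UJ J x w"
  unfolding DJ_def UJ_def sum_distrib_left
  by (rule order.trans[OF sum_abs], intro sum_mono) (use D_bound in \<open>simp add: mult.assoc\<close>)

lemma UJ_allmom: "allmom \<Gamma> (UJ J x)"
  unfolding UJ_def by (intro allmom_intros)

lemma DJ_raw[measurable (raw)]:
  assumes [measurable]: "f \<in> measurable N P" "g \<in> measurable N \<Gamma>"
  shows "(%z. DJ n J (f z) (g z)) \<in> borel_measurable N"
  unfolding DJ_def by measurable

lemma UJ_raw[measurable (raw)]:
  assumes [measurable]: "f \<in> measurable N P" "g \<in> measurable N \<Gamma>"
  shows "(%z. UJ J (f z) (g z)) \<in> borel_measurable N"
  unfolding UJ_def by measurable

lemma DJ_allmom: "n \<ge> 1 ==> allmom \<Gamma> (DJ n J x)"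
  unfolding allmom_def
proof (intro conjI allI)
  assume n: "n \<ge> 1"
  show "DJ n J x \<in> borel_measurable \<Gamma>" by measurable
  fix m :: nat
  have "allmom \<Gamma> (%w. st n * UJ J x w)" by (intro allmom_intros UJ_allmom)
  then have "integrable \<Gamma> (%w. abs (st n * UJ J x w) ^ m)" unfolding allmom_def by blast
  then show "integrable \<Gamma> (%w. abs (DJ n J x w) ^ m)"
  proof (rule Bochner_Integration.integrable_bound)
    show "AE w in \<Gamma>. norm (abs (DJ n J x w) ^ m) <= norm (abs (st n * UJ J x w) ^ m)"
      using DJ_bound[OF n, of J x] UJ_nonneg[of J x] by (intro AE_I2) (auto intro!: power_mono)
  qed measurable
qed

lemma bounded_times_allmom:
  assumes F: "allmom \<Gamma> F" and h: "h \<in> borel_measurable \<Gamma>" "!!w. abs (h w) <= 1"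
  shows "integrable \<Gamma> (%w. h w * F w)"
  by (rule Bochner_Integration.integrable_bound[OF allmom_int[OF F]])
     (use allmom_meas[OF F] h in \<open>auto simp: abs_mult intro!: mult_left_le_one_le\<close>)

text \<open>\<open>S n J\<close> does not involve the noise in J, so a bounded function of it is
  independent of F once x is fixed.\<close>

lemma tail_indep:
  assumes F: "allmom \<Gamma> F" and dF: "Gauss.dep J F" and [measurable]: "\<psi> \<in> borel_measurable borel" and b: "!!s. abs (\<psi> s) <= 1"
  shows "(LINT w|\<Gamma>. \<psi> (S n J x w) * F w) = (LINT w|\<Gamma>. \<psi> (S n J x w)) * (LINT w|\<Gamma>. F w)"
proof (rule Gauss.indep_integral(2)[where A="-J" and B=J])
  show "integrable \<Gamma> (%w. \<psi> (S n J x w))"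
    by (rule Gauss.Q.integrable_const_bound[where B=1]) (auto simp: b)
  have "S n J x w = S n J x w'" if "\<forall>i\<in>-J. w i = w' i" for w w'
    unfolding S_def using that by (intro sum.cong) auto
  then show "Gauss.dep (- J) (%w. \<psi> (S n J x w))"
    unfolding Gauss.dep_def by (metis (no_types, lifting))
qed (use F dF allmom_int in auto)

text \<open>Removing J from the log ratio changes \<open>A\<close> by at most
  \<open>st n * UJ J x w\<close>, because \<open>gg\<close> is 1-Lipschitz. What remains is
  independent of F, and its mean is compared with \<open>cc\<close>.\<close>

lemma head_split:
  assumes n: "n \<ge> 1" and J: "J \<subseteq> {..<n}" and F: "allmom \<Gamma> F" and dF: "Gauss.dep J F"
  shows "abs ((LINT w|\<Gamma>. A n x w * F w) - cc * (LINT w|\<Gamma>. F w))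
    <= st n * (LINT w|\<Gamma>. UJ J x w * abs (F w)) + abs ((LINT w|\<Gamma>. gg (S n J x w)) - cc) * (LINT w|\<Gamma>. abs (F w))"
proof -
  note [measurable] = allmom_meas[OF F]
  have i1: "integrable \<Gamma> (%w. A n x w * F w)"
    by (rule bounded_times_allmom[OF F]) (auto simp: A_bounds)
  have i2: "integrable \<Gamma> (%w. gg (S n J x w) * F w)"
    by (rule bounded_times_allmom[OF F]) (auto simp: gg_bounds)
  have i3: "integrable \<Gamma> (%w. UJ J x w * abs (F w))"
    by (intro allmom_int allmom_intros UJ_allmom F)
  have "abs ((LINT w|\<Gamma>. A n x w * F w) - (LINT w|\<Gamma>. gg (S n J x w) * F w)) = abs (\<integral>w. A n x w * F w - gg (S n J x w) * F w \<partial>\<Gamma>)"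
    using i1 i2 by simp
  also have "... <= (LINT w|\<Gamma>. abs (A n x w * F w - gg (S n J x w) * F w))" by (rule integral_abs_bound)
  also have "... <= (LINT w|\<Gamma>. st n * (UJ J x w * abs (F w)))"
  proof (rule integral_mono)
    fix w
    have "abs (A n x w - gg (S n J x w)) <= st n * UJ J x w"
      using gg_lip[of "S n {} x w" "S n J x w"] DJ_bound[OF n, of J x w] unfolding A_eq by (simp add: S_split[OF J])
    then have "abs (A n x w - gg (S n J x w)) * abs (F w) <= st n * UJ J x w * abs (F w)" by (intro mult_right_mono) auto
    then show "abs (A n x w * F w - gg (S n J x w) * F w) <= st n * (UJ J x w * abs (F w))"
      by (simp add: left_diff_distrib[symmetric] abs_mult mult.assoc)
  qed (use i1 i2 i3 in auto)
  finally have 1: "abs ((LINT w|\<Gamma>. A n x w * F w) - (LINT w|\<Gamma>. gg (S n J x w) * F w)) <= st n * (LINT w|\<Gamma>. UJ J x w * abs (F w))" by simp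
  have "(LINT w|\<Gamma>. gg (S n J x w) * F w) = (LINT w|\<Gamma>. gg (S n J x w)) * (LINT w|\<Gamma>. F w)"
    by (rule tail_indep[OF F dF]) (auto simp: gg_bounds)
  then have "abs ((LINT w|\<Gamma>. gg (S n J x w) * F w) - cc * (LINT w|\<Gamma>. F w)) = abs ((LINT w|\<Gamma>. gg (S n J x w)) - cc) * abs (\<integral>w. F w \<partial>\<Gamma>)"
    by (simp add: left_diff_distrib[symmetric] abs_mult)
  also have "... <= abs ((LINT w|\<Gamma>. gg (S n J x w)) - cc) * (LINT w|\<Gamma>. abs (F w))"
    by (intro mult_left_mono integral_abs_bound) simp
  finally show ?thesis using 1 by linarith
qed

lemma UJ_integral_split:
  assumes F: "allmom \<Gamma> F"
  shows "(LINT w|\<Gamma>. UJ J x w * abs (F w)) = (\<Sum>j\<in>J. abs (d (x j)) * (LINT w|\<Gamma>. abs (w j) * abs (F w)) + (LINT w|\<Gamma>. abs (w j) * B (w j) * abs (F w)))"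
proof -
  have i: "integrable \<Gamma> (%w. abs (w j) * abs (F w))" "integrable \<Gamma> (%w. abs (w j) * B (w j) * abs (F w))" for j
    by (intro allmom_int allmom_intros F)+
  have "(LINT w|\<Gamma>. UJ J x w * abs (F w)) = (LINT w|\<Gamma>. (\<Sum>j\<in>J. abs (d (x j)) * (abs (w j) * abs (F w)) + abs (w j) * B (w j) * abs (F w)))"
    unfolding UJ_def sum_distrib_right by (intro Bochner_Integration.integral_cong refl sum.cong) (simp add: algebra_simps)
  also have "... = (\<Sum>j\<in>J. abs (d (x j)) * (LINT w|\<Gamma>. abs (w j) * abs (F w)) + (LINT w|\<Gamma>. abs (w j) * B (w j) * abs (F w)))"
    using i by simp
  finally show ?thesis .
qed

lemma UJ_integrable_P:
  assumes F: "allmom \<Gamma> F"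
  shows "integrable P (%x. \<integral>w. UJ J x w * abs (F w) \<partial>\<Gamma>)"
proof -
  have "integrable P (%x. abs (d (x j)))" for j using d_int(2) T.integrable_coord[of "%t. abs (d t)" j] by simp
  then show ?thesis unfolding UJ_integral_split[OF F] by simp
qed

lemma gg_clt:
  assumes J: "finite J"
  shows "(%n. \<integral>x. abs ((LINT w|\<Gamma>. gg (S n J x w)) - cc) \<partial>P) \<longlonglongrightarrow> 0"
proof (rule Lim_null_comparison[OF _ delta_lim[OF J]])
  show "\<forall>\<^sub>F n in sequentially. norm (LINT x|P. abs ((LINT w|\<Gamma>. gg (S n J x w)) - cc)) <= \<delta> J n"
    using clt[OF _ J gg_meas gg_bounds(3), of _ 1] by (auto simp: gg_lip EZ_gg eventually_sequentially intro!: exI[of _ 1])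
qed

lemma cc_le: "cc <= 1" "0 <= cc"
proof -
  have "EZ gg <= (LINT z|std_gauss. 1)"
    unfolding EZ_def by (intro integral_mono gauss_int_bounded[where C=1]) (auto simp: gg_bounds)
  then show "cc <= 1" by (simp add: EZ_gg Gauss.prob_space[simplified])
qed (use cc_pos in simp)

lemma inner_gg_int: "integrable P (%x. abs ((LINT w|\<Gamma>. \<psi> (S n J x w)) - c))"
  if [measurable]: "\<psi> \<in> borel_measurable borel" and b: "!!s. abs (\<psi> s) <= 1" for \<psi> :: "real => real" and c :: real
proof (rule T.Q.integrable_const_bound[where B="1 + abs c"])
  have "abs (\<integral>w. \<psi> (S n J x w) \<partial>\<Gamma>) <= 1" for x
  proof -
    have "abs (\<integral>w. \<psi> (S n J x w) \<partial>\<Gamma>) <= (LINT w|\<Gamma>. abs (\<psi> (S n J x w)))" by (rule integral_abs_bound)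
    also have "... <= (LINT w|\<Gamma>. 1)"
      by (intro integral_mono Gauss.Q.integrable_const_bound[where B=1]) (auto simp: b)
    finally show ?thesis by (simp add: Gauss.Q.prob_space[simplified])
  qed
  then show "AE x in P. norm (abs ((LINT w|\<Gamma>. \<psi> (S n J x w)) - c)) <= 1 + abs c"
  proof (intro AE_I2)
    fix x
    assume h: "!!x. abs (\<integral>w. \<psi> (S n J x w) \<partial>\<Gamma>) <= 1"
    show "norm (abs ((LINT w|\<Gamma>. \<psi> (S n J x w)) - c)) <= 1 + abs c"
      using h[of x] abs_triangle_ineq4[of "\<integral>w. \<psi> (S n J x w) \<partial>\<Gamma>" c] by simp
  qed
qed measurable

lemma head_L1:
  assumes J: "finite J" and F: "allmom \<Gamma> F" and dF: "Gauss.dep J F"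
  shows "(%n. \<integral>x. abs ((LINT w|\<Gamma>. A n x w * F w) - cc * (LINT w|\<Gamma>. F w)) \<partial>P) \<longlonglongrightarrow> 0"
proof (rule Lim_null_comparison)
  note [measurable] = allmom_meas[OF F]
  let ?b = "%n. st n * (LINT x|P. (LINT w|\<Gamma>. UJ J x w * abs (F w))) + (LINT x|P. abs ((LINT w|\<Gamma>. gg (S n J x w)) - cc)) * (LINT w|\<Gamma>. abs (F w))"
  have "?b \<longlonglongrightarrow> 0 * (LINT x|P. (LINT w|\<Gamma>. UJ J x w * abs (F w))) + 0 * (LINT w|\<Gamma>. abs (F w))"
    by (intro tendsto_add tendsto_mult tendsto_const st_lim gg_clt J)
  then show "?b \<longlonglongrightarrow> 0" by simp
  obtain N where N: "J \<subseteq> {..<N}" using J finite_nat_iff_bounded by blast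
  show "\<forall>\<^sub>F n in sequentially. norm (LINT x|P. abs ((LINT w|\<Gamma>. A n x w * F w) - cc * (LINT w|\<Gamma>. F w))) <= ?b n"
  proof (rule eventually_sequentiallyI[of "max 1 N"])
    fix n assume "max 1 N <= n"
    then have n: "n \<ge> 1" "J \<subseteq> {..<n}" using N by auto
    have i: "integrable P (%x. st n * (LINT w|\<Gamma>. UJ J x w * abs (F w)) + abs ((LINT w|\<Gamma>. gg (S n J x w)) - cc) * (LINT w|\<Gamma>. abs (F w)))"
      by (intro Bochner_Integration.integrable_add integrable_mult_right integrable_mult_left UJ_integrable_P F inner_gg_int) (auto simp: gg_bounds)
    have "(LINT x|P. abs ((LINT w|\<Gamma>. A n x w * F w) - cc * (LINT w|\<Gamma>. F w)))
      <= (LINT x|P. st n * (LINT w|\<Gamma>. UJ J x w * abs (F w)) + abs ((LINT w|\<Gamma>. gg (S n J x w)) - cc) * (LINT w|\<Gamma>. abs (F w)))"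
    proof (rule integral_mono[OF _ i])
      show "integrable P (%x. abs ((LINT w|\<Gamma>. A n x w * F w) - cc * (LINT w|\<Gamma>. F w)))"
        by (rule Bochner_Integration.integrable_bound[OF i]) (use head_split[OF n F dF] in \<open>auto intro!: order.trans[OF head_split[OF n F dF]]\<close>)
    qed (rule head_split[OF n F dF])
    also have "... = ?b n"
      using UJ_integrable_P[OF F, of J] inner_gg_int[of gg n J cc] by (simp add: gg_bounds)
    finally show "norm (LINT x|P. abs ((LINT w|\<Gamma>. A n x w * F w) - cc * (LINT w|\<Gamma>. F w))) <= ?b n" by simp
  qed
qed

lemma gauss_coord_product: "(LINT w|\<Gamma>. w i * w j) = (if i = j then 1 else 0)"
proof (cases "i = j")
  case True
  have "(LINT t|std_gauss. t * t) = 1" using gauss_second_moment by (simp add: power2_eq_square)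
  then show ?thesis using True Gauss.integral_coord[of "%t. t * t" i] by simp
next
  case False
  have c: "integrable \<Gamma> (%w. w k)" "(LINT w|\<Gamma>. w k) = 0" for k
    using allmom_int[OF allmom_coord] Gauss.integral_coord[of "%t. t" k] by (auto simp: gauss_mean)
  have "(LINT w|\<Gamma>. w i * w j) = (LINT w|\<Gamma>. w i) * (LINT w|\<Gamma>. w j)"
    using False by (intro Gauss.indep_integral(2)[where A="{i}" and B="{j}"] c) (auto simp: Gauss.dep_def)
  then show ?thesis using False by (simp add: c)
qed

lemma quad_L1: "(%n. \<integral>x. abs ((LINT w|\<Gamma>. A n x w * (w i * w j)) - cc * (if i = j then 1 else 0)) \<partial>P) \<longlonglongrightarrow> 0"
  unfolding gauss_coord_product[symmetric]
  by (rule head_L1[of "{i, j}"]) (auto intro!: allmom_intros simp: Gauss.dep_def)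

lemma A_allmom_int: "allmom \<Gamma> F ==> integrable \<Gamma> (%w. A n x w * F w)"
  by (rule bounded_times_allmom) (auto simp: A_bounds)

lemma PG_bounded_allmom:
  assumes F: "allmom \<Gamma> F" and h[measurable]: "h \<in> borel_measurable PG" and b: "!!z. abs (h z) <= C"
  shows "integrable PG (%z. h z * F (snd z))"
proof (rule Bochner_Integration.integrable_bound)
  note [measurable] = allmom_meas[OF F]
  show "integrable PG (%z. C * abs (F (snd z)))"
    using PG.integrable_times(1)[of "%x. C" "%w. abs (F w)"] allmom_int[OF allmom_abs[OF F]] by simp
  show "(%z. h z * F (snd z)) \<in> borel_measurable PG" by measurable
  have "abs (h z) <= abs C" for z using b[of z] by simp
  then show "AE z in PG. norm (h z * F (snd z)) <= norm (C * abs (F (snd z)))"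
    by (intro AE_I2) (simp add: abs_mult mult_right_mono)
qed

text \<open>In the limit acceptance decouples from the pair \<open>w i\<close>, \<open>w j\<close>
  given x, so the Gaussian covariance leaves the diagonal terms, each with weight
  \<open>cc\<close>.\<close>

lemma quad_lim:
  fixes \<xi> :: "nat => (nat => real) => real"
  assumes m[measurable]: "!!k. \<xi> k \<in> borel_measurable P" and b: "!!k x. abs (\<xi> k x) <= C"
  shows "(%n. \<integral>z. A n (fst z) (snd z) * (\<Sum>k<N. \<xi> k (fst z) * snd z k)^2 \<partial>PG) \<longlonglongrightarrow> cc * (\<Sum>k<N. \<integral>x. (\<xi> k x)^2 \<partial>P)"
proof -
  have C0: "0 <= C" using order.trans[OF abs_ge_zero b[of 0 undefined]] .
  have bb: "abs (\<xi> i x * \<xi> j x) <= C * C" for i j x unfolding abs_mult by (intro mult_mono b) (auto simp: C0)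
  have int: "integrable PG (%z. (A n (fst z) (snd z) * (\<xi> i (fst z) * \<xi> j (fst z))) * (snd z i * snd z j))" for n i j
  proof (rule PG_bounded_allmom[where C="1 * (C * C)" and F="%w. w i * w j"])
    show "abs (A n (fst z) (snd z) * (\<xi> i (fst z) * \<xi> j (fst z))) <= 1 * (C * C)" for z
      unfolding abs_mult[of "A _ _ _"] by (intro mult_mono A_bounds bb) auto
  qed (auto intro!: allmom_intros)
  have ai: "integrable \<Gamma> (%w. A n x w * (w i * w j))" for n x i j
    by (intro A_allmom_int allmom_intros)
  let ?G = "%n i j x. \<integral>w. A n x w * (w i * w j) \<partial>\<Gamma>"
  let ?\<delta> = "%i j. cc * (if i = (j::nat) then 1 else 0)"
  have inner: "(LINT w|\<Gamma>. (A n x w * (\<xi> i x * \<xi> j x)) * (w i * w j)) = \<xi> i x * \<xi> j x * ?G n i j x" for n i j x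
  proof -
    have "(LINT w|\<Gamma>. (A n x w * (\<xi> i x * \<xi> j x)) * (w i * w j)) = (LINT w|\<Gamma>. (\<xi> i x * \<xi> j x) * (A n x w * (w i * w j)))"
      by (intro Bochner_Integration.integral_cong refl) (simp add: mult_ac)
    then show ?thesis by simp
  qed
  have eq: "(LINT z|PG. A n (fst z) (snd z) * (\<Sum>k<N. \<xi> k (fst z) * snd z k)^2)
     = (\<Sum>i<N. \<Sum>j<N. \<integral>x. \<xi> i x * \<xi> j x * ?G n i j x \<partial>P)" for n
  proof -
    have "(LINT z|PG. A n (fst z) (snd z) * (\<Sum>k<N. \<xi> k (fst z) * snd z k)^2)
      = (LINT z|PG. (\<Sum>i<N. \<Sum>j<N. (A n (fst z) (snd z) * (\<xi> i (fst z) * \<xi> j (fst z))) * (snd z i * snd z j)))"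
      by (intro Bochner_Integration.integral_cong refl) (simp add: power2_eq_square sum_product sum_distrib_left mult_ac)
    also have "... = (\<Sum>i<N. \<Sum>j<N. \<integral>z. (A n (fst z) (snd z) * (\<xi> i (fst z) * \<xi> j (fst z))) * (snd z i * snd z j) \<partial>PG)"
      using int by simp
    also have "... = (\<Sum>i<N. \<Sum>j<N. \<integral>x. \<xi> i x * \<xi> j x * ?G n i j x \<partial>P)"
    proof (intro sum.cong refl)
      fix i j
      have "(LINT z|PG. (A n (fst z) (snd z) * (\<xi> i (fst z) * \<xi> j (fst z))) * (snd z i * snd z j))
        = (LINT x|P. (LINT w|\<Gamma>. (A n x w * (\<xi> i x * \<xi> j x)) * (w i * w j)))"
        using PG.integral_fst'[OF int] by simp
      also have "... = (LINT x|P. \<xi> i x * \<xi> j x * ?G n i j x)" by (simp only: inner)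
      finally show "(LINT z|PG. (A n (fst z) (snd z) * (\<xi> i (fst z) * \<xi> j (fst z))) * (snd z i * snd z j)) = (LINT x|P. \<xi> i x * \<xi> j x * ?G n i j x)" .
    qed
    finally show ?thesis .
  qed
  have xi_int: "integrable P (%x. \<xi> i x * \<xi> j x * c)" for i j c
    by (rule T.Q.integrable_const_bound[where B="C * C * abs c"])
       (use bb in \<open>auto simp: abs_mult[of "_ * _" c] intro!: AE_I2 mult_right_mono\<close>)
  have Gi: "integrable P (?G n i j)" for n i j
    using PG.integrable_fst'[OF PG_bounded_allmom[of "%w. w i * w j" "%z. A n (fst z) (snd z)" 1]]
    by (simp add: A_bounds allmom_mult allmom_coord)
  have Gi2: "integrable P (%x. \<xi> i x * \<xi> j x * ?G n i j x)" for n i j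
    using PG.integrable_fst'[OF int[of n i j]] by (simp only: fst_conv snd_conv inner)
  have l: "(%n. \<integral>x. \<xi> i x * \<xi> j x * ?G n i j x \<partial>P) \<longlonglongrightarrow> (LINT x|P. \<xi> i x * \<xi> j x * ?\<delta> i j)" for i j
  proof (rule Lim_null[THEN iffD2], rule Lim_null_comparison[OF always_eventually], rule allI)
    show "(%n. C * C * (LINT x|P. abs (?G n i j x - ?\<delta> i j))) \<longlonglongrightarrow> 0"
      using tendsto_mult[OF tendsto_const quad_L1, of "C * C" i j] by simp
    fix n
    have "abs ((LINT x|P. \<xi> i x * \<xi> j x * ?G n i j x) - (LINT x|P. \<xi> i x * \<xi> j x * ?\<delta> i j))
       = abs (\<integral>x. \<xi> i x * \<xi> j x * ?G n i j x - \<xi> i x * \<xi> j x * ?\<delta> i j \<partial>P)"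
      using Gi2[of i j n] xi_int[of i j "?\<delta> i j"] by simp
    also have "... <= (LINT x|P. abs (\<xi> i x * \<xi> j x * ?G n i j x - \<xi> i x * \<xi> j x * ?\<delta> i j))" by (rule integral_abs_bound)
    also have "... <= (LINT x|P. C * C * abs (?G n i j x - ?\<delta> i j))"
    proof (rule integral_mono)
      show "integrable P (%x. abs (\<xi> i x * \<xi> j x * ?G n i j x - \<xi> i x * \<xi> j x * ?\<delta> i j))"
        by (intro integrable_abs Bochner_Integration.integrable_diff Gi2 xi_int)
      show "integrable P (%x. C * C * abs (?G n i j x - ?\<delta> i j))"
        by (intro integrable_mult_right integrable_abs Bochner_Integration.integrable_diff Gi T.Q.integrable_const)
      fix x
      have "abs (\<xi> i x * \<xi> j x * (?G n i j x - ?\<delta> i j)) <= C * C * abs (?G n i j x - ?\<delta> i j)"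
        unfolding abs_mult[of "_ * _"] by (intro mult_right_mono bb) simp
      then show "abs (\<xi> i x * \<xi> j x * ?G n i j x - \<xi> i x * \<xi> j x * ?\<delta> i j) <= C * C * abs (?G n i j x - ?\<delta> i j)"
        by (simp only: right_diff_distrib)
    qed
    finally show "norm ((LINT x|P. \<xi> i x * \<xi> j x * ?G n i j x) - (LINT x|P. \<xi> i x * \<xi> j x * ?\<delta> i j)) <= C * C * (LINT x|P. abs (?G n i j x - ?\<delta> i j))"
      by simp
  qed
  have "(%n. \<Sum>i<N. \<Sum>j<N. \<integral>x. \<xi> i x * \<xi> j x * ?G n i j x \<partial>P) \<longlonglongrightarrow> (\<Sum>i<N. \<Sum>j<N. \<integral>x. \<xi> i x * \<xi> j x * ?\<delta> i j \<partial>P)"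
    by (intro tendsto_sum l)
  moreover have "(\<Sum>i<N. \<Sum>j<N. \<integral>x. \<xi> i x * \<xi> j x * ?\<delta> i j \<partial>P) = cc * (\<Sum>k<N. \<integral>x. (\<xi> k x)^2 \<partial>P)"
  proof -
    have "(\<Sum>j<N. \<integral>x. \<xi> i x * \<xi> j x * ?\<delta> i j \<partial>P) = cc * (LINT x|P. (\<xi> i x)^2)" if "i < N" for i
    proof -
      have "(\<Sum>j<N. \<integral>x. \<xi> i x * \<xi> j x * ?\<delta> i j \<partial>P) = (\<Sum>j<N. if i = j then cc * (LINT x|P. (\<xi> i x)^2) else 0)"
        by (intro sum.cong refl) (auto simp: power2_eq_square mult.commute)
      also have "... = cc * (LINT x|P. (\<xi> i x)^2)" using that by (simp add: sum.delta)
      finally show ?thesis .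
    qed
    then show ?thesis by (simp add: sum_distrib_left)
  qed
  ultimately show ?thesis unfolding eq by simp
qed

end

section \<open>Limit of the adjoint fields\<close>

lemma integrable_dominated:
  fixes f g :: "'a => real"
  assumes "integrable M g" "f \<in> borel_measurable M" "!!x. 0 <= f x" "!!x. f x <= g x"
  shows "integrable M f"
proof (rule Bochner_Integration.integrable_bound[OF assms(1,2)], rule AE_I2)
  fix x show "norm (f x) <= norm (g x)" using assms(3,4)[of x] by simp
qed

lemma mvt_increment:
  fixes g g' :: "real => real"
  assumes "!!t. (g has_real_derivative g' t) (at t)"
  shows "\<exists>z. abs z <= abs h \<and> g (a + h) - g a = h * g' (a + z)"
proof -
  consider "h = 0" | "0 < h" | "h < 0" by linarith
  then show ?thesis
  proof cases
    case 1 then show ?thesis by auto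
  next
    case 2
    then obtain z where "a < z" "z < a + h" "g (a + h) - g a = (a + h - a) * g' z"
      using MVT2[of a "a + h" g g'] assms by auto
    then show ?thesis by (intro exI[of _ "z - a"]) auto
  next
    case 3
    then obtain z where "a + h < z" "z < a" "g a - g (a + h) = (a - (a + h)) * g' z"
      using MVT2[of "a + h" a g g'] assms by auto
    then show ?thesis by (intro exI[of _ "z - a"]) (auto simp: algebra_simps)
  qed
qed

lemma allmom_bound:
  assumes F: "allmom M F" and [measurable]: "G \<in> borel_measurable M" and b: "!!x. abs (G x) <= abs (F x)"
  shows "allmom M G"
  unfolding allmom_def
proof (intro conjI allI)
  fix m :: nat
  note [measurable] = allmom_meas[OF F]
  have "integrable M (%x. abs (F x) ^ m)" using F by (simp add: allmom_def)
  then show "integrable M (%x. abs (G x) ^ m)"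
    by (rule Bochner_Integration.integrable_bound) (auto intro!: AE_I2 power_mono b)
qed fact

lemma (in seq_prob) continuous_measurable:
  "continuous_on UNIV f ==> (f :: (nat => real) => real) \<in> borel_measurable Q"
  using borel_measurable_continuous_onI[of f] by (simp add: measurable_cong_sets[OF sets_Q_borel refl])

context mh_rate begin

section \<open>Contribution of the increment of the test field: the derivative term\<close>

definition Qn :: "((nat => real) => real) => nat => (nat => real) => (nat => real) => real" where
  "Qn \<xi> n x w = (\<xi> (pr (st n) n x w) - \<xi> x) / st n"

text \<open>Consecutive proposals differ in coordinate k alone, so telescoping reduces the increment
  to one-dimensional mean values along coordinate directions.\<close>

lemma pr_increment:
  assumes c: "C1b \<xi> N C"
  shows "\<exists>z. \<forall>k. abs (z k) <= abs (s * w k) \<and>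
    \<xi> (pr s (Suc k) x w) - \<xi> (pr s k x w) = s * w k * partial k \<xi> ((pr s k x w)(k := x k + z k))"
proof -
  have "\<exists>z. abs z <= abs (s * w k) \<and>
    \<xi> (pr s (Suc k) x w) - \<xi> (pr s k x w) = s * w k * partial k \<xi> ((pr s k x w)(k := x k + z))" for k
  proof -
    have e1: "pr s (Suc k) x w = (pr s k x w)(k := x k + s * w k)" by (auto simp: pr_def fun_eq_iff less_Suc_eq)
    \<comment> \<open>At stage k coordinate k has not been moved yet.\<close>
    have e2: "pr s k x w = (pr s k x w)(k := x k)" by (auto simp: pr_def fun_eq_iff)
    show ?thesis
      using mvt_increment[of "%t. \<xi> ((pr s k x w)(k := t))" "%t. partial k \<xi> ((pr s k x w)(k := t))" "s * w k" "x k", OF C1b_at[OF c]]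
      unfolding e1 by (subst (2) e2) auto
  qed
  then show ?thesis by metis
qed

lemma pr_head: "C1b \<xi> N C ==> N <= n ==> \<xi> (pr s n x w) = \<xi> (pr s N x w)"
  unfolding C1b_def by (elim conjE, rule depends_firstD) (auto simp: pr_def)

lemma pr_telescope:
  fixes \<xi> :: "(nat => real) => real"
  shows "\<xi> (pr s N x w) - \<xi> x = (\<Sum>k<N. \<xi> (pr s (Suc k) x w) - \<xi> (pr s k x w))"
proof -
  have "pr s 0 x w = x" by (simp add: pr_def)
  then show ?thesis using sum_lessThan_telescope[of "%k. \<xi> (pr s k x w)" N] by simp
qed

lemma Qn_bound:
  assumes c: "C1b \<xi> N C" and n: "n \<ge> 1" "N <= n"
  shows "abs (Qn \<xi> n x w) <= C * (\<Sum>k<N. abs (w k))"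
proof -
  obtain z where z: "!!k. \<xi> (pr (st n) (Suc k) x w) - \<xi> (pr (st n) k x w) = st n * w k * partial k \<xi> ((pr (st n) k x w)(k := x k + z k))"
    using pr_increment[OF c] by metis
  have "abs (\<xi> (pr (st n) n x w) - \<xi> x) <= (\<Sum>k<N. abs (st n * w k * partial k \<xi> ((pr (st n) k x w)(k := x k + z k))))"
    unfolding pr_head[OF c n(2)] pr_telescope z by (rule sum_abs)
  also have "... <= (\<Sum>k<N. st n * (C * abs (w k)))"
  proof (rule sum_mono)
    fix k
    have "abs (partial k \<xi> y) <= C" for y using c by (auto simp: C1b_def)
    then have "st n * (abs (partial k \<xi> ((pr (st n) k x w)(k := x k + z k))) * abs (w k)) <= st n * (C * abs (w k))"
      by (intro mult_left_mono mult_right_mono) auto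
    then show "abs (st n * w k * partial k \<xi> ((pr (st n) k x w)(k := x k + z k))) <= st n * (C * abs (w k))"
      by (simp add: abs_mult mult_ac)
  qed
  also have "... = st n * (C * (\<Sum>k<N. abs (w k)))" by (simp add: sum_distrib_left)
  finally show ?thesis using st_pos[OF n(1)] by (simp add: Qn_def field_simps)
qed

lemma Qn_lim:
  assumes c: "C1b \<xi> N C"
  shows "(%n. Qn \<xi> n x w) \<longlonglongrightarrow> (\<Sum>k<N. w k * partial k \<xi> x)"
proof -
  have "\<forall>n. \<exists>z. \<forall>k. abs (z k) <= abs (st n * w k) \<and>
    \<xi> (pr (st n) (Suc k) x w) - \<xi> (pr (st n) k x w) = st n * w k * partial k \<xi> ((pr (st n) k x w)(k := x k + z k))"
    by (intro allI pr_increment[OF c])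
  then obtain z where z1: "!!n k. abs (z n k) <= abs (st n * w k)" and
    z2: "!!n k. \<xi> (pr (st n) (Suc k) x w) - \<xi> (pr (st n) k x w) = st n * w k * partial k \<xi> ((pr (st n) k x w)(k := x k + z n k))"
    by metis
  have zl: "(%n. z n k) \<longlonglongrightarrow> 0" for k
  proof (rule Lim_null_comparison[OF always_eventually], rule allI)
    show "norm (z n k) <= abs (st n * w k)" for n using z1 by simp
    show "(%n. abs (st n * w k)) \<longlonglongrightarrow> 0" using tendsto_rabs[OF tendsto_mult_right[OF st_lim, of "w k"]] by (simp add: mult.commute)
  qed
  have pl: "(%n. partial k \<xi> ((pr (st n) k x w)(k := x k + z n k))) \<longlonglongrightarrow> partial k \<xi> x" for k
  proof -
    have lx: "(%n. (pr (st n) k x w)(k := x k + z n k)) \<longlonglongrightarrow> x"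
    proof (rule tendsto_seq_componentwise)
      fix i
      have "(%n. x i + st n * w i) \<longlonglongrightarrow> x i + 0 * w i" "(%n. x k + z n k) \<longlonglongrightarrow> x k + 0"
        by (intro tendsto_add tendsto_mult tendsto_const st_lim zl)+
      then show "(%n. ((pr (st n) k x w)(k := x k + z n k)) i) \<longlonglongrightarrow> x i"
        by (cases "i = k"; cases "i < k") (auto simp: pr_def)
    qed
    have "continuous_on UNIV (partial k \<xi>)" using c by (simp add: C1b_def)
    from continuous_on_tendsto_compose[OF this lx] show ?thesis by simp
  qed
  have "(%n. \<Sum>k<N. w k * partial k \<xi> ((pr (st n) k x w)(k := x k + z n k))) \<longlonglongrightarrow> (\<Sum>k<N. w k * partial k \<xi> x)"
    by (intro tendsto_sum tendsto_mult tendsto_const pl)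
  then show ?thesis
  proof (rule Lim_transform_eventually)
    show "\<forall>\<^sub>F n in sequentially. (\<Sum>k<N. w k * partial k \<xi> ((pr (st n) k x w)(k := x k + z n k))) = Qn \<xi> n x w"
    proof (rule eventually_sequentiallyI[of "max 1 N"])
      fix n assume "max 1 N <= n"
      then have n: "n \<ge> 1" "N <= n" by auto
      show "(\<Sum>k<N. w k * partial k \<xi> ((pr (st n) k x w)(k := x k + z n k))) = Qn \<xi> n x w"
        unfolding Qn_def pr_head[OF c n(2)] pr_telescope z2 sum_divide_distrib
        using st_pos[OF n(1)] by (intro sum.cong) auto
    qed
  qed
qed

lemma C1b_meas: "C1b \<xi> N C ==> \<xi> \<in> borel_measurable P" "C1b \<xi> N C ==> partial j \<xi> \<in> borel_measurable P"
  by (auto simp: C1b_def intro: T.continuous_measurable)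

lemma Qn_raw:
  assumes c: "C1b \<xi> N C" and [measurable]: "f \<in> measurable M P" "g \<in> measurable M \<Gamma>"
  shows "(%z. Qn \<xi> n (f z) (g z)) \<in> borel_measurable M"
proof -
  note [measurable] = C1b_meas(1)[OF c]
  show ?thesis unfolding Qn_def by measurable
qed

lemma C1b_C0: "C1b \<xi> N C ==> 0 <= C"
  unfolding C1b_def by (elim conjE, rule order.trans[OF abs_ge_zero], blast)

lemma Qn_allmom:
  assumes c: "C1b \<xi> N C" and n: "n \<ge> 1" "N <= n"
  shows "allmom \<Gamma> (Qn \<xi> n x)"
proof (rule allmom_bound[where F="%w. C * (\<Sum>k<N. abs (w k))"])
  show "allmom \<Gamma> (%w. C * (\<Sum>k<N. abs (w k)))" by (intro allmom_intros)
  show "Qn \<xi> n x \<in> borel_measurable \<Gamma>" by (rule Qn_raw[OF c]) auto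
  show "abs (Qn \<xi> n x w) <= abs (C * (\<Sum>k<N. abs (w k)))" for w
    using Qn_bound[OF c n, of x w] by linarith
qed

text \<open>\<open>Qn\<close> tends to the sum of \<open>w k * partial k \<xi> x\<close>;
  multiplying by \<open>w i\<close> and averaging selects k = i, and the decoupled acceptance
  contributes \<open>cc\<close>. The second claim is the uniform bound used to pass from L1 to
  L2.\<close>

lemma accept_increment_lim:
  assumes c: "C1b \<xi> N C"
  shows "(%n. \<integral>x. abs ((LINT w|\<Gamma>. A n x w * (Qn \<xi> n x w * w i)) - cc * partial i \<xi> x) \<partial>P) \<longlonglongrightarrow> 0"
    and "n \<ge> 1 ==> N <= n ==> abs (\<integral>w. A n x w * (Qn \<xi> n x w * w i) \<partial>\<Gamma>) <= (LINT w|\<Gamma>. C * (\<Sum>k<N. abs (w k)) * abs (w i))"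
proof -
  define J where "J = {..<max N (Suc i)}"
  have J: "finite J" by (simp add: J_def)
  define E where "E w = C * (\<Sum>k<N. abs (w k)) * abs (w i)" for w :: "nat => real"
  have C0: "0 <= C" by (rule C1b_C0[OF c])
  have E0: "0 <= E w" for w unfolding E_def using C0 by (intro mult_nonneg_nonneg sum_nonneg) auto
  have Em: "allmom \<Gamma> E" unfolding E_def by (intro allmom_intros)
  have Ei: "integrable \<Gamma> E" by (rule allmom_int[OF Em])
  note [measurable] = allmom_meas[OF Em] C1b_meas[OF c] Qn_raw[OF c]
  let ?F = "%n x w. Qn \<xi> n x w * w i"
  have FE: "abs (?F n x w) <= E w" if "n \<ge> 1" "N <= n" for n x w
    unfolding E_def abs_mult by (intro mult_right_mono Qn_bound[OF c that]) simp
  have Fa: "allmom \<Gamma> (?F n x)" if "n \<ge> 1" "N <= n" for n x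
    by (intro allmom_intros Qn_allmom[OF c that])
  have Fd: "Gauss.dep J (?F n x)" if "N <= n" for n x
    unfolding Gauss.dep_def
  proof (intro allI impI)
    fix w w' :: "nat => real" assume h: "\<forall>i\<in>J. w i = w' i"
    have dfN: "depends_first N \<xi>" using c by (simp add: C1b_def)
    have "\<xi> (pr (st n) n x w) = \<xi> (pr (st n) n x w')"
      by (rule depends_firstD[OF dfN]) (use h in \<open>auto simp: pr_def J_def\<close>)
    then show "?F n x w = ?F n x w'" using h by (simp add: Qn_def J_def)
  qed
  have bnd: "abs (\<integral>w. h w * ?F n x w \<partial>\<Gamma>) <= (LINT w|\<Gamma>. E w)"
    if "n \<ge> 1" "N <= n" and h: "h \<in> borel_measurable \<Gamma>" "!!w. abs (h w) <= 1" for n x h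
  proof -
    have "abs (\<integral>w. h w * ?F n x w \<partial>\<Gamma>) <= (LINT w|\<Gamma>. abs (h w * ?F n x w))" by (rule integral_abs_bound)
    also have "... <= (LINT w|\<Gamma>. E w)"
    proof (rule integral_mono[OF _ Ei])
      show "integrable \<Gamma> (%w. abs (h w * ?F n x w))" by (intro integrable_abs bounded_times_allmom[OF Fa] that h)
      show "abs (h w * ?F n x w) <= E w" for w
        using mult_mono[OF h(2) FE[OF that(1,2), of x w]] by (simp add: abs_mult)
    qed
    finally show ?thesis .
  qed
  show "n \<ge> 1 ==> N <= n ==> abs (\<integral>w. A n x w * (Qn \<xi> n x w * w i) \<partial>\<Gamma>) <= (LINT w|\<Gamma>. C * (\<Sum>k<N. abs (w k)) * abs (w i))"
    using bnd[of n "A n x" x] by (auto simp: E_def[abs_def] A_bounds)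
  \<comment> \<open>From this index on, n is positive, the proposal moves every coordinate on which
    \<xi> depends, and J lies below n.\<close>
  let ?m = "max 1 (max N (Suc i))"
  have l3: "(%n. \<integral>x. abs ((LINT w|\<Gamma>. ?F (n + ?m) x w) - partial i \<xi> x) \<partial>P) \<longlonglongrightarrow> (LINT x|P. 0)"
  proof (rule integral_dominated_convergence[where w="%_. (LINT w|\<Gamma>. E w) + C"])
    show "AE x in P. (%n. abs ((LINT w|\<Gamma>. ?F (n + ?m) x w) - partial i \<xi> x)) \<longlonglongrightarrow> 0"
    proof (rule AE_I2)
      fix x
      have "(%n. \<integral>w. ?F (n + ?m) x w \<partial>\<Gamma>) \<longlonglongrightarrow> (LINT w|\<Gamma>. (\<Sum>k<N. w k * partial k \<xi> x) * w i)"
      proof (rule integral_dominated_convergence[where w=E])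
        show "AE w in \<Gamma>. (%n. ?F (n + ?m) x w) \<longlonglongrightarrow> (\<Sum>k<N. w k * partial k \<xi> x) * w i"
          by (intro AE_I2 tendsto_mult tendsto_const LIMSEQ_ignore_initial_segment Qn_lim[OF c])
        show "AE w in \<Gamma>. norm (?F (n + ?m) x w) <= E w" for n
          by (intro AE_I2) (use FE[of "n + ?m" x] in auto)
      qed (use Ei in auto)
      also have "(LINT w|\<Gamma>. (\<Sum>k<N. w k * partial k \<xi> x) * w i) = (LINT w|\<Gamma>. (\<Sum>k<N. partial k \<xi> x * (w k * w i)))"
        by (intro Bochner_Integration.integral_cong refl) (simp add: sum_distrib_left mult_ac)
      also have "... = (\<Sum>k<N. \<integral>w. partial k \<xi> x * (w k * w i) \<partial>\<Gamma>)"
        by (intro Bochner_Integration.integral_sum integrable_mult_right allmom_int allmom_intros)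
      also have "... = (\<Sum>k<N. if k = i then partial k \<xi> x else 0)"
        by (intro sum.cong refl) (simp add: gauss_coord_product)
      also have "... = partial i \<xi> x"
        using partial_beyond[of N \<xi> i x] c by (auto simp: sum.delta C1b_def)
      finally have "(%n. (LINT w|\<Gamma>. ?F (n + ?m) x w) - partial i \<xi> x) \<longlonglongrightarrow> partial i \<xi> x - partial i \<xi> x"
        by (intro tendsto_diff tendsto_const)
      then show "(%n. abs ((LINT w|\<Gamma>. ?F (n + ?m) x w) - partial i \<xi> x)) \<longlonglongrightarrow> 0"
        using tendsto_rabs_zero by auto
    qed
    show "AE x in P. norm (abs ((LINT w|\<Gamma>. ?F (n + ?m) x w) - partial i \<xi> x)) <= (LINT w|\<Gamma>. E w) + C" for n
    proof (rule AE_I2)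
      fix x
      have "abs (partial i \<xi> x) <= C" using c by (simp add: C1b_def)
      moreover have "abs (\<integral>w. ?F (n + ?m) x w \<partial>\<Gamma>) <= (LINT w|\<Gamma>. E w)"
        using bnd[of "n + ?m" "%_. 1" x] by simp
      ultimately show "norm (abs ((LINT w|\<Gamma>. ?F (n + ?m) x w) - partial i \<xi> x)) <= (LINT w|\<Gamma>. E w) + C"
        using abs_triangle_ineq4[of "\<integral>w. ?F (n + ?m) x w \<partial>\<Gamma>" "partial i \<xi> x"] by simp
    qed
  qed measurable
  have l3': "(%n. \<integral>x. abs ((LINT w|\<Gamma>. ?F n x w) - partial i \<xi> x) \<partial>P) \<longlonglongrightarrow> 0"
    by (rule LIMSEQ_offset[where f="%n. \<integral>x. abs ((LINT w|\<Gamma>. ?F n x w) - partial i \<xi> x) \<partial>P" and k="?m"])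
       (rule l3[unfolded Bochner_Integration.integral_zero])
  let ?b = "%n. st n * (LINT x|P. (LINT w|\<Gamma>. UJ J x w * abs (E w))) + (LINT x|P. abs ((LINT w|\<Gamma>. gg (S n J x w)) - cc)) * (LINT w|\<Gamma>. E w)
     + (LINT x|P. abs ((LINT w|\<Gamma>. ?F n x w) - partial i \<xi> x))"
  show "(%n. \<integral>x. abs ((LINT w|\<Gamma>. A n x w * ?F n x w) - cc * partial i \<xi> x) \<partial>P) \<longlonglongrightarrow> 0"
  proof (rule Lim_null_comparison)
    have "?b \<longlonglongrightarrow> 0 * (LINT x|P. (LINT w|\<Gamma>. UJ J x w * abs (E w))) + 0 * (LINT w|\<Gamma>. E w) + 0"
      by (intro tendsto_add tendsto_mult tendsto_const st_lim gg_clt J l3')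
    then show "?b \<longlonglongrightarrow> 0" by simp
    show "\<forall>\<^sub>F n in sequentially. norm (LINT x|P. abs ((LINT w|\<Gamma>. A n x w * ?F n x w) - cc * partial i \<xi> x)) <= ?b n"
    proof (rule eventually_sequentiallyI[of ?m])
      fix n assume "?m <= n"
      then have n: "n \<ge> 1" "N <= n" "J \<subseteq> {..<n}" by (auto simp: J_def)
      let ?r = "%x. st n * (LINT w|\<Gamma>. UJ J x w * abs (E w)) + abs ((LINT w|\<Gamma>. gg (S n J x w)) - cc) * (LINT w|\<Gamma>. E w) + abs ((LINT w|\<Gamma>. ?F n x w) - partial i \<xi> x)"
      have pt: "abs ((LINT w|\<Gamma>. A n x w * ?F n x w) - cc * partial i \<xi> x) <= ?r x" for x
      proof -
        have h: "abs ((LINT w|\<Gamma>. A n x w * ?F n x w) - cc * (LINT w|\<Gamma>. ?F n x w))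
          <= st n * (LINT w|\<Gamma>. UJ J x w * abs (?F n x w)) + abs ((LINT w|\<Gamma>. gg (S n J x w)) - cc) * (LINT w|\<Gamma>. abs (?F n x w))"
          by (rule head_split[OF n(1,3) Fa[OF n(1,2)] Fd[OF n(2)]])
        have "st n * (LINT w|\<Gamma>. UJ J x w * abs (?F n x w)) <= st n * (LINT w|\<Gamma>. UJ J x w * abs (E w))"
        proof (intro mult_left_mono integral_mono)
          show "integrable \<Gamma> (%w. UJ J x w * abs (?F n x w))" "integrable \<Gamma> (%w. UJ J x w * abs (E w))"
            by (intro allmom_int allmom_intros UJ_allmom Qn_allmom[OF c n(1,2)] Em)+
          show "abs (?F n x w) <= abs (E w)" for w using FE[OF n(1,2), of x w] E0[of w] by linarith
        qed (auto simp: UJ_nonneg)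
        moreover have "abs ((LINT w|\<Gamma>. gg (S n J x w)) - cc) * (LINT w|\<Gamma>. abs (?F n x w)) <= abs ((LINT w|\<Gamma>. gg (S n J x w)) - cc) * (LINT w|\<Gamma>. E w)"
        proof (intro mult_left_mono integral_mono)
          show "integrable \<Gamma> (%w. abs (?F n x w))" by (intro allmom_int allmom_abs Fa n)
        qed (use Ei FE[OF n(1,2)] in auto)
        moreover have "abs (cc * (LINT w|\<Gamma>. ?F n x w) - cc * partial i \<xi> x) <= abs ((LINT w|\<Gamma>. ?F n x w) - partial i \<xi> x)"
        proof -
          have "abs (cc * ((LINT w|\<Gamma>. ?F n x w) - partial i \<xi> x)) <= 1 * abs ((LINT w|\<Gamma>. ?F n x w) - partial i \<xi> x)"
            unfolding abs_mult using cc_le by (intro mult_right_mono) auto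
          then show ?thesis by (simp add: right_diff_distrib)
        qed
        ultimately show ?thesis using h by linarith
      qed
      have i3: "integrable P (%x. abs ((LINT w|\<Gamma>. ?F n x w) - partial i \<xi> x))"
      proof (rule T.Q.integrable_const_bound[where B="(LINT w|\<Gamma>. E w) + C"])
        show "AE x in P. norm (abs ((LINT w|\<Gamma>. ?F n x w) - partial i \<xi> x)) <= (LINT w|\<Gamma>. E w) + C"
        proof (rule AE_I2)
          fix x
          have "abs (partial i \<xi> x) <= C" using c by (simp add: C1b_def)
          moreover have "abs (\<integral>w. ?F n x w \<partial>\<Gamma>) <= (LINT w|\<Gamma>. E w)"
            using bnd[OF n(1,2), of "%_. 1" x] by simp
          ultimately show "norm (abs ((LINT w|\<Gamma>. ?F n x w) - partial i \<xi> x)) <= (LINT w|\<Gamma>. E w) + C"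
            using abs_triangle_ineq4[of "\<integral>w. ?F n x w \<partial>\<Gamma>" "partial i \<xi> x"] by simp
        qed
      qed measurable
      have i1: "integrable P (%x. st n * (LINT w|\<Gamma>. UJ J x w * abs (E w)))"
        by (intro integrable_mult_right UJ_integrable_P Em)
      have i2: "integrable P (%x. abs ((LINT w|\<Gamma>. gg (S n J x w)) - cc) * (LINT w|\<Gamma>. E w))"
        by (intro integrable_mult_left inner_gg_int) (auto simp: gg_bounds)
      have ir: "integrable P ?r" using i1 i2 i3 by simp
      have "(LINT x|P. abs ((LINT w|\<Gamma>. A n x w * ?F n x w) - cc * partial i \<xi> x)) <= (LINT x|P. ?r x)"
      proof (rule integral_mono[OF _ ir pt])
        show "integrable P (%x. abs ((LINT w|\<Gamma>. A n x w * ?F n x w) - cc * partial i \<xi> x))"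
          by (rule integrable_dominated[OF ir _ _ pt]) auto
      qed
      also have "... = ?b n" using i1 i2 i3 by simp
      finally show "norm (LINT x|P. abs ((LINT w|\<Gamma>. A n x w * ?F n x w) - cc * partial i \<xi> x)) <= ?b n" by simp
    qed
  qed
qed

section \<open>Correlation of acceptance with the noise: the drift term\<close>

definition C3 :: "nat => real" where "C3 i = (LINT w|\<Gamma>. abs (w i) * B (w i) * abs (w i))"

lemma C3_nonneg: "0 <= C3 i" unfolding C3_def by (intro Bochner_Integration.integral_nonneg) simp

lemma coord_mean: "(LINT w|\<Gamma>. w i) = 0"
  using Gauss.integral_coord[of "%t. t" i] by (simp add: gauss_mean)

lemma UJ_single: "(LINT w|\<Gamma>. UJ {i} x w * abs (w i)) = abs (d (x i)) + C3 i"
proof -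
  have "(LINT w|\<Gamma>. abs (w i) * abs (w i)) = 1" using gauss_coord_product[of i i] by simp
  then show ?thesis by (subst UJ_integral_split) (auto intro: allmom_coord simp: C3_def)
qed

text \<open>The tail without coordinate i is independent of the centred \<open>w i\<close>. The mean
  is therefore of the order of the step, which keeps its quotient by \<open>st n\<close>
  bounded.\<close>

lemma wi_bound:
  assumes n: "n \<ge> 1" "i < n"
  shows "abs (\<integral>w. A n x w * w i \<partial>\<Gamma>) <= st n * (abs (d (x i)) + C3 i)"
proof -
  have J: "{i} \<subseteq> {..<n}" using n by simp
  have i1: "integrable \<Gamma> (%w. A n x w * w i)" by (intro A_allmom_int allmom_coord)
  have i2: "integrable \<Gamma> (%w. gg (S n {i} x w) * w i)"
    by (rule bounded_times_allmom[OF allmom_coord]) (auto simp: gg_bounds)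
  have i3: "integrable \<Gamma> (%w. UJ {i} x w * abs (w i))" by (intro allmom_int allmom_intros UJ_allmom)
  have "(LINT w|\<Gamma>. gg (S n {i} x w) * w i) = 0"
    by (subst tail_indep) (auto intro: allmom_coord simp: Gauss.dep_def gg_bounds coord_mean)
  then have "abs (\<integral>w. A n x w * w i \<partial>\<Gamma>) = abs (\<integral>w. A n x w * w i - gg (S n {i} x w) * w i \<partial>\<Gamma>)" using i1 i2 by simp
  also have "... <= (LINT w|\<Gamma>. abs (A n x w * w i - gg (S n {i} x w) * w i))" by (rule integral_abs_bound)
  also have "... <= (LINT w|\<Gamma>. st n * (UJ {i} x w * abs (w i)))"
  proof (rule integral_mono)
    fix w
    have "abs (A n x w - gg (S n {i} x w)) <= st n * UJ {i} x w"
      using gg_lip[of "S n {} x w" "S n {i} x w"] DJ_bound[OF n(1), of "{i}" x w] unfolding A_eq by (simp add: S_split[OF J])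
    then have "abs (A n x w - gg (S n {i} x w)) * abs (w i) <= st n * UJ {i} x w * abs (w i)" by (intro mult_right_mono) auto
    then show "abs (A n x w * w i - gg (S n {i} x w) * w i) <= st n * (UJ {i} x w * abs (w i))"
      by (simp add: left_diff_distrib[symmetric] abs_mult mult.assoc)
  qed (use i1 i2 i3 in auto)
  finally show ?thesis by (simp add: UJ_single)
qed

text \<open>Expand \<open>A\<close> as \<open>gg\<close> of tail plus single term around the tail.
  The constant term is killed by the mean of \<open>w i\<close>; the linear term factors into the
  mean of \<open>qde e\<close> and the covariance of the single log ratio with \<open>w i\<close>,
  which is \<open>st n\<close> times d(x i) plus a small error. Kink and second order terms give the
  first two summands of the bound.\<close>

lemma accept_drift_estimate:
  assumes n: "n \<ge> 1" "i < n" and e: "0 < e" "e <= 1"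
  shows "abs ((LINT w|\<Gamma>. A n x w * w i) / st n - cc / 2 * d (x i))
    <= 2 * (LINT w|\<Gamma>. pde e (S n {i} x w)) * (abs (d (x i)) + C3 i) + 2 / e * st n * (LINT w|\<Gamma>. (UJ {i} x w)^2 * abs (w i))
      + abs ((LINT w|\<Gamma>. qde e (S n {i} x w)) - cc / 2) * (abs (d (x i)) + C3 i) + C3 i * \<kappa> n"
proof -
  let ?D = "%w. DJ n {i} x w" and ?U = "%w. UJ {i} x w" and ?S = "%w. S n {i} x w"
  let ?s = "st n"
  have s: "0 < ?s" by (rule st_pos[OF n(1)])
  have J: "{i} \<subseteq> {..<n}" using n by simp
  have am: "allmom \<Gamma> (%w. w i)" "allmom \<Gamma> ?D" "allmom \<Gamma> ?U" by (intro allmom_coord DJ_allmom n UJ_allmom)+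
  have i1: "integrable \<Gamma> (%w. A n x w * w i)" by (intro A_allmom_int allmom_coord)
  have i2: "integrable \<Gamma> (%w. gg (?S w) * w i)"
    by (rule bounded_times_allmom[OF am(1)]) (auto simp: gg_bounds)
  have i3: "integrable \<Gamma> (%w. qde e (?S w) * (?D w * w i))"
    by (rule bounded_times_allmom) (auto intro!: allmom_mult am simp: qde_bounds)
  have i4: "integrable \<Gamma> (%w. pde e (?S w) * (?U w * abs (w i)))"
    by (rule bounded_times_allmom) (auto intro!: allmom_mult allmom_abs am simp: pde_bounds)
  have i5: "integrable \<Gamma> (%w. (?U w)^2 * abs (w i))"
    unfolding power2_eq_square by (intro allmom_int allmom_mult allmom_abs am)
  have g0: "(LINT w|\<Gamma>. gg (?S w) * w i) = 0"
    by (subst tail_indep) (auto intro: allmom_coord simp: Gauss.dep_def gg_bounds coord_mean)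
  have qf: "(LINT w|\<Gamma>. qde e (?S w) * (?D w * w i)) = (LINT w|\<Gamma>. qde e (?S w)) * (LINT w|\<Gamma>. ?D w * w i)"
    by (rule tail_indep[OF allmom_mult[OF am(2) am(1)]]) (auto simp: Gauss.dep_def qde_bounds DJ_def)
  have pf: "(LINT w|\<Gamma>. pde e (?S w) * (?U w * abs (w i))) = (LINT w|\<Gamma>. pde e (?S w)) * (abs (d (x i)) + C3 i)"
    unfolding UJ_single[symmetric]
    by (rule tail_indep[OF allmom_mult[OF am(3) allmom_abs[OF am(1)]]]) (auto simp: Gauss.dep_def pde_bounds UJ_def)
  have err: "abs ((LINT w|\<Gamma>. A n x w * w i) - (LINT w|\<Gamma>. qde e (?S w) * (?D w * w i)))
     <= 2 * ?s * ((LINT w|\<Gamma>. pde e (?S w)) * (abs (d (x i)) + C3 i)) + 2 / e * ?s\<^sup>2 * (LINT w|\<Gamma>. (?U w)^2 * abs (w i))"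
  proof -
    have eq: "(LINT w|\<Gamma>. A n x w * w i) - (LINT w|\<Gamma>. qde e (?S w) * (?D w * w i))
       = (LINT w|\<Gamma>. A n x w * w i - gg (?S w) * w i - qde e (?S w) * (?D w * w i))"
      using i1 i2 i3 g0 by simp
    have "abs ((LINT w|\<Gamma>. A n x w * w i) - (LINT w|\<Gamma>. qde e (?S w) * (?D w * w i)))
       <= (LINT w|\<Gamma>. abs (A n x w * w i - gg (?S w) * w i - qde e (?S w) * (?D w * w i)))"
      unfolding eq by (rule integral_abs_bound)
    also have "... <= (LINT w|\<Gamma>. 2 * ?s * (pde e (?S w) * (?U w * abs (w i))) + 2 / e * ?s\<^sup>2 * ((?U w)^2 * abs (w i)))"
    proof (rule integral_mono)
      fix w
      have Db: "abs (?D w) <= ?s * ?U w" by (rule DJ_bound[OF n(1)])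
      have "abs (gg (?S w + ?D w) - gg (?S w) - qde e (?S w) * ?D w) <= 2 * abs (?D w) * pde e (?S w) + 2 * (?D w)^2 / e"
        by (rule gg_expansion[OF e])
      also have "... <= 2 * (?s * ?U w) * pde e (?S w) + 2 * (?s * ?U w)^2 / e"
        using power_mono[OF Db, of 2] Db e by (intro add_mono mult_right_mono divide_right_mono) (auto simp: pde_bounds)
      finally have h: "abs (gg (?S w + ?D w) - gg (?S w) - qde e (?S w) * ?D w) * abs (w i) <= (2 * (?s * ?U w) * pde e (?S w) + 2 * (?s * ?U w)^2 / e) * abs (w i)"
        by (rule mult_right_mono) simp
      have "A n x w = gg (?S w + ?D w)" by (simp add: A_eq S_split[OF J])
      then have "abs (A n x w * w i - gg (?S w) * w i - qde e (?S w) * (?D w * w i)) = abs (gg (?S w + ?D w) - gg (?S w) - qde e (?S w) * ?D w) * abs (w i)"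
        by (simp add: abs_mult[symmetric] left_diff_distrib mult.assoc)
      also have "... <= 2 * ?s * (pde e (?S w) * (?U w * abs (w i))) + 2 / e * ?s\<^sup>2 * ((?U w)^2 * abs (w i))"
      proof -
        have "(2 * (?s * ?U w) * pde e (?S w) + 2 * (?s * ?U w)^2 / e) * abs (w i)
          = 2 * ?s * (pde e (?S w) * (?U w * abs (w i))) + 2 / e * ?s\<^sup>2 * ((?U w)^2 * abs (w i))"
          using e by (simp add: field_simps power_mult_distrib)
        then show ?thesis using h by (simp only:)
      qed
      finally show "abs (A n x w * w i - gg (?S w) * w i - qde e (?S w) * (?D w * w i)) <= 2 * ?s * (pde e (?S w) * (?U w * abs (w i))) + 2 / e * ?s\<^sup>2 * ((?U w)^2 * abs (w i))" .
    qed (use i1 i2 i3 i4 i5 in auto)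
    also have "... = 2 * ?s * ((LINT w|\<Gamma>. pde e (?S w)) * (abs (d (x i)) + C3 i)) + 2 / e * ?s\<^sup>2 * (LINT w|\<Gamma>. (?U w)^2 * abs (w i))"
      using i4 i5 by (simp add: pf)
    finally show ?thesis .
  qed
  \<comment> \<open>Contribution of the Taylor remainder to the covariance with \<open>w i\<close>,
    divided by the step; it is at most \<open>C3 i * \<kappa> n\<close>.\<close>
  define \<rho> where "\<rho> = (LINT w|\<Gamma>. r n (x i) (w i) * w i) / ?s"
  have rb: "abs (r n (x i) (w i) * w i) <= ?s * \<kappa> n * (abs (w i) * B (w i) * abs (w i))" for w :: "nat => real"
    using mult_right_mono[OF r_bound[OF n(1), of "x i" "w i"], of "abs (w i)"] by (simp add: abs_mult mult_ac)
  have ib: "integrable \<Gamma> (%w. abs (w i) * B (w i) * abs (w i))" by (intro allmom_int allmom_intros)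
  have rm[measurable]: "(%w. r n (x i) (w i)) \<in> borel_measurable \<Gamma>" unfolding r_def by measurable
  have ir: "integrable \<Gamma> (%w. r n (x i) (w i) * w i)"
    by (rule Bochner_Integration.integrable_bound[where f="%w. ?s * \<kappa> n * (abs (w i) * B (w i) * abs (w i))"])
       (use ib in \<open>auto intro!: AE_I2 order.trans[OF rb]\<close>)
  have rho: "abs \<rho> <= C3 i * \<kappa> n"
  proof -
    have "abs (\<integral>w. r n (x i) (w i) * w i \<partial>\<Gamma>) <= (LINT w|\<Gamma>. abs (r n (x i) (w i) * w i))" by (rule integral_abs_bound)
    also have "... <= (LINT w|\<Gamma>. ?s * \<kappa> n * (abs (w i) * B (w i) * abs (w i)))"
      by (intro integral_mono integrable_abs ir integrable_mult_right ib rb)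
    also have "... = ?s * (C3 i * \<kappa> n)" by (simp add: C3_def)
    finally show ?thesis using s by (simp add: \<rho>_def field_simps)
  qed
  have Dm: "(LINT w|\<Gamma>. ?D w * w i) / ?s = d (x i) + \<rho>"
  proof -
    have "(LINT w|\<Gamma>. ?D w * w i) = (LINT w|\<Gamma>. ?s * d (x i) * (w i * w i) + r n (x i) (w i) * w i)"
      by (intro Bochner_Integration.integral_cong refl) (simp add: DJ_def r_def algebra_simps)
    also have "... = ?s * d (x i) + (LINT w|\<Gamma>. r n (x i) (w i) * w i)"
      using ir allmom_int[OF allmom_mult[OF am(1) am(1)]] by (simp add: gauss_coord_product)
    finally show ?thesis using s by (simp add: \<rho>_def add_divide_distrib)
  qed
  let ?q = "\<integral>w. qde e (?S w) \<partial>\<Gamma>" let ?p = "\<integral>w. pde e (?S w) \<partial>\<Gamma>" let ?u = "\<integral>w. (?U w)^2 * abs (w i) \<partial>\<Gamma>"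
  have e1: "abs ((LINT w|\<Gamma>. A n x w * w i) / ?s - ?q * (d (x i) + \<rho>)) <= 2 * ?p * (abs (d (x i)) + C3 i) + 2 / e * ?s * ?u"
  proof -
    have eq: "(LINT w|\<Gamma>. A n x w * w i) / ?s - ?q * (d (x i) + \<rho>) = ((LINT w|\<Gamma>. A n x w * w i) - ?q * (LINT w|\<Gamma>. ?D w * w i)) / ?s"
      unfolding Dm[symmetric] by (simp add: diff_divide_distrib)
    have "abs ((LINT w|\<Gamma>. A n x w * w i) / ?s - ?q * (d (x i) + \<rho>)) = abs ((LINT w|\<Gamma>. A n x w * w i) - ?q * (LINT w|\<Gamma>. ?D w * w i)) / ?s"
      unfolding eq abs_divide using s by simp
    also have "... <= (2 * ?s * (?p * (abs (d (x i)) + C3 i)) + 2 / e * ?s\<^sup>2 * ?u) / ?s"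
      using err s unfolding qf by (intro divide_right_mono) auto
    also have "... = 2 * ?p * (abs (d (x i)) + C3 i) + 2 / e * ?s * ?u"
      using s by (simp add: add_divide_distrib power2_eq_square)
    finally show ?thesis .
  qed
  have e2: "abs (?q * (d (x i) + \<rho>) - cc / 2 * d (x i)) <= abs (?q - cc / 2) * (abs (d (x i)) + C3 i) + C3 i * \<kappa> n"
  proof -
    have eq: "?q * (d (x i) + \<rho>) - cc / 2 * d (x i) = (?q - cc / 2) * (d (x i) + \<rho>) + cc / 2 * \<rho>"
      by (simp add: algebra_simps)
    have "abs (?q * (d (x i) + \<rho>) - cc / 2 * d (x i)) <= abs (?q - cc / 2) * abs (d (x i) + \<rho>) + cc / 2 * abs \<rho>"
      unfolding eq using abs_triangle_ineq[of "(?q - cc / 2) * (d (x i) + \<rho>)" "cc / 2 * \<rho>"] cc_le by (simp add: abs_mult)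
    also have "... <= abs (?q - cc / 2) * (abs (d (x i)) + C3 i) + 1 * (C3 i * \<kappa> n)"
    proof (intro add_mono mult_left_mono mult_mono rho)
      have "C3 i * \<kappa> n <= C3 i * 1" by (intro mult_left_mono kappa1 C3_nonneg)
      then show "abs (d (x i) + \<rho>) <= abs (d (x i)) + C3 i" using rho abs_triangle_ineq[of "d (x i)" \<rho>] by linarith
    qed (use cc_le in auto)
    finally show ?thesis by simp
  qed
  show ?thesis using e1 e2 by linarith
qed

text \<open>The mean slope of 1 \<and> exp is \<open>cc / 2\<close>, and the 2 in front of \<xi>
  comes from its two occurrences in \<open>Vn\<close>. On the support of \<xi> the coordinate x i
  stays in a compact interval, so the continuous \<open>d\<close> is bounded there. The smoothing
  scale \<open>e k\<close> goes to 0 after n has gone to infinity.\<close>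

lemma accept_drift_lim:
  assumes c: "C1b \<xi> N C" and R: "!!x. abs (x i) > R ==> \<xi> x = 0"
  shows "(%n. \<integral>x. abs (2 * \<xi> x * ((LINT w|\<Gamma>. A n x w * w i) / st n) - cc * (d (x i) * \<xi> x)) \<partial>P) \<longlonglongrightarrow> 0"
    and "\<exists>C'. \<forall>n x. n \<ge> 1 --> i < n --> abs (2 * \<xi> x * ((LINT w|\<Gamma>. A n x w * w i) / st n)) <= C'"
    and "\<exists>C'. \<forall>x. abs (d (x i) * \<xi> x) <= C'"
proof -
  have C0: "0 <= C" by (rule C1b_C0[OF c])
  have xiC: "abs (\<xi> x) <= C" for x using c by (simp add: C1b_def)
  note [measurable] = C1b_meas(1)[OF c]
  have "compact (d ` {-R..R})"
    using d_cont by (intro compact_continuous_image continuous_on_subset[OF d_cont]) auto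
  then obtain Cd' where Cd': "!!t. t \<in> {-R..R} ==> abs (d t) <= Cd'"
  proof -
    assume *: "!!Cd'. (!!t. t \<in> {-R..R} ==> abs (d t) <= Cd') ==> thesis" and c: "compact (d ` {-R..R})"
    from compact_imp_bounded[OF c] obtain a where "\<forall>y\<in>d ` {-R..R}. norm y <= a" unfolding bounded_iff by blast
    then show thesis by (intro *[of a]) auto
  qed
  define Cd where "Cd = max Cd' 0"
  have Cd: "abs (d (x i)) <= Cd" if "\<xi> x \<noteq> 0" for x
  proof -
    have "abs (x i) <= R" using R[of x] that by force
    then have "abs (d (x i)) <= Cd'" by (intro Cd') auto
    then show ?thesis by (simp add: Cd_def)
  qed
  have Cd0: "0 <= Cd" by (simp add: Cd_def)
  define C4 where "C4 = Cd + C3 i"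
  have C40: "0 <= C4" using Cd0 C3_nonneg by (simp add: C4_def)
  define C5 where "C5 = (LINT w|\<Gamma>. (abs (w i) * (Cd + B (w i)))^2 * abs (w i))"
  show "\<exists>C'. \<forall>n x. n \<ge> 1 --> i < n --> abs (2 * \<xi> x * ((LINT w|\<Gamma>. A n x w * w i) / st n)) <= C'"
  proof (intro exI[of _ "2 * C * C4"] allI impI)
    fix n :: nat and x assume n: "n \<ge> 1" "i < n"
    show "abs (2 * \<xi> x * ((LINT w|\<Gamma>. A n x w * w i) / st n)) <= 2 * C * C4"
    proof (cases "\<xi> x = 0")
      case True then show ?thesis using C0 C40 by simp
    next
      case False
      have "abs ((LINT w|\<Gamma>. A n x w * w i) / st n) <= abs (d (x i)) + C3 i"
        using wi_bound[OF n, of x] st_pos[OF n(1)] by (simp add: field_simps)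
      also have "... <= C4" using Cd[OF False] by (simp add: C4_def)
      finally show ?thesis
        unfolding abs_mult[of "2 * \<xi> x"] using xiC[of x] C0 by (intro mult_mono) auto
    qed
  qed
  show "\<exists>C'. \<forall>x. abs (d (x i) * \<xi> x) <= C'"
  proof (intro exI[of _ "Cd * C"] allI)
    fix x show "abs (d (x i) * \<xi> x) <= Cd * C"
      using Cd[of x] xiC[of x] Cd0 C0 by (cases "\<xi> x = 0") (auto simp: abs_mult intro!: mult_mono)
  qed
  define e where "e k = 1 / real (Suc k)" for k
  have e: "0 < e k" "e k <= 1" for k by (auto simp: e_def)
  define pb where "pb k n x = (LINT w|\<Gamma>. pde (e k) (S n {i} x w))" for k n x
  define qb where "qb k n x = (LINT w|\<Gamma>. qde (e k) (S n {i} x w))" for k n x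
  have pbm[measurable]: "pb k n \<in> borel_measurable P" and qbm[measurable]: "qb k n \<in> borel_measurable P" for k n
    unfolding pb_def qb_def by measurable
  define b where "b k n = 2 * C * (2 * (EZ (pde (e k)) + 1 / e k * \<delta> {i} n) * C4 + 2 / e k * st n * C5
     + ((1 + 1 / e k) * \<delta> {i} n + abs (EZ (qde (e k)) - cc / 2)) * C4 + C3 i * \<kappa> n)" for k n
  have pt: "abs (2 * \<xi> x * ((LINT w|\<Gamma>. A n x w * w i) / st n) - cc * (d (x i) * \<xi> x))
     <= 2 * C * (2 * (abs (pb k n x - EZ (pde (e k))) + EZ (pde (e k))) * C4 + 2 / e k * st n * C5
       + (abs (qb k n x - EZ (qde (e k))) + abs (EZ (qde (e k)) - cc / 2)) * C4 + C3 i * \<kappa> n)" (is "_ <= 2 * C * ?r")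
    if n: "n \<ge> 1" "i < n" for n k x
  proof -
    have C50: "0 <= C5" unfolding C5_def by (intro Bochner_Integration.integral_nonneg) simp
    have EZp: "0 <= EZ (pde (e k))" unfolding EZ_def by (intro Bochner_Integration.integral_nonneg) (simp add: pde_bounds)
    have r0: "0 <= ?r"
      using e[of k] C40 C50 EZp by (intro add_nonneg_nonneg mult_nonneg_nonneg) (auto simp: C3_nonneg kappa0)
    show ?thesis
    proof (cases "\<xi> x = 0")
      case True then show ?thesis using r0 C0 by simp
    next
      case False
      let ?T = "(LINT w|\<Gamma>. A n x w * w i) / st n - cc / 2 * d (x i)"
      have u: "(LINT w|\<Gamma>. (UJ {i} x w)^2 * abs (w i)) <= C5"
        unfolding C5_def
      proof (rule integral_mono)
        show "integrable \<Gamma> (%w. (UJ {i} x w)^2 * abs (w i))" "integrable \<Gamma> (%w. (abs (w i) * (Cd + B (w i)))^2 * abs (w i))"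
          unfolding power2_eq_square by (intro allmom_int allmom_intros UJ_allmom)+
        show "(UJ {i} x w)^2 * abs (w i) <= (abs (w i) * (Cd + B (w i)))^2 * abs (w i)" for w
          unfolding UJ_def using Cd[OF False] by (intro mult_right_mono power_mono) (auto intro!: mult_left_mono)
      qed
      have pb0: "0 <= pb k n x" unfolding pb_def by (intro Bochner_Integration.integral_nonneg) (simp add: pde_bounds)
      have "abs ?T <= 2 * pb k n x * (abs (d (x i)) + C3 i) + 2 / e k * st n * (LINT w|\<Gamma>. (UJ {i} x w)^2 * abs (w i))
        + abs (qb k n x - cc / 2) * (abs (d (x i)) + C3 i) + C3 i * \<kappa> n"
        unfolding pb_def qb_def by (rule accept_drift_estimate[OF n e])
      also have "... <= ?r"
      proof (intro add_mono mult_mono mult_left_mono u)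
        show "abs (d (x i)) + C3 i <= C4" "abs (d (x i)) + C3 i <= C4" using Cd[OF False] by (simp_all add: C4_def)
        show "pb k n x <= abs (pb k n x - EZ (pde (e k))) + EZ (pde (e k))" by linarith
        show "abs (qb k n x - cc / 2) <= abs (qb k n x - EZ (qde (e k))) + abs (EZ (qde (e k)) - cc / 2)" by linarith
        show "0 <= 2 * (abs (pb k n x - EZ (pde (e k))) + EZ (pde (e k)))" using EZp by simp
      qed (use pb0 e[of k] EZp C3_nonneg[of i] kappa0[of n] in auto)
      finally have T: "abs ?T <= ?r" .
      have "2 * \<xi> x * ((LINT w|\<Gamma>. A n x w * w i) / st n) - cc * (d (x i) * \<xi> x) = (2 * \<xi> x) * ?T"
        by (simp add: algebra_simps)
      then have "abs (2 * \<xi> x * ((LINT w|\<Gamma>. A n x w * w i) / st n) - cc * (d (x i) * \<xi> x)) = abs (2 * \<xi> x) * abs ?T"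
        by (simp only: abs_mult)
      also have "... <= 2 * C * ?r" using xiC[of x] C0 T by (intro mult_mono) auto
      finally show ?thesis .
    qed
  qed
  show "(%n. \<integral>x. abs (2 * \<xi> x * ((LINT w|\<Gamma>. A n x w * w i) / st n) - cc * (d (x i) * \<xi> x)) \<partial>P) \<longlonglongrightarrow> 0"
  proof (rule tendsto_zero_double[where b=b and \<beta>="%k. 2 * C * (2 * (EZ (pde (e k)) + 1 / e k * 0) * C4 + 2 / e k * 0 * C5
     + ((1 + 1 / e k) * 0 + abs (EZ (qde (e k)) - cc / 2)) * C4 + C3 i * 0)"])
    show "b k \<longlonglongrightarrow> 2 * C * (2 * (EZ (pde (e k)) + 1 / e k * 0) * C4 + 2 / e k * 0 * C5
     + ((1 + 1 / e k) * 0 + abs (EZ (qde (e k)) - cc / 2)) * C4 + C3 i * 0)" for k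
      unfolding b_def by (intro tendsto_add tendsto_mult tendsto_const delta_lim st_lim kappa_lim) auto
    have "(%k. 2 * C * (2 * EZ (pde (e k)) * C4 + abs (EZ (qde (e k)) - cc / 2) * C4)) \<longlonglongrightarrow> 2 * C * (2 * 0 * C4 + abs (cc / 2 - cc / 2) * C4)"
      unfolding e_def by (intro tendsto_add tendsto_mult tendsto_const tendsto_rabs tendsto_diff EZ_pde_lim EZ_qde_lim)
    then show "(%k. 2 * C * (2 * (EZ (pde (e k)) + 1 / e k * 0) * C4 + 2 / e k * 0 * C5
     + ((1 + 1 / e k) * 0 + abs (EZ (qde (e k)) - cc / 2)) * C4 + C3 i * 0)) \<longlonglongrightarrow> 0" by simp
    show "\<forall>\<^sub>F n in sequentially. (LINT x|P. abs (2 * \<xi> x * ((LINT w|\<Gamma>. A n x w * w i) / st n) - cc * (d (x i) * \<xi> x))) <= b k n" for k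
    proof (rule eventually_sequentiallyI[of "Suc i"])
      fix n assume "Suc i <= n"
      then have n: "n \<ge> 1" "i < n" by auto
      let ?ip = "\<integral>x. abs (pb k n x - EZ (pde (e k))) \<partial>P" and ?iq = "\<integral>x. abs (qb k n x - EZ (qde (e k))) \<partial>P"
      have i1: "integrable P (%x. abs (pb k n x - EZ (pde (e k))))"
        unfolding pb_def by (rule inner_gg_int) (auto simp: pde_bounds)
      have i2: "integrable P (%x. abs (qb k n x - EZ (qde (e k))))"
        unfolding qb_def by (rule inner_gg_int) (auto simp: qde_bounds)
      let ?r = "%x. 2 * C * (2 * (abs (pb k n x - EZ (pde (e k))) + EZ (pde (e k))) * C4 + 2 / e k * st n * C5
       + (abs (qb k n x - EZ (qde (e k))) + abs (EZ (qde (e k)) - cc / 2)) * C4 + C3 i * \<kappa> n)"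
      have ir: "integrable P ?r" using i1 i2 by simp
      have "(LINT x|P. abs (2 * \<xi> x * ((LINT w|\<Gamma>. A n x w * w i) / st n) - cc * (d (x i) * \<xi> x))) <= (LINT x|P. ?r x)"
      proof (rule integral_mono[OF _ ir pt[OF n]])
        show "integrable P (%x. abs (2 * \<xi> x * ((LINT w|\<Gamma>. A n x w * w i) / st n) - cc * (d (x i) * \<xi> x)))"
          by (rule integrable_dominated[OF ir _ _ pt[OF n]]) auto
      qed
      also have "(LINT x|P. ?r x) = 2 * C * (2 * (?ip + EZ (pde (e k))) * C4 + 2 / e k * st n * C5
       + (?iq + abs (EZ (qde (e k)) - cc / 2)) * C4 + C3 i * \<kappa> n)"
        using i1 i2 by (simp add: T.Q.prob_space[simplified])
      also have "... <= b k n"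
      proof -
        have ip: "?ip <= 1 / e k * \<delta> {i} n"
          unfolding pb_def using e[of k] by (intro clt n pde_lip) (auto simp: pde_bounds)
        have iq: "?iq <= (1 + 1 / e k) * \<delta> {i} n"
          unfolding qb_def using e[of k] by (intro clt n qde_lip) (auto simp: qde_bounds)
        have x1: "2 * (?ip + EZ (pde (e k))) * C4 <= 2 * (EZ (pde (e k)) + 1 / e k * \<delta> {i} n) * C4"
          by (rule mult_right_mono[OF mult_left_mono C40]) (use ip in auto)
        have x2: "(?iq + abs (EZ (qde (e k)) - cc / 2)) * C4 <= ((1 + 1 / e k) * \<delta> {i} n + abs (EZ (qde (e k)) - cc / 2)) * C4"
          by (rule mult_right_mono[OF _ C40]) (use iq in auto)
        show ?thesis
          unfolding b_def
          by (rule mult_left_mono[OF add_mono[OF add_mono[OF add_mono[OF x1 order_refl] x2] order_refl]]) (use C0 in simp)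
      qed
      finally show "(LINT x|P. abs (2 * \<xi> x * ((LINT w|\<Gamma>. A n x w * w i) / st n) - cc * (d (x i) * \<xi> x))) <= b k n" .
    qed
  qed auto
qed

text \<open>A sum of the values at both ends, because the reversal that moves the difference of h
  onto the field also flips the sign of \<open>w i\<close>. Written as increment plus twice the
  value at x, it splits into derivative and drift.\<close>

definition Vn :: "nat => ((nat => real) => real) => nat => (nat => real) => real" where
  "Vn i \<xi> n x = (LINT w|\<Gamma>. A n x w * ((\<xi> (pr (st n) n x w) + \<xi> x) / st n * w i))"

text \<open>\<open>- VV i\<close> is the formal adjoint of the i-th partial derivative in \<open>L\<^sup>2(P)\<close>.\<close>

definition VV :: "nat => ((nat => real) => real) => (nat => real) => real" where
  "VV i \<xi> x = partial i \<xi> x + d (x i) * \<xi> x"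

lemma VV_sqi: "testf i \<xi> ==> VV i \<xi> \<in> sqi P"
proof -
  assume "testf i \<xi>"
  then obtain N C R where c: "C1b \<xi> N C" and R: "!!x. abs (x i) > R ==> \<xi> x = 0" by (auto simp: testf_iff)
  note [measurable] = C1b_meas[OF c]
  obtain C' where C': "!!x. abs (d (x i) * \<xi> x) <= C'" using accept_drift_lim(3)[where i=i and R=R, OF c R] by auto
  show ?thesis
    unfolding VV_def
  proof (rule sqi_add; rule T.Q.sqi_bounded)
    show "abs (partial i \<xi> x) <= C" for x using c by (simp add: C1b_def)
  qed (use C' in auto)
qed

lemma Vn_conv:
  assumes "testf i \<xi>"
  shows "(%n. l2 P (%x. Vn i \<xi> n x - cc * VV i \<xi> x)) \<longlonglongrightarrow> 0" and "\<exists>n0. \<forall>n\<ge>n0. Vn i \<xi> n \<in> sqi P"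
proof -
  obtain N C R where c: "C1b \<xi> N C" and R: "!!x. abs (x i) > R ==> \<xi> x = 0" using assms by (auto simp: testf_iff)
  note [measurable] = C1b_meas[OF c] Qn_raw[OF c]
  obtain C1 where C1: "!!x. abs (d (x i) * \<xi> x) <= C1" using accept_drift_lim(3)[where i=i and R=R, OF c R] by auto
  obtain C2 where C2: "!!n x. n \<ge> 1 ==> i < n ==> abs (2 * \<xi> x * ((LINT w|\<Gamma>. A n x w * w i) / st n)) <= C2"
    using accept_drift_lim(2)[where i=i and R=R, OF c R] by blast
  define C3 where "C3 = (LINT w|\<Gamma>. C * (\<Sum>k<N. abs (w k)) * abs (w i))"
  let ?n0 = "max 1 (max N (Suc i))"
  let ?t1 = "%n x. \<integral>w. A n x w * (Qn \<xi> n x w * w i) \<partial>\<Gamma>" and ?t2 = "%n x. 2 * \<xi> x * ((LINT w|\<Gamma>. A n x w * w i) / st n)"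
  have Vm: "Vn i \<xi> n \<in> borel_measurable P" "VV i \<xi> \<in> borel_measurable P" for n
    unfolding Vn_def VV_def by measurable
  note [measurable] = Vm
  have eq: "Vn i \<xi> n x = ?t1 n x + ?t2 n x" if n: "n \<ge> ?n0" for n x
  proof -
    have n': "n \<ge> 1" "N <= n" using n by auto
    have "Vn i \<xi> n x = (LINT w|\<Gamma>. A n x w * (Qn \<xi> n x w * w i) + (2 * \<xi> x / st n) * (A n x w * w i))"
      unfolding Vn_def by (intro Bochner_Integration.integral_cong refl) (simp add: Qn_def add_divide_distrib diff_divide_distrib algebra_simps)
    also have "... = ?t1 n x + ?t2 n x"
      using A_allmom_int[OF allmom_mult[OF Qn_allmom[OF c n'] allmom_coord], of n x x i] A_allmom_int[OF allmom_coord, of n x i] by simp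
    finally show ?thesis .
  qed
  have Vb: "abs (Vn i \<xi> n x) <= C3 + C2" if n: "n \<ge> ?n0" for n x
    unfolding eq[OF n] C3_def using accept_increment_lim(2)[OF c, of n x i] C2[of n x] n
      abs_triangle_ineq[of "?t1 n x" "?t2 n x"] by auto
  show "\<exists>n0. \<forall>n\<ge>n0. Vn i \<xi> n \<in> sqi P"
    using T.Q.sqi_bounded[OF Vm(1) Vb] by blast
  show "(%n. l2 P (%x. Vn i \<xi> n x - cc * VV i \<xi> x)) \<longlonglongrightarrow> 0"
  proof (rule l2_from_L1[where ?n0.0="?n0" and C="C3 + C2 + (C + C1)"])
    have VVb: "abs (cc * VV i \<xi> x) <= C + C1" for x
    proof -
      have "abs (partial i \<xi> x) <= C" using c by (simp add: C1b_def)
      then have "abs (VV i \<xi> x) <= C + C1" unfolding VV_def using C1[of x] by linarith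
      moreover have "abs (cc * VV i \<xi> x) <= 1 * abs (VV i \<xi> x)" unfolding abs_mult using cc_le by (intro mult_right_mono) auto
      ultimately show ?thesis by linarith
    qed
    show "abs (Vn i \<xi> n x - cc * VV i \<xi> x) <= C3 + C2 + (C + C1)" if "n \<ge> ?n0" for n x
      using Vb[OF that, of x] VVb[of x] by linarith
    show "(%n. \<integral>x. abs (Vn i \<xi> n x - cc * VV i \<xi> x) \<partial>P) \<longlonglongrightarrow> 0"
    proof (rule Lim_null_comparison)
      let ?b = "%n. (LINT x|P. abs (?t1 n x - cc * partial i \<xi> x)) + (LINT x|P. abs (?t2 n x - cc * (d (x i) * \<xi> x)))"
      show "?b \<longlonglongrightarrow> 0" using tendsto_add[OF accept_increment_lim(1)[OF c, of i] accept_drift_lim(1)[where i=i and R=R, OF c R]] by simp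
      show "\<forall>\<^sub>F n in sequentially. norm (LINT x|P. abs (Vn i \<xi> n x - cc * VV i \<xi> x)) <= ?b n"
      proof (rule eventually_sequentiallyI[of ?n0])
        fix n assume n: "?n0 <= n"
        then have n': "n \<ge> 1" "N <= n" "i < n" by auto
        have pC: "abs (partial i \<xi> x) <= C" for x using c by (simp add: C1b_def)
        have i1: "integrable P (?t1 n)"
          using accept_increment_lim(2)[OF c n'(1,2), of _ i] by (intro T.Q.integrable_const_bound[where B=C3] AE_I2) (simp_all add: C3_def)
        have i4: "integrable P (?t2 n)"
          by (intro T.Q.integrable_const_bound[where B=C2] AE_I2) (use C2[OF n'(1,3)] in simp_all)
        have i5: "integrable P (%x. partial i \<xi> x)"
          by (intro T.Q.integrable_const_bound[where B=C] AE_I2) (use pC in simp_all)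
        have i6: "integrable P (%x. d (x i) * \<xi> x)"
          by (intro T.Q.integrable_const_bound[where B=C1] AE_I2) (use C1 in simp_all)
        have i2: "integrable P (%x. abs (?t1 n x - cc * partial i \<xi> x))" "integrable P (%x. abs (?t2 n x - cc * (d (x i) * \<xi> x)))"
          by (rule integrable_abs[OF Bochner_Integration.integrable_diff[OF i1 integrable_mult_right[OF i5]]],
              rule integrable_abs[OF Bochner_Integration.integrable_diff[OF i4 integrable_mult_right[OF i6]]])
        have "(LINT x|P. abs (Vn i \<xi> n x - cc * VV i \<xi> x)) <= (LINT x|P. abs (?t1 n x - cc * partial i \<xi> x) + abs (?t2 n x - cc * (d (x i) * \<xi> x)))"
        proof (rule integral_mono)
          show le: "abs (Vn i \<xi> n x - cc * VV i \<xi> x) <= abs (?t1 n x - cc * partial i \<xi> x) + abs (?t2 n x - cc * (d (x i) * \<xi> x))" for x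
          proof -
            have "Vn i \<xi> n x - cc * VV i \<xi> x = (?t1 n x - cc * partial i \<xi> x) + (?t2 n x - cc * (d (x i) * \<xi> x))"
              unfolding eq[OF n] VV_def by (simp add: distrib_left)
            then show ?thesis by (simp only: abs_triangle_ineq)
          qed
          show "integrable P (%x. abs (?t1 n x - cc * partial i \<xi> x) + abs (?t2 n x - cc * (d (x i) * \<xi> x)))"
            by (intro Bochner_Integration.integrable_add i2)
          then show "integrable P (%x. abs (Vn i \<xi> n x - cc * VV i \<xi> x))"
            by (rule integrable_dominated[OF _ _ _ le]) auto
        qed
        also have "... = ?b n" by (rule Bochner_Integration.integral_add[OF i2])
        finally show "norm (LINT x|P. abs (Vn i \<xi> n x - cc * VV i \<xi> x)) <= ?b n" by simp
      qed
    qed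
  qed (unfold_locales, measurable)
qed

end

section \<open>Bounds for the forms\<close>

context mh_rate begin

section \<open>The forms as integrals over positions and noise\<close>

lemma proposal_eq: "proposal \<tau> n x w = pr (st n) n x w"
  by (simp add: proposal_def pr_def st_def)

lemma accept_eq: "accept_prob \<phi> \<tau> n x w = A n x w"
proof -
  have "(\<Prod>i<n. exp (\<phi> (proposal \<tau> n x w i))) / (\<Prod>i<n. exp (\<phi> (x i))) = (\<Prod>i<n. exp (D (st n) (x i) (w i)))"
    unfolding prod_dividef[symmetric] by (intro prod.cong) (auto simp: proposal_eq pr_def D_def exp_diff)
  then show ?thesis by (simp add: accept_prob_def A_def acc_def exp_sum)
qed

lemma inH_iff: "inH \<phi> h \<longleftrightarrow> h \<in> sqi P"
  by (auto simp: inH_def P_eq sqi_iff_nn_integral)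

definition dif :: "((nat => real) => real) => nat => (nat => real) \<times> (nat => real) => real" where
  "dif h n z = h (pr (st n) n (fst z) (snd z)) - h (fst z)"

lemma uniform_below: "0 <= a ==> a <= 1 ==> emeasure (uniform_measure lborel {0<..<1}) {..<a} = ennreal a" for a :: real
proof -
  assume a: "0 <= a" "a <= 1"
  have "{0<..<1} \<inter> {..<a} = {0<..<a}" using a by auto
  moreover have "emeasure lborel {0<..<1::real} = 1" "emeasure lborel {0<..<a} = ennreal a" using a by simp_all
  moreover have "ennreal a / 1 = ennreal a" using divide_ennreal[of a 1] a by simp
  ultimately have "emeasure lborel ({0<..<1} \<inter> {..<a}) / emeasure lborel {0<..<1::real} = ennreal a"
    by (simp only:)
  then show ?thesis by (subst emeasure_uniform_measure) (simp_all only: sets_lborel open_greaterThanLessThan open_lessThan borel_open)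
qed

text \<open>Integrating out the uniform variable replaces acceptance by its probability; after a
  rejection the increment is 0.\<close>

lemma Phi_n_eq:
  assumes h[measurable]: "h \<in> borel_measurable P"
  shows "Phi_n \<phi> \<tau> n h = ennreal (real n / 2) * (\<integral>\<^sup>+z. ennreal (A n (fst z) (snd z) * (dif h n z)^2) \<partial>PG)"
proof -
  let ?U = "uniform_measure lborel {0<..<1::real}"
  interpret U: prob_space ?U by (rule prob_space_uniform_measure) auto
  interpret GU: pair_sigma_finite \<Gamma> ?U by unfold_locales
  have sU[measurable_cong]: "sets ?U = sets borel" by simp
  have ss: "sample_space \<phi> = P \<Otimes>\<^sub>M (\<Gamma> \<Otimes>\<^sub>M ?U)"
    by (simp add: sample_space_def P_eq Gauss.Q_def)
  let ?g = "%\<omega>. indicator {z. snd (snd z) < A n (fst z) (fst (snd z))} \<omega> * ennreal ((dif h n (fst \<omega>, fst (snd \<omega>)))^2)"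
  have dm[measurable]: "dif h n \<in> borel_measurable PG" unfolding dif_def by measurable
  have gm: "?g \<in> borel_measurable (P \<Otimes>\<^sub>M (\<Gamma> \<Otimes>\<^sub>M ?U))"
    unfolding dif_def by measurable
  have "(\<integral>\<^sup>+\<omega>. ennreal ((h (mh_step \<phi> \<tau> n (fst \<omega>) (fst (snd \<omega>)) (snd (snd \<omega>))) - h (fst \<omega>))^2) \<partial>sample_space \<phi>)
    = (\<integral>\<^sup>+\<omega>. ?g \<omega> \<partial>(P \<Otimes>\<^sub>M (\<Gamma> \<Otimes>\<^sub>M ?U)))"
    unfolding ss by (intro nn_integral_cong) (auto simp: mh_step_def accept_eq proposal_eq dif_def indicator_def)
  also have "... = (\<integral>\<^sup>+x. \<integral>\<^sup>+wu. ?g (x, wu) \<partial>(\<Gamma> \<Otimes>\<^sub>M ?U) \<partial>P)"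
    by (rule GU.P.nn_integral_fst[symmetric]) (rule gm)
  also have "... = (\<integral>\<^sup>+x. \<integral>\<^sup>+w. \<integral>\<^sup>+u. ?g (x, (w, u)) \<partial>?U \<partial>\<Gamma> \<partial>P)"
    by (intro nn_integral_cong U.nn_integral_fst[symmetric] measurable_Pair2'[THEN measurable_compose, OF _ gm]) auto
  also have "... = (\<integral>\<^sup>+x. \<integral>\<^sup>+w. ennreal (A n x w * (dif h n (x, w))^2) \<partial>\<Gamma> \<partial>P)"
  proof (intro nn_integral_cong)
    fix x w
    have "(\<integral>\<^sup>+u. ?g (x, (w, u)) \<partial>?U) = (\<integral>\<^sup>+u. ennreal ((dif h n (x, w))^2) * indicator {..<A n x w} u \<partial>?U)"
      by (intro nn_integral_cong) (auto simp: indicator_def)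
    also have "... = ennreal ((dif h n (x, w))^2) * emeasure ?U {..<A n x w}"
      by (subst nn_integral_cmult_indicator) auto
    also have "... = ennreal (A n x w * (dif h n (x, w))^2)"
      by (subst uniform_below) (auto simp: A_bounds ennreal_mult mult.commute)
    finally show "(\<integral>\<^sup>+u. ?g (x, (w, u)) \<partial>?U) = ennreal (A n x w * (dif h n (x, w))^2)" .
  qed
  also have "... = (\<integral>\<^sup>+z. ennreal (A n (fst z) (snd z) * (dif h n z)^2) \<partial>PG)"
    by (subst Gauss.Q.nn_integral_fst[symmetric]) auto
  finally show ?thesis by (simp add: Phi_n_def)
qed

text \<open>Square integrability of h refers to the target law and says nothing directly about h at
  a proposal. Weighted by the acceptance probability, the square of h at the proposal is carried by
  reversal to the square of h at the start.\<close>

lemma A_dif_sq_int: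
  assumes h: "h \<in> sqi P"
  shows "integrable PG (%z. A n (fst z) (snd z) * (dif h n z)^2)"
proof -
  have [measurable]: "h \<in> borel_measurable P" using h by (rule sqi_meas)
  have i1: "integrable PG (%z. (h (fst z))^2)"
    using PG.integrable_times(1)[OF sqi_int[OF h], of "%w. 1"] by simp
  have i2: "integrable PG (%z. A n (fst z) (snd z) * (h (fst z))^2)"
  proof (rule integrable_dominated[OF i1])
    show "A n (fst z) (snd z) * (h (fst z))^2 <= (h (fst z))^2" for z
      using mult_right_mono[OF A_bounds(2), of "(h (fst z))^2"] by simp
  qed (auto simp: A_bounds)
  have i3: "integrable PG (%z. A n (fst z) (snd z) * (h (pr (st n) n (fst z) (snd z)))^2)"
    using reversal_integral(2)[of "%z. (h (fst z))^2" "st n" n] i2 by (simp add: A_def \<theta>_def split_beta')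
  show ?thesis
  proof (rule integrable_dominated)
    show "integrable PG (%z. 2 * (A n (fst z) (snd z) * (h (pr (st n) n (fst z) (snd z)))^2) + 2 * (A n (fst z) (snd z) * (h (fst z))^2))"
      using i2 i3 by simp
    show "A n (fst z) (snd z) * (dif h n z)^2 <= 2 * (A n (fst z) (snd z) * (h (pr (st n) n (fst z) (snd z)))^2) + 2 * (A n (fst z) (snd z) * (h (fst z))^2)" for z
    proof -
      have "(a - b)^2 <= 2 * a\<^sup>2 + 2 * b\<^sup>2" for a b :: real
        using zero_le_power2[of "a + b"] by (simp add: power2_sum power2_diff)
      from mult_left_mono[OF this A_bounds(1)] show ?thesis by (simp add: dif_def distrib_left mult.left_commute)
    qed
    show "(%z. A n (fst z) (snd z) * (dif h n z)^2) \<in> borel_measurable PG" unfolding dif_def by measurable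
  qed (auto simp: A_bounds)
qed

lemma Phi_n_real:
  assumes h: "h \<in> sqi P"
  shows "Phi_n \<phi> \<tau> n h = ennreal (real n / 2 * (LINT z|PG. A n (fst z) (snd z) * (dif h n z)^2))"
proof -
  have "(\<integral>\<^sup>+z. ennreal (A n (fst z) (snd z) * (dif h n z)^2) \<partial>PG) = ennreal (LINT z|PG. A n (fst z) (snd z) * (dif h n z)^2)"
    by (rule nn_integral_eq_integral[OF A_dif_sq_int[OF h]]) (auto simp: A_bounds)
  then have "Phi_n \<phi> \<tau> n h = ennreal (real n / 2) * ennreal (LINT z|PG. A n (fst z) (snd z) * (dif h n z)^2)"
    by (simp only: Phi_n_eq[OF sqi_meas[OF h]])
  also have "... = ennreal (real n / 2 * (LINT z|PG. A n (fst z) (snd z) * (dif h n z)^2))"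
    by (rule ennreal_mult[symmetric]) (auto intro!: Bochner_Integration.integral_nonneg simp: A_bounds)
  finally show ?thesis .
qed

lemma C1b_meas2: "testf i \<xi> ==> \<xi> \<in> borel_measurable P" "testf i \<xi> ==> \<exists>C. \<forall>x. abs (\<xi> x) <= C"
  unfolding testf_iff using C1b_meas(1) by (blast, auto simp: C1b_def)

lemma testf_sqi: "testf i \<xi> ==> \<xi> \<in> sqi P"
  using C1b_meas2[of i \<xi>] T.Q.sqi_bounded by blast

text \<open>The Cauchy--Schwarz step: testing \<open>h (Y) - h (X)\<close> against \<open>\<tau> \<Sum>\<^sub>i \<xi>\<^sub>i(X) W\<^sub>i\<close>
  and moving the difference onto the test field by reversibility.\<close>

lemma Phi_n_lower:
  fixes \<xi> :: "nat => (nat => real) => real"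
  assumes h: "h \<in> sqi P" and t: "!!i. i < M ==> testf i (\<xi> i)" and n: "n \<ge> 1" "M <= n"
  shows "\<tau>\<^sup>2 * (- (\<Sum>i<M. \<integral>x. h x * Vn i (\<xi> i) n x \<partial>P) - (1/2) * (LINT z|PG. A n (fst z) (snd z) * (\<Sum>i<M. \<xi> i (fst z) * snd z i)^2))
    <= real n / 2 * (LINT z|PG. A n (fst z) (snd z) * (dif h n z)^2)"
proof -
  have hm[measurable]: "h \<in> borel_measurable P" using h by (rule sqi_meas)
  define s where "s = st n"
  have s: "0 < s" unfolding s_def by (rule st_pos[OF n(1)])
  let ?A = "%z. A n (fst z) (snd z)" and ?Y = "%z. pr s n (fst z) (snd z)"
  let ?p = "%i z. \<xi> i (fst z) * snd z i"
  let ?\<psi> = "%z. \<Sum>i<M. ?p i z"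
  have xm: "\<xi> i \<in> borel_measurable P" if "i < M" for i using C1b_meas2(1)[OF t[OF that]] .
  have xb: "\<exists>C. \<forall>x. abs (\<xi> i x) <= C" if "i < M" for i using C1b_meas2(2)[OF t[OF that]] .
  have h1: "integrable P h" by (rule T.Q.sqi_integrable[OF h])
  have hw: "integrable PG (%z. h (fst z) * snd z i)" for i
    using PG.integrable_times(1)[OF h1, of "%w. w i"] allmom_int[OF allmom_coord] by simp
  have bnd: "integrable PG (%z. g z * (h (fst z) * snd z i))" if [measurable]: "g \<in> borel_measurable PG" and b: "!!z. abs (g z) <= C" for g C i
  proof (rule Bochner_Integration.integrable_bound)
    show "integrable PG (%z. C * abs (h (fst z) * snd z i))" using hw by simp
    have "abs (g z) <= abs C" for z using b[of z] by linarith
    then show "AE z in PG. norm (g z * (h (fst z) * snd z i)) <= norm (C * abs (h (fst z) * snd z i))"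
      by (intro AE_I2) (simp add: abs_mult mult_right_mono)
  qed measurable
  have i1: "integrable PG (%z. (?A z * \<xi> i (fst z)) * (h (fst z) * snd z i))"
   and i2: "integrable PG (%z. (?A z * \<xi> i (?Y z)) * (h (fst z) * snd z i))" if i: "i < M" for i
  proof -
    note [measurable] = xm[OF i]
    obtain C where C: "!!x. abs (\<xi> i x) <= C" using xb[OF i] by auto
    have b: "abs (?A z * \<xi> i y) <= 1 * C" for z y unfolding abs_mult by (intro mult_mono A_bounds C) auto
    show "integrable PG (%z. (?A z * \<xi> i (fst z)) * (h (fst z) * snd z i))" by (rule bnd[OF _ b]) measurable
    show "integrable PG (%z. (?A z * \<xi> i (?Y z)) * (h (fst z) * snd z i))" by (rule bnd[OF _ b]) measurable
  qed
  have psi_m[measurable]: "?\<psi> \<in> borel_measurable PG" by (intro borel_measurable_sum) (use xm in measurable)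
  have Yth: "fst (\<theta> s n z) = ?Y z" "i < n ==> snd (\<theta> s n z) i = - snd z i" for z i
    by (simp_all add: \<theta>_def split_beta' flip_def)
  have psith: "?\<psi> (\<theta> s n z) = - (\<Sum>i<M. \<xi> i (?Y z) * snd z i)" for z
    using n(2) by (simp add: Yth sum_negf[symmetric])
  have a1: "integrable PG (%z. ?A z * (h (fst z) * ?\<psi> z))"
  proof -
    have "(%z. ?A z * (h (fst z) * ?\<psi> z)) = (%z. \<Sum>i<M. (?A z * \<xi> i (fst z)) * (h (fst z) * snd z i))"
      by (simp add: sum_distrib_left mult_ac)
    then show ?thesis by (simp only:) (intro Bochner_Integration.integrable_sum i1, simp)
  qed
  have e2: "?A z * (h (fst z) * ?\<psi> (\<theta> s n z)) = - (\<Sum>i<M. (?A z * \<xi> i (?Y z)) * (h (fst z) * snd z i))" for z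
    unfolding psith by (simp add: sum_distrib_left mult_ac)
  have a2: "integrable PG (%z. ?A z * (h (fst z) * ?\<psi> (\<theta> s n z)))"
    unfolding e2 by (intro Bochner_Integration.integrable_minus Bochner_Integration.integrable_sum i2) simp
  let ?G = "%z. h (fst z) * ?\<psi> (\<theta> s n z)"
  have Gm: "?G \<in> borel_measurable PG"
    using measurable_compose[OF theta_meas psi_m] by measurable
  have a3: "integrable PG (%z. ?A z * (h (?Y z) * ?\<psi> z))"
    using reversal_integral(2)[OF Gm, of s n] a2 by (simp add: A_def s_def theta_invol Yth[unfolded s_def])
  have rev: "(LINT z|PG. ?A z * (h (?Y z) * ?\<psi> z)) = (LINT z|PG. ?A z * (h (fst z) * ?\<psi> (\<theta> s n z)))"
    using reversal_integral(1)[OF Gm, of s n] by (simp add: A_def s_def theta_invol Yth[unfolded s_def])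
  \<comment> \<open>Reversal changes the sign of the noise, so the two terms of the difference add
    up instead of cancelling; the factor s undoes the division in \<open>Vn\<close>.\<close>
  have cross: "(LINT z|PG. ?A z * (dif h n z * ?\<psi> z)) = - s * (\<Sum>i<M. \<integral>x. h x * Vn i (\<xi> i) n x \<partial>P)"
  proof -
    have "(LINT z|PG. ?A z * (dif h n z * ?\<psi> z)) = (LINT z|PG. ?A z * (h (?Y z) * ?\<psi> z) - ?A z * (h (fst z) * ?\<psi> z))"
      by (intro Bochner_Integration.integral_cong refl) (simp add: dif_def s_def algebra_simps)
    also have "... = (LINT z|PG. ?A z * (h (fst z) * ?\<psi> (\<theta> s n z))) - (LINT z|PG. ?A z * (h (fst z) * ?\<psi> z))"
      using a1 a3 by (simp add: rev)
    also have "... = (LINT z|PG. ?A z * (h (fst z) * ?\<psi> (\<theta> s n z)) - ?A z * (h (fst z) * ?\<psi> z))"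
      using a1 a2 by simp
    also have "... = (LINT z|PG. (\<Sum>i<M. - ((?A z * \<xi> i (?Y z)) * (h (fst z) * snd z i) + (?A z * \<xi> i (fst z)) * (h (fst z) * snd z i))))"
      unfolding e2 by (intro Bochner_Integration.integral_cong refl)
        (simp add: sum_negf[symmetric] sum_subtractf[symmetric] sum_distrib_left mult_ac)
    also have "... = (\<Sum>i<M. \<integral>z. - ((?A z * \<xi> i (?Y z)) * (h (fst z) * snd z i) + (?A z * \<xi> i (fst z)) * (h (fst z) * snd z i)) \<partial>PG)"
      by (intro Bochner_Integration.integral_sum Bochner_Integration.integrable_minus Bochner_Integration.integrable_add i1 i2) auto
    also have "... = (\<Sum>i<M. - s * (LINT x|P. h x * Vn i (\<xi> i) n x))"
    proof (rule sum.cong[OF refl])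
      fix i assume "i \<in> {..<M}" then have i: "i < M" by simp
      let ?f = "%z. - ((?A z * \<xi> i (?Y z)) * (h (fst z) * snd z i) + (?A z * \<xi> i (fst z)) * (h (fst z) * snd z i))"
      have fi: "integrable PG ?f" using i1[OF i] i2[OF i] by simp
      have "(LINT z|PG. ?f z) = (LINT x|P. \<integral>w. ?f (x, w) \<partial>\<Gamma>)" by (rule PG.integral_fst'[OF fi, symmetric])
      also have "... = (LINT x|P. - s * (h x * Vn i (\<xi> i) n x))"
      proof (rule Bochner_Integration.integral_cong[OF refl])
        fix x
        have "(LINT w|\<Gamma>. ?f (x, w)) = (LINT w|\<Gamma>. (- s * h x) * (A n x w * ((\<xi> i (pr (st n) n x w) + \<xi> i x) / st n * w i)))"
          using s by (intro Bochner_Integration.integral_cong refl) (simp add: s_def[symmetric] field_simps)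
        then show "(LINT w|\<Gamma>. ?f (x, w)) = - s * (h x * Vn i (\<xi> i) n x)" by (simp add: Vn_def)
      qed
      finally show "(LINT z|PG. ?f z) = - s * (LINT x|P. h x * Vn i (\<xi> i) n x)" by simp
    qed
    finally show ?thesis by (simp add: sum_distrib_left)
  qed
  have b1: "integrable PG (%z. ?A z * (dif h n z)^2)" by (rule A_dif_sq_int[OF h])
  have b2: "integrable PG (%z. ?A z * (?\<psi> z)^2)"
  proof -
    have "integrable PG (%z. (?A z * (\<xi> i (fst z) * \<xi> j (fst z))) * (snd z i * snd z j))" if i: "i < M" and j: "j < M" for i j
    proof -
      note [measurable] = xm[OF i] xm[OF j]
      obtain C where C: "!!x. abs (\<xi> i x) <= C" using xb[OF i] by auto
      obtain C' where C': "!!x. abs (\<xi> j x) <= C'" using xb[OF j] by auto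
      have C0: "0 <= C" using order.trans[OF abs_ge_zero C[of undefined]] .
      show ?thesis
      proof (rule PG_bounded_allmom[where F="%w. w i * w j" and C="1 * (C * C')"])
        show "abs (?A z * (\<xi> i (fst z) * \<xi> j (fst z))) <= 1 * (C * C')" for z
          unfolding abs_mult using C0 by (intro mult_mono A_bounds C C') auto
      qed (auto intro!: allmom_intros)
    qed
    then have "integrable PG (%z. \<Sum>i<M. \<Sum>j<M. (?A z * (\<xi> i (fst z) * \<xi> j (fst z))) * (snd z i * snd z j))"
      by (intro Bochner_Integration.integrable_sum) auto
    moreover have "(%z. \<Sum>i<M. \<Sum>j<M. (?A z * (\<xi> i (fst z) * \<xi> j (fst z))) * (snd z i * snd z j)) = (%z. ?A z * (?\<psi> z)^2)"
      by (simp add: power2_eq_square sum_product sum_distrib_left mult_ac)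
    ultimately show ?thesis by simp
  qed
  have b3: "integrable PG (%z. ?A z * (dif h n z * ?\<psi> z))"
  proof -
    have "(%z. ?A z * (dif h n z * ?\<psi> z)) = (%z. ?A z * (h (?Y z) * ?\<psi> z) - ?A z * (h (fst z) * ?\<psi> z))"
      by (simp add: dif_def s_def algebra_simps)
    then show ?thesis using a1 a3 by simp
  qed
  \<comment> \<open>Nonnegativity of \<open>(dif h n z / s - ?\<psi> z)\<^sup>2\<close> with weight
    A, where n is rewritten as \<open>\<tau>\<^sup>2 / s\<^sup>2\<close>.\<close>
  have pt: "\<tau>\<^sup>2 / s * (?A z * (dif h n z * ?\<psi> z)) - \<tau>\<^sup>2 / 2 * (?A z * (?\<psi> z)^2) <= real n / 2 * (?A z * (dif h n z)^2)" for z
  proof -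
    have ns: "real n = \<tau>\<^sup>2 / s\<^sup>2" using st_sq[OF n(1)] s by (simp add: s_def field_simps)
    have "0 <= ?A z * (\<tau>\<^sup>2 / 2 * (dif h n z / s - ?\<psi> z)^2)" by (intro mult_nonneg_nonneg) (auto simp: A_bounds)
    also have "... = \<tau>\<^sup>2 / s\<^sup>2 / 2 * (?A z * (dif h n z)^2) - \<tau>\<^sup>2 / s * (?A z * (dif h n z * ?\<psi> z)) + \<tau>\<^sup>2 / 2 * (?A z * (?\<psi> z)^2)"
    proof -
      have "a * (t / 2 * (D / s - p)^2) = t / s\<^sup>2 / 2 * (a * D\<^sup>2) - t / s * (a * (D * p)) + t / 2 * (a * p\<^sup>2)" for a t D p
        using s by (simp add: power2_diff power_divide field_simps power2_eq_square)
      then show ?thesis .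
    qed
    finally show ?thesis unfolding ns by linarith
  qed
  have "(LINT z|PG. \<tau>\<^sup>2 / s * (?A z * (dif h n z * ?\<psi> z)) - \<tau>\<^sup>2 / 2 * (?A z * (?\<psi> z)^2)) <= (LINT z|PG. real n / 2 * (?A z * (dif h n z)^2))"
    by (intro integral_mono pt Bochner_Integration.integrable_diff integrable_mult_right b1 b2 b3)
  moreover have "(LINT z|PG. \<tau>\<^sup>2 / s * (?A z * (dif h n z * ?\<psi> z)) - \<tau>\<^sup>2 / 2 * (?A z * (?\<psi> z)^2))
    = \<tau>\<^sup>2 / s * (- s * (\<Sum>i<M. \<integral>x. h x * Vn i (\<xi> i) n x \<partial>P)) - \<tau>\<^sup>2 / 2 * (LINT z|PG. ?A z * (?\<psi> z)^2)"
    using b2 b3 by (simp add: cross)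
  moreover have "... = \<tau>\<^sup>2 * (- (\<Sum>i<M. \<integral>x. h x * Vn i (\<xi> i) n x \<partial>P) - (1/2) * (LINT z|PG. ?A z * (?\<psi> z)^2))"
    using s by (simp add: right_diff_distrib)
  ultimately show ?thesis by simp
qed

text \<open>The fields \<open>Vn\<close> converge in norm and \<open>hs\<close> converges weakly;
  the pairings converge because a weakly convergent sequence is bounded in norm.\<close>

lemma M1_lower:
  fixes \<xi> :: "nat => (nat => real) => real"
  assumes hs: "!!n. hs n \<in> sqi P" and h: "h \<in> sqi P" and wc: "weak_conv \<phi> hs h"
    and t: "!!i. i < M ==> testf i (\<xi> i)"
  shows "ennreal (\<tau>\<^sup>2 * cc * (- (\<Sum>i<M. \<integral>x. h x * VV i (\<xi> i) x \<partial>P) - (1/2) * (\<Sum>i<M. \<integral>x. (\<xi> i x)^2 \<partial>P)))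
    <= liminf (%n. Phi_n \<phi> \<tau> n (hs n))"
proof -
  have wl: "(%n. \<integral>x. hs n x * g x \<partial>P) \<longlonglongrightarrow> (LINT x|P. h x * g x)" if "g \<in> sqi P" for g
    using wc that by (simp add: weak_conv_def inH_iff P_eq)
  obtain B where B: "!!n. l2 P (hs n) <= B"
  proof -
    have "\<exists>B. \<forall>n. l2 P (hs n) <= B"
    proof (rule l2_uniform_boundedness[OF hs])
      show "Bseq (%n. \<integral>x. hs n x * g x \<partial>P)" if "g \<in> sqi P" for g
        using wl[OF that] by (intro convergent_imp_Bseq convergentI)
    qed
    then show ?thesis using that by blast
  qed
  have lim: "(%n. \<integral>x. hs n x * Vn i (\<xi> i) n x \<partial>P) \<longlonglongrightarrow> cc * (LINT x|P. h x * VV i (\<xi> i) x)" if i: "i < M" for i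
  proof -
    have V: "VV i (\<xi> i) \<in> sqi P" by (rule VV_sqi[OF t[OF i]])
    obtain n0 where n0: "!!n. n \<ge> n0 ==> Vn i (\<xi> i) n \<in> sqi P" using Vn_conv(2)[OF t[OF i]] by auto
    have cV: "(%x. cc * VV i (\<xi> i) x) \<in> sqi P" by (rule sqi_scale[OF V])
    have "(%n. (LINT x|P. hs n x * Vn i (\<xi> i) n x) - cc * (LINT x|P. hs n x * VV i (\<xi> i) x)) \<longlonglongrightarrow> 0"
    proof (rule Lim_null_comparison)
      show "(%n. B * l2 P (%x. Vn i (\<xi> i) n x - cc * VV i (\<xi> i) x)) \<longlonglongrightarrow> 0"
        using tendsto_mult[OF tendsto_const Vn_conv(1)[OF t[OF i]], of B] by simp
      show "\<forall>\<^sub>F n in sequentially. norm ((LINT x|P. hs n x * Vn i (\<xi> i) n x) - cc * (LINT x|P. hs n x * VV i (\<xi> i) x)) <= B * l2 P (%x. Vn i (\<xi> i) n x - cc * VV i (\<xi> i) x)"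
      proof (rule eventually_sequentiallyI[of n0])
        fix n assume n: "n0 <= n"
        have eq: "(LINT x|P. hs n x * Vn i (\<xi> i) n x) - cc * (LINT x|P. hs n x * VV i (\<xi> i) x) = (LINT x|P. hs n x * (Vn i (\<xi> i) n x - cc * VV i (\<xi> i) x))"
          using sqi_mult_integrable[OF hs n0[OF n], of n] sqi_mult_integrable[OF hs V, of n]
          by (simp add: right_diff_distrib mult.left_commute[of _ cc])
        have "abs (\<integral>x. hs n x * (Vn i (\<xi> i) n x - cc * VV i (\<xi> i) x) \<partial>P) <= l2 P (hs n) * l2 P (%x. Vn i (\<xi> i) n x - cc * VV i (\<xi> i) x)"
          by (rule l2_Cauchy_Schwarz[OF hs sqi_diff[OF n0[OF n] cV]])
        also have "... <= B * l2 P (%x. Vn i (\<xi> i) n x - cc * VV i (\<xi> i) x)" by (intro mult_right_mono B) simp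
        finally show "norm ((LINT x|P. hs n x * Vn i (\<xi> i) n x) - cc * (LINT x|P. hs n x * VV i (\<xi> i) x)) <= B * l2 P (%x. Vn i (\<xi> i) n x - cc * VV i (\<xi> i) x)"
          unfolding eq by simp
      qed
    qed
    from tendsto_add[OF this tendsto_mult[OF tendsto_const wl[OF V], of cc]] show ?thesis by simp
  qed
  \<comment> \<open>Extension by 0 beyond M, since \<open>quad_lim\<close> asks for one bound valid
    for all indices.\<close>
  define \<xi>' where "\<xi>' i = (if i < M then \<xi> i else (%x. 0))" for i
  have xm: "\<xi>' i \<in> borel_measurable P" for i using C1b_meas2(1)[OF t] by (simp add: \<xi>'_def)
  have "\<exists>C. \<forall>k x. abs (\<xi>' k x) <= C"
  proof -
    have "\<forall>i. \<exists>C. i < M --> (\<forall>x. abs (\<xi> i x) <= C)" using C1b_meas2(2)[OF t] by blast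
    then obtain C where C: "!!i x. i < M ==> abs (\<xi> i x) <= C i" by metis
    have "abs (\<xi>' k x) <= (\<Sum>i<M. abs (C i))" for k x
    proof (cases "k < M")
      case True
      have "abs (\<xi> k x) <= abs (C k)" using C[OF True, of x] by linarith
      also have "... <= (\<Sum>i<M. abs (C i))" using True by (intro member_le_sum) auto
      finally show ?thesis using True by (simp add: \<xi>'_def)
    qed (simp add: \<xi>'_def sum_nonneg)
    then show ?thesis by blast
  qed
  then obtain C where C: "!!k x. abs (\<xi>' k x) <= C" by blast
  have sw: "(\<Sum>k<M. \<xi>' k (fst z) * snd z k) = (\<Sum>k<M. \<xi> k (fst z) * snd z k)" "(\<Sum>k<M. \<integral>x. (\<xi>' k x)^2 \<partial>P) = (\<Sum>k<M. \<integral>x. (\<xi> k x)^2 \<partial>P)" for z :: "(nat => real) \<times> (nat => real)"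
    by (auto simp: \<xi>'_def)
  let ?low = "%n. \<tau>\<^sup>2 * (- (\<Sum>i<M. \<integral>x. hs n x * Vn i (\<xi> i) n x \<partial>P) - (1/2) * (LINT z|PG. A n (fst z) (snd z) * (\<Sum>i<M. \<xi> i (fst z) * snd z i)^2))"
  have "?low \<longlonglongrightarrow> \<tau>\<^sup>2 * (- (\<Sum>i<M. cc * (LINT x|P. h x * VV i (\<xi> i) x)) - (1/2) * (cc * (\<Sum>k<M. \<integral>x. (\<xi> k x)^2 \<partial>P)))"
    using quad_lim[where N=M and \<xi>=\<xi>', OF xm C] unfolding sw
    by (intro tendsto_mult tendsto_const tendsto_diff tendsto_minus tendsto_sum lim) auto
  moreover have "\<tau>\<^sup>2 * (- (\<Sum>i<M. cc * (LINT x|P. h x * VV i (\<xi> i) x)) - (1/2) * (cc * (\<Sum>k<M. \<integral>x. (\<xi> k x)^2 \<partial>P)))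
    = \<tau>\<^sup>2 * cc * (- (\<Sum>i<M. \<integral>x. h x * VV i (\<xi> i) x \<partial>P) - (1/2) * (\<Sum>i<M. \<integral>x. (\<xi> i x)^2 \<partial>P))" (is "_ = ?L")
    by (simp add: sum_distrib_left[symmetric] right_diff_distrib)
  ultimately have "(%n. ennreal (?low n)) \<longlonglongrightarrow> ennreal ?L" by (intro tendsto_ennrealI) (simp only:)
  then have "ennreal ?L = liminf (%n. ennreal (?low n))" by (intro lim_imp_Liminf[symmetric]) auto
  also have "... <= liminf (%n. Phi_n \<phi> \<tau> n (hs n))"
  proof (rule Liminf_mono, rule eventually_sequentiallyI[of "max 1 M"])
    fix n assume "max 1 M <= n"
    then show "ennreal (?low n) <= Phi_n \<phi> \<tau> n (hs n)"
      unfolding Phi_n_real[OF hs] by (intro ennreal_leI Phi_n_lower hs t) auto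
  qed
  finally show ?thesis .
qed

text \<open>The squared difference quotient converges in L1 of the joint law to the square of a
  linear form in w. As the acceptance probability is at most 1, the quotient may be replaced by that
  form, which \<open>quad_lim\<close> evaluates.\<close>

lemma Phi_n_smooth_lim:
  assumes c: "C1b u N C"
  shows "(%n. Phi_n \<phi> \<tau> n u) \<longlonglongrightarrow> ennreal (\<tau>\<^sup>2 / 2 * cc * (\<Sum>k<N. \<integral>x. (partial k u x)^2 \<partial>P))"
proof -
  note [measurable] = C1b_meas[OF c] Qn_raw[OF c]
  have pC: "abs (partial k u x) <= C" for k x using c by (simp add: C1b_def)
  have uS: "u \<in> sqi P" by (rule T.Q.sqi_bounded[where C=C]) (use c in \<open>auto simp: C1b_def\<close>)
  let ?L = "%z. \<Sum>k<N. partial k u (fst z) * snd z k" and ?Q = "%n z. Qn u n (fst z) (snd z)" and ?A = "%n z. A n (fst z) (snd z)"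
  let ?E = "%w :: nat => real. C * (\<Sum>k<N. abs (w k))"
  have C0: "0 <= C" by (rule C1b_C0[OF c])
  have Ea: "allmom \<Gamma> (%w. (?E w)^2)" unfolding power2_eq_square by (intro allmom_intros)
  have Ei: "integrable PG (%z. (?E (snd z))^2)"
    using PG_bounded_allmom[OF Ea, of "%z. 1" 1] by simp
  have Lb: "abs (?L z) <= ?E (snd z)" for z
  proof -
    have "abs (?L z) <= (\<Sum>k<N. abs (partial k u (fst z) * snd z k))" by (rule sum_abs)
    also have "... <= (\<Sum>k<N. C * abs (snd z k))" by (intro sum_mono) (simp add: abs_mult mult_right_mono pC)
    finally show ?thesis by (simp add: sum_distrib_left)
  qed
  have Lsq: "(?L z)^2 <= (?E (snd z))^2" for z using power_mono[OF Lb[of z], of 2] by simp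
  let ?m = "max 1 N"
  have Qsq: "(?Q n z)^2 <= (?E (snd z))^2" if "n \<ge> ?m" for n z
    using power_mono[OF Qn_bound[OF c, of n "fst z" "snd z"], of 2] that by simp
  have Lm: "?L \<in> borel_measurable PG" by measurable
  have l0: "(%n. \<integral>z. abs ((?Q (n + ?m) z)^2 - (?L z)\<^sup>2) \<partial>PG) \<longlonglongrightarrow> (LINT z|PG. 0)"
  proof (rule integral_dominated_convergence[where w="%z. 2 * (?E (snd z))^2"])
    show "AE z in PG. (%n. abs ((?Q (n + ?m) z)^2 - (?L z)\<^sup>2)) \<longlonglongrightarrow> 0"
    proof (rule AE_I2)
      fix z :: "(nat => real) \<times> (nat => real)"
      have "(%n. ?Q (n + ?m) z) \<longlonglongrightarrow> ?L z"
        using LIMSEQ_ignore_initial_segment[OF Qn_lim[OF c, of "fst z" "snd z"], of ?m] by (simp add: mult.commute)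
      from tendsto_diff[OF tendsto_power[OF this, of 2] tendsto_const[of "(?L z)^2"]]
      show "(%n. abs ((?Q (n + ?m) z)^2 - (?L z)\<^sup>2)) \<longlonglongrightarrow> 0"
        by (intro tendsto_rabs_zero) simp
    qed
    show "AE z in PG. norm (abs ((?Q (n + ?m) z)^2 - (?L z)\<^sup>2)) <= 2 * (?E (snd z))^2" for n
    proof (rule AE_I2)
      fix z :: "(nat => real) \<times> (nat => real)"
      have "0 <= (?Q (n + ?m) z)^2" "0 <= (?L z)^2" by auto
      then show "norm (abs ((?Q (n + ?m) z)^2 - (?L z)\<^sup>2)) <= 2 * (?E (snd z))^2"
        using Lsq[of z] Qsq[of "n + ?m" z] by (simp only: real_norm_def) linarith
    qed
    show "integrable PG (%z. 2 * (?E (snd z))^2)" using Ei by (rule integrable_mult_right)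
  qed measurable
  have l1: "(%n. \<integral>z. abs ((?Q n z)^2 - (?L z)\<^sup>2) \<partial>PG) \<longlonglongrightarrow> 0"
    by (rule LIMSEQ_offset[where f="%n. \<integral>z. abs ((?Q n z)^2 - (?L z)\<^sup>2) \<partial>PG" and k="?m"])
       (rule l0[unfolded Bochner_Integration.integral_zero])
  have iL: "integrable PG (%z. ?A n z * (?L z)^2)" for n
  proof (rule integrable_dominated[OF Ei])
    show "?A n z * (?L z)^2 <= (?E (snd z))^2" for z
      using mult_mono[OF A_bounds(2)[of n "fst z" "snd z"] Lsq[of z]] by simp
  qed (auto simp: A_bounds)
  have iQ: "integrable PG (%z. ?A n z * (?Q n z)^2)" "integrable PG (%z. abs ((?Q n z)^2 - (?L z)\<^sup>2))" if n: "n \<ge> ?m" for n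
  proof -
    show "integrable PG (%z. ?A n z * (?Q n z)^2)"
    proof (rule integrable_dominated[OF Ei])
      show "?A n z * (?Q n z)^2 <= (?E (snd z))^2" for z
        using mult_mono[OF A_bounds(2)[of n "fst z" "snd z"] Qsq[OF n, of z]] by simp
    qed (auto simp: A_bounds)
    have "integrable PG (%z. (?Q n z)^2)" "integrable PG (%z. (?L z)^2)"
      by (rule integrable_dominated[OF Ei _ _ Qsq[OF n]]; measurable) (rule integrable_dominated[OF Ei _ _ Lsq]; measurable)
    then show "integrable PG (%z. abs ((?Q n z)^2 - (?L z)\<^sup>2))" by simp
  qed
  have ql: "(%n. \<integral>z. ?A n z * (?L z)^2 \<partial>PG) \<longlonglongrightarrow> cc * (\<Sum>k<N. \<integral>x. (partial k u x)^2 \<partial>P)"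
    by (rule quad_lim[where C=C]) (use pC in auto)
  have dl: "(%n. (LINT z|PG. ?A n z * (?Q n z)^2) - (LINT z|PG. ?A n z * (?L z)^2)) \<longlonglongrightarrow> 0"
  proof (rule Lim_null_comparison[OF _ l1], rule eventually_sequentiallyI[of ?m])
    fix n assume n: "?m <= n"
    have eq: "(LINT z|PG. ?A n z * (?Q n z)^2) - (LINT z|PG. ?A n z * (?L z)^2) = (LINT z|PG. ?A n z * (?Q n z)^2 - ?A n z * (?L z)^2)"
      by (rule Bochner_Integration.integral_diff[symmetric, OF iQ(1)[OF n] iL])
    have "abs (\<integral>z. ?A n z * (?Q n z)^2 - ?A n z * (?L z)^2 \<partial>PG) <= (LINT z|PG. abs (?A n z * (?Q n z)^2 - ?A n z * (?L z)^2))" by (rule integral_abs_bound)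
    also have "... <= (LINT z|PG. abs ((?Q n z)^2 - (?L z)\<^sup>2))"
    proof (rule integral_mono)
      show "integrable PG (%z. abs (?A n z * (?Q n z)^2 - ?A n z * (?L z)^2))"
        by (intro integrable_abs Bochner_Integration.integrable_diff iQ(1)[OF n] iL)
      show "abs (?A n z * (?Q n z)^2 - ?A n z * (?L z)^2) <= abs ((?Q n z)^2 - (?L z)\<^sup>2)" for z
        unfolding right_diff_distrib[symmetric] abs_mult using mult_right_mono[OF A_bounds(3), of "abs ((?Q n z)^2 - (?L z)\<^sup>2)"] by simp
    qed (rule iQ(2)[OF n])
    finally show "norm ((LINT z|PG. ?A n z * (?Q n z)^2) - (LINT z|PG. ?A n z * (?L z)^2)) <= (LINT z|PG. abs ((?Q n z)^2 - (?L z)\<^sup>2))"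
      unfolding eq by simp
  qed
  have "(%n. \<tau>\<^sup>2 / 2 * (LINT z|PG. ?A n z * (?Q n z)^2)) \<longlonglongrightarrow> \<tau>\<^sup>2 / 2 * (cc * (\<Sum>k<N. \<integral>x. (partial k u x)^2 \<partial>P))"
    using tendsto_add[OF dl ql] by (intro tendsto_mult tendsto_const) simp
  then have "(%n. ennreal (\<tau>\<^sup>2 / 2 * (LINT z|PG. ?A n z * (?Q n z)^2))) \<longlonglongrightarrow> ennreal (\<tau>\<^sup>2 / 2 * cc * (\<Sum>k<N. \<integral>x. (partial k u x)^2 \<partial>P))"
    by (intro tendsto_ennrealI) (simp add: mult.assoc)
  then show ?thesis
  proof (rule Lim_transform_eventually)
    show "\<forall>\<^sub>F n in sequentially. ennreal (\<tau>\<^sup>2 / 2 * (LINT z|PG. ?A n z * (?Q n z)^2)) = Phi_n \<phi> \<tau> n u"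
    proof (rule eventually_sequentiallyI[of 1])
      fix n :: nat assume n: "1 <= n"
      have "real n / 2 * (LINT z|PG. ?A n z * (dif u n z)^2) = (LINT z|PG. real n / 2 * (?A n z * (dif u n z)^2))" by simp
      also have "... = (LINT z|PG. \<tau>\<^sup>2 / 2 * (?A n z * (?Q n z)^2))"
      proof (rule Bochner_Integration.integral_cong[OF refl])
        fix z
        have "dif u n z = st n * ?Q n z" using st_pos[OF n] by (simp add: dif_def Qn_def)
        then show "real n / 2 * (?A n z * (dif u n z)^2) = \<tau>\<^sup>2 / 2 * (?A n z * (?Q n z)^2)"
          unfolding st_sq[OF n, symmetric] by (simp add: power_mult_distrib)
      qed
      also have "... = \<tau>\<^sup>2 / 2 * (LINT z|PG. ?A n z * (?Q n z)^2)" by simp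
      finally show "ennreal (\<tau>\<^sup>2 / 2 * (LINT z|PG. ?A n z * (?Q n z)^2)) = Phi_n \<phi> \<tau> n u"
        unfolding Phi_n_real[OF uS] by simp
    qed
  qed
qed

end

section \<open>Bump functions, cylinder functions and the Schur test\<close>

text \<open>The two exponents make the linear span closed under differentiation.\<close>

definition bump0 :: "nat => nat => real => real" where
  "bump0 a b x = (if abs x < 1 then x ^ a * (1 / (1 - x\<^sup>2)) ^ b * exp (- (1 / (1 - x\<^sup>2))) else 0)"

inductive_set bumps :: "(real => real) set" where
  base: "bump0 a b \<in> bumps"
| lin: "u \<in> bumps ==> v \<in> bumps ==> (%x. c * u x + e * v x) \<in> bumps"

lemma power_exp_bound: "0 <= s ==> s ^ n * exp (- s) <= fact n" for s :: real
proof -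
  assume s: "0 <= s"
  have "s ^ n /\<^sub>R fact n = (\<Sum>k\<in>{n}. s ^ k /\<^sub>R fact k)" by simp
  also have "... <= (\<Sum>k. s ^ k /\<^sub>R fact k)"
    by (rule sum_le_suminf[OF summable_exp_generic]) (use s in auto)
  also have "... = exp s" by (simp add: exp_def)
  finally have "s ^ n <= fact n * exp s" by (simp add: field_simps)
  then show ?thesis by (simp add: exp_minus field_simps)
qed

lemma abs_lt1_sq: "abs x < 1 ==> 0 < 1 - x\<^sup>2" for x :: real
  by (simp add: abs_square_less_1)

text \<open>With s = 1/(1 - x^2), a power of s times exp(-s) is at most a factorial; two spare
  powers of s yield the quadratic vanishing at the end points.\<close>

lemma bump0_bound: "abs (bump0 a b x) <= fact (b + 2) * (1 - x\<^sup>2)^2" "abs (bump0 a b x) <= fact b"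
proof -
  define s where "s = 1 / (1 - x\<^sup>2)"
  have gen: "abs (bump0 a b x) <= s ^ b * exp (- s)" if x: "abs x < 1"
  proof -
    have s: "0 < s" using abs_lt1_sq[OF x] by (simp add: s_def)
    have "abs (bump0 a b x) = abs x ^ a * (s ^ b * exp (- s))" using x s by (simp add: bump0_def s_def[symmetric] abs_mult power_abs)
    also have "... <= 1 * (s ^ b * exp (- s))"
      using x s by (intro mult_right_mono power_le_one) auto
    finally show ?thesis by simp
  qed
  show "abs (bump0 a b x) <= fact (b + 2) * (1 - x\<^sup>2)^2"
  proof (cases "abs x < 1")
    case True
    have p: "0 < 1 - x\<^sup>2" by (rule abs_lt1_sq[OF True])
    have s: "0 < s" using p by (simp add: s_def)
    have "s ^ b * exp (- s) = (s ^ (b + 2) * exp (- s)) * (1 - x\<^sup>2)^2"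
    proof -
      have "s * (1 - x\<^sup>2) = 1" using p by (simp add: s_def)
      then have "(s * (1 - x\<^sup>2))^2 = 1" by simp
      then have "s\<^sup>2 * (1 - x\<^sup>2)^2 = 1" by (simp only: power_mult_distrib)
      moreover have "(s ^ (b + 2) * exp (- s)) * (1 - x\<^sup>2)^2 = (s ^ b * exp (- s)) * (s\<^sup>2 * (1 - x\<^sup>2)^2)"
        by (simp only: power_add mult_ac)
      ultimately show ?thesis by simp
    qed
    also have "... <= fact (b + 2) * (1 - x\<^sup>2)^2" using s by (intro mult_right_mono power_exp_bound) auto
    finally show ?thesis using gen[OF True] by linarith
  qed (simp add: bump0_def)
  show "abs (bump0 a b x) <= fact b"
  proof (cases "abs x < 1")
    case True
    have "0 <= s" using abs_lt1_sq[OF True] by (simp add: s_def)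
    then show ?thesis using gen[OF True] power_exp_bound[of s b] by linarith
  qed (simp add: bump0_def)
qed

lemma has_derivative_zero_quadratic:
  fixes u :: "real => real"
  assumes "!!y. abs (y - x) <= 1 ==> abs (u y) <= C * (y - x)^2"
  shows "(u has_real_derivative 0) (at x)"
  unfolding DERIV_def
proof (rule Lim_null_comparison)
  have u0: "u x = 0" using assms[of x] by simp
  show "\<forall>\<^sub>F h in at 0. norm ((u (x + h) - u x) / h) <= abs C * abs h"
    unfolding eventually_at
  proof (intro exI[of _ 1] conjI ballI impI)
    fix h :: real assume h: "h \<noteq> 0 \<and> dist h 0 < 1"
    have "abs (u (x + h)) <= C * h\<^sup>2" using assms[of "x + h"] h by simp
    also have "... <= abs C * h\<^sup>2" by (intro mult_right_mono) auto
    finally have "abs (u (x + h)) / abs h <= abs C * h\<^sup>2 / abs h" by (rule divide_right_mono) simp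
    also have "abs C * h\<^sup>2 / abs h = abs C * abs h" using h by (simp add: power2_eq_square abs_if)
    finally show "norm ((u (x + h) - u x) / h) <= abs C * abs h" by (simp add: u0)
  qed simp
  have "((%h. abs C * abs h) \<longlongrightarrow> (abs C) * abs 0) (at (0::real))" by (intro tendsto_intros)
  then show "((%h. abs C * abs h) \<longlongrightarrow> 0) (at (0::real))" by simp
qed

text \<open>At |x| = 1 every \<open>bump0\<close> is 0 and the quadratic decay makes the derivative
  0 as well. For a = 0 the truncated subtraction \<open>a - 1\<close> is harmless because of the
  factor \<open>real a\<close>.\<close>

lemma bump0_deriv:
  "(bump0 a b has_real_derivative (real a * bump0 (a - 1) b x + (2 * real b * bump0 (a + 1) (b + 1) x - 2 * bump0 (a + 1) (b + 2) x))) (at x)"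
proof -
  consider "abs x < 1" | "abs x > 1" | "abs x = 1" by linarith
  then show ?thesis
  proof cases
    case 1
    have p: "0 < 1 - x\<^sup>2" by (rule abs_lt1_sq[OF 1])
    define s where "s = 1 / (1 - x\<^sup>2)"
    have ds: "((%x. 1 / (1 - x\<^sup>2)) has_real_derivative 2 * x * s\<^sup>2) (at x)"
      unfolding s_def using p by (auto intro!: derivative_eq_intros simp: power2_eq_square field_simps)
    have "((%x. x ^ a * (1 / (1 - x\<^sup>2)) ^ b * exp (- (1 / (1 - x\<^sup>2)))) has_real_derivative
       (real a * x ^ (a - 1) * s ^ b * exp (- s) + x ^ a * (real b * s ^ (b - 1) * (2 * x * s\<^sup>2)) * exp (- s) + x ^ a * s ^ b * (exp (- s) * (- (2 * x * s\<^sup>2))))) (at x)"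
      by (rule derivative_eq_intros ds refl)+ (simp add: s_def[symmetric] algebra_simps)
    also have "real a * x ^ (a - 1) * s ^ b * exp (- s) + x ^ a * (real b * s ^ (b - 1) * (2 * x * s\<^sup>2)) * exp (- s) + x ^ a * s ^ b * (exp (- s) * (- (2 * x * s\<^sup>2)))
      = real a * bump0 (a - 1) b x + (2 * real b * bump0 (a + 1) (b + 1) x - 2 * bump0 (a + 1) (b + 2) x)"
    proof -
      have e: "real b * s ^ (b - 1) * s\<^sup>2 = real b * s ^ (b + 1)"
        by (cases b) (simp_all add: power2_eq_square)
      have "x ^ a * (real b * s ^ (b - 1) * (2 * x * s\<^sup>2)) * exp (- s) = 2 * (real b * s ^ (b - 1) * s\<^sup>2) * x ^ (a + 1) * exp (- s)"
        by (simp only: power_add power_one_right mult_ac)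
      then have "x ^ a * (real b * s ^ (b - 1) * (2 * x * s\<^sup>2)) * exp (- s) = 2 * (real b * s ^ (b + 1)) * x ^ (a + 1) * exp (- s)"
        unfolding e .
      moreover have "x ^ a * s ^ b * (exp (- s) * (- (2 * x * s\<^sup>2))) = - (2 * (x ^ (a + 1) * s ^ (b + 2) * exp (- s)))"
        by (simp add: power_add power2_eq_square mult_ac)
      moreover have "bump0 a' b' x = x ^ a' * s ^ b' * exp (- s)" for a' b' using 1 by (simp add: bump0_def s_def)
      ultimately show ?thesis by (simp only:) (simp add: algebra_simps)
    qed
    finally have *: "((%x. x ^ a * (1 / (1 - x\<^sup>2)) ^ b * exp (- (1 / (1 - x\<^sup>2)))) has_real_derivative
       (real a * bump0 (a - 1) b x + (2 * real b * bump0 (a + 1) (b + 1) x - 2 * bump0 (a + 1) (b + 2) x))) (at x)" .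
    show ?thesis
    proof (rule has_field_derivative_transform_within_open[OF *, of "{-1<..<1}"])
      show "x \<in> {-1<..<1}" using 1 by (auto simp: abs_if split: if_splits)
      show "y ^ a * (1 / (1 - y\<^sup>2)) ^ b * exp (- (1 / (1 - y\<^sup>2))) = bump0 a b y" if "y \<in> {-1<..<1}" for y
      proof -
        have "abs y < 1" using that by auto
        then show ?thesis by (simp add: bump0_def)
      qed
    qed simp
  next
    case 2
    have o: "open {y::real. 1 < abs y}" by (intro open_Collect_less continuous_intros)
    have "((%_. 0) has_real_derivative 0) (at x)" by simp
    then have "(bump0 a b has_real_derivative 0) (at x)"
      by (rule has_field_derivative_transform_within_open[OF _ o]) (use 2 in \<open>auto simp: bump0_def\<close>)
    then show ?thesis using 2 by (simp add: bump0_def)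
  next
    case 3
    have "(bump0 a b has_real_derivative 0) (at x)"
    proof (rule has_derivative_zero_quadratic)
      fix y assume y: "abs (y - x) <= 1"
      have x2: "x\<^sup>2 = 1" using 3 by (metis power2_abs one_power2)
      have yx: "abs (x + y) <= 3" using 3 y by linarith
      have "1 - y\<^sup>2 = (x - y) * (x + y)" using x2 by (simp add: power2_eq_square algebra_simps)
      then have "(1 - y\<^sup>2)^2 = (y - x)^2 * (x + y)^2" by (simp add: power_mult_distrib power2_commute)
      also have "... <= (y - x)^2 * 3\<^sup>2"
        using power_mono[OF yx, of 2] by (intro mult_left_mono) auto
      finally have "fact (b + 2) * (1 - y\<^sup>2)^2 <= fact (b + 2) * ((y - x)^2 * 3\<^sup>2)" by (intro mult_left_mono) auto
      then show "abs (bump0 a b y) <= (fact (b + 2) * 3\<^sup>2) * (y - x)^2"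
        using order.trans[OF bump0_bound(1)[of a b y]] by (simp only: mult_ac)
    qed
    then show ?thesis using 3 by (simp add: bump0_def)
  qed
qed

lemma bumps_deriv: "u \<in> bumps ==> \<exists>u'\<in>bumps. \<forall>x. (u has_real_derivative u' x) (at x)"
proof (induction rule: bumps.induct)
  case (base a b)
  have "(%x. real a * bump0 (a - 1) b x + 1 * (2 * real b * bump0 (a + 1) (b + 1) x + (- 2) * bump0 (a + 1) (b + 2) x)) \<in> bumps"
    by (intro bumps.intros)
  then show ?case using bump0_deriv[of a b] by (intro bexI) auto
next
  case (lin u v c e)
  then obtain u' v' where "u' \<in> bumps" "v' \<in> bumps"
    "!!x. (u has_real_derivative u' x) (at x)" "!!x. (v has_real_derivative v' x) (at x)" by blast
  then show ?case
    by (intro bexI[of _ "%x. c * u' x + e * v' x"]) (auto intro!: derivative_eq_intros bumps.lin)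
qed

lemma bumps_cont: "u \<in> bumps ==> continuous_on UNIV u"
  using bumps_deriv by (metis DERIV_isCont continuous_on_eq_continuous_at open_UNIV UNIV_I)

lemma bumps_meas: "u \<in> bumps ==> u \<in> borel_measurable borel"
  by (rule borel_measurable_continuous_onI[OF bumps_cont])

lemma bumps_supp: "u \<in> bumps ==> 1 <= abs x ==> u x = 0"
  by (induction rule: bumps.induct) (auto simp: bump0_def)

lemma bumps_bounded: "u \<in> bumps ==> \<exists>C. \<forall>x. abs (u x) <= C"
proof (induction rule: bumps.induct)
  case (base a b) then show ?case using bump0_bound(2) by blast
next
  case (lin u v c e)
  then obtain C C' where C: "!!x. abs (u x) <= C" "!!x. abs (v x) <= C'" by blast
  have "abs (c * u x + e * v x) <= abs c * C + abs e * C'" for x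
  proof -
    have "abs (c * u x + e * v x) <= abs c * abs (u x) + abs e * abs (v x)" using abs_triangle_ineq[of "c * u x" "e * v x"] by (simp add: abs_mult)
    also have "... <= abs c * C + abs e * C'" by (intro add_mono mult_left_mono C) auto
    finally show ?thesis .
  qed
  then show ?case by blast
qed

lemma bumps_scale: "u \<in> bumps ==> (%x. c * u x) \<in> bumps"
  using bumps.lin[of u u c 0] by simp

lemma mollifier_exists: "\<exists>\<rho>\<in>bumps. (\<forall>x. 0 <= \<rho> x) \<and> integrable lborel \<rho> \<and> (LINT x|lborel. \<rho> x) = 1"
proof -
  let ?b = "bump0 0 0"
  have bb: "?b \<in> bumps" by (rule bumps.base)
  have nn: "0 <= ?b x" for x by (simp add: bump0_def)
  have i: "integrable lborel ?b"
  proof (rule Bochner_Integration.integrable_bound[where f="indicator {-1..1::real} :: real => real"])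
    show "integrable lborel (indicator {-1..1::real} :: real => real)" by (simp add: integrable_indicator_iff)
    show "?b \<in> borel_measurable lborel" using bumps_meas[OF bb] by simp
    show "AE x in lborel. norm (?b x) <= norm (indicator {-1..1::real} x :: real)"
    proof (rule AE_I2)
      fix x show "norm (?b x) <= norm (indicator {-1..1::real} x :: real)"
      proof (cases "x \<in> {-1..1}")
        case True then show ?thesis using bump0_bound(2)[of 0 0 x] by simp
      next
        case False
        then have "1 <= abs x" by auto
        then show ?thesis using bumps_supp[OF bb, of x] by simp
      qed
    qed
  qed
  define Z where "Z = (LINT x|lborel. ?b x)"
  have Z: "0 < Z"
  proof -
    have "Z \<noteq> 0"
    proof
      assume "Z = 0"
      then have "AE x in lborel. ?b x = 0"
        unfolding Z_def using i by (subst (asm) integral_nonneg_eq_0_iff_AE) (auto simp: nn)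
      then have "AE x in lborel. x \<notin> {-1<..<1::real}"
        by eventually_elim (auto simp: bump0_def abs_if split: if_splits)
      then have "emeasure lborel {-1<..<1::real} = 0" by (subst (asm) AE_iff_null_sets[symmetric]) auto
      then show False by simp
    qed
    moreover have "0 <= Z" unfolding Z_def by (intro Bochner_Integration.integral_nonneg nn)
    ultimately show ?thesis by simp
  qed
  show ?thesis
    using Z nn i by (intro bexI[of _ "%x. (1 / Z) * ?b x"] bumps_scale bb) (auto simp: Z_def[symmetric])
qed

section \<open>Density of bounded continuous cylinder functions\<close>

lemma l2_dominated:
  fixes f :: "nat => 'a => real"
  assumes m: "!!n. f n \<in> borel_measurable M" and h: "h \<in> borel_measurable M" and g: "g \<in> sqi M"
    and b: "!!n x. abs (f n x - h x) <= g x" and l: "AE x in M. (%n. f n x) \<longlonglongrightarrow> h x"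
  shows "(%n. l2 M (%x. f n x - h x)) \<longlonglongrightarrow> 0"
proof -
  have "(%n. \<integral>x. (f n x - h x)^2 \<partial>M) \<longlonglongrightarrow> (LINT x|M. 0)"
  proof (rule integral_dominated_convergence[where w="%x. (g x)^2"])
    show "AE x in M. (%n. (f n x - h x)^2) \<longlonglongrightarrow> 0"
      using l
    proof eventually_elim
      case (elim x)
      from tendsto_power[OF tendsto_diff[OF elim tendsto_const[of "h x"]], of 2] show ?case by simp
    qed
    show "AE x in M. norm ((f n x - h x)^2) <= (g x)^2" for n
    proof (rule AE_I2)
      fix x show "norm ((f n x - h x)^2) <= (g x)^2" using power_mono[OF b[of n x], of 2] by simp
    qed
  qed (use m h sqi_int[OF g] in auto)
  from tendsto_real_sqrt[OF this] show ?thesis by (simp add: l2_def)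
qed

context seq_prob begin

definition cyl :: "((nat => real) => real) => bool" where
  "cyl b \<longleftrightarrow> continuous_on UNIV b \<and> (\<exists>N C. depends_first N b \<and> (\<forall>x. abs (b x) <= C))"

lemma cyl_sqi: "cyl b ==> b \<in> sqi Q"
  unfolding cyl_def using Q.sqi_bounded[OF continuous_measurable] by blast

lemma cyl_const: "cyl (%x. c)"
  unfolding cyl_def by (auto simp: depends_first_def)

lemma cyl_combine:
  assumes a: "cyl a" and b: "cyl b" and F: "continuous_on UNIV (%z. F (fst z) (snd z))"
    and bd: "!!C C'. \<exists>K. \<forall>s t. abs s <= C --> abs t <= C' --> abs (F s t) <= K"
  shows "cyl (%x. F (a x) (b x :: real) :: real)"
proof -
  obtain N C N' C' where N: "depends_first N a" "!!x. abs (a x) <= C" "depends_first N' b" "!!x. abs (b x) <= C'"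
    using a b unfolding cyl_def by blast
  obtain K where K: "!!s t. abs s <= C ==> abs t <= C' ==> abs (F s t) <= K" using bd[of C C'] by auto
  have d: "depends_first (max N N') (%x. F (a x) (b x))"
    unfolding depends_first_def
  proof (intro allI impI)
    fix x y :: "nat => real" assume h: "\<forall>i<max N N'. x i = y i"
    have "a x = a y" by (rule depends_firstD[OF N(1)]) (use h in auto)
    moreover have "b x = b y" by (rule depends_firstD[OF N(3)]) (use h in auto)
    ultimately show "F (a x) (b x) = F (a y) (b y)" by simp
  qed
  have c: "continuous_on UNIV (%x. F (a x) (b x))"
    using continuous_on_compose2[OF F continuous_on_Pair, of UNIV a b] a b by (auto simp: cyl_def)
  have e: "\<exists>C. \<forall>x. abs (F (a x) (b x)) <= C" using K[OF N(2) N(4)] by (intro exI[of _ K] allI)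
  show ?thesis unfolding cyl_def using c d e by blast
qed

lemma cyl_lin: "cyl a ==> cyl b ==> cyl (%x. c * a x + e * b x)"
proof (rule cyl_combine[where F="%s t. c * s + e * t"])
  show "\<exists>K. \<forall>s t. abs s <= C --> abs t <= C' --> abs (c * s + e * t) <= K" for C C' :: real
  proof (intro exI[of _ "abs c * C + abs e * C'"] allI impI)
    fix s t :: real assume "abs s <= C" "abs t <= C'"
    then have "abs c * abs s + abs e * abs t <= abs c * C + abs e * C'" by (intro add_mono mult_left_mono) auto
    then show "abs (c * s + e * t) <= abs c * C + abs e * C'" using abs_triangle_ineq[of "c * s" "e * t"] by (simp add: abs_mult)
  qed
qed (auto intro!: continuous_intros)

lemma cyl_max: "cyl a ==> cyl b ==> cyl (%x. max (a x) (b x))"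
proof (rule cyl_combine[where F=max])
  show "\<exists>K. \<forall>s t. abs s <= C --> abs t <= C' --> abs (max s t) <= K" for C C' :: real
    by (rule exI[of _ "max C C'"]) auto
qed (auto intro!: continuous_intros)

definition appr :: "((nat => real) => real) => bool" where
  "appr h \<longleftrightarrow> h \<in> sqi Q \<and> (\<forall>\<eta>>0. \<exists>b. cyl b \<and> l2 Q (%x. h x - b x) < \<eta>)"

lemma apprD: "appr h ==> 0 < \<eta> ==> \<exists>b. cyl b \<and> l2 Q (%x. h x - b x) < \<eta>"
  by (simp add: appr_def)

lemma appr_lin:
  assumes a: "appr g" and b: "appr h"
  shows "appr (%x. c * g x + e * h x)"
  unfolding appr_def
proof (intro conjI allI impI)
  have s: "g \<in> sqi Q" "h \<in> sqi Q" using a b by (auto simp: appr_def)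
  show "(%x. c * g x + e * h x) \<in> sqi Q" by (intro sqi_add sqi_scale s)
  fix \<eta> :: real assume \<eta>: "0 < \<eta>"
  let ?K = "abs c + abs e + 1"
  have K: "0 < ?K" by simp
  obtain u v where u: "cyl u" "l2 Q (%x. g x - u x) < \<eta> / ?K" and v: "cyl v" "l2 Q (%x. h x - v x) < \<eta> / ?K"
    using apprD[OF a divide_pos_pos[OF \<eta> K]] apprD[OF b divide_pos_pos[OF \<eta> K]] by blast
  have "l2 Q (%x. (c * g x + e * h x) - (c * u x + e * v x)) = l2 Q (%x. c * (g x - u x) + e * (h x - v x))"
    by (rule arg_cong[where f="l2 Q"]) (simp add: algebra_simps)
  also have "... <= l2 Q (%x. c * (g x - u x)) + l2 Q (%x. e * (h x - v x))"
    by (intro l2_triangle sqi_scale sqi_diff s cyl_sqi u v)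
  also have "... = abs c * l2 Q (%x. g x - u x) + abs e * l2 Q (%x. h x - v x)" by (simp only: l2_scale)
  also have "... <= abs c * (\<eta> / ?K) + abs e * (\<eta> / ?K)" using u v by (intro add_mono mult_left_mono) auto
  also have "... = (abs c + abs e) * (\<eta> / ?K)" by (simp only: distrib_right)
  also have "... < ?K * (\<eta> / ?K)" using \<eta> K by (intro mult_strict_right_mono) auto
  also have "... = \<eta>" using K by simp
  finally show "\<exists>b. cyl b \<and> l2 Q (%x. (c * g x + e * h x) - b x) < \<eta>"
    using cyl_lin[OF u(1) v(1)] by blast
qed

lemma appr_limit:
  assumes f: "!!n. appr (f n)" and h: "h \<in> sqi Q" and l: "(%n. l2 Q (%x. f n x - h x)) \<longlonglongrightarrow> 0"
  shows "appr h"
  unfolding appr_def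
proof (intro conjI h allI impI)
  fix \<eta> :: real assume \<eta>: "0 < \<eta>"
  have "\<forall>\<^sub>F n in sequentially. l2 Q (%x. f n x - h x) < \<eta> / 2" by (rule order_tendstoD(2)[OF l]) (use \<eta> in simp)
  then obtain n where n: "l2 Q (%x. f n x - h x) < \<eta> / 2" by (auto simp: eventually_sequentially)
  obtain b where b: "cyl b" "l2 Q (%x. f n x - b x) < \<eta> / 2" using apprD[OF f, of "\<eta> / 2" n] \<eta> by auto
  have "l2 Q (%x. h x - b x) <= l2 Q (%x. h x - f n x) + l2 Q (%x. f n x - b x)"
    by (rule l2_triangle_diff[OF h _ cyl_sqi[OF b(1)]]) (use f[of n] in \<open>simp add: appr_def\<close>)
  also have "... < \<eta>" using n b l2_minus_commute[of Q h "f n"] by simp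
  finally show "\<exists>b. cyl b \<and> l2 Q (%x. h x - b x) < \<eta>" using b(1) by blast
qed

lemma appr_cyl: "cyl b ==> appr b"
  unfolding appr_def using cyl_sqi by (auto simp: l2_def)

text \<open>Sets with approximable indicator. They are closed under complements and countable unions
  and contain the coordinate preimages of open sets, hence they are all measurable sets.\<close>

definition asets :: "(nat => real) set set" where
  "asets = {A \<in> sets Q. appr (indicator A)}"

lemma ind_sqi: "A \<in> sets Q ==> (indicator A :: _ => real) \<in> sqi Q"
  by (rule Q.sqi_bounded[where C=1]) (auto simp: indicator_def)

lemma asets_empty: "{} \<in> asets"
proof -
  have e: "indicator {} = (%x. 0 :: real)" by (auto simp: indicator_def)
  show ?thesis using appr_cyl[OF cyl_const[of 0]] by (simp add: asets_def e)
qed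

lemma asets_compl: "A \<in> asets ==> UNIV - A \<in> asets"
proof -
  assume A: "A \<in> asets"
  have e: "indicator (UNIV - A) = (%x. 1 * 1 + (-1) * indicator A x :: real)" by (auto simp: indicator_def)
  have "appr (indicator (UNIV - A))"
    unfolding e using A by (intro appr_lin appr_cyl[OF cyl_const]) (simp add: asets_def)
  moreover have "UNIV - A \<in> sets Q" using A sets.compl_sets[of A Q] by (simp add: asets_def)
  ultimately show ?thesis by (simp add: asets_def)
qed

text \<open>The maximum of two approximants works, since its error is at most the sum of their
  errors pointwise.\<close>

lemma asets_Un: "A \<in> asets ==> B \<in> asets ==> A \<union> B \<in> asets"
proof -
  assume A: "A \<in> asets" and B: "B \<in> asets"
  have "appr (indicator (A \<union> B))"
    unfolding appr_def
  proof (intro conjI allI impI)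
    have sA: "A \<in> sets Q" "B \<in> sets Q" using A B by (auto simp: asets_def)
    then show s: "(indicator (A \<union> B) :: _ => real) \<in> sqi Q" by (intro ind_sqi) auto
    fix \<eta> :: real assume \<eta>: "0 < \<eta>"
    obtain u where u: "cyl u" "l2 Q (%x. indicator A x - u x) < \<eta> / 2"
      using apprD[of "indicator A" "\<eta> / 2"] A \<eta> by (auto simp: asets_def)
    obtain v where v: "cyl v" "l2 Q (%x. indicator B x - v x) < \<eta> / 2"
      using apprD[of "indicator B" "\<eta> / 2"] B \<eta> by (auto simp: asets_def)
    have c: "cyl (%x. max (u x) (v x))" by (rule cyl_max[OF u(1) v(1)])
    let ?a = "%x. abs (indicator A x - u x)" and ?b = "%x. abs (indicator B x - v x)"
    have ab: "?a \<in> sqi Q" "?b \<in> sqi Q"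
      using sqi_diff[OF ind_sqi[OF sA(1)] cyl_sqi[OF u(1)]] sqi_diff[OF ind_sqi[OF sA(2)] cyl_sqi[OF v(1)]] by (auto simp: sqi_def)
    have "l2 Q (%x. indicator (A \<union> B) x - max (u x) (v x)) <= l2 Q (%x. ?a x + ?b x)"
      unfolding l2_def
    proof (intro real_sqrt_le_mono integral_mono)
      show "integrable Q (%x. (indicator (A \<union> B) x - max (u x) (v x))^2)"
        by (intro sqi_int sqi_diff s cyl_sqi c)
      show "integrable Q (%x. (?a x + ?b x)^2)" by (intro sqi_int sqi_add ab)
      fix x
      have "abs (indicator (A \<union> B) x - max (u x) (v x)) <= ?a x + ?b x"
        by (auto simp: indicator_def)
      from power_mono[OF this, of 2] show "(indicator (A \<union> B) x - max (u x) (v x))^2 <= (?a x + ?b x)^2" by simp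
    qed
    also have "... <= l2 Q ?a + l2 Q ?b" by (rule l2_triangle[OF ab])
    also have "... < \<eta>" using u v by (simp add: l2_def)
    finally show "\<exists>b. cyl b \<and> l2 Q (%x. indicator (A \<union> B) x - b x) < \<eta>" using c by blast
  qed
  then show ?thesis using A B by (auto simp: asets_def)
qed

lemma asets_UN: "(!!n :: nat. A n \<in> asets) ==> (\<Union>n. A n) \<in> asets"
proof -
  assume A: "!!n :: nat. A n \<in> asets"
  have F: "(\<Union>k<n. A k) \<in> asets" for n
  proof (induction n)
    case 0 then show ?case using asets_empty by simp
  next
    case (Suc n)
    have "(\<Union>k<Suc n. A k) = (\<Union>k<n. A k) \<union> A n" by (auto simp: less_Suc_eq)
    then show ?case using asets_Un[OF Suc A[of n]] by simp
  qed
  have sA: "A n \<in> sets Q" for n using A[of n] by (simp add: asets_def)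
  have U: "(\<Union>n. A n) \<in> sets Q" using sA by auto
  have "appr (indicator (\<Union>n. A n))"
  proof (rule appr_limit)
    show "appr (indicator (\<Union>k<n. A k))" for n using F[of n] by (simp add: asets_def)
    show "(indicator (\<Union>n. A n) :: _ => real) \<in> sqi Q" by (rule ind_sqi[OF U])
    show "(%n. l2 Q (%x. indicator (\<Union>k<n. A k) x - indicator (\<Union>n. A n) x)) \<longlonglongrightarrow> 0"
    proof (rule l2_dominated[where g="%x. 1"])
      show "AE x in Q. (%n. indicator (\<Union>k<n. A k) x) \<longlonglongrightarrow> (indicator (\<Union>n. A n) x :: real)"
        by (intro AE_I2 LIMSEQ_indicator_UN)
      show "(%x. 1) \<in> sqi Q" by (rule Q.sqi_bounded[where C=1]) auto
      show "indicator (\<Union>k<n. A k) \<in> borel_measurable Q" for n using F[of n] by (auto simp: asets_def intro: borel_measurable_indicator)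
      show "indicator (\<Union>n. A n) \<in> borel_measurable Q" using U by simp
    qed (auto simp: indicator_def)
  qed
  then show ?thesis using U by (simp add: asets_def)
qed

text \<open>Truncated multiples of the distance to the complement increase to the indicator. The
  whole line is treated apart because \<open>infdist\<close> to the empty set is 0 by
  convention.\<close>

lemma asets_open:
  assumes U: "open (U :: real set)"
  shows "{x. x i \<in> U} \<in> asets"
proof (cases "U = UNIV")
  case True
  then show ?thesis using asets_compl[OF asets_empty] by simp
next
  case False
  then have ne: "- U \<noteq> {}" by auto
  have cl: "closed (- U)" using U by (simp add: closed_Compl)
  have m: "{x. x i \<in> U} \<in> sets Q"
    using cyl_sets[of "{i}" "%_. U"] U by simp
  let ?b = "%k x. min 1 (real k * infdist (x i) (- U))"
  have c: "cyl (?b k)" for k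
    unfolding cyl_def
  proof (intro conjI exI[of _ "Suc i"] exI[of _ 1] allI)
    show "continuous_on UNIV (?b k)"
      by (intro continuous_intros continuous_on_infdist continuous_on_product_coordinates)
    show "depends_first (Suc i) (?b k)" by (simp add: depends_first_def)
    fix x show "abs (?b k x) <= 1" using infdist_nonneg[of "x i" "- U"] by (simp add: abs_if min_def mult_less_0_iff)
  qed
  have "appr (indicator {x. x i \<in> U})"
  proof (rule appr_limit[where f="?b"])
    show "appr (?b n)" for n by (rule appr_cyl[OF c])
    show "(indicator {x. x i \<in> U} :: _ => real) \<in> sqi Q" by (rule ind_sqi[OF m])
    show "(%n. l2 Q (%x. ?b n x - indicator {x. x i \<in> U} x)) \<longlonglongrightarrow> 0"
    proof (rule l2_dominated[where g="%x. 1"])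
      show "(%x. 1) \<in> sqi Q" by (rule Q.sqi_bounded[where C=1]) auto
      show "?b n \<in> borel_measurable Q" for n by (rule sqi_meas[OF cyl_sqi[OF c]])
      show "(indicator {x. x i \<in> U} :: _ => real) \<in> borel_measurable Q" by (rule sqi_meas[OF ind_sqi[OF m]])
      show "abs (?b n x - indicator {x. x i \<in> U} x) <= 1" for n x
        using infdist_nonneg[of "x i" "- U"] by (simp add: abs_if min_def indicator_def mult_less_0_iff)
      show "AE x in Q. (%n. ?b n x) \<longlonglongrightarrow> indicator {x. x i \<in> U} x"
      proof (rule AE_I2, rule tendsto_eventually)
        fix x :: "nat => real"
        show "\<forall>\<^sub>F n in sequentially. ?b n x = indicator {x. x i \<in> U} x"
        proof (cases "x i \<in> U")
          case True
          then have p: "0 < infdist (x i) (- U)"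
            using infdist_pos_not_in_closed[OF cl ne, of "x i"] by simp
          obtain N :: nat where N: "1 / infdist (x i) (- U) <= real N" using real_arch_simple by blast
          show ?thesis
          proof (rule eventually_sequentiallyI[of N])
            fix n assume "N <= n"
            then have "1 / infdist (x i) (- U) <= real n" using N by linarith
            then have "1 <= real n * infdist (x i) (- U)" using p by (simp add: field_simps)
            then show "?b n x = indicator {x. x i \<in> U} x" using True by simp
          qed
        qed (auto simp: infdist_zero)
      qed
    qed
  qed
  then show ?thesis using m by (simp add: asets_def)
qed

text \<open>One induction for two uses: F is first the preimage under a coordinate, for Borel sets
  of the line, and then the identity on the sequence space.\<close>

lemma asets_sigma:
  assumes G: "!!A. A \<in> G ==> F A \<in> asets" and B: "B \<in> sigma_sets \<Omega> G"
    and F0: "F {} = {}" and Fc: "!!A. A \<in> sigma_sets \<Omega> G ==> F (\<Omega> - A) = UNIV - F A" and FU: "!!A :: nat => _. F (\<Union>n. A n) = (\<Union>n. F (A n))"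
  shows "F B \<in> asets"
  using B
proof (induction rule: sigma_sets.induct)
  case (Basic a) then show ?case by (rule G)
next
  case Empty then show ?case by (simp add: F0 asets_empty)
next
  case (Compl a) then show ?case by (simp add: Fc asets_compl)
next
  case (Union a) then show ?case by (simp add: FU asets_UN)
qed

lemma asets_all: "A \<in> sets Q ==> A \<in> asets"
proof -
  assume A: "A \<in> sets Q"
  have c: "{x. x i \<in> B} \<in> asets" if B: "B \<in> sets borel" for i :: nat and B :: "real set"
  proof -
    have "B \<in> sigma_sets UNIV {S. open S}" using B by (simp add: borel_def)
    then show ?thesis
      by (rule asets_sigma[where F="%B. {x. x i \<in> B}", rotated]) (auto intro: asets_open)
  qed
  have "sets Q = sigma_sets UNIV {{f. f i \<in> B} | i B. B \<in> sets borel}"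
    unfolding sets_Q sets_PiM_single by (simp add: PiE_def extensional_def)
  then have "A \<in> sigma_sets UNIV {{f. f i \<in> B} | i B. B \<in> sets borel}" using A by simp
  then show ?thesis
    by (rule asets_sigma[where F="%A. A", rotated]) (use c in auto)
qed

lemma appr_all:
  assumes h: "h \<in> sqi Q"
  shows "appr h"
proof -
  have hm: "h \<in> borel_measurable Q" by (rule sqi_meas[OF h])
  from borel_measurable_implies_sequence_metric[OF hm, of 0] obtain F where
    F: "!!n. simple_function Q (F n)" "!!x. (%n. F n x) \<longlonglongrightarrow> h x" "!!n x. abs (F n x) <= 2 * abs (h x)"
    by (auto simp: dist_real_def)
  have sF: "appr (F n)" for n
  proof -
    have fin: "finite (range (F n))" using F(1)[of n] by (simp add: simple_function_def)
    have ms: "F n -` {y} \<in> sets Q" for y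
    proof (cases "y \<in> range (F n)")
      case True then show ?thesis using F(1)[of n] by (auto simp: simple_function_def)
    next
      case False
      then have "F n -` {y} = {}" by auto
      then show ?thesis by simp
    qed
    have "appr (%x. \<Sum>y\<in>Y. y * indicator (F n -` {y}) x)" if "finite Y" for Y
      using that
    proof (induction Y)
      case empty then show ?case using appr_cyl[OF cyl_const[of 0]] by simp
    next
      case (insert y Y)
      have "appr (indicator (F n -` {y}))" using asets_all[OF ms[of y]] by (simp add: asets_def)
      from appr_lin[OF this insert.IH, of y 1] show ?case by (simp only: sum.insert[OF insert.hyps] mult_1)
    qed
    from this[OF fin] have "appr (%x. \<Sum>y\<in>range (F n). y * indicator (F n -` {y}) x)" .
    moreover have "(\<Sum>y\<in>range (F n). y * indicator (F n -` {y}) x) = F n x" for x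
    proof -
      have "(\<Sum>y\<in>range (F n). y * indicator (F n -` {y}) x) = (\<Sum>y\<in>range (F n). if y = F n x then y else 0)"
        by (intro sum.cong refl) (auto simp: indicator_def)
      also have "... = F n x" using fin by (simp add: sum.delta)
      finally show ?thesis .
    qed
    ultimately show ?thesis by simp
  qed
  show ?thesis
  proof (rule appr_limit[OF sF h])
    show "(%n. l2 Q (%x. F n x - h x)) \<longlonglongrightarrow> 0"
    proof (rule l2_dominated[where g="%x. 3 * abs (h x)"])
      show "F n \<in> borel_measurable Q" for n by (rule borel_measurable_simple_function[OF F(1)])
      show "(%x. 3 * abs (h x)) \<in> sqi Q" using h by (intro sqi_scale) (auto simp: sqi_def)
      show "abs (F n x - h x) <= 3 * abs (h x)" for n x using F(3)[of n x] by linarith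
    qed (use hm F in auto)
  qed
qed

lemma cyl_dense: "h \<in> sqi Q ==> 0 < \<eta> ==> \<exists>b. cyl b \<and> l2 Q (%x. h x - b x) < \<eta>"
  using appr_all by (auto simp: appr_def)

text \<open>Schur test: Cauchy--Schwarz after splitting |k| into two square roots, then Fubini. The
  norm bound involves the marginal masses a and b, which multiply over the coordinates of a product
  kernel.\<close>

lemma schur:
  fixes k :: "(nat => real) => (nat => real) => real"
  assumes km[measurable]: "(%(x, y). k x y) \<in> borel_measurable (Q \<Otimes>\<^sub>M Q)"
    and kb: "!!x y. abs (k x y) <= C"
    and a: "!!x. (LINT y|Q. abs (k x y)) <= a" and b: "!!y. (LINT x|Q. abs (k x y)) <= b" and ab: "0 <= a"
    and h: "h \<in> sqi Q"
  shows "(%x. \<integral>y. h y * k x y \<partial>Q) \<in> sqi Q" "(LINT x|Q. (LINT y|Q. h y * k x y)^2) <= a * b * (LINT y|Q. (h y)^2)"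
proof -
  note [measurable] = sqi_meas[OF h]
  have kx[measurable]: "(%y. k x y) \<in> borel_measurable Q" for x by measurable
  have C0: "0 <= C" using order.trans[OF abs_ge_zero kb] .
  let ?T = "%x. \<integral>y. h y * k x y \<partial>Q"
  have Tm[measurable]: "?T \<in> borel_measurable Q" by measurable
  have i2: "integrable (Q \<Otimes>\<^sub>M Q) (%(x, y). abs (k x y) * (h y)^2)"
  proof (rule Bochner_Integration.integrable_bound)
    show "integrable (Q \<Otimes>\<^sub>M Q) (%z. C * (h (snd z))^2)"
      using QQ.integrable_times(1)[of "%x. C" "%y. (h y)^2"] sqi_int[OF h] by simp
    show "AE z in Q \<Otimes>\<^sub>M Q. norm (case z of (x, y) => (abs (k x y)) * (h y)^2) <= norm (C * (h (snd z))^2)"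
      using kb C0 by (intro AE_I2) (auto simp: abs_mult intro!: mult_right_mono)
  qed measurable
  have pt: "(?T x)^2 <= a * (LINT y|Q. abs (k x y) * (h y)^2)" for x
  proof -
    \<comment> \<open>The sign of the kernel is put into the second factor, so that the product of
      the two is exactly \<open>h y * k x y\<close>.\<close>
    let ?u = "%y. sqrt (abs (k x y))" and ?v = "%y. sgn (k x y) * (sqrt (abs (k x y)) * h y)"
    have us: "?u \<in> sqi Q"
      by (rule Q.sqi_bounded[where C="sqrt C"]) (auto simp: kb)
    have vs: "?v \<in> sqi Q"
    proof -
      have "(%y. (sgn (k x y) * sqrt (abs (k x y))) * h y) \<in> sqi Q"
        by (rule sqi_bounded_mult[OF h, where C="sqrt C"]) (auto simp: abs_mult kb abs_sgn_eq C0)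
      then show ?thesis by (simp add: mult.assoc)
    qed
    have "?u y * ?v y = h y * k x y" for y
    proof -
      have "?u y * ?v y = sgn (k x y) * (sqrt (abs (k x y)) * sqrt (abs (k x y))) * h y" by (simp only: mult_ac)
      also have "... = sgn (k x y) * abs (k x y) * h y" by simp
      also have "sgn (k x y) * abs (k x y) * h y = h y * k x y" unfolding sgn_mult_abs by (rule mult.commute)
      finally show ?thesis .
    qed
    then have "?T x = (LINT y|Q. ?u y * ?v y)" by (simp only:)
    then have e: "abs (?T x) <= l2 Q ?u * l2 Q ?v" using l2_Cauchy_Schwarz[OF us vs] by simp
    have "(?T x)^2 <= (l2 Q ?u)^2 * (l2 Q ?v)^2" using power_mono[OF e, of 2] by (simp add: power_mult_distrib)
    also have "(l2 Q ?u)^2 = (LINT y|Q. abs (k x y))" by (simp add: l2_sq)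
    also have "(l2 Q ?v)^2 = (LINT y|Q. abs (k x y) * (h y)^2)"
      unfolding l2_sq by (intro Bochner_Integration.integral_cong refl) (auto simp: power_mult_distrib sgn_if)
    also have "(LINT y|Q. abs (k x y)) * (LINT y|Q. abs (k x y) * (h y)^2) <= a * (LINT y|Q. abs (k x y) * (h y)^2)"
      by (intro mult_right_mono a Bochner_Integration.integral_nonneg) auto
    finally show ?thesis .
  qed
  have i1: "integrable Q (%x. \<integral>y. abs (k x y) * (h y)^2 \<partial>Q)" using QQ.integrable_fst[OF i2] .
  have i3: "integrable Q (%x. (?T x)^2)"
    by (rule integrable_dominated[OF integrable_mult_right[OF i1] _ _ pt]) auto
  then show "?T \<in> sqi Q" by (intro sqiI) auto
  have "(LINT x|Q. (?T x)^2) <= (LINT x|Q. a * (LINT y|Q. abs (k x y) * (h y)^2))"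
    by (intro integral_mono i3 integrable_mult_right i1 pt)
  also have "... = a * (LINT x|Q. (LINT y|Q. abs (k x y) * (h y)^2))" by simp
  also have "(LINT x|Q. (LINT y|Q. abs (k x y) * (h y)^2)) = (LINT y|Q. (LINT x|Q. abs (k x y) * (h y)^2))"
    by (rule QQ.Fubini_integral[symmetric, OF i2])
  also have "... <= (LINT y|Q. b * (h y)^2)"
  proof (rule integral_mono)
    show "integrable Q (%y. \<integral>x. abs (k x y) * (h y)^2 \<partial>Q)" using QQ.integrable_snd[OF i2] .
    show "(LINT x|Q. abs (k x y) * (h y)^2) <= b * (h y)^2" for y
      using mult_right_mono[OF b[of y], of "(h y)^2"] by simp
  qed (use sqi_int[OF h] in simp)
  also have "(LINT y|Q. b * (h y)^2) = b * (LINT y|Q. (h y)^2)" by simp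
  finally show "(LINT x|Q. (?T x)^2) <= a * b * (LINT y|Q. (h y)^2)"
    using ab by (simp add: mult_left_mono mult.assoc)
qed

end

section \<open>Mollification in finitely many coordinates\<close>

lemma bounded_compact_support:
  fixes f :: "real => real"
  assumes c: "continuous_on UNIV f" and z: "!!t. R < abs t ==> f t = 0"
  shows "\<exists>C. \<forall>t. abs (f t) <= C"
proof -
  have "compact (f ` {-R..R})"
    by (intro compact_continuous_image continuous_on_subset[OF c]) auto
  from compact_imp_bounded[OF this] obtain C where C: "\<forall>y\<in>f ` {-R..R}. abs y <= C"
    by (auto simp only: bounded_iff real_norm_def)
  have "abs (f t) <= max C 0" for t
  proof (cases "t \<in> {-R..R}")
    case True
    then have "abs (f t) <= C" using C by blast
    then show ?thesis by simp
  next
    case False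
    then have "R < abs t" by auto
    then show ?thesis by (simp add: z)
  qed
  then show ?thesis by blast
qed

lemma max_sq_deriv: "((%y. (max 0 y)^2) has_real_derivative 2 * max 0 y) (at (y :: real))"
proof -
  consider "y > 0" | "y < 0" | "y = 0" by linarith
  then show ?thesis
  proof cases
    case 1
    have "((%y. y\<^sup>2) has_real_derivative 2 * max 0 y) (at y)" using 1 by (auto intro!: derivative_eq_intros)
    then show ?thesis
      by (rule has_field_derivative_transform_within_open[where S="{0<..}"]) (use 1 in auto)
  next
    case 2
    have "((%y. 0) has_real_derivative 2 * max 0 y) (at y)" using 2 by (auto intro!: derivative_eq_intros)
    then show ?thesis
      by (rule has_field_derivative_transform_within_open[where S="{..<0}"]) (use 2 in auto)
  next
    case 3
    have "((%y. (max 0 y)^2) has_real_derivative 0) (at y)"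
      by (rule has_derivative_zero_quadratic[where C=1]) (use 3 in \<open>auto simp: max_def\<close>)
    then show ?thesis using 3 by simp
  qed
qed

lemma abs_prod_le: "finite J ==> (!!j. j \<in> J ==> abs (g j) <= C) ==> abs (\<Prod>j\<in>J. g j :: real) <= C ^ card J" for C :: real
  unfolding abs_prod using prod_mono[of J "%j. abs (g j)" "%_. C"] by simp

lemma prod_fun_upd_split:
  assumes i: "i < (N :: nat)"
  shows "(\<Prod>j<N. g j ((x(i := t)) j)) = g i t * (\<Prod>j\<in>{..<N} - {i}. g j (x j) :: real)"
proof -
  have "(\<Prod>j<N. g j ((x(i := t)) j)) = g i ((x(i := t)) i) * (\<Prod>j\<in>{..<N} - {i}. g j ((x(i := t)) j))"
    by (rule prod.remove) (use i in auto)
  also have "(\<Prod>j\<in>{..<N} - {i}. g j ((x(i := t)) j)) = (\<Prod>j\<in>{..<N} - {i}. g j (x j))"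
    by (intro prod.cong) auto
  finally show ?thesis by simp
qed

lemma prod_split: "i < (N :: nat) ==> (\<Prod>j<N. g j (x j)) = g i (x i) * (\<Prod>j\<in>{..<N} - {i}. g j (x j) :: real)"
  by (rule prod.remove) auto

text \<open>For the mollifying kernel as a function of the integrated variable, which becomes a test
  field. One bound C >= 1 for factors and derivatives gives \<open>C ^ N\<close> for the product and
  its partial derivatives.\<close>

lemma prod_C1b:
  fixes g g' :: "nat => real => real"
  assumes d: "!!j t. (g j has_real_derivative g' j t) (at t)" and c: "!!j. continuous_on UNIV (g' j)"
    and b: "!!j t. abs (g j t) <= C" "!!j t. abs (g' j t) <= C" and C: "1 <= C"
  shows "C1b (%y. \<Prod>j<N. g j (y j)) N (C ^ N)"
    "i < N ==> partial i (%y. \<Prod>j<N. g j (y j)) x = g' i (x i) * (\<Prod>j\<in>{..<N} - {i}. g j (x j))"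
proof -
  let ?F = "%y :: nat => real. \<Prod>j<N. g j (y j)"
  have gc: "continuous_on UNIV (g j)" for j
    using DERIV_isCont[OF d[of j]] by (simp add: continuous_on_eq_continuous_at)
  have co: "continuous_on UNIV (%x :: nat => real. f (x j))" if "continuous_on UNIV f" for f :: "real => real" and j
    by (rule continuous_on_compose2[OF that continuous_on_product_coordinates]) auto
  have dF: "((%t. ?F (x(i := t))) has_real_derivative g' i s * (\<Prod>j\<in>{..<N} - {i}. g j (x j))) (at s)" if "i < N" for i x s
    unfolding prod_fun_upd_split[OF that] by (rule DERIV_cmult_right[OF d])
  have pF: "partial i ?F x = g' i (x i) * (\<Prod>j\<in>{..<N} - {i}. g j (x j))" if "i < N" for i x
    unfolding partial_def by (rule DERIV_imp_deriv[OF dF[OF that]])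
  then show "i < N ==> partial i ?F x = g' i (x i) * (\<Prod>j\<in>{..<N} - {i}. g j (x j))" .
  have dep: "depends_first N ?F" unfolding depends_first_def by (auto intro!: prod.cong)
  have pF0: "partial i ?F = (%x. 0)" if "\<not> i < N" for i
    by (rule ext) (rule partial_beyond[OF dep], use that in simp)
  show "C1b ?F N (C ^ N)"
    unfolding C1b_def
  proof (intro conjI allI dep)
    show "continuous_on UNIV ?F" by (intro continuous_on_prod co gc)
    fix j x
    show "continuous_on UNIV (partial j ?F)"
    proof (cases "j < N")
      case True
      have "partial j ?F = (%x. g' j (x j) * (\<Prod>k\<in>{..<N} - {j}. g k (x k)))" using pF[OF True] by blast
      then show ?thesis by (simp only:) (intro continuous_on_mult continuous_on_prod co gc c)
    qed (simp add: pF0)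
    show "((%t. ?F (x(j := t))) has_real_derivative partial j ?F x) (at (x j))"
      using dF[of j x "x j"] pF[of j x] deriv_beyond[OF dep, of j x] partial_beyond[OF dep, of j x] by (cases "j < N") auto
    show "abs (?F x) <= C ^ N" using abs_prod_le[of "{..<N}" "%j. g j (x j)" C] b by simp
    show "abs (partial j ?F x) <= C ^ N"
    proof (cases "j < N")
      case True
      have "abs (partial j ?F x) = abs (g' j (x j)) * abs (\<Prod>k\<in>{..<N} - {j}. g k (x k))" by (simp only: pF[OF True] abs_mult)
      also have "... <= C * C ^ (N - 1)"
        using abs_prod_le[of "{..<N} - {j}" "%j. g j (x j)" C] b True C by (intro mult_mono) auto
      also have "... = C ^ N" using True by (cases N) auto
      finally show ?thesis .
    qed (use C in \<open>simp add: pF0\<close>)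
  qed
qed

context seq_prob begin

section \<open>Integral operators with product kernels\<close>

definition kern :: "(real => real => real) => bool" where
  "kern q \<longleftrightarrow> (%(s, t). q s t) \<in> borel_measurable (borel \<Otimes>\<^sub>M borel) \<and> (\<exists>C. \<forall>s t. abs (q s t) <= C)"

definition UU :: "nat => (nat => real => real => real) => ((nat => real) => real) => (nat => real) => real" where
  "UU N B h x = (LINT y|Q. h y * (\<Prod>j<N. B j (x j) (y j)))"

lemma kern_bound:
  fixes B :: "nat => real => real => real"
  assumes B: "!!j. kern (B j)"
  shows "\<exists>C. 1 <= C \<and> (\<forall>j s t. j < N --> abs (B j s t) <= C)"
proof (induction N)
  case 0 show ?case by (rule exI[of _ 1]) simp
next
  case (Suc N)
  then obtain C where C0: "1 <= C \<and> (\<forall>j s t. j < N --> abs (B j s t) <= C)" ..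
  then have C: "1 <= C" "!!j s t. j < N ==> abs (B j s t) <= C" by auto
  obtain C' where C': "!!s t. abs (B N s t) <= C'" using B[of N] by (auto simp: kern_def)
  have "abs (B j s t) <= max C C'" if "j < Suc N" for j s t
    using C(2)[of j s t] C'[of s t] that by (cases "j = N") (auto simp: le_max_iff_disj)
  then show ?case using C(1) by (intro exI[of _ "max C C'"]) auto
qed

lemma kern_raw:
  assumes q: "kern q" and f: "f \<in> borel_measurable L" and g: "g \<in> borel_measurable L"
  shows "(%z. q (f z) (g z)) \<in> borel_measurable L"
proof -
  have "(%z. (f z, g z)) \<in> measurable L (borel \<Otimes>\<^sub>M borel)" using f g by measurable
  from measurable_compose[OF this, of "%(s, t). q s t" borel] q show ?thesis by (simp add: kern_def)
qed

lemma kern_prod_meas: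
  assumes B: "!!j. kern (B j)"
  shows "(%y. \<Prod>j\<in>J. B j (x j) (y j)) \<in> borel_measurable Q"
    "(%z. \<Prod>j\<in>J. B j (fst z j) (snd z j)) \<in> borel_measurable (Q \<Otimes>\<^sub>M Q)"
  by (intro borel_measurable_prod kern_raw[OF B]; simp)+

lemma UU_integrable:
  assumes B: "!!j. kern (B j)" and h: "h \<in> sqi Q"
  shows "integrable Q (%y. h y * (\<Prod>j<N. B j (x j) (y j)))"
proof -
  obtain C where C0: "1 <= C \<and> (\<forall>j s t. j < N --> abs (B j s t) <= C)" using kern_bound[where B=B and N=N, OF B] ..
  then have C: "1 <= C" "!!j s t. j < N ==> abs (B j s t) <= C" by auto
  have "(%y. (\<Prod>j<N. B j (x j) (y j)) * h y) \<in> sqi Q"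
    using abs_prod_le[of "{..<N}" "%j. B j (x j) (y j)" C for y] C
    by (intro sqi_bounded_mult[OF h kern_prod_meas(1)[OF B], where C="C ^ N"]) auto
  then show ?thesis by (intro Q.sqi_integrable) (simp add: mult.commute)
qed

lemma UU_schur:
  assumes B: "!!j. kern (B j)" and h: "h \<in> sqi Q"
    and a: "!!j s. (LINT t|M. abs (B j s t)) <= a j" and b: "!!j t. (LINT s|M. abs (B j s t)) <= b j"
  shows "UU N B h \<in> sqi Q" "(LINT x|Q. (UU N B h x)^2) <= (\<Prod>j<N. a j) * (\<Prod>j<N. b j) * (LINT y|Q. (h y)^2)"
proof -
  obtain C where C0: "1 <= C \<and> (\<forall>j s t. j < N --> abs (B j s t) <= C)" using kern_bound[where B=B and N=N, OF B] ..
  then have C: "1 <= C" "!!j s t. j < N ==> abs (B j s t) <= C" by auto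
  let ?k = "%x y. \<Prod>j<N. B j (x j) (y j)"
  have i1: "integrable M (%t. abs (B j s t))" and i2: "integrable M (%t. abs (B j t s))" if "j < N" for j s
    by (rule integrable_const_bound[where B=C]; use C(2)[OF that] in \<open>auto intro!: borel_measurable_abs kern_raw[OF B] simp: measurable_cong_sets[OF sets_M refl]\<close>)+
  have e: "abs (?k x y) = (\<Prod>j<N. abs (B j (x j) (y j)))" for x y by (rule abs_prod)
  have ka: "(LINT y|Q. abs (?k x y)) <= (\<Prod>j<N. a j)" for x
    unfolding e using prod_expect[of "{..<N}" "%j t. abs (B j (x j) t)"] i1 a by (auto intro!: prod_mono Bochner_Integration.integral_nonneg)
  have kb: "(LINT x|Q. abs (?k x y)) <= (\<Prod>j<N. b j)" for y
    unfolding e using prod_expect[of "{..<N}" "%j s. abs (B j s (y j))"] i2 b by (auto intro!: prod_mono Bochner_Integration.integral_nonneg)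
  have m: "(%(x, y). ?k x y) \<in> borel_measurable (Q \<Otimes>\<^sub>M Q)"
    using kern_prod_meas(2)[where B=B and J="{..<N}", OF B] by (simp add: case_prod_unfold)
  have bd: "abs (?k x y) <= C ^ N" for x y using abs_prod_le[of "{..<N}" "%j. B j (x j) (y j)" C] C(2) by simp
  have a0: "0 <= (\<Prod>j<N. a j)" using order.trans[OF _ ka] by (simp add: Bochner_Integration.integral_nonneg)
  show "UU N B h \<in> sqi Q" "(LINT x|Q. (UU N B h x)^2) <= (\<Prod>j<N. a j) * (\<Prod>j<N. b j) * (LINT y|Q. (h y)^2)"
    using schur[OF m bd ka kb a0 h] by (simp_all add: UU_def[abs_def])
qed

lemma UU_dep: "depends_first N (UU N B h)"
  unfolding depends_first_def UU_def by (intro allI impI Bochner_Integration.integral_cong refl) (auto intro!: prod.cong)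

lemma UU_cont:
  assumes B: "!!j. kern (B j)" and h: "h \<in> sqi Q" and c: "!!j t. continuous_on UNIV (%s. B j s t)"
  shows "continuous_on UNIV (UU N B h)"
  unfolding continuous_on_sequentially
proof (intro allI ballI impI)
  obtain C where C0: "1 <= C \<and> (\<forall>j s t. j < N --> abs (B j s t) <= C)" using kern_bound[where B=B and N=N, OF B] ..
  then have C: "1 <= C" "!!j s t. j < N ==> abs (B j s t) <= C" by auto
  note [measurable] = sqi_meas[OF h] kern_prod_meas(1)[OF B]
  fix X :: "nat => nat => real" and x assume X: "(\<forall>n. X n \<in> UNIV) \<and> X \<longlonglongrightarrow> x"
  have co: "(%n. X n j) \<longlonglongrightarrow> x j" for j
    using continuous_on_tendsto_compose[OF continuous_on_product_coordinates conjunct2[OF X]] by simp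
  have "(%n. UU N B h (X n)) \<longlonglongrightarrow> UU N B h x"
    unfolding UU_def
  proof (rule integral_dominated_convergence[where w="%y. C ^ N * abs (h y)"])
    show "integrable Q (%y. C ^ N * abs (h y))" using Q.sqi_integrable[OF h] by simp
    show "AE y in Q. (%n. h y * (\<Prod>j<N. B j (X n j) (y j))) \<longlonglongrightarrow> h y * (\<Prod>j<N. B j (x j) (y j))"
      by (intro AE_I2 tendsto_intros continuous_on_tendsto_compose[OF c co]) auto
    show "AE y in Q. norm (h y * (\<Prod>j<N. B j (X n j) (y j))) <= C ^ N * abs (h y)" for n
    proof (rule AE_I2)
      fix y
      have "abs (\<Prod>j<N. B j (X n j) (y j)) <= C ^ N" using abs_prod_le[of "{..<N}" "%j. B j (X n j) (y j)" C] C(2) by simp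
      from mult_left_mono[OF this, of "abs (h y)"] show "norm (h y * (\<Prod>j<N. B j (X n j) (y j))) <= C ^ N * abs (h y)"
        by (simp add: abs_mult mult.commute)
    qed
  qed measurable
  then show "(UU N B h \<circ> X) \<longlonglongrightarrow> UU N B h x" by (simp add: comp_def)
qed

text \<open>Differentiation in coordinate i acts on a single factor of the kernel, so the derivative
  is an operator of the same form; iterating this gives smoothness of all orders.\<close>

lemma UU_deriv:
  assumes B: "!!j. kern (B j)" and h: "h \<in> sqi Q" and i: "i < N"
    and d: "!!s t. ((%s. B i s t) has_real_derivative B' s t) (at s)" and B': "kern B'"
  shows "((%t. UU N B h (x(i := t))) has_real_derivative UU N (B(i := B')) h (x(i := s))) (at s)"
    "partial i (UU N B h) x = UU N (B(i := B')) h x"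
proof -
  have k2: "kern ((B(i := B')) j)" for j using B B' by simp
  obtain C where C0: "1 <= C \<and> (\<forall>j s t. j < N --> abs ((B(i := B')) j s t) <= C)" using kern_bound[where B="B(i := B')" and N=N, OF k2] ..
  then have C: "1 <= C" "!!j s t. j < N ==> abs ((B(i := B')) j s t) <= C" by blast+
  let ?P = "%y. \<Prod>j\<in>{..<N} - {i}. B j (x j) (y j)"
  have e1: "(\<Prod>j<N. B j ((x(i := t)) j) (y j)) = B i t (y i) * ?P y" for t y
    using prod_fun_upd_split[OF i, of "%j s. B j s (y j)" x t] by simp
  have e2: "(\<Prod>j<N. (B(i := B')) j ((x(i := t)) j) (y j)) = B' t (y i) * ?P y" for t y
    using prod_fun_upd_split[OF i, of "%j s. (B(i := B')) j s (y j)" x t] by simp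
  have "((%t. \<integral>y. h y * (B i t (y i) * ?P y) \<partial>Q) has_real_derivative (LINT y|Q. h y * (B' s (y i) * ?P y))) (at s)" for s
  proof (rule deriv_under_integral[where B="%y. C ^ N * abs (h y)"])
    show "integrable Q (%y. h y * (B i t (y i) * ?P y))" for t using UU_integrable[where B=B and N=N and x="x(i := t)", OF B h] by (simp only: e1)
    show "(%y. h y * (B' t (y i) * ?P y)) \<in> borel_measurable Q" for t
      using borel_measurable_integrable[OF UU_integrable[where B="B(i := B')" and N=N and x="x(i := t)", OF k2 h]] by (simp only: e2)
    show "((%t. h y * (B i t (y i) * ?P y)) has_real_derivative h y * (B' t (y i) * ?P y)) (at t)" for t y
      by (intro DERIV_cmult DERIV_cmult_right d)
    show "abs (h y * (B' t (y i) * ?P y)) <= C ^ N * abs (h y)" for t y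
    proof -
      have "abs (B' t (y i) * ?P y) <= C ^ N"
        using abs_prod_le[of "{..<N}" "%j. (B(i := B')) j ((x(i := t)) j) (y j)" C] C(2) unfolding e2 by simp
      from mult_left_mono[OF this, of "abs (h y)"] show ?thesis by (simp only: abs_mult abs_ge_zero mult.commute)
    qed
    show "integrable Q (%y. C ^ N * abs (h y))" using Q.sqi_integrable[OF h] by simp
  qed
  then have *: "((%t. UU N B h (x(i := t))) has_real_derivative UU N (B(i := B')) h (x(i := s))) (at s)" for s
    unfolding UU_def e1 e2 .
  show "((%t. UU N B h (x(i := t))) has_real_derivative UU N (B(i := B')) h (x(i := s))) (at s)" by (rule *)
  show "partial i (UU N B h) x = UU N (B(i := B')) h x"
    unfolding partial_def by (rule DERIV_imp_deriv) (use *[of "x i"] in simp)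
qed

end

text \<open>The oscillation allowed at scale \<epsilon> is tied to the number N of coordinates:
  Schur bounds multiply over coordinates, and \<open>exp (1 / (real N + 1)) ^ N\<close> stays below
  3.\<close>

locale mol = mh_rate \<phi> \<tau> K p \<kappa> for \<phi> \<tau> K p \<kappa> +
  fixes \<rho> :: "real => real" and N :: nat and R \<epsilon> :: real
  assumes rho: "\<rho> \<in> bumps" "!!z. 0 <= \<rho> z" "integrable lborel \<rho>" "(LINT z|lborel. \<rho> z) = 1"
    and R: "0 < R" and eps: "0 < \<epsilon>" "\<epsilon> <= 1"
    and osc: "!!s t. abs t <= R ==> abs (s - t) <= \<epsilon> ==> abs (\<phi> s - \<phi> t) <= 1 / (real N + 1)"
begin

text \<open>A C1 cutoff. It acts on the integrated variable and is differentiated once, in the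
  integration by parts; smoothness of the result comes from the bump in the other variable.\<close>

definition kap :: "real => real" where "kap t = (max 0 (1 - (t / R)\<^sup>2))^2"
definition kap' :: "real => real" where "kap' t = 2 * max 0 (1 - (t / R)\<^sup>2) * (- (2 * t / R\<^sup>2))"
definition wt :: "(real => real) => bool" where
  "wt w \<longleftrightarrow> continuous_on UNIV w \<and> (\<forall>t. R < abs t --> w t = 0)"
definition kk :: "(real => real) => (real => real) => real => real => real" where
  "kk u w s t = u ((s - t) / \<epsilon>) * (w t * exp (- \<phi> t))"
definition \<rho>1 :: "real => real" where "\<rho>1 z = (1 / \<epsilon>) * \<rho> z"

abbreviation "q \<equiv> kk \<rho>1 kap"

text \<open>Dividing by the density \<open>exp \<circ> \<phi>\<close> in \<open>kk\<close> turns integration against the target law into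
  integration against Lebesgue measure, so \<open>q\<close> mollifies at scale \<open>\<epsilon>\<close> and cuts off at radius R.\<close>

lemma rho1: "\<rho>1 \<in> bumps" "0 <= \<rho>1 z"
  unfolding \<rho>1_def[abs_def] using bumps_scale[OF rho(1), of "1 / \<epsilon>"] rho(2) eps by auto

lemma beyond_R: "R < abs t ==> 1 - (t / R)\<^sup>2 <= 0"
proof -
  assume "R < abs t"
  then have "1 <= abs (t / R)" using R by (simp add: field_simps)
  then have "1\<^sup>2 <= (abs (t / R))^2" by (intro power_mono) auto
  then show ?thesis by (simp only: power2_abs) simp
qed

lemma kap_deriv: "(kap has_real_derivative kap' t) (at t)"
proof -
  have "((%t. 1 - (t / R)\<^sup>2) has_real_derivative - (2 * t / R\<^sup>2)) (at t)"
    using R by (auto intro!: derivative_eq_intros simp: power2_eq_square)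
  from DERIV_chain2[OF max_sq_deriv this] show ?thesis unfolding kap_def[abs_def] kap'_def .
qed

lemma wt_kap: "wt kap" "wt kap'"
proof -
  have z: "max 0 (1 - (t / R)\<^sup>2) = 0" if "R < abs t" for t using beyond_R[OF that] by simp
  have c: "continuous_on UNIV (%t. max 0 (1 - (t / R)\<^sup>2))" using R by (intro continuous_intros) auto
  show "wt kap" unfolding wt_def kap_def[abs_def] using z c by (auto intro!: continuous_on_power)
  show "wt kap'" unfolding wt_def kap'_def[abs_def] using z c R
    by (intro conjI continuous_on_mult continuous_on_const continuous_intros allI impI) auto
qed

lemma kap_bounds: "0 <= kap t" "kap t <= 1" "abs (kap t) <= 1"
proof -
  have "(max 0 (1 - (t / R)\<^sup>2))^2 <= 1\<^sup>2" by (intro power_mono) auto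
  then show "0 <= kap t" "kap t <= 1" "abs (kap t) <= 1" by (auto simp: kap_def)
qed

lemma kap_lower: "1 - 2 * (t / R)^2 <= kap t"
proof (cases "(t / R)^2 <= 1")
  case True
  then have "kap t = 1 - 2 * (t / R)^2 + ((t / R)^2)^2" unfolding kap_def by (simp add: power2_eq_square algebra_simps)
  then show ?thesis by simp
next
  case False then show ?thesis using kap_bounds(1)[of t] by linarith
qed

lemma kap'_bound: "abs (kap' t) <= 4 / R"
proof (cases "R < abs t")
  case True
  then show ?thesis using wt_kap(2) R by (simp add: wt_def)
next
  case False
  let ?m = "max 0 (1 - (t / R)\<^sup>2)"
  have "abs (kap' t) = ?m * (4 * abs t / R\<^sup>2)" unfolding kap'_def by (simp add: abs_mult)
  also have "... <= 1 * (4 * R / R\<^sup>2)" using False R by (intro mult_mono divide_right_mono) auto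
  also have "... = 4 / R" using R by (simp add: power2_eq_square)
  finally show ?thesis .
qed

lemma wt_meas: "wt w ==> w \<in> borel_measurable borel"
  by (auto simp: wt_def intro: borel_measurable_continuous_onI)

lemma wt_exp_bounded: "wt w ==> \<exists>C. \<forall>t. abs (w t * exp (- \<phi> t)) <= C"
  by (rule bounded_compact_support[where R=R]) (auto simp: wt_def intro!: continuous_intros phi_cont)

lemma kk_kern:
  assumes u: "u \<in> bumps" and w: "wt w"
  shows "T.kern (kk u w)"
  unfolding T.kern_def
proof
  note [measurable] = bumps_meas[OF u] wt_meas[OF w]
  show "(%(s, t). kk u w s t) \<in> borel_measurable (borel \<Otimes>\<^sub>M borel)" unfolding kk_def by measurable
  obtain C where C: "!!z. abs (u z) <= C" using bumps_bounded[OF u] by blast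
  obtain C' where C': "!!t. abs (w t * exp (- \<phi> t)) <= C'" using wt_exp_bounded[OF w] by blast
  have "abs (kk u w s t) <= C * C'" for s t
    unfolding kk_def abs_mult[of "u _"] using C C' order.trans[OF abs_ge_zero C] by (intro mult_mono) auto
  then show "\<exists>C. \<forall>s t. abs (kk u w s t) <= C" by blast
qed

lemma kk_cont: "u \<in> bumps ==> continuous_on UNIV (%s. kk u w s t)"
  unfolding kk_def
  using eps by (intro continuous_on_mult continuous_on_const continuous_on_compose2[OF bumps_cont, of u UNIV]) (auto intro!: continuous_intros)

lemma kk_deriv_s:
  assumes u': "!!z. (u has_real_derivative u' z) (at z)"
  shows "((%s. kk u w s t) has_real_derivative kk (%z. (1 / \<epsilon>) * u' z) w s t) (at s)"
proof -
  have "((%s. (s - t) / \<epsilon>) has_real_derivative 1 / \<epsilon>) (at s)" using eps by (auto intro!: derivative_eq_intros)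
  from DERIV_cmult_right[OF DERIV_chain2[OF u' this], of "w t * exp (- \<phi> t)"]
  show ?thesis unfolding kk_def by (simp add: mult_ac)
qed

text \<open>Minus the s-derivative, the differentiated cutoff, and a term with -d from dividing by
  the density; the last one cancels the drift in \<open>VV\<close>.\<close>

lemma kk_deriv_t:
  assumes u': "!!z. (u has_real_derivative u' z) (at z)"
  shows "((%t. kk u kap s t) has_real_derivative - kk (%z. (1 / \<epsilon>) * u' z) kap s t + kk u kap' s t - d t * kk u kap s t) (at t)"
proof -
  have "((%t. (s - t) / \<epsilon>) has_real_derivative - (1 / \<epsilon>)) (at t)" using eps by (auto intro!: derivative_eq_intros)
  from DERIV_chain2[OF u' this] have 1: "((%t. u ((s - t) / \<epsilon>)) has_real_derivative u' ((s - t) / \<epsilon>) * - (1 / \<epsilon>)) (at t)" .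
  have 2: "((%t. exp (- \<phi> t)) has_real_derivative exp (- \<phi> t) * (- d t)) (at t)"
    by (rule DERIV_fun_exp[OF DERIV_minus[OF d_deriv]])
  from DERIV_mult[OF 1 DERIV_mult[OF kap_deriv 2]] show ?thesis unfolding kk_def
    by (rule DERIV_cong) (simp add: algebra_simps)
qed

lemma kk_zero:
  assumes "u \<in> bumps" "wt w" "R + \<epsilon> < abs s \<or> R < abs t"
  shows "kk u w s t = 0"
proof (cases "R < abs t")
  case True
  then show ?thesis using assms by (simp add: kk_def wt_def)
next
  case False
  then have "\<epsilon> <= abs (s - t)" using assms by linarith
  then have "1 <= abs ((s - t) / \<epsilon>)" using eps by (simp add: field_simps)
  then show ?thesis using bumps_supp[OF assms(1)] by (simp add: kk_def)
qed

text \<open>Coinduction over all families of profiles in \<open>bumps\<close>: a partial derivative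
  replaces one profile by its scaled derivative, which lies in \<open>bumps\<close> again.\<close>

lemma UU_smooth:
  assumes h: "h \<in> sqi P" and B: "!!j. \<beta> j \<in> bumps"
  shows "smoothN N (T.UU N (%j. kk (\<beta> j) kap) h)"
proof (rule smoothN.coinduct[where X="%f. \<exists>\<beta>. (\<forall>j. \<beta> j \<in> bumps) \<and> f = T.UU N (%j. kk (\<beta> j) kap) h"])
  show "\<exists>\<beta>'. (\<forall>j. \<beta>' j \<in> bumps) \<and> T.UU N (%j. kk (\<beta> j) kap) h = T.UU N (%j. kk (\<beta>' j) kap) h" using B by blast
  fix f assume "\<exists>\<beta>. (\<forall>j. \<beta> j \<in> bumps) \<and> f = T.UU N (%j. kk (\<beta> j) kap) h"
  then obtain \<beta> where B: "!!j. \<beta> j \<in> bumps" and f: "f = T.UU N (%j. kk (\<beta> j) kap) h" by blast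
  have kB: "T.kern (kk (\<beta> j) kap)" for j by (rule kk_kern[OF B wt_kap(1)])
  have st: "(\<forall>x. ((%t. f (x(i := t))) has_real_derivative partial i f x) (at (x i))) \<and>
     (\<exists>\<beta>. (\<forall>j. \<beta> j \<in> bumps) \<and> partial i f = T.UU N (%j. kk (\<beta> j) kap) h)" if i: "i < N" for i
  proof -
    obtain v where v: "v \<in> bumps" "!!z. (\<beta> i has_real_derivative v z) (at z)" using bumps_deriv[OF B] by blast
    let ?v = "%z. (1 / \<epsilon>) * v z"
    have vb: "?v \<in> bumps" by (rule bumps_scale[OF v(1)])
    have e: "(%j. kk (\<beta> j) kap)(i := kk ?v kap) = (%j. kk ((\<beta>(i := ?v)) j) kap)" by (auto simp: fun_eq_iff)
    note D = T.UU_deriv[where B="%j. kk (\<beta> j) kap" and i=i and N=N and B'="kk ?v kap", OF kB h i kk_deriv_s[OF v(2)] kk_kern[OF vb wt_kap(1)]]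
    have p: "partial i f = T.UU N (%j. kk ((\<beta>(i := ?v)) j) kap) h"
      unfolding f by (rule ext) (simp only: D(2) e)
    have "((%t. f (x(i := t))) has_real_derivative partial i f x) (at (x i))" for x
      using D(1)[of x "x i"] unfolding f D(2) by (simp only: fun_upd_triv)
    moreover have "\<forall>j. (\<beta>(i := ?v)) j \<in> bumps" using B vb by simp
    ultimately show ?thesis using p by blast
  qed
  have c: "continuous_on UNIV f" unfolding f by (rule T.UU_cont[OF kB h kk_cont[OF B]])
  show "\<exists>g. f = g \<and> depends_first N g \<and> continuous_on UNIV g \<and> (\<forall>i<N. (\<forall>x. ((%t. g (x(i := t))) has_real_derivative partial i g x) (at (x i))) \<and>
     ((\<exists>\<beta>. (\<forall>j. \<beta> j \<in> bumps) \<and> partial i g = T.UU N (%j. kk (\<beta> j) kap) h) \<or> smoothN N (partial i g)))"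
    using st c T.UU_dep[of N _ h] f by blast
qed

section \<open>Norm bounds for the mollifier and its commutators with derivatives\<close>

definition TT :: "((nat => real) => real) => (nat => real) => real" where "TT = T.UU N (%j. q)"
definition MM :: "nat => ((nat => real) => real) => (nat => real) => real" where "MM i = T.UU N ((%j. q)(i := kk \<rho>1 kap'))"

lemma TT_C0inf:
  assumes h: "h \<in> sqi P"
  shows "TT h \<in> C0inf N"
proof -
  have "abs (x i) <= R + \<epsilon>" if "TT h x \<noteq> 0" "i < N" for x i
  proof (rule ccontr)
    assume "\<not> abs (x i) <= R + \<epsilon>"
    then have "q (x i) (y i) = 0" for y :: "nat => real" by (intro kk_zero rho1 wt_kap) auto
    then have "(\<Prod>j<N. q (x j) (y j)) = 0" for y :: "nat => real" using \<open>i < N\<close> by (auto intro!: prod_zero)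
    then have "TT h x = 0" unfolding TT_def T.UU_def by (simp only: mult_zero_right integral_zero)
    then show False using that by simp
  qed
  then show ?thesis using UU_smooth[OF h, of "%j. \<rho>1"] rho1 by (auto simp: C0inf_def TT_def)
qed

lemma rho1_affine:
  assumes a: "a = 1 / \<epsilon> \<or> a = - (1 / \<epsilon>)"
  shows "integrable lborel (%t. \<rho>1 (c + a * t))" "(LINT t|lborel. \<rho>1 (c + a * t)) = 1"
proof -
  have a0: "a \<noteq> 0" "abs a = 1 / \<epsilon>" using a eps by auto
  have "integrable lborel (%t. \<rho> (c + a * t))" by (rule lborel_integrable_real_affine[OF rho(3) a0(1)])
  then show "integrable lborel (%t. \<rho>1 (c + a * t))" by (simp add: \<rho>1_def)
  have "1 = abs a * (LINT t|lborel. \<rho> (c + a * t))" using lborel_integral_real_affine[OF a0(1), of \<rho> c] rho(4) by simp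
  then show "(LINT t|lborel. \<rho>1 (c + a * t)) = 1" by (simp only: \<rho>1_def a0(2) integral_mult_right_zero)
qed

lemma rho1_integral_t: "integrable lborel (%t. \<rho>1 ((s - t) / \<epsilon>))" "(LINT t|lborel. \<rho>1 ((s - t) / \<epsilon>)) = 1"
  using rho1_affine[of "- (1 / \<epsilon>)" "s / \<epsilon>"] by (simp_all add: diff_divide_distrib)

lemma rho1_integral_s: "integrable lborel (%s. \<rho>1 ((s - t) / \<epsilon>))" "(LINT s|lborel. \<rho>1 ((s - t) / \<epsilon>)) = 1"
  using rho1_affine[of "1 / \<epsilon>" "- t / \<epsilon>"] by (simp_all add: diff_divide_distrib)

lemma kk_target:
  assumes w: "wt w"
  shows "(LINT t|target \<phi>. kk \<rho>1 w s t) = (LINT t|lborel. \<rho>1 ((s - t) / \<epsilon>) * w t)"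
    "(LINT t|target \<phi>. abs (kk \<rho>1 w s t)) = (LINT t|lborel. \<rho>1 ((s - t) / \<epsilon>) * abs (w t))"
proof -
  have [measurable]: "(%t. kk \<rho>1 w s t) \<in> borel_measurable borel"
    by (rule T.kern_raw[OF kk_kern[OF rho1(1) w]]) auto
  have e: "exp (\<phi> t) * kk \<rho>1 w s t = \<rho>1 ((s - t) / \<epsilon>) * w t" for t
    by (simp add: kk_def exp_minus)
  have e2: "exp (\<phi> t) * abs (kk \<rho>1 w s t) = \<rho>1 ((s - t) / \<epsilon>) * abs (w t)" for t
    by (simp add: kk_def exp_minus abs_mult rho1)
  show "(LINT t|target \<phi>. kk \<rho>1 w s t) = (LINT t|lborel. \<rho>1 ((s - t) / \<epsilon>) * w t)"
    by (subst target_integral) (simp_all add: e)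
  show "(LINT t|target \<phi>. abs (kk \<rho>1 w s t)) = (LINT t|lborel. \<rho>1 ((s - t) / \<epsilon>) * abs (w t))"
    by (subst target_integral) (simp_all add: e2)
qed

text \<open>Integrating over t cancels the density exactly and leaves the mollifier, of mass 1,
  against the weight.\<close>

lemma schur_a:
  assumes w: "wt w" and c: "!!t. abs (w t) <= c"
  shows "(LINT t|target \<phi>. abs (kk \<rho>1 w s t)) <= c"
proof -
  have "(LINT t|lborel. \<rho>1 ((s - t) / \<epsilon>) * abs (w t)) <= (LINT t|lborel. \<rho>1 ((s - t) / \<epsilon>) * c)"
    by (rule integral_mono') (use rho1_integral_t(1) rho1 c order.trans[OF abs_ge_zero c] in \<open>auto intro: mult_left_mono\<close>)
  also have "... = c" by (simp add: rho1_integral_t)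
  finally show ?thesis unfolding kk_target[OF w] .
qed

text \<open>Integrating over s leaves the density ratio exp(\<phi> s - \<phi> t), which
  \<open>osc\<close> bounds where the kernel is nonzero; this is the loss of exp(1/(N+1)) per
  coordinate.\<close>

lemma schur_b:
  assumes w: "wt w" and c: "!!t. abs (w t) <= c"
  shows "(LINT s|target \<phi>. abs (kk \<rho>1 w s t)) <= c * exp (1 / (real N + 1))"
proof -
  have [measurable]: "(%s. kk \<rho>1 w s t) \<in> borel_measurable borel"
    by (rule T.kern_raw[OF kk_kern[OF rho1(1) w]]) auto
  have c0: "0 <= c" using order.trans[OF abs_ge_zero c] .
  have pt: "exp (\<phi> s) * abs (kk \<rho>1 w s t) <= \<rho>1 ((s - t) / \<epsilon>) * (c * exp (1 / (real N + 1)))" for s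
  proof (cases "R < abs t \<or> \<epsilon> < abs (s - t)")
    case True
    then have "kk \<rho>1 w s t = 0"
    proof
      assume "\<epsilon> < abs (s - t)"
      then have "1 <= abs ((s - t) / \<epsilon>)" using eps by (simp add: field_simps)
      then show ?thesis using bumps_supp[OF rho1(1)] by (simp add: kk_def)
    qed (use kk_zero[OF rho1(1) w] in blast)
    then show ?thesis using rho1 c0 by simp
  next
    case False
    then have "abs (\<phi> s - \<phi> t) <= 1 / (real N + 1)" by (intro osc) auto
    then have "exp (\<phi> s + - \<phi> t) <= exp (1 / (real N + 1))" by simp
    then have "\<rho>1 ((s - t) / \<epsilon>) * (abs (w t) * exp (\<phi> s + - \<phi> t)) <= \<rho>1 ((s - t) / \<epsilon>) * (c * exp (1 / (real N + 1)))"
      using c c0 by (intro mult_left_mono mult_mono rho1) auto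
    moreover have "exp (\<phi> s) * abs (kk \<rho>1 w s t) = \<rho>1 ((s - t) / \<epsilon>) * (abs (w t) * exp (\<phi> s + - \<phi> t))"
      by (simp only: kk_def abs_mult exp_add abs_exp_cancel abs_of_nonneg[OF rho1(2)] mult_ac)
    ultimately show ?thesis by simp
  qed
  have "(LINT s|target \<phi>. abs (kk \<rho>1 w s t)) = (LINT s|lborel. exp (\<phi> s) * abs (kk \<rho>1 w s t))"
    by (subst target_integral) auto
  also have "... <= (LINT s|lborel. \<rho>1 ((s - t) / \<epsilon>) * (c * exp (1 / (real N + 1))))"
    by (rule integral_mono'[OF _ pt]) (use rho1_integral_s(1) c0 rho1(2) in auto)
  also have "... = c * exp (1 / (real N + 1))" by (simp add: rho1_integral_s)
  finally show ?thesis .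
qed

lemma exp_prod_le: "exp (1 / (real N + 1)) ^ N <= 3"
proof -
  have "exp (1 / (real N + 1)) ^ N = exp (real N * (1 / (real N + 1)))" by (simp only: exp_of_nat_mult)
  also have "... <= exp 1" by (simp add: field_simps)
  also have "... <= 3" by (rule exp_le)
  finally show ?thesis .
qed

lemma TT_bound:
  assumes h: "h \<in> sqi P"
  shows "TT h \<in> sqi P" "(l2 P (TT h))^2 <= 3 * (l2 P h)^2"
proof -
  note S = T.UU_schur[where B="%j. q" and N=N and a="%j. 1" and b="%j. 1 * exp (1 / (real N + 1))",
    OF kk_kern[OF rho1(1) wt_kap(1)] h schur_a[OF wt_kap(1) kap_bounds(3)] schur_b[OF wt_kap(1) kap_bounds(3)]]
  show "TT h \<in> sqi P" unfolding TT_def by (rule S(1))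
  have "(l2 P (TT h))^2 <= exp (1 / (real N + 1)) ^ N * (l2 P h)^2" using S(2) by (simp add: TT_def l2_sq)
  also have "... <= 3 * (l2 P h)^2" by (intro mult_right_mono exp_prod_le) simp
  finally show "(l2 P (TT h))^2 <= 3 * (l2 P h)^2" .
qed

text \<open>In coordinate i the differentiated cutoff, of size 4/R, enters both marginal masses;
  with the factor 3 from the densities this gives 48. Hence the commutator vanishes as R grows,
  uniformly in N.\<close>

lemma MM_bound:
  assumes h: "h \<in> sqi P" and i: "i < N"
  shows "MM i h \<in> sqi P" "(l2 P (MM i h))^2 <= 48 / R\<^sup>2 * (l2 P h)^2"
proof -
  let ?e = "exp (1 / (real N + 1))"
  let ?B = "(%j. q)(i := kk \<rho>1 kap')" and ?a = "%j. if j = i then 4 / R else 1"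
  let ?b = "%j. ?a j * ?e"
  have B: "T.kern (?B j)" for j using kk_kern[OF rho1(1)] wt_kap by simp
  have a: "(LINT t|target \<phi>. abs (?B j s t)) <= ?a j" for j s
    using schur_a[OF wt_kap(1) kap_bounds(3)] schur_a[OF wt_kap(2) kap'_bound] by simp
  have b: "(LINT s|target \<phi>. abs (?B j s t)) <= ?b j" for j t
    using schur_b[OF wt_kap(1) kap_bounds(3), of t] schur_b[OF wt_kap(2) kap'_bound, of t] by simp
  note S = T.UU_schur[where B="?B" and N=N and a="?a" and b="?b", OF B h a b]
  show "MM i h \<in> sqi P" unfolding MM_def by (rule S(1))
  have pa: "(\<Prod>j<N. ?a j) = 4 / R" using i by (simp add: prod.delta)
  have pb: "(\<Prod>j<N. ?b j) = 4 / R * ?e ^ N" by (simp only: prod.distrib pa prod_constant card_lessThan)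
  have "(l2 P (MM i h))^2 <= (\<Prod>j<N. ?a j) * (\<Prod>j<N. ?b j) * (l2 P h)^2" using S(2) by (simp add: MM_def l2_sq)
  also have "... = ?e ^ N * (16 / R\<^sup>2 * (l2 P h)^2)" unfolding pa pb by (simp add: power2_eq_square)
  also have "... <= 3 * (16 / R\<^sup>2 * (l2 P h)^2)" by (intro mult_right_mono exp_prod_le) simp
  finally show "(l2 P (MM i h))^2 <= 48 / R\<^sup>2 * (l2 P h)^2" by simp
qed

text \<open>For fixed x the kernel is a test field in y. By \<open>kk_deriv_t\<close> its adjoint
  field consists of minus the x-derivative of the kernel and the differentiated cutoff, so the weak
  derivative of h passes under the operator up to the commutator \<open>MM i h\<close>.\<close>

lemma TT_partial:
  assumes h: "h \<in> sqi P" and i: "i < N" and G: "G \<in> sqi P"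
    and ibp: "!!\<xi>. testf i \<xi> ==> - (LINT y|P. h y * VV i \<xi> y) = (LINT y|P. G y * \<xi> y)"
  shows "partial i (TT h) x = TT G x + MM i h x"
proof -
  obtain v where v: "v \<in> bumps" "!!z. (\<rho>1 has_real_derivative v z) (at z)" using bumps_deriv[OF rho1(1)] by blast
  let ?v = "%z. (1 / \<epsilon>) * v z"
  have vb: "?v \<in> bumps" by (rule bumps_scale[OF v(1)])
  let ?g = "%j t. q (x j) t" and ?g' = "%j t. - kk ?v kap (x j) t + kk \<rho>1 kap' (x j) t - d t * q (x j) t"
  let ?\<xi> = "%y. \<Prod>j<N. q (x j) (y j)" and ?r = "%y. \<Prod>j\<in>{..<N} - {i}. q (x j) (y j)"
  have cd: "continuous_on UNIV (%t. u ((s - t) / \<epsilon>))" if "u \<in> bumps" for u s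
    using eps by (intro continuous_on_compose2[OF bumps_cont[OF that]]) (auto intro!: continuous_intros)
  have ck: "continuous_on UNIV (kk u w s)" if "u \<in> bumps" "wt w" for u w s
    unfolding kk_def using that by (intro continuous_intros cd phi_cont) (auto simp: wt_def)
  have dw: "wt (%t. d t * kap t)" using wt_kap(1) by (auto simp: wt_def intro!: continuous_on_mult d_cont)
  have dk: "d t * q s t = kk \<rho>1 (%t. d t * kap t) s t" for s t by (simp add: kk_def)
  have g'c: "continuous_on UNIV (?g' j)" for j
    unfolding dk by (intro continuous_on_add continuous_on_diff continuous_on_minus ck rho1 wt_kap vb dw)
  obtain C1 where C1: "!!s t. abs (q s t) <= C1" using kk_kern[OF rho1(1) wt_kap(1)] by (auto simp: T.kern_def)
  obtain C2 where C2: "!!s t. abs (kk ?v kap s t) <= C2" using kk_kern[OF vb wt_kap(1)] unfolding T.kern_def by blast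
  obtain C3 where C3: "!!s t. abs (kk \<rho>1 kap' s t) <= C3" using kk_kern[OF rho1(1) wt_kap(2)] by (auto simp: T.kern_def)
  obtain C4 where C4: "!!s t. abs (d t * q s t) <= C4" using kk_kern[OF rho1(1) dw] unfolding dk by (auto simp: T.kern_def)
  let ?C = "1 + C1 + C2 + C3 + C4"
  have C0: "0 <= C1" "0 <= C2" "0 <= C3" "0 <= C4" using order.trans[OF abs_ge_zero C1] order.trans[OF abs_ge_zero C2] order.trans[OF abs_ge_zero C3] order.trans[OF abs_ge_zero C4] .
  have gb: "abs (?g j t) <= ?C" for j t using C1[of "x j" t] C0 by linarith
  have gb': "abs (?g' j t) <= ?C" for j t using C2[of "x j" t] C3[of "x j" t] C4[of t "x j"] C0 by linarith
  have C: "1 <= ?C" using C0 by linarith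
  note pc = prod_C1b[where g="?g" and g'="?g'" and C="?C" and N=N, OF kk_deriv_t[OF v(2)] g'c gb gb' C]
  have z: "?\<xi> y = 0" if "abs (y i) > R" for y
    unfolding prod_split[OF i, of "?g"] using kk_zero[OF rho1(1) wt_kap(1), of "x i" "y i"] that by simp
  have tf: "testf i ?\<xi>" unfolding testf_iff using pc(1) z by blast
  have V: "VV i ?\<xi> y = - (kk ?v kap (x i) (y i) * ?r y) + kk \<rho>1 kap' (x i) (y i) * ?r y" for y
  proof -
    have "VV i ?\<xi> y = (- kk ?v kap (x i) (y i) + kk \<rho>1 kap' (x i) (y i) - d (y i) * q (x i) (y i)) * ?r y + d (y i) * (q (x i) (y i) * ?r y)"
      unfolding VV_def by (simp only: pc(2)[OF i]) (simp only: prod_split[OF i, of "?g"])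
    then show ?thesis by (simp add: left_diff_distrib distrib_right)
  qed
  have kq: "T.kern q" "T.kern (kk ?v kap)" "T.kern (kk \<rho>1 kap')" by (intro kk_kern rho1 vb wt_kap)+
  have kv: "T.kern (((%j. q)(i := kk ?v kap)) j)" "T.kern (((%j. q)(i := kk \<rho>1 kap')) j)" for j using kq by simp_all
  have sp: "(\<Prod>j<N. ((%j. q)(i := b)) j (x j) (y j)) = b (x i) (y i) * ?r y" for b y
    unfolding prod_split[OF i, of "%j s. ((%j. q)(i := b)) j (x j) s"] by (simp cong: prod.cong_simp)
  have "(LINT y|P. h y * VV i ?\<xi> y) = (LINT y|P. h y * (kk \<rho>1 kap' (x i) (y i) * ?r y) - h y * (kk ?v kap (x i) (y i) * ?r y))"
    unfolding V by (intro Bochner_Integration.integral_cong refl) (simp add: right_diff_distrib)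
  also have "... = MM i h x - T.UU N ((%j. q)(i := kk ?v kap)) h x"
    unfolding MM_def T.UU_def sp
    by (rule Bochner_Integration.integral_diff) (rule T.UU_integrable[where B="(%j. q)(i := kk \<rho>1 kap')" and N=N and x=x, OF kv(2) h, unfolded sp]
        T.UU_integrable[where B="(%j. q)(i := kk ?v kap)" and N=N and x=x, OF kv(1) h, unfolded sp])+
  also have "T.UU N ((%j. q)(i := kk ?v kap)) h x = partial i (TT h) x"
    unfolding TT_def by (rule T.UU_deriv(2)[symmetric, OF kq(1) h i kk_deriv_s[OF v(2)] kq(2)])
  finally have "- (LINT y|P. h y * VV i ?\<xi> y) = partial i (TT h) x - MM i h x" by simp
  moreover have "(LINT y|P. G y * ?\<xi> y) = TT G x" by (simp add: TT_def T.UU_def)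
  ultimately show ?thesis using ibp[OF tf] by simp
qed

section \<open>Mass of the kernel and pointwise approximation\<close>

lemma q_kern: "T.kern q"
  by (intro kk_kern rho1 wt_kap)

lemma q_nonneg: "0 <= q s t"
  by (simp add: kk_def rho1 kap_bounds)

lemma q_mass:
  shows "integrable P (%y. \<Prod>j<N. q (x j) (y j))"
    "(LINT y|P. (\<Prod>j<N. q (x j) (y j))) = (\<Prod>j<N. \<integral>t. q (x j) t \<partial>target \<phi>)"
    "(LINT y|P. (\<Prod>j<N. q (x j) (y j))) <= 1"
proof -
  obtain C1 where C1: "!!s t. abs (q s t) <= C1" using q_kern by (auto simp: T.kern_def)
  have qi: "integrable (target \<phi>) (q s)" for s
    by (rule T.integrable_const_bound[where B=C1]) (use C1 in \<open>auto intro!: T.kern_raw[OF q_kern]\<close>)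
  show mass: "(LINT y|P. (\<Prod>j<N. q (x j) (y j))) = (\<Prod>j<N. \<integral>t. q (x j) t \<partial>target \<phi>)"
    and "integrable P (%y. \<Prod>j<N. q (x j) (y j))"
    using T.prod_expect[of "{..<N}" "%j t. q (x j) t"] qi by simp_all
  have m1: "(LINT t|target \<phi>. q (x j) t) <= 1" for j
    using schur_a[OF wt_kap(1) kap_bounds(3), of "x j"] by (simp add: q_nonneg)
  show "(LINT y|P. (\<Prod>j<N. q (x j) (y j))) <= 1"
    unfolding mass by (rule prod_le_1) (auto simp: m1 q_nonneg intro!: Bochner_Integration.integral_nonneg)
qed

text \<open>The kernel is nonnegative, lives within \<epsilon> of x in the first N coordinates, and
  has mass between the displayed product and 1. The oscillation of b gives the first error, the
  missing mass the second.\<close>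

lemma TT_local:
  assumes bm: "b \<in> sqi P" and C: "!!x. abs (b x) <= C" and loc: "!!y. (!!j. j < N ==> abs (x j - y j) <= \<epsilon>) ==> abs (b y - b x) <= \<eta>"
    and R2: "!!j. j < N ==> 2 * ((abs (x j) + 1) / R)^2 <= 1"
  shows "abs (TT b x - b x) <= \<eta> + C * (1 - (\<Prod>j<N. 1 - 2 * ((abs (x j) + 1) / R)^2))"
proof -
  let ?k = "%y. \<Prod>j<N. q (x j) (y j)" and ?l = "%j. 1 - 2 * ((abs (x j) + 1) / R)^2"
  let ?m = "%j. \<integral>t. q (x j) t \<partial>target \<phi>"
  note [measurable] = bumps_meas[OF rho1(1)] wt_meas[OF wt_kap(1)]
  have k0: "0 <= ?k y" for y by (intro prod_nonneg q_nonneg)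
  note ki = q_mass(1)[of x] and mass = q_mass(2)[of x] and up = q_mass(3)[of x]
  have bki: "integrable P (%y. b y * ?k y)" by (rule T.UU_integrable[OF q_kern bm])
  have ml: "?l j <= ?m j" for j
  proof -
    have pt: "\<rho>1 ((x j - t) / \<epsilon>) * ?l j <= \<rho>1 ((x j - t) / \<epsilon>) * kap t" for t
    proof (cases "abs (x j - t) < \<epsilon>")
      case True
      then have "abs t <= abs (x j) + 1" using eps by linarith
      then have "abs (t / R) <= (abs (x j) + 1) / R" using R by (simp add: divide_right_mono)
      from power_mono[OF this, of 2] have "(t / R)^2 <= ((abs (x j) + 1) / R)^2" by (simp only: power2_abs abs_ge_zero)
      then have "?l j <= kap t" using kap_lower[of t] by linarith
      then show ?thesis by (rule mult_left_mono) (rule rho1)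
    next
      case False
      then have "1 <= abs ((x j - t) / \<epsilon>)" using eps by (simp add: field_simps)
      then show ?thesis using bumps_supp[OF rho1(1)] by simp
    qed
    have "?l j = (LINT t|lborel. \<rho>1 ((x j - t) / \<epsilon>) * ?l j)" by (simp add: rho1_integral_t)
    also have "... <= (LINT t|lborel. \<rho>1 ((x j - t) / \<epsilon>) * kap t)"
    proof (rule integral_mono[OF _ _ pt])
      show "integrable lborel (%t. \<rho>1 ((x j - t) / \<epsilon>) * ?l j)" using rho1_integral_t by simp
      show "integrable lborel (%t. \<rho>1 ((x j - t) / \<epsilon>) * kap t)"
        by (rule integrable_dominated[OF rho1_integral_t(1)[of "x j"]]) (auto simp: rho1 kap_bounds mult_left_le)
    qed
    also have "... = ?m j" by (rule kk_target(1)[OF wt_kap(1), symmetric])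
    finally show ?thesis .
  qed
  have lo: "(\<Prod>j<N. ?l j) <= (LINT y|P. ?k y)" unfolding mass using ml R2 by (intro prod_mono) auto
  have \<eta>0: "0 <= \<eta>" using loc[of x] eps by simp
  have C0: "0 <= C" using order.trans[OF abs_ge_zero C] .
  have "abs (b y - b x) * ?k y <= \<eta> * ?k y" for y
  proof (cases "\<forall>j<N. abs (x j - y j) <= \<epsilon>")
    case True
    then show ?thesis by (intro mult_right_mono loc k0) auto
  next
    case False
    then obtain j where j: "j < N" "\<epsilon> < abs (x j - y j)" by auto
    then have "1 <= abs ((x j - y j) / \<epsilon>)" using eps by (simp add: field_simps)
    then have "q (x j) (y j) = 0" using bumps_supp[OF rho1(1)] by (simp add: kk_def)
    then have "?k y = 0" using j by (auto intro!: prod_zero)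
    then show ?thesis by (simp only: mult_zero_right)
  qed
  then have pt: "abs (b y * ?k y - b x * ?k y) <= \<eta> * ?k y" for y
    using k0[of y] by (simp only: left_diff_distrib[symmetric] abs_mult abs_of_nonneg)
  have d1: "abs (\<integral>y. b y * ?k y - b x * ?k y \<partial>P) <= (LINT y|P. \<eta> * ?k y)"
    by (rule order.trans[OF integral_abs_bound]) (intro integral_mono pt integrable_abs Bochner_Integration.integrable_diff bki integrable_mult_right ki)
  have d2: "(LINT y|P. \<eta> * ?k y) <= \<eta>" using mult_left_mono[OF up \<eta>0] by simp
  have d3: "(LINT y|P. b y * ?k y - b x * ?k y) = TT b x - b x * (LINT y|P. ?k y)"
    using Bochner_Integration.integral_diff[OF bki integrable_mult_right[OF ki, of "b x"]] by (simp add: TT_def T.UU_def)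
  have "abs (b x * (LINT y|P. ?k y) - b x) = abs (b x) * (1 - (LINT y|P. ?k y))"
  proof -
    have "b x * (LINT y|P. ?k y) - b x = b x * - (1 - (LINT y|P. ?k y))" by (simp add: algebra_simps)
    then show ?thesis using up by (simp only: abs_mult abs_minus_cancel abs_of_nonneg)
  qed
  also have "... <= C * (1 - (\<Prod>j<N. ?l j))"
    using C[of x] C0 lo up by (intro mult_mono) auto
  finally show ?thesis using d1 d2 d3 by linarith
qed

lemma TT_sup:
  assumes b: "b \<in> sqi P" and C: "!!x. abs (b x) <= C"
  shows "abs (TT b x) <= C"
proof -
  have C0: "0 <= C" using order.trans[OF abs_ge_zero C] .
  let ?k = "%y. \<Prod>j<N. q (x j) (y j)"
  note ki = q_mass(1)[of x] and up = q_mass(3)[of x]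
  have "abs (TT b x) <= (LINT y|P. C * ?k y)"
    unfolding TT_def T.UU_def
  proof (rule order.trans[OF integral_abs_bound], rule integral_mono')
    show "integrable P (%y. C * ?k y)" using ki by simp
    show "abs (b y * ?k y) <= C * ?k y" for y unfolding abs_mult using C[of y] prod_nonneg[of "{..<N}" "%j. q (x j) (y j)"] q_nonneg
      by (simp add: mult_right_mono)
  qed (auto simp: C0 q_nonneg intro!: mult_nonneg_nonneg prod_nonneg)
  also have "... <= C" using mult_left_mono[OF up C0] by simp
  finally show ?thesis .
qed

end

context mol begin

lemma TT_diff:
  assumes f: "f \<in> sqi P" and g: "g \<in> sqi P"
  shows "TT (%x. f x - g x) x = TT f x - TT g x"
proof -
  show ?thesis
    unfolding TT_def T.UU_def left_diff_distrib
    by (rule Bochner_Integration.integral_diff) (rule T.UU_integrable[where B="%j. q", OF q_kern f] T.UU_integrable[where B="%j. q", OF q_kern g])+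
qed

text \<open>The factor 2 dominates the square root of the 3 in \<open>TT_bound\<close>.\<close>

lemma TT_contraction: "h \<in> sqi P ==> l2 P (TT h) <= 2 * l2 P h"
proof -
  assume h: "h \<in> sqi P"
  have "(l2 P (TT h))^2 <= (2 * l2 P h)^2" unfolding power_mult_distrib
    by (rule order.trans[OF TT_bound(2)[OF h]]) simp
  then show ?thesis by (rule power2_le_imp_le) simp
qed

end

text \<open>A sequence violating the claim can be replaced by one that equals x beyond coordinate N
  without changing b; it then converges to x in the product topology, against continuity.\<close>

lemma cyl_local:
  fixes b :: "(nat => real) => real"
  assumes c: "continuous_on UNIV b" and d: "depends_first N b" and \<eta>: "0 < \<eta>"
  shows "\<exists>\<delta>>0. \<forall>y. (\<forall>j<N. abs (x j - y j) <= \<delta>) --> abs (b y - b x) < \<eta>"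
proof (rule ccontr)
  assume a: "\<not> ?thesis"
  have "\<exists>y. (\<forall>j<N. abs (x j - y j) <= 1 / (real n + 1)) \<and> \<eta> <= abs (b y - b x)" for n :: nat
  proof -
    have "0 < 1 / (real n + 1)" by simp
    then show ?thesis using a by (meson not_less)
  qed
  then obtain Y where Y: "!!n j. j < N ==> abs (x j - Y n j) <= 1 / (real n + 1)" "!!n. \<eta> <= abs (b (Y n) - b x)" by metis
  define Z where "Z n j = (if j < N then Y n j else x j)" for n j
  have bz: "b (Z n) = b (Y n)" for n by (rule depends_firstD[OF d]) (simp add: Z_def)
  have l0: "(%n. 1 / (real n + 1)) \<longlonglongrightarrow> 0" using LIMSEQ_inverse_real_of_nat by (simp add: inverse_eq_divide add.commute)
  have "Z \<longlonglongrightarrow> x"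
  proof (rule tendsto_seq_componentwise)
    fix j
    have "(%n. Z n j - x j) \<longlonglongrightarrow> 0"
      by (rule Lim_null_comparison[OF always_eventually l0]) (use Y(1)[of j] in \<open>auto simp: Z_def abs_minus_commute\<close>)
    then show "(%n. Z n j) \<longlonglongrightarrow> x j" by (rule LIM_zero_cancel)
  qed
  then have "(%n. b (Z n)) \<longlonglongrightarrow> b x" by (intro continuous_on_tendsto_compose[OF c]) auto
  from tendstoD[OF this \<eta>] have "\<forall>\<^sub>F n in sequentially. abs (b (Y n) - b x) < \<eta>" by (simp add: dist_real_def bz)
  then obtain n where "abs (b (Y n) - b x) < \<eta>" by (auto simp: eventually_sequentially)
  then show False using Y(2)[of n] by simp
qed

text \<open>Uniform continuity of \<phi> on an interval longer than the cutoff by 1 on each side,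
  since a shift by at most 1 may leave the cutoff interval.\<close>

lemma (in mh_rate) mol_exists:
  assumes r: "\<rho> \<in> bumps" "!!z. 0 <= \<rho> z" "integrable lborel \<rho>" "(LINT z|lborel. \<rho> z) = 1"
  shows "\<exists>e. mol \<phi> \<tau> K p \<kappa> \<rho> N (real m + 1) e \<and> e <= 1 / (real m + 1)"
proof -
  let ?S = "{- (real m + 2)..real m + 2}"
  have "uniformly_continuous_on ?S \<phi>"
    by (intro compact_uniformly_continuous continuous_on_subset[OF phi_cont]) auto
  moreover have "0 < 1 / (real N + 1)" by simp
  ultimately obtain dl where dl: "0 < dl" "!!s t. s \<in> ?S ==> t \<in> ?S ==> dist s t < dl ==> dist (\<phi> s) (\<phi> t) < 1 / (real N + 1)"
    unfolding uniformly_continuous_on_def by metis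
  define e where "e = min (dl / 2) (1 / (real m + 1))"
  have e: "0 < e" "e < dl" "e <= 1 / (real m + 1)" using dl(1) by (auto simp: e_def min_def)
  have "1 / (real m + 1) <= 1" by simp
  then have e1: "e <= 1" using e(3) by linarith
  have "mol \<phi> \<tau> K p \<kappa> \<rho> N (real m + 1) e"
  proof (intro mol.intro mol_axioms.intro)
    fix s t assume st: "abs t <= real m + 1" "abs (s - t) <= e"
    then have "s \<in> ?S" "t \<in> ?S" "dist s t < dl" using e e1 by (auto simp: dist_real_def)
    from dl(2)[OF this] show "abs (\<phi> s - \<phi> t) <= 1 / (real N + 1)" by (simp add: dist_real_def)
  qed (use r e e1 mh_rate_axioms in auto)
  then show ?thesis using e by blast
qed

lemma sq_split: "(l2 M (%x. f x + g x))^2 <= 2 * (l2 M f)^2 + 2 * (l2 M g)^2" if "f \<in> sqi M" "g \<in> sqi M"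
proof -
  have "(l2 M (%x. f x + g x))^2 <= (l2 M f + l2 M g)^2" by (intro power_mono l2_triangle that) simp
  also have "... <= 2 * (l2 M f)^2 + 2 * (l2 M g)^2" using sum_squares_bound[of "l2 M f" "l2 M g"] by (simp add: power2_sum)
  finally show ?thesis .
qed

lemma sum_lt_const: "0 <= a ==> (\<Sum>i<M. if i < n then a else 0) <= real n * a" for n M :: nat and a :: real
proof -
  assume a: "0 <= a"
  have "(\<Sum>i<M. if i < n then a else 0) = (\<Sum>i\<in>{..<M} \<inter> {..<n}. a)"
    by (subst sum.inter_restrict) auto
  also have "... = real (card ({..<M} \<inter> {..<n})) * a" by simp
  also have "... <= real n * a" using card_mono[of "{..<n}" "{..<M} \<inter> {..<n}"] a by (intro mult_right_mono) auto
  finally show ?thesis .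
qed

section \<open>Simultaneous approximation of a function and its weak gradient\<close>

locale molseq = mh_rate \<phi> \<tau> K p \<kappa> for \<phi> \<tau> K p \<kappa> +
  fixes \<rho> :: "real => real" and e :: "nat => nat => real"
  assumes m: "!!N m. mol \<phi> \<tau> K p \<kappa> \<rho> N (real m + 1) (e N m)" and e_le: "!!N m. e N m <= 1 / (real m + 1)"
begin

abbreviation "V N k \<equiv> mol.TT \<phi> \<rho> N (real k + 1) (e N k)"
abbreviation "W N k \<equiv> mol.MM \<phi> \<rho> N (real k + 1) (e N k)"

text \<open>At a fixed point the missing mass tends to 0 as the radius grows, and the scale, at most
  1/(k+1), makes the oscillation small. The uniform bound 2C gives convergence in norm.\<close>

lemma V_cyl:
  assumes b: "T.cyl b" and d: "depends_first N b"
  shows "(%k. l2 P (%x. V N k b x - b x)) \<longlonglongrightarrow> 0"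
proof -
  have bs: "b \<in> sqi P" by (rule T.cyl_sqi[OF b])
  obtain C where C: "!!x. abs (b x) <= C" and c: "continuous_on UNIV b" using b by (auto simp: T.cyl_def)
  have l0: "(%n. 1 / (real n + 1)) \<longlonglongrightarrow> 0" using LIMSEQ_inverse_real_of_nat by (simp add: inverse_eq_divide add.commute)
  have Cp: "0 <= C" using order.trans[OF abs_ge_zero C] .
  show ?thesis
  proof (rule l2_dominated[where g="%x. 2 * C"])
    show "V N k b \<in> borel_measurable P" for k by (rule sqi_meas[OF mol.TT_bound(1)[OF m bs]])
    show "b \<in> borel_measurable P" by (rule sqi_meas[OF bs])
    show "(%x. 2 * C) \<in> sqi P" by (rule T.Q.sqi_bounded[where C="2 * C"]) (use Cp in auto)
    show "abs (V N k b x - b x) <= 2 * C" for k x using mol.TT_sup[OF m bs C, of N k x] C[of x] by linarith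
    show "AE x in P. (%k. V N k b x) \<longlonglongrightarrow> b x"
    proof (rule AE_I2, rule tendstoI)
      fix x and \<eta> :: real assume \<eta>: "0 < \<eta>"
      obtain dl where dl: "0 < dl" "!!y. (!!j. j < N ==> abs (x j - y j) <= dl) ==> abs (b y - b x) < \<eta> / 2"
        using cyl_local[OF c d, of "\<eta> / 2" x] \<eta> by auto
      let ?t = "%k j. 2 * ((abs (x j) + 1) / (real k + 1))^2"
      have t0: "(%k. ?t k j) \<longlonglongrightarrow> 0" for j
        using tendsto_mult[OF tendsto_const[of 2] tendsto_power[OF tendsto_mult[OF tendsto_const[of "abs (x j) + 1"] l0], of 2]] by simp
      have "(%k. C * (1 - (\<Prod>j<N. 1 - ?t k j))) \<longlonglongrightarrow> C * (1 - (\<Prod>j<N. 1 - 0))"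
        by (intro tendsto_intros t0)
      then have "(%k. C * (1 - (\<Prod>j<N. 1 - ?t k j))) \<longlonglongrightarrow> 0" by simp
      then have e1: "\<forall>\<^sub>F k in sequentially. C * (1 - (\<Prod>j<N. 1 - ?t k j)) < \<eta> / 2" by (rule order_tendstoD(2)) (use \<eta> in simp)
      have e2: "\<forall>\<^sub>F k in sequentially. \<forall>j\<in>{..<N}. ?t k j < 1"
        by (intro eventually_ball_finite ballI order_tendstoD(2)[OF t0]) auto
      have e3: "\<forall>\<^sub>F k in sequentially. 1 / (real k + 1) < dl" by (rule order_tendstoD(2)[OF l0 dl(1)])
      show "\<forall>\<^sub>F k in sequentially. dist (V N k b x) (b x) < \<eta>"
        using e1 e2 e3
      proof eventually_elim
        case (elim k)
        have "abs (V N k b x - b x) <= \<eta> / 2 + C * (1 - (\<Prod>j<N. 1 - ?t k j))"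
        proof (rule mol.TT_local[OF m bs C])
          show "abs (b y - b x) <= \<eta> / 2" if "!!j. j < N ==> abs (x j - y j) <= e N k" for y
          proof (rule less_imp_le, rule dl(2))
            fix j assume "j < N"
            then show "abs (x j - y j) <= dl" using that[of j] e_le[of N k] elim(3) by linarith
          qed
          show "?t k j <= 1" if "j < N" for j using bspec[OF elim(2), of j] that by simp
        qed
        then show ?case using elim(1) by (simp add: dist_real_def)
      qed
    qed
  qed
qed

text \<open>Density of cylinder functions combined with a norm bound uniform in N and k; the
  approximating cylinder function is captured once N reaches its dimension.\<close>

lemma V_lim:
  assumes h: "h \<in> sqi P" and \<eta>: "0 < \<eta>"
  shows "\<exists>N1. \<forall>N\<ge>N1. \<forall>\<^sub>F k in sequentially. l2 P (%x. V N k h x - h x) < \<eta>"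
proof -
  obtain b where b: "T.cyl b" "l2 P (%x. h x - b x) < \<eta> / 4" using T.cyl_dense[OF h, of "\<eta> / 4"] \<eta> by auto
  obtain N1 where N1: "depends_first N1 b" using b(1) by (auto simp: T.cyl_def)
  have bs: "b \<in> sqi P" by (rule T.cyl_sqi[OF b(1)])
  have "\<forall>\<^sub>F k in sequentially. l2 P (%x. V N k h x - h x) < \<eta>" if N: "N1 <= N" for N
  proof -
    have d: "depends_first N b" using N1 N by (auto simp: depends_first_def)
    have "\<forall>\<^sub>F k in sequentially. l2 P (%x. V N k b x - b x) < \<eta> / 4"
      by (rule order_tendstoD(2)[OF V_cyl[OF b(1) d]]) (use \<eta> in simp)
    then show ?thesis
    proof eventually_elim
      case (elim k)
      note s = mol.TT_bound(1)[OF m h, of N k] mol.TT_bound(1)[OF m bs, of N k]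
      have "l2 P (%x. V N k h x - V N k b x) = l2 P (V N k (%x. h x - b x))"
        by (rule arg_cong[where f="l2 P"]) (rule ext, rule mol.TT_diff[OF m h bs, symmetric])
      also have "... <= 2 * l2 P (%x. h x - b x)" by (rule mol.TT_contraction[OF m sqi_diff[OF h bs]])
      finally have 1: "l2 P (%x. V N k h x - V N k b x) < \<eta> / 2" using b(2) by linarith
      have 2: "l2 P (%x. V N k h x - h x) <= l2 P (%x. V N k h x - V N k b x) + l2 P (%x. V N k b x - h x)"
        by (rule l2_triangle_diff[OF s h])
      have 3: "l2 P (%x. V N k b x - h x) <= l2 P (%x. V N k b x - b x) + l2 P (%x. b x - h x)"
        by (rule l2_triangle_diff[OF s(2) bs h])
      show ?case using 1 2 3 elim b(2) l2_minus_commute[of P b h] by linarith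
    qed
  qed
  then show ?thesis by blast
qed

text \<open>The order of choices is a cut N0 beyond which G has energy below \<eta>, then the number
  N of mollified coordinates, then the radius index k. The radius can come last because a single
  commutator bound does not depend on N.\<close>

lemma grad_approx:
  fixes G :: "nat => (nat => real) => real"
  assumes h: "h \<in> sqi P" and G: "!!i. G i \<in> sqi P" and C: "!!M. (\<Sum>i<M. (l2 P (G i))^2) <= C"
    and ibp: "!!i \<xi>. testf i \<xi> ==> - (LINT y|P. h y * VV i \<xi> y) = (LINT y|P. G i y * \<xi> y)" and \<eta>: "0 < \<eta>"
  shows "\<exists>N u. u \<in> C0inf N \<and> (l2 P (%x. u x - h x))\<^sup>2 <= \<eta> \<and> (\<forall>M. (\<Sum>i<M. (l2 P (%x. partial i u x - G i x))^2) <= 22 * \<eta>)"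
proof -
  let ?g = "%i. (l2 P (G i))^2"
  have su: "summable ?g" by (rule summableI_nonneg_bounded[of _ C]) (use C in auto)
  obtain N0 where N0: "!!n. (\<Sum>i\<in>{N0..<n}. ?g i) < \<eta>"
  proof -
    from su[unfolded summable_Cauchy, rule_format, OF \<eta>] obtain N0 where "!!m n. N0 <= m ==> norm (sum ?g {m..<n}) < \<eta>" by blast
    from this[of N0] have "abs (\<Sum>i\<in>{N0..<n}. ?g i) < \<eta>" for n by simp
    then have "(\<Sum>i\<in>{N0..<n}. ?g i) < \<eta>" for n using abs_ge_self[of "\<Sum>i\<in>{N0..<n}. ?g i"] by (rule order.strict_trans1[rotated])
    then show ?thesis using that by blast
  qed
  define \<eta>0 where "\<eta>0 = \<eta> / (real N0 + 1)"
  have \<eta>0: "0 < \<eta>0" "real N0 * \<eta>0 <= \<eta>" using \<eta> by (auto simp: \<eta>0_def field_simps)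
  obtain n0 where n0: "!!N. n0 <= N ==> \<forall>\<^sub>F k in sequentially. l2 P (%x. V N k h x - h x) < sqrt \<eta>"
    using V_lim[OF h, of "sqrt \<eta>"] \<eta> by auto
  have "\<forall>i. \<exists>n1. \<forall>N\<ge>n1. \<forall>\<^sub>F k in sequentially. l2 P (%x. V N k (G i) x - G i x) < sqrt \<eta>0"
    using V_lim[OF G] \<eta>0 by simp
  from choice[OF this] obtain n1 where n1: "!!i N. n1 i <= N ==> \<forall>\<^sub>F k in sequentially. l2 P (%x. V N k (G i) x - G i x) < sqrt \<eta>0" by blast
  \<comment> \<open>Large enough for h and for each of the finitely many \<open>G i\<close> with i <
    N0 at once.\<close>
  define N where "N = n0 + N0 + (\<Sum>i<N0. n1 i)"
  have N: "n0 <= N" "N0 <= N" "i < N0 ==> n1 i <= N" for i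
    using member_le_sum[of i "{..<N0}" n1] by (auto simp: N_def)
  define \<eta>1 where "\<eta>1 = \<eta> / (real N + 1)"
  have \<eta>1: "0 < \<eta>1" "real N * \<eta>1 <= \<eta>" using \<eta> by (auto simp: \<eta>1_def field_simps)
  have ev1: "\<forall>\<^sub>F k in sequentially. l2 P (%x. V N k h x - h x) < sqrt \<eta>" by (rule n0[OF N(1)])
  have ev2: "\<forall>\<^sub>F k in sequentially. \<forall>i\<in>{..<N0}. l2 P (%x. V N k (G i) x - G i x) < sqrt \<eta>0"
    by (intro eventually_ball_finite ballI n1 N(3)) auto
  have "(%k. 48 * (inverse (real (Suc k)))^2 * (l2 P h)^2) \<longlonglongrightarrow> 48 * 0\<^sup>2 * (l2 P h)^2"
    by (intro tendsto_intros LIMSEQ_inverse_real_of_nat)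
  then have ev3: "\<forall>\<^sub>F k in sequentially. 48 * (inverse (real (Suc k)))^2 * (l2 P h)^2 < \<eta>1"
    by (rule order_tendstoD(2)) (use \<eta>1 in simp)
  from eventually_conj[OF ev1 eventually_conj[OF ev2 ev3]] obtain k where
    k1: "l2 P (%x. V N k h x - h x) < sqrt \<eta>" and k2: "!!i. i < N0 ==> l2 P (%x. V N k (G i) x - G i x) < sqrt \<eta>0"
    and k3: "48 * (inverse (real (Suc k)))^2 * (l2 P h)^2 < \<eta>1" by (auto simp: eventually_sequentially)
  let ?u = "V N k h"
  have u: "?u \<in> C0inf N" by (rule mol.TT_C0inf[OF m h])
  have "(l2 P (%x. ?u x - h x))^2 <= (sqrt \<eta>)^2" using k1 by (intro power_mono) auto
  then have a: "(l2 P (%x. ?u x - h x))^2 <= \<eta>" using \<eta> by simp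
  have W: "W N k i h \<in> sqi P" "(l2 P (W N k i h))^2 <= \<eta>1" if "i < N" for i
  proof -
    show "W N k i h \<in> sqi P" by (rule mol.MM_bound(1)[OF m h that])
    have "(l2 P (W N k i h))^2 <= 48 / (real k + 1)^2 * (l2 P h)^2" by (rule mol.MM_bound(2)[OF m h that])
    also have "48 / (real k + 1)^2 = 48 * (inverse (real (Suc k)))^2" by (simp add: inverse_eq_divide power_divide add.commute)
    finally show "(l2 P (W N k i h))^2 <= \<eta>1" using k3 by linarith
  qed
  \<comment> \<open>For i < N0 the mollified field is close to \<open>G i\<close>. For N0 <= i < N
    the difference is at most three times \<open>G i\<close> in norm, hence 2 * 9 = 18. For i >= N
    the derivative is 0 and the error is \<open>G i\<close> itself. The N commutators add
    \<open>2 * \<eta>1\<close> each, which gives 2 + 18 + 2 = 22 in total.\<close>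
  have t: "(l2 P (%x. partial i ?u x - G i x))^2 <= (if i < N0 then 2 * \<eta>0 else 0) + (if i < N0 then 0 else 18 * ?g i) + (if i < N then 2 * \<eta>1 else 0)" for i
  proof (cases "i < N")
    case False
    have "smoothN N ?u" using u by (simp add: C0inf_def)
    then have "depends_first N ?u" by (cases rule: smoothN.cases) auto
    then have "partial i ?u x = 0" for x by (rule partial_beyond) (use False in simp)
    then have "(l2 P (%x. partial i ?u x - G i x))^2 = ?g i" by (simp add: l2_def)
    then show ?thesis using False N(2) by simp
  next
    case True
    note s = mol.TT_bound(1)[OF m G[of i], of N k]
    let ?D = "%x. V N k (G i) x - G i x"
    have D: "?D \<in> sqi P" by (rule sqi_diff[OF s G])
    have "(%x. partial i ?u x - G i x) = (%x. ?D x + W N k i h x)"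
      using mol.TT_partial[OF m h True G ibp] by (auto simp: fun_eq_iff)
    then have le: "(l2 P (%x. partial i ?u x - G i x))^2 <= 2 * (l2 P ?D)^2 + 2 * \<eta>1"
      using sq_split[OF D W(1)[OF True]] W(2)[OF True] by simp
    show ?thesis
    proof (cases "i < N0")
      case i0: True
      have "(l2 P ?D)^2 <= (sqrt \<eta>0)^2" using k2[OF i0] by (intro power_mono) auto
      then show ?thesis using le True i0 \<eta>0 by simp
    next
      case i0: False
      have "l2 P ?D <= l2 P (V N k (G i)) + l2 P (G i)"
        using l2_triangle[OF s sqi_scale[OF G, of "-1" i]] l2_scale[of P "-1" "G i"] by simp
      also have "... <= 3 * l2 P (G i)" using mol.TT_contraction[OF m G[of i], of N k] by simp
      finally have "(l2 P ?D)^2 <= (3 * l2 P (G i))^2" by (intro power_mono) auto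
      then show ?thesis using le True i0 by (simp add: power_mult_distrib)
    qed
  qed
  have "(\<Sum>i<M. (l2 P (%x. partial i ?u x - G i x))^2) <= 22 * \<eta>" for M
  proof -
    have "(\<Sum>i<M. if i < N0 then 0 else 18 * ?g i) <= 18 * (\<Sum>i\<in>{N0..<M}. ?g i)"
    proof -
      have "(\<Sum>i<M. if i < N0 then 0 else 18 * ?g i) = (\<Sum>i\<in>{N0..<M}. 18 * ?g i)"
        by (rule sum.mono_neutral_cong_right) auto
      then show ?thesis by (simp add: sum_distrib_left)
    qed
    then have 2: "(\<Sum>i<M. if i < N0 then 0 else 18 * ?g i) <= 18 * \<eta>" using N0[of M] by linarith
    have 1: "(\<Sum>i<M. if i < N0 then 2 * \<eta>0 else 0) <= 2 * \<eta>" using sum_lt_const[where a="2 * \<eta>0" and M=M and n=N0] \<eta>0 by simp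
    have 3: "(\<Sum>i<M. if i < N then 2 * \<eta>1 else 0) <= 2 * \<eta>" using sum_lt_const[where a="2 * \<eta>1" and M=M and n=N] \<eta>1 by simp
    have "(\<Sum>i<M. (l2 P (%x. partial i ?u x - G i x))^2) <= (\<Sum>i<M. (if i < N0 then 2 * \<eta>0 else 0) + (if i < N0 then 0 else 18 * ?g i) + (if i < N then 2 * \<eta>1 else 0))"
      by (rule sum_mono) (rule t)
    then show ?thesis using 1 2 3 by (simp only: sum.distrib)
  qed
  then show ?thesis using u a by blast
qed

end

lemma (in mh_rate) grad_approximation:
  fixes G :: "nat => (nat => real) => real"
  assumes h: "h \<in> sqi P" and G: "!!i. G i \<in> sqi P" and C: "!!M. (\<Sum>i<M. (l2 P (G i))^2) <= C"
    and ibp: "!!i \<xi>. testf i \<xi> ==> - (LINT y|P. h y * VV i \<xi> y) = (LINT y|P. G i y * \<xi> y)" and \<eta>: "0 < \<eta>"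
  shows "\<exists>N u. u \<in> C0inf N \<and> (l2 P (%x. u x - h x))\<^sup>2 <= \<eta> \<and> (\<forall>M. (\<Sum>i<M. (l2 P (%x. partial i u x - G i x))^2) <= 22 * \<eta>)"
proof -
  obtain \<rho> where r: "\<rho> \<in> bumps" "!!z. 0 <= \<rho> z" "integrable lborel \<rho>" "(LINT z|lborel. \<rho> z) = 1"
    using mollifier_exists by blast
  have "\<forall>z. \<exists>e. mol \<phi> \<tau> K p \<kappa> \<rho> (fst z) (real (snd z) + 1) e \<and> e <= 1 / (real (snd z) + 1)" using mol_exists[OF r] by blast
  from choice[OF this] obtain e where e: "!!z. mol \<phi> \<tau> K p \<kappa> \<rho> (fst z) (real (snd z) + 1) (e z) \<and> e z <= 1 / (real (snd z) + 1)" by blast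
  interpret molseq \<phi> \<tau> K p \<kappa> \<rho> "%N m. e (N, m)"
  proof (intro molseq.intro molseq_axioms.intro mh_rate_axioms)
    show "mol \<phi> \<tau> K p \<kappa> \<rho> N (real m + 1) (e (N, m))" "e (N, m) <= 1 / (real m + 1)" for N m using e[of "(N, m)"] by simp_all
  qed
  show ?thesis using grad_approx[OF h G C ibp \<eta>] .
qed

section \<open>Gradients in the limit space\<close>

text \<open>The support is a cylinder in the sequence space, with free later coordinates. Setting
  those to 0 does not change f and lands in a compact product of intervals.\<close>

lemma compact_support_bounded:
  fixes f :: "(nat => real) => real"
  assumes c: "continuous_on UNIV f" and d: "depends_first N f" and z: "!!x i. f x \<noteq> 0 ==> i < N ==> abs (x i) <= R"
  shows "\<exists>C. \<forall>x. abs (f x) <= C"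
proof -
  let ?S = "%i. if i < N then {-abs R..abs R} else {0 :: real}"
  have "compactin (product_topology (%i. euclidean) UNIV) (Pi\<^sub>E UNIV ?S)"
    unfolding compactin_PiE by (auto simp: compactin_euclidean_iff)
  then have "compact (Pi\<^sub>E UNIV ?S)" by (simp add: euclidean_product_topology compactin_euclidean_iff)
  then have "compact (f ` Pi\<^sub>E UNIV ?S)" by (intro compact_continuous_image continuous_on_subset[OF c]) auto
  from compact_imp_bounded[OF this] obtain C where C: "\<forall>y\<in>f ` Pi\<^sub>E UNIV ?S. abs y <= C"
    by (auto simp only: bounded_iff real_norm_def)
  have "abs (f x) <= max C 0" for x
  proof (cases "f x = 0")
    case False
    let ?y = "%i. if i < N then x i else 0"
    have "abs (x i) <= abs R" if "i < N" for i using z[OF False that] by simp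
    then have "?y \<in> Pi\<^sub>E UNIV ?S" by (auto simp: PiE_def extensional_def abs_le_iff minus_le_iff)
    then have "abs (f ?y) <= C" using C by blast
    moreover have "f x = f ?y" by (rule depends_firstD[OF d]) simp
    ultimately show ?thesis by simp
  qed simp
  then show ?thesis by blast
qed

lemma C0infD:
  assumes u: "u \<in> C0inf N"
  shows "depends_first N u" "continuous_on UNIV u"
    "i < N ==> ((%t. u (x(i := t))) has_real_derivative partial i u x) (at (x i))"
    "i < N ==> partial i u \<in> C0inf N"
    "\<exists>C. \<forall>x. abs (u x) <= C" "\<exists>R. \<forall>x. i < N --> abs (x i) > R --> u x = 0"
proof -
  obtain R where sm: "smoothN N u" and R: "!!x i. u x \<noteq> 0 ==> i < N ==> abs (x i) <= R" using u unfolding C0inf_def by blast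
  from sm show d: "depends_first N u" and c: "continuous_on UNIV u" by (cases rule: smoothN.cases, simp)+
  have D: "((%t. u (x(i := t))) has_real_derivative partial i u x) (at (x i))" "smoothN N (partial i u)" if "i < N" for i x
    using that by (cases rule: smoothN.cases[OF sm], auto)+
  then show "i < N ==> ((%t. u (x(i := t))) has_real_derivative partial i u x) (at (x i))" by blast
  show "\<exists>C. \<forall>x. abs (u x) <= C" by (rule compact_support_bounded[where R=R, OF c d]) (rule R)
  show "\<exists>R. \<forall>x. i < N --> abs (x i) > R --> u x = 0" using R by (intro exI[of _ R]) force
  assume i: "i < N"
  have "abs (x j) <= R" if nz: "partial i u x \<noteq> 0" and j: "j < N" for x j
  proof (rule ccontr)
    assume a: "\<not> abs (x j) <= R"
    have z: "u (x(i := t)) = 0" if "abs ((x(i := t)) j) > R" for t using R[of "x(i := t)" j] j that by force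
    have o: "open {t. R < abs ((x(i := t)) j)}"
    proof (cases "i = j")
      case True
      then show ?thesis by (simp, intro open_Collect_less continuous_intros)
    next
      case False then show ?thesis using a by simp
    qed
    have "((%t. 0) has_real_derivative 0) (at (x i))" by simp
    then have "((%t. u (x(i := t))) has_real_derivative 0) (at (x i))"
      by (rule has_field_derivative_transform_within_open[OF _ o]) (use a z in auto)
    then have "partial i u x = 0" by (simp add: partial_def DERIV_imp_deriv)
    then show False using nz by simp
  qed
  then show "partial i u \<in> C0inf N" using D(2)[OF i] by (auto simp: C0inf_def)
qed

lemma C0inf_C1b:
  assumes u: "u \<in> C0inf N"
  shows "\<exists>C. C1b u N C"
proof -
  obtain C0 where C0: "!!x. abs (u x) <= C0" using C0infD(5)[OF u] by blast
  have "\<forall>i. \<exists>c. \<forall>x. i < N --> abs (partial i u x) <= c" using C0infD(5)[OF C0infD(4)[OF u]] by blast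
  from choice[OF this] obtain c where c: "!!i x. i < N ==> abs (partial i u x) <= c i" by blast
  have p0: "partial i u x = 0" if "\<not> i < N" for i x using partial_beyond[OF C0infD(1)[OF u]] that by simp
  let ?C = "abs C0 + (\<Sum>i<N. abs (c i))"
  have "abs (partial i u x) <= ?C" for i x
  proof (cases "i < N")
    case True
    have "abs (c i) <= (\<Sum>i<N. abs (c i))" by (rule member_le_sum) (use True in auto)
    then show ?thesis using c[OF True, of x] by linarith
  qed (simp add: p0 sum_nonneg)
  moreover have "abs (u x) <= ?C" for x proof -
    have "0 <= (\<Sum>i<N. abs (c i))" by (rule sum_nonneg) simp
    then show ?thesis using C0[of x] by linarith
  qed
  moreover have "continuous_on UNIV (partial i u)" for i
  proof (cases "i < N")
    case True then show ?thesis by (rule C0infD(2)[OF C0infD(4)[OF u]])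
  next
    case False
    then have "partial i u = (%x. 0)" using p0 by blast
    then show ?thesis by simp
  qed
  moreover have "((%t. u (x(i := t))) has_real_derivative partial i u x) (at (x i))" for i x
  proof (cases "i < N")
    case True then show ?thesis by (rule C0infD(3)[OF u])
  next
    case False
    then show ?thesis using deriv_beyond[OF C0infD(1)[OF u], of i x] p0[of i x] by simp
  qed
  ultimately have "C1b u N ?C" unfolding C1b_def using C0infD(1,2)[OF u] by blast
  then show ?thesis ..
qed

lemma C0inf_testf: "u \<in> C0inf N ==> i < N ==> testf i (partial i u)"
  unfolding testf_iff using C0inf_C1b[OF C0infD(4)] C0infD(6)[OF C0infD(4)] by metis

lemma testf_combine:
  assumes u: "testf i u" and v: "testf i v"
  shows "testf i (%x. a * u x + b * v x)" "partial j (%x. a * u x + b * v x) x = a * partial j u x + b * partial j v x"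
proof -
  obtain N C R where u: "C1b u N C" "!!x. abs (x i) > R ==> u x = 0" using u unfolding testf_iff by blast
  obtain N' C' R' where v: "C1b v N' C'" "!!x. abs (x i) > R' ==> v x = 0" using v unfolding testf_iff by blast
  let ?w = "%x. a * u x + b * v x"
  have D: "((%t. ?w (x(j := t))) has_real_derivative a * partial j u x + b * partial j v x) (at (x j))" for j x
    using u v unfolding C1b_def by (intro DERIV_add DERIV_cmult) auto
  have p: "partial j ?w x = a * partial j u x + b * partial j v x" for j x
    unfolding partial_def by (rule DERIV_imp_deriv) (use D in \<open>simp add: partial_def\<close>)
  then show "partial j ?w x = a * partial j u x + b * partial j v x" .
  let ?C = "abs a * C + abs b * C'"
  have bd: "abs (a * s + b * t) <= ?C" if "abs s <= C" "abs t <= C'" for s t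
  proof -
    have "abs (a * s + b * t) <= abs a * abs s + abs b * abs t" using abs_triangle_ineq[of "a * s" "b * t"] by (simp add: abs_mult)
    also have "... <= ?C" using that by (intro add_mono mult_left_mono) auto
    finally show ?thesis .
  qed
  have "C1b ?w (max N N') ?C"
    unfolding C1b_def
  proof (intro conjI allI)
    show "continuous_on UNIV ?w" using u v unfolding C1b_def by (intro continuous_intros) auto
    show "depends_first (max N N') ?w"
    proof -
      have "depends_first N u" "depends_first N' v" using u v by (auto simp: C1b_def)
      then have "depends_first (max N N') u" "depends_first (max N N') v" by (auto simp: depends_first_def)
      then show ?thesis unfolding depends_first_def by metis
    qed
    fix j x
    have "partial j ?w = (%x. a * partial j u x + b * partial j v x)" using p by blast
    then show "continuous_on UNIV (partial j ?w)" using u v unfolding C1b_def by (auto intro!: continuous_intros)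
    show "((%t. ?w (x(j := t))) has_real_derivative partial j ?w x) (at (x j))" unfolding p by (rule D)
    show "abs (partial j ?w x) <= ?C" unfolding p by (rule bd) (use u v in \<open>auto simp: C1b_def\<close>)
    show "abs (?w x) <= ?C" by (rule bd) (use u v in \<open>auto simp: C1b_def\<close>)
  qed
  moreover have "?w x = 0" if "abs (x i) > max R R'" for x using u(2)[of x] v(2)[of x] that by simp
  ultimately show "testf i ?w" unfolding testf_iff by blast
qed

lemma testf_zero: "testf i (%x. 0)" "partial j (%x. 0) x = 0"
  by (auto simp: testf_def partial_def depends_first_def intro!: exI[of _ "0 :: real"])

lemma ennreal_le_suminf: "f i <= (\<Sum>i. f i)" "(\<Sum>i<n. f i) <= (\<Sum>i. f i)" for f :: "nat => ennreal"
  using sum_le_suminf[of f "{i}"] sum_le_suminf[of f "{..<n}"] by auto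

lemma nn_integral_sum_sq:
  assumes m: "!!i. F i \<in> sqi M" and C: "!!n. (\<Sum>i<n. (l2 M (F i))^2) <= C"
  shows "(\<integral>\<^sup>+x. (\<Sum>i. ennreal ((F i x)^2)) \<partial>M) = ennreal (\<Sum>i. (l2 M (F i))^2)" "summable (%i. (l2 M (F i))^2)"
    "(\<Sum>i. (l2 M (F i))^2) <= C"
proof -
  show s: "summable (%i. (l2 M (F i))^2)" by (rule summableI_nonneg_bounded[of _ C]) (use C in auto)
  have "(\<integral>\<^sup>+x. (\<Sum>i. ennreal ((F i x)^2)) \<partial>M) = (\<Sum>i. \<integral>\<^sup>+x. ennreal ((F i x)^2) \<partial>M)"
    using sqi_meas[OF m] by (intro nn_integral_suminf) auto
  also have "... = (\<Sum>i. ennreal ((l2 M (F i))^2))" by (simp add: nn_integral_sq_eq[OF m])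
  also have "... = ennreal (\<Sum>i. (l2 M (F i))^2)" by (rule suminf_ennreal2) (use s in auto)
  finally show "(\<integral>\<^sup>+x. (\<Sum>i. ennreal ((F i x)^2)) \<partial>M) = ennreal (\<Sum>i. (l2 M (F i))^2)" .
  show "(\<Sum>i. (l2 M (F i))^2) <= C" by (rule suminf_le_const[OF s C])
qed

context mh_rate begin

section \<open>Integration by parts and the energy of a gradient\<close>

lemma VV_combine:
  assumes u: "testf i u" and v: "testf i v"
  shows "VV i (%x. a * u x + b * v x) = (%x. a * VV i u x + b * VV i v x)"
  unfolding VV_def using testf_combine(2)[OF u v] by (auto simp: algebra_simps)

text \<open>In the single variable i the integrand times exp(\<phi>) is the derivative of u \<xi>
  exp(\<phi>), which vanishes at the end points because \<xi> has bounded support in that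
  direction.\<close>

lemma integration_by_parts:
  assumes u: "C1b u N C" and \<xi>: "testf i \<xi>"
  shows "- (LINT x|P. u x * VV i \<xi> x) = (LINT x|P. partial i u x * \<xi> x)"
proof -
  obtain N' C' R where x: "C1b \<xi> N' C'" "!!x. abs (x i) > R ==> \<xi> x = 0" using \<xi> unfolding testf_iff by blast
  note [measurable] = C1b_meas[OF u]
  have us: "u \<in> sqi P" by (rule T.Q.sqi_bounded[where C=C]) (use u in \<open>auto simp: C1b_def\<close>)
  have ps: "partial i u \<in> sqi P" by (rule T.Q.sqi_bounded[where C=C]) (use u in \<open>auto simp: C1b_def\<close>)
  have i1: "integrable P (%x. u x * VV i \<xi> x)" by (rule sqi_mult_integrable[OF us VV_sqi[OF \<xi>]])
  have i2: "integrable P (%x. partial i u x * \<xi> x)" by (rule sqi_mult_integrable[OF ps testf_sqi[OF \<xi>]])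
  let ?F = "%x. u x * VV i \<xi> x + partial i u x * \<xi> x"
  have inner: "(LINT t|target \<phi>. ?F (x(i := t))) = 0" for x
  proof -
    let ?g = "%t. u (x(i := t)) * \<xi> (x(i := t)) * exp (\<phi> t)"
    let ?f = "%t. exp (\<phi> t) * ?F (x(i := t))"
    let ?R = "abs R + 1"
    have up: "continuous_on UNIV (%t. x(i := t) :: nat => real)"
    proof (rule continuous_on_coordinatewise_then_product)
      show "continuous_on UNIV (%t. (x(i := t)) j)" for j by (cases "j = i") (auto intro!: continuous_intros)
    qed
    have co: "continuous_on UNIV (%t. f (x(i := t)))" if "continuous_on UNIV f" for f :: "_ => real"
      by (rule continuous_on_compose2[OF that up]) auto
    have cf: "continuous_on UNIV ?f"
      using u x unfolding VV_def C1b_def by (simp, intro continuous_on_mult continuous_on_add co continuous_on_exp phi_cont d_cont) auto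
    have z: "\<xi> (x(i := t)) = 0" if "abs t > R" for t using x(2)[of "x(i := t)"] that by simp
    have pz: "partial i \<xi> (x(i := t)) = 0" if "abs t > R" for t
    proof -
      have o: "open {t :: real. R < abs t}" by (intro open_Collect_less continuous_intros)
      have "((%t. 0) has_real_derivative 0) (at t)" by simp
      then have "((%t. \<xi> (x(i := t))) has_real_derivative 0) (at t)"
        by (rule has_field_derivative_transform_within_open[OF _ o]) (use that z in auto)
      with C1b_at[OF x(1)] show ?thesis by (rule DERIV_unique)
    qed
    have fz: "?f t = ?f t * indicator {-?R..?R} t" for t
    proof (cases "t \<in> {-?R..?R}")
      case False
      then have "abs t > R" by auto
      then show ?thesis using False z pz by (simp add: VV_def)
    qed simp
    have dg: "(?g has_real_derivative ?f t) (at t)" for t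
    proof -
      have "((%t. exp (\<phi> t)) has_real_derivative exp (\<phi> t) * d t) (at t)" by (rule DERIV_fun_exp[OF d_deriv])
      from DERIV_mult[OF DERIV_mult[OF C1b_at[OF u] C1b_at[OF x(1)]] this] show ?thesis
        by (rule DERIV_cong) (simp add: VV_def algebra_simps)
    qed
    have "(LINT t|target \<phi>. ?F (x(i := t))) = (LINT t|lborel. ?f t)"
    proof (rule target_integral)
      have "(%t. exp (- \<phi> t) * ?f t) \<in> borel_measurable borel"
        using borel_measurable_continuous_onI[OF cf] by measurable
      moreover have "exp (- \<phi> t) * (exp (\<phi> t) * r) = r" for t r by (simp only: mult.assoc[symmetric] exp_add[symmetric]) simp
      ultimately show "(%t. ?F (x(i := t))) \<in> borel_measurable borel" by (simp only:)
    qed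
    also have "... = (LINT t|lborel. ?f t * indicator {-?R..?R} t)"
      by (rule Bochner_Integration.integral_cong[OF refl fz])
    also have "... = ?g ?R - ?g (-?R)"
    proof (rule integral_FTC_Icc_real)
      show "-?R <= ?R" by simp
      show "(?g has_real_derivative ?f t) (at t)" for t by (rule dg)
      show "isCont ?f t" for t using cf unfolding continuous_on_eq_continuous_at[OF open_UNIV] by blast
    qed
    also have "... = 0" using z[of ?R] z[of "-?R"] by simp
    finally show ?thesis .
  qed
  have "(LINT x|P. ?F x) = (LINT x|P. (LINT t|target \<phi>. ?F (x(i := t))))"
    by (rule T.integral_upd[OF Bochner_Integration.integrable_add[OF i1 i2]])
  then have "(LINT x|P. ?F x) = 0" by (simp only: inner integral_zero)
  then show ?thesis using Bochner_Integration.integral_add[OF i1 i2] by linarith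
qed

lemma C0inf_sqi: "u \<in> C0inf N ==> u \<in> sqi P" "u \<in> C0inf N ==> partial i u \<in> sqi P"
proof -
  assume "u \<in> C0inf N"
  then obtain C where u: "C1b u N C" using C0inf_C1b by blast
  note [measurable] = C1b_meas[OF u]
  show "u \<in> sqi P" by (rule T.Q.sqi_bounded[where C=C]) (use u in \<open>auto simp: C1b_def\<close>)
  show "partial i u \<in> sqi P" by (rule T.Q.sqi_bounded[where C=C]) (use u in \<open>auto simp: C1b_def\<close>)
qed

text \<open>Trades the extended-valued series in \<open>is_grad\<close> for one real null sequence
  that bounds all partial sums; indices at which the integrated series may be infinite are
  dropped.\<close>

lemma is_grad_seq:
  assumes g: "is_grad \<phi> h G"
  shows "h \<in> sqi P" "(%x. G x i) \<in> sqi P"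
    "\<exists>hs Ns s. (\<forall>k. hs k \<in> C0inf (Ns k)) \<and> (%k. l2 P (%x. hs k x - h x)) \<longlonglongrightarrow> 0 \<and> s \<longlonglongrightarrow> 0 \<and>
       (\<forall>k n. (\<Sum>i<n. (l2 P (%x. partial i (hs k) x - G x i))^2) <= s k)"
proof -
  show h: "h \<in> sqi P" using g by (simp add: is_grad_def inH_iff)
  have [measurable]: "(%x. G x i) \<in> borel_measurable P" for i using g by (simp add: is_grad_def P_eq)
  obtain hs Ns where hs: "!!k. hs k \<in> C0inf (Ns k)" and
    l1: "(%k. \<integral>\<^sup>+x. ennreal ((hs k x - h x)^2) \<partial>P) \<longlonglongrightarrow> 0" and
    l2: "(%k. \<integral>\<^sup>+x. (\<Sum>i. ennreal ((partial i (hs k) x - G x i)^2)) \<partial>P) \<longlonglongrightarrow> 0"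
    using g unfolding is_grad_def P_eq by blast
  let ?I = "%k. \<integral>\<^sup>+x. (\<Sum>i. ennreal ((partial i (hs k) x - G x i)^2)) \<partial>P"
  have "\<forall>\<^sub>F k in sequentially. ?I k < 1" by (rule order_tendstoD(2)[OF l2]) simp
  then obtain k0 where k0: "!!k. k0 <= k ==> ?I k < 1" by (auto simp: eventually_sequentially)
  have term_le: "(\<integral>\<^sup>+x. ennreal ((partial i (hs k) x - G x i)^2) \<partial>P) <= ?I k" for i k
    by (intro nn_integral_mono ennreal_le_suminf(1)[of "%i. ennreal ((partial i (hs k) _ - G _ i)^2)" i])
  have D: "(%x. partial i (hs k) x - G x i) \<in> sqi P" if k: "k0 <= k" for i k
    unfolding sqi_iff_nn_integral
  proof
    note [measurable] = sqi_meas[OF C0inf_sqi(2)[OF hs]]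
    show "(%x. partial i (hs k) x - G x i) \<in> borel_measurable P" by measurable
    show "(\<integral>\<^sup>+x. ennreal ((partial i (hs k) x - G x i)^2) \<partial>P) < \<infinity>"
      using order.strict_trans1[OF term_le k0[OF k]] by (rule order.strict_trans) simp
  qed
  show "(%x. G x i) \<in> sqi P" for i
    using sqi_diff[OF C0inf_sqi(2)[OF hs, of i k0] D[OF order_refl, of i]] by simp
  have sl: "(\<Sum>i<n. (l2 P (%x. partial i (hs k) x - G x i))^2) <= enn2real (?I k)" if k: "k0 <= k" for n k
  proof -
    have "ennreal (\<Sum>i<n. (l2 P (%x. partial i (hs k) x - G x i))^2) = (\<Sum>i<n. ennreal ((l2 P (%x. partial i (hs k) x - G x i))^2))"
      by (rule sum_ennreal[symmetric]) simp
    also have "... = (\<Sum>i<n. \<integral>\<^sup>+x. ennreal ((partial i (hs k) x - G x i)^2) \<partial>P)" by (simp only: nn_integral_sq_eq[OF D[OF k]])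
    also have "... = (\<integral>\<^sup>+x. (\<Sum>i<n. ennreal ((partial i (hs k) x - G x i)^2)) \<partial>P)"
      using sqi_meas[OF D[OF k]] by (intro nn_integral_sum[symmetric]) auto
    also have "... <= ?I k" by (intro nn_integral_mono ennreal_le_suminf(2))
    finally have "ennreal (\<Sum>i<n. (l2 P (%x. partial i (hs k) x - G x i))^2) <= ?I k" .
    moreover have "?I k < \<infinity>" using k0[OF k] by (rule order.strict_trans) simp
    ultimately have "enn2real (ennreal (\<Sum>i<n. (l2 P (%x. partial i (hs k) x - G x i))^2)) <= enn2real (?I k)"
      unfolding infinity_ennreal_def by (rule enn2real_mono)
    then show ?thesis by (subst (asm) enn2real_ennreal) (simp_all add: sum_nonneg)
  qed
  have t1: "(%k. enn2real (?I (k + k0))) \<longlonglongrightarrow> 0"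
    using tendsto_enn2real[of "%k. ?I (k + k0)" 0, OF _ order_refl] LIMSEQ_ignore_initial_segment[OF l2, of k0] by (simp only: ennreal_0)
  have "(%k. enn2real (\<integral>\<^sup>+x. ennreal ((hs k x - h x)^2) \<partial>P)) \<longlonglongrightarrow> 0"
    using tendsto_enn2real[of "%k. \<integral>\<^sup>+x. ennreal ((hs k x - h x)^2) \<partial>P" 0, OF _ order_refl] l1 by (simp only: ennreal_0)
  then have "(%k. (l2 P (%x. hs k x - h x))^2) \<longlonglongrightarrow> 0"
    by (simp add: nn_integral_sq_eq[OF sqi_diff[OF C0inf_sqi(1)[OF hs] h]])
  from tendsto_real_sqrt[OF this] have t0: "(%k. l2 P (%x. hs k x - h x)) \<longlonglongrightarrow> 0" by simp
  show "\<exists>hs Ns s. (\<forall>k. hs k \<in> C0inf (Ns k)) \<and> (%k. l2 P (%x. hs k x - h x)) \<longlonglongrightarrow> 0 \<and> s \<longlonglongrightarrow> 0 \<and>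
       (\<forall>k n. (\<Sum>i<n. (l2 P (%x. partial i (hs k) x - G x i))^2) <= s k)"
    using hs LIMSEQ_ignore_initial_segment[OF t0, of k0] t1 sl
    by (intro exI[of _ "%k. hs (k + k0)"] exI[of _ "%k. Ns (k + k0)"] exI[of _ "%k. enn2real (?I (k + k0))"]) auto
qed

text \<open>A single approximant suffices for finiteness: it has finitely many nonzero partial
  derivatives, and G differs from its gradient by finite energy.\<close>

lemma is_grad_energy:
  assumes g: "is_grad \<phi> h G"
  shows "summable (%i. (l2 P (%x. G x i))^2)"
    "(\<integral>\<^sup>+x. (\<Sum>i. ennreal ((G x i)^2)) \<partial>P) = ennreal (\<Sum>i. (l2 P (%x. G x i))^2)"
proof -
  note G = is_grad_seq(2)[OF g]
  obtain hs :: "nat => _" and Ns s where hs: "!!k. hs k \<in> C0inf (Ns k)" and s: "!!k n. (\<Sum>i<n. (l2 P (%x. partial i (hs k) x - G x i))^2) <= s k"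
    using is_grad_seq(3)[OF g] by blast
  let ?u = "hs 0" and ?C = "\<Sum>i<Ns 0. (l2 P (partial i (hs 0)))^2"
  have t: "(l2 P (%x. G x i))^2 <= 2 * (if i < Ns 0 then (l2 P (partial i ?u))\<^sup>2 else 0) + 2 * (l2 P (%x. partial i ?u x - G x i))^2" for i
  proof -
    have e: "(%x. G x i) = (%x. partial i ?u x + (-1) * (partial i ?u x - G x i))" by auto
    have p: "(l2 P (partial i ?u))^2 = (if i < Ns 0 then (l2 P (partial i ?u))\<^sup>2 else 0)"
      using partial_beyond[OF C0infD(1)[OF hs], of 0 i] by (simp add: l2_def)
    have "(l2 P (%x. G x i))^2 <= 2 * (l2 P (partial i ?u))^2 + 2 * (l2 P (%x. (-1) * (partial i ?u x - G x i)))^2"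
      by (subst e) (rule sq_split[OF C0inf_sqi(2)[OF hs] sqi_scale[OF sqi_diff[OF C0inf_sqi(2)[OF hs] G]]])
    then show ?thesis unfolding l2_scale p[symmetric] by simp
  qed
  have "(\<Sum>i<n. (l2 P (%x. G x i))^2) <= 2 * ?C + 2 * s 0" for n
  proof -
    have "(\<Sum>i<n. if i < Ns 0 then (l2 P (partial i ?u))\<^sup>2 else 0) = (\<Sum>i\<in>{..<n} \<inter> {..<Ns 0}. (l2 P (partial i ?u))^2)"
      by (subst sum.inter_restrict) auto
    also have "... <= ?C" by (rule sum_mono2) auto
    finally have "(\<Sum>i<n. if i < Ns 0 then (l2 P (partial i ?u))\<^sup>2 else 0) <= ?C" .
    moreover have "(\<Sum>i<n. (l2 P (%x. partial i ?u x - G x i))^2) <= s 0" by (rule s)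
    moreover have "(\<Sum>i<n. (l2 P (%x. G x i))^2) <= (\<Sum>i<n. 2 * (if i < Ns 0 then (l2 P (partial i ?u))\<^sup>2 else 0) + 2 * (l2 P (%x. partial i ?u x - G x i))^2)"
      by (rule sum_mono) (rule t)
    ultimately show ?thesis
      by (simp add: sum.distrib sum_distrib_left[symmetric])
  qed
  from nn_integral_sum_sq[OF G this]
  show "summable (%i. (l2 P (%x. G x i))^2)" "(\<integral>\<^sup>+x. (\<Sum>i. ennreal ((G x i)^2)) \<partial>P) = ennreal (\<Sum>i. (l2 P (%x. G x i))^2)"
    by auto
qed

lemma is_grad_ibp:
  assumes g: "is_grad \<phi> h G" and \<xi>: "testf i \<xi>"
  shows "- (LINT x|P. h x * VV i \<xi> x) = (LINT x|P. G x i * \<xi> x)"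
proof -
  note h = is_grad_seq(1)[OF g] and G = is_grad_seq(2)[OF g]
  obtain hs Ns s where hs: "!!k. hs k \<in> C0inf (Ns k)" and l: "(%k. l2 P (%x. hs k x - h x)) \<longlonglongrightarrow> 0"
    and s0: "s \<longlonglongrightarrow> 0" and s: "!!k n. (\<Sum>i<n. (l2 P (%x. partial i (hs k) x - G x i))^2) <= s k"
    using is_grad_seq(3)[OF g] by blast
  have "(l2 P (%x. partial i (hs k) x - G x i))^2 <= s k" for k
  proof -
    have "(\<Sum>j<Suc i. (l2 P (%x. partial j (hs k) x - G x j))^2) <= s k" by (rule s)
    then show ?thesis using sum_nonneg[of "{..<i}" "%i. (l2 P (%x. partial i (hs k) x - G x i))^2"] by simp
  qed
  then have "(%k. (l2 P (%x. partial i (hs k) x - G x i))^2) \<longlonglongrightarrow> 0"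
    by (intro tendsto_sandwich[OF _ _ tendsto_const s0]) auto
  from tendsto_real_sqrt[OF this] have l': "(%k. l2 P (%x. partial i (hs k) x - G x i)) \<longlonglongrightarrow> 0" by simp
  have 1: "(%k. - (LINT x|P. hs k x * VV i \<xi> x)) \<longlonglongrightarrow> - (LINT x|P. h x * VV i \<xi> x)"
    by (intro tendsto_minus l2_tendsto_inner[OF C0inf_sqi(1)[OF hs] h VV_sqi[OF \<xi>] l])
  have 2: "(%k. \<integral>x. partial i (hs k) x * \<xi> x \<partial>P) \<longlonglongrightarrow> (LINT x|P. G x i * \<xi> x)"
    by (rule l2_tendsto_inner[OF C0inf_sqi(2)[OF hs] G testf_sqi[OF \<xi>] l'])
  have "- (LINT x|P. hs k x * VV i \<xi> x) = (LINT x|P. partial i (hs k) x * \<xi> x)" for k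
    using C0inf_C1b[OF hs] integration_by_parts[OF _ \<xi>] by blast
  then show ?thesis using LIMSEQ_unique[OF 1] 2 by simp
qed

end

section \<open>Mosco convergence\<close>

lemma ennreal_squeeze_zero:
  fixes f :: "nat => ennreal"
  assumes le: "!!k. f k <= ennreal (g k)" and g: "g \<longlonglongrightarrow> 0"
  shows "f \<longlonglongrightarrow> 0"
proof (rule tendsto_sandwich[OF _ _ tendsto_const])
  show "(%k. ennreal (g k)) \<longlonglongrightarrow> 0" using tendsto_ennrealI[OF g] by simp
qed (use le in auto)

text \<open>Turns the lower bound for test fields v into the energy of G minus the squared distance
  of v from G, so fields close to G are nearly optimal.\<close>

lemma inner_complete_square:
  assumes v: "v \<in> sqi M" and G: "G \<in> sqi M"
  shows "(LINT x|M. G x * v x) - (1/2) * (LINT x|M. (v x)^2) = (1/2) * (l2 M G)^2 - (1/2) * (l2 M (%x. v x - G x))^2"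
  using l2_expand[OF v G, of 1 "-1"] by (simp add: l2_sq mult.commute diff_divide_distrib add_divide_distrib)

text \<open>The optimal t is l / Y; for Y = 0 the choice t = (L + 1) / l would contradict the bound
  unless l = 0.\<close>

lemma quadratic_bound:
  fixes l Y L :: real
  assumes q: "!!t. t * l - t\<^sup>2 * Y / 2 <= L" and Y: "0 <= Y"
  shows "l\<^sup>2 <= 2 * L * Y"
proof (cases "Y = 0")
  case True
  have "l = 0"
  proof (rule ccontr)
    assume "l \<noteq> 0"
    then show False using q[of "(L + 1) / l"] True by simp
  qed
  then show ?thesis using True by simp
next
  case False
  then have "0 < Y" using Y by simp
  then have "l\<^sup>2 / Y - l\<^sup>2 / Y / 2 <= L" using q[of "l / Y"] by (simp add: power2_eq_square field_simps)
  then have "l\<^sup>2 / Y <= 2 * L" by simp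
  then show ?thesis using \<open>0 < Y\<close> by (simp add: field_simps)
qed

lemma l2_young:
  assumes f: "f \<in> sqi M" and g: "g \<in> sqi M" and \<theta>: "0 < \<theta>"
  shows "(l2 M (%x. f x + g x))^2 <= (1 + \<theta>) * (l2 M f)^2 + (1 + 1 / \<theta>) * (l2 M g)^2"
proof -
  let ?F = "l2 M f" and ?G = "l2 M g"
  have "0 <= (\<theta> * ?F - ?G)^2 / \<theta>" using \<theta> by simp
  also have "(\<theta> * ?F - ?G)^2 / \<theta> = \<theta> * ?F\<^sup>2 - 2 * ?F * ?G + 1 / \<theta> * ?G\<^sup>2"
    using \<theta> by (simp add: power2_eq_square field_simps)
  finally have y: "2 * ?F * ?G <= \<theta> * ?F\<^sup>2 + 1 / \<theta> * ?G\<^sup>2" by simp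
  have "(l2 M (%x. f x + g x))^2 <= (?F + ?G)^2" by (intro power_mono l2_triangle f g) simp
  also have "... = ?F\<^sup>2 + 2 * ?F * ?G + ?G\<^sup>2" by (simp add: power2_sum)
  finally show ?thesis using y by (simp only: distrib_right mult_1)
qed

text \<open>Takes the largest k <= n whose threshold \<open>r k\<close> has been reached by n. The
  set is nonempty once n >= r 0, as it then contains 0.\<close>

lemma diagonal_selection:
  fixes r :: "nat => nat"
  shows "\<exists>sel. filterlim sel at_top sequentially \<and> (\<forall>n\<ge>r 0. r (sel n) <= n)"
proof -
  define sel where "sel n = Max {k. k <= n \<and> r k <= n}" for n
  have fin: "finite {k. k <= n \<and> r k <= n}" for n by simp
  have "\<forall>\<^sub>F n in sequentially. k <= sel n" for k
  proof (rule eventually_sequentiallyI[of "max k (r k)"])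
    fix n assume "max k (r k) <= n"
    then show "k <= sel n" unfolding sel_def by (intro Max_ge fin) auto
  qed
  moreover have "r (sel n) <= n" if "r 0 <= n" for n
    using Max_in[OF fin[of n]] that unfolding sel_def by blast
  ultimately show ?thesis unfolding filterlim_at_top by blast
qed

context mh_rate begin

section \<open>The two halves of the convergence statement\<close>

lemma cc_tau_pos: "0 < \<tau>\<^sup>2 * cc"
  using cc_pos tau_pos by simp

lemma grad_exists:
  assumes hs: "!!n. hs n \<in> sqi P" and h: "h \<in> sqi P" and wc: "weak_conv \<phi> hs h"
    and L: "0 <= L" "liminf (%n. Phi_n \<phi> \<tau> n (hs n)) <= ennreal L"
  shows "inS \<phi> h"
proof -
  define L' where "L' = L / (\<tau>\<^sup>2 * cc)"
  have L'0: "0 <= L'" using L cc_tau_pos unfolding L'_def by (intro divide_nonneg_nonneg) auto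
  let ?l = "%i \<xi>. - (LINT x|P. h x * VV i \<xi> x)"
  have B1: "(\<Sum>i<M. ?l i (\<xi> i) - (1/2) * (LINT x|P. (\<xi> i x)^2)) <= L'" if t: "!!i. i < M ==> testf i (\<xi> i)" for M and \<xi> :: "nat => (nat => real) => real"
  proof -
    have "ennreal (\<tau>\<^sup>2 * cc * (- (\<Sum>i<M. \<integral>x. h x * VV i (\<xi> i) x \<partial>P) - (1/2) * (\<Sum>i<M. \<integral>x. (\<xi> i x)^2 \<partial>P))) <= ennreal L"
      by (rule order.trans[OF M1_lower[OF hs h wc t] L(2)])
    then have "\<tau>\<^sup>2 * cc * (- (\<Sum>i<M. \<integral>x. h x * VV i (\<xi> i) x \<partial>P) - (1/2) * (\<Sum>i<M. \<integral>x. (\<xi> i x)^2 \<partial>P)) <= L"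
      by (simp only: ennreal_le_iff[OF L(1)])
    then have "- (\<Sum>i<M. \<integral>x. h x * VV i (\<xi> i) x \<partial>P) - (1/2) * (\<Sum>i<M. \<integral>x. (\<xi> i x)^2 \<partial>P) <= L'"
      unfolding L'_def by (subst pos_le_divide_eq[OF cc_tau_pos]) (simp only: mult.commute)
    then show ?thesis by (simp add: sum_subtractf sum_negf sum_distrib_left)
  qed
  have lin: "?l i (%x. a * u x + b * v x) = a * ?l i u + b * ?l i v" if "testf i u" "testf i v" for i a b u v
  proof -
    have "(LINT x|P. h x * VV i (%x. a * u x + b * v x) x) = (LINT x|P. a * (h x * VV i u x) + b * (h x * VV i v x))"
      unfolding VV_combine[OF that] by (intro Bochner_Integration.integral_cong refl) (simp add: algebra_simps)
    also have "... = a * (LINT x|P. h x * VV i u x) + b * (LINT x|P. h x * VV i v x)"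
      using sqi_mult_integrable[OF h VV_sqi[OF that(1)]] sqi_mult_integrable[OF h VV_sqi[OF that(2)]] by simp
    finally show ?thesis by simp
  qed
  have bnd: "abs (?l i \<xi>) <= sqrt (2 * L') * l2 P \<xi>" if t: "testf i \<xi>" for i \<xi>
  proof -
    have q: "s * ?l i \<xi> - s\<^sup>2 * (l2 P \<xi>)^2 / 2 <= L'" for s
    proof -
      \<comment> \<open>One field scaled by s in slot i and zero elsewhere; varying s turns the
        quadratic bound into boundedness of the linear functional. The summand
        \<open>0 * \<xi> x\<close> matches the shape of \<open>testf_combine\<close>.\<close>
      let ?\<xi> = "%j. if j = i then (%x. s * \<xi> x + 0 * \<xi> x) else (%x. 0)"
      have z: "?l j (%x. 0) = 0" for j by (simp add: VV_def testf_zero)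
      have e: "?l j (?\<xi> j) - (1/2) * (LINT x|P. (?\<xi> j x)^2) = (if j = i then s * ?l i \<xi> - s\<^sup>2 * (l2 P \<xi>)^2 / 2 else 0)" for j
      proof (cases "j = i")
        case True
        then show ?thesis using lin[OF t t, of s 0] by (simp add: l2_sq power_mult_distrib)
      next
        case False then show ?thesis using z[of j] by simp
      qed
      have "testf j (?\<xi> j)" for j using testf_combine(1)[OF t t, of s 0] testf_zero(1)[of j] by auto
      from B1[of "Suc i" ?\<xi>, OF this] show ?thesis unfolding e by (simp add: sum.delta)
    qed
    have "(?l i \<xi>)^2 <= 2 * L' * (l2 P \<xi>)^2" by (rule quadratic_bound[OF q]) simp
    then have "sqrt ((?l i \<xi>)^2) <= sqrt (2 * L' * (l2 P \<xi>)^2)" by (rule real_sqrt_le_mono)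
    then show ?thesis by (simp only: real_sqrt_abs real_sqrt_mult abs_of_nonneg[OF l2_nonneg])
  qed
  have "\<exists>G \<in> sqi P. (\<exists>v. (\<forall>k. v k \<in> {\<xi>. testf i \<xi>}) \<and> (%k. l2 P (%x. v k x - G x)) \<longlonglongrightarrow> 0)
    \<and> (\<forall>v\<in>{\<xi>. testf i \<xi>}. ?l i v = (LINT x|P. G x * v x))" for i
    by (rule l2_riesz[where ?v0.0="%x. 0" and C="sqrt (2 * L')"])
      (use testf_sqi testf_zero(1) testf_combine(1) lin bnd in auto)
  then have "\<forall>i. \<exists>G. G \<in> sqi P \<and> (\<exists>v. (\<forall>k. testf i (v k)) \<and> (%k. l2 P (%x. v k x - G x)) \<longlonglongrightarrow> 0)
    \<and> (\<forall>v. testf i v --> ?l i v = (LINT x|P. G x * v x))" by (simp add: Bex_def)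
  from choice[OF this] obtain G where G: "!!i. G i \<in> sqi P" and Gv: "!!i. \<exists>v. (\<forall>k. testf i (v k)) \<and> (%k. l2 P (%x. v k x - G i x)) \<longlonglongrightarrow> 0"
    and ibp: "!!i v. testf i v ==> ?l i v = (LINT x|P. G i x * v x)" by blast
  have "\<forall>i. \<exists>v. (\<forall>k. testf i (v k)) \<and> (%k. l2 P (%x. v k x - G i x)) \<longlonglongrightarrow> 0" using Gv by blast
  from choice[OF this] obtain v where v: "!!i k. testf i (v i k)" "!!i. (%k. l2 P (%x. v i k x - G i x)) \<longlonglongrightarrow> 0" by blast
  \<comment> \<open>Inserting fields that approach all \<open>G i\<close> with i < M at once bounds
    the total energy uniformly in M, which bounds on the single components would not give.\<close>
  have C: "(\<Sum>i<M. (l2 P (G i))^2) <= 2 * L'" for M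
  proof -
    have "(\<Sum>i<M. (1/2) * (l2 P (G i))^2 - (1/2) * (l2 P (%x. v i k x - G i x))^2) <= L'" for k
      using B1[of M "%i. v i k", OF v(1)] by (simp only: ibp[OF v(1)] inner_complete_square[OF testf_sqi[OF v(1)] G])
    moreover have "(%k. \<Sum>i<M. (1/2) * (l2 P (G i))^2 - (1/2) * (l2 P (%x. v i k x - G i x))^2) \<longlonglongrightarrow> (\<Sum>i<M. (1/2) * (l2 P (G i))^2 - (1/2) * 0\<^sup>2)"
      by (intro tendsto_intros v)
    ultimately have "(\<Sum>i<M. (1/2) * (l2 P (G i))^2 - (1/2) * 0\<^sup>2) <= L'" by (intro LIMSEQ_le_const2) auto
    then show ?thesis by (simp add: sum_distrib_left[symmetric] sum_divide_distrib[symmetric])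
  qed
  have "\<forall>k. \<exists>z. snd z \<in> C0inf (fst z) \<and> (l2 P (%x. snd z x - h x))\<^sup>2 <= inverse (real (Suc k)) \<and> (\<forall>M. (\<Sum>i<M. (l2 P (%x. partial i (snd z) x - G i x))^2) <= 22 * inverse (real (Suc k)))"
  proof
    fix k
    have "0 < inverse (real (Suc k))" by simp
    from grad_approximation[OF h G C ibp this] show "\<exists>z. snd z \<in> C0inf (fst z) \<and> (l2 P (%x. snd z x - h x))\<^sup>2 <= inverse (real (Suc k)) \<and> (\<forall>M. (\<Sum>i<M. (l2 P (%x. partial i (snd z) x - G i x))^2) <= 22 * inverse (real (Suc k)))"
      unfolding split_paired_Ex fst_conv snd_conv by blast
  qed
  from choice[OF this] obtain z where z: "!!k. snd (z k) \<in> C0inf (fst (z k))" "!!k. (l2 P (%x. snd (z k) x - h x))^2 <= inverse (real (Suc k))"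
    "!!k M. (\<Sum>i<M. (l2 P (%x. partial i (snd (z k)) x - G i x))^2) <= 22 * inverse (real (Suc k))" by blast
  have "is_grad \<phi> h (%x i. G i x)"
    unfolding is_grad_def P_eq inH_iff
  proof (intro conjI h allI exI[of _ "%k. snd (z k)"] exI[of _ "%k. fst (z k)"] z(1))
    show "G i \<in> borel_measurable P" for i by (rule sqi_meas[OF G])
    show "(%k. \<integral>\<^sup>+x. ennreal ((snd (z k) x - h x)^2) \<partial>P) \<longlonglongrightarrow> 0"
    proof (rule ennreal_squeeze_zero[OF _ LIMSEQ_inverse_real_of_nat])
      show "(\<integral>\<^sup>+x. ennreal ((snd (z k) x - h x)^2) \<partial>P) <= ennreal (inverse (real (Suc k)))" for k
        unfolding nn_integral_sq_eq[OF sqi_diff[OF C0inf_sqi(1)[OF z(1)] h]] by (rule ennreal_leI[OF z(2)])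
    qed
    show "(%k. \<integral>\<^sup>+x. (\<Sum>i. ennreal ((partial i (snd (z k)) x - G i x)^2)) \<partial>P) \<longlonglongrightarrow> 0"
    proof (rule ennreal_squeeze_zero)
      fix k
      note N = nn_integral_sum_sq[where F="%i x. partial i (snd (z k)) x - G i x" and M=P, OF sqi_diff[OF C0inf_sqi(2)[OF z(1)] G] z(3)]
      show "(\<integral>\<^sup>+x. (\<Sum>i. ennreal ((partial i (snd (z k)) x - G i x)^2)) \<partial>P) <= ennreal (22 * inverse (real (Suc k)))"
        unfolding N(1) by (rule ennreal_leI[OF N(3)])
      show "(%k. 22 * inverse (real (Suc k))) \<longlonglongrightarrow> 0"
        using tendsto_mult[OF tendsto_const[of 22] LIMSEQ_inverse_real_of_nat] by simp
    qed
  qed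
  then show ?thesis by (auto simp: inS_def)
qed

text \<open>G is an arbitrary gradient field of h, so the choice made inside
  \<open>grad_energy\<close> causes no difficulty. The test fields are partial derivatives of smooth
  approximants, and completing the square shows that they lose at most \<open>s k\<close>.\<close>

lemma energy_lower:
  assumes hs: "!!n. hs n \<in> sqi P" and wc: "weak_conv \<phi> hs h" and g: "is_grad \<phi> h G"
  shows "ennreal (1/2 * \<tau>\<^sup>2 * cc) * (\<integral>\<^sup>+x. (\<Sum>i. ennreal ((G x i)^2)) \<partial>P) <= liminf (%n. Phi_n \<phi> \<tau> n (hs n))" (is "_ <= ?\<Lambda>")
proof -
  note h = is_grad_seq(1)[OF g] and G = is_grad_seq(2)[OF g] and E = is_grad_energy[OF g]
  obtain us Ns s where us: "!!k. us k \<in> C0inf (Ns k)" and s0: "s \<longlonglongrightarrow> 0"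
    and s: "!!k n. (\<Sum>i<n. (l2 P (%x. partial i (us k) x - G x i))^2) <= s k"
    using is_grad_seq(3)[OF g] by blast
  let ?g = "%i. (l2 P (%x. G x i))^2"
  have step: "ennreal (\<tau>\<^sup>2 * cc * ((1/2) * (\<Sum>i<n. ?g i) - s k)) <= ?\<Lambda>" for n k
  proof -
    let ?N = "Ns k" and ?\<xi> = "%i. partial i (us k)"
    let ?D = "%i. (l2 P (%x. partial i (us k) x - G x i))^2"
    let ?m = "max n ?N"
    have t: "testf i (?\<xi> i)" if "i < ?N" for i by (rule C0inf_testf[OF us that])
    have "- (\<Sum>i<?N. \<integral>x. h x * VV i (?\<xi> i) x \<partial>P) - (1/2) * (\<Sum>i<?N. \<integral>x. (?\<xi> i x)^2 \<partial>P)
      = (\<Sum>i<?N. - (LINT x|P. h x * VV i (?\<xi> i) x) - (1/2) * (LINT x|P. (?\<xi> i x)^2))"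
      by (simp add: sum_subtractf sum_negf sum_distrib_left)
    also have "... = (\<Sum>i<?N. (1/2) * ?g i - (1/2) * ?D i)"
    proof (intro sum.cong refl)
      fix i assume "i \<in> {..<?N}"
      then have i: "testf i (?\<xi> i)" using t by simp
      show "- (LINT x|P. h x * VV i (?\<xi> i) x) - (1/2) * (LINT x|P. (?\<xi> i x)^2) = (1/2) * ?g i - (1/2) * ?D i"
        unfolding is_grad_ibp[OF g i] by (rule inner_complete_square[OF testf_sqi[OF i] G])
    qed
    also have "... = (1/2) * (\<Sum>i<?N. ?g i - ?D i)" by (simp add: sum_distrib_left right_diff_distrib)
    \<comment> \<open>Beyond \<open>Ns k\<close> the approximant has zero partial derivatives, so
      both terms coincide and the sum can be extended past any n.\<close>
    also have "(\<Sum>i<?N. ?g i - ?D i) = (\<Sum>i<?m. ?g i - ?D i)"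
    proof (rule sum.mono_neutral_left)
      have "?D i = ?g i" if "?N <= i" for i
        using partial_beyond[OF C0infD(1)[OF us] that] by (simp add: l2_def)
      then show "\<forall>i\<in>{..<?m} - {..<?N}. ?g i - ?D i = 0" by auto
    qed auto
    finally have eq: "- (\<Sum>i<?N. \<integral>x. h x * VV i (?\<xi> i) x \<partial>P) - (1/2) * (\<Sum>i<?N. \<integral>x. (?\<xi> i x)^2 \<partial>P) = (1/2) * (\<Sum>i<?m. ?g i - ?D i)" .
    have "(\<Sum>i<n. ?g i) <= (\<Sum>i<?m. ?g i)" by (rule sum_mono2) auto
    moreover have "(\<Sum>i<?m. ?D i) <= s k" "(\<Sum>i<0. ?D i) <= s k" by (rule s)+
    ultimately have "(1/2) * (\<Sum>i<n. ?g i) - s k <= (1/2) * (\<Sum>i<?m. ?g i - ?D i)" by (simp add: sum_subtractf)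
    then have "\<tau>\<^sup>2 * cc * ((1/2) * (\<Sum>i<n. ?g i) - s k) <= \<tau>\<^sup>2 * cc * ((1/2) * (\<Sum>i<?m. ?g i - ?D i))"
      using cc_tau_pos by (intro mult_left_mono) auto
    then have "ennreal (\<tau>\<^sup>2 * cc * ((1/2) * (\<Sum>i<n. ?g i) - s k)) <= ennreal (\<tau>\<^sup>2 * cc * ((1/2) * (\<Sum>i<?m. ?g i - ?D i)))"
      by (rule ennreal_leI)
    also have "... <= ?\<Lambda>" using M1_lower[where M="?N" and \<xi>="?\<xi>", OF hs h wc t] unfolding eq .
    finally show ?thesis .
  qed
  have "ennreal (\<tau>\<^sup>2 * cc * ((1/2) * (\<Sum>i<n. ?g i) - 0)) <= ?\<Lambda>" for n
  proof (rule LIMSEQ_le_const2)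
    show "(%k. ennreal (\<tau>\<^sup>2 * cc * ((1/2) * (\<Sum>i<n. ?g i) - s k))) \<longlonglongrightarrow> ennreal (\<tau>\<^sup>2 * cc * ((1/2) * (\<Sum>i<n. ?g i) - 0))"
      by (intro tendsto_ennrealI tendsto_intros s0)
  qed (use step in blast)
  then have st: "ennreal (\<tau>\<^sup>2 * cc * ((1/2) * (\<Sum>i<n. ?g i))) <= ?\<Lambda>" for n by simp
  have "ennreal (\<tau>\<^sup>2 * cc * ((1/2) * (\<Sum>i. ?g i))) <= ?\<Lambda>"
  proof (rule LIMSEQ_le_const2)
    show "(%n. ennreal (\<tau>\<^sup>2 * cc * ((1/2) * (\<Sum>i<n. ?g i)))) \<longlonglongrightarrow> ennreal (\<tau>\<^sup>2 * cc * ((1/2) * (\<Sum>i. ?g i)))"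
      by (intro tendsto_ennrealI tendsto_intros summable_LIMSEQ E(1))
  qed (use st in blast)
  moreover have "ennreal (1/2 * \<tau>\<^sup>2 * cc) * (\<integral>\<^sup>+x. (\<Sum>i. ennreal ((G x i)^2)) \<partial>P) = ennreal (\<tau>\<^sup>2 * cc * ((1/2) * (\<Sum>i. ?g i)))"
    unfolding E(2) using cc_tau_pos by (subst ennreal_mult[symmetric]) (auto intro!: suminf_nonneg E(1) simp: mult_ac)
  ultimately show ?thesis by simp
qed

text \<open>The smooth approximants of h, traversed so slowly that for each large n the form at the
  current approximant is already below the limiting value plus a vanishing error.\<close>

lemma recovery_sequence:
  assumes g: "is_grad \<phi> h G"
  shows "\<exists>us. (\<forall>n. us n \<in> sqi P) \<and> (%n. \<integral>\<^sup>+x. ennreal ((us n x - h x)^2) \<partial>P) \<longlonglongrightarrow> 0 \<and>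
    limsup (%n. Phi_n \<phi> \<tau> n (us n)) <= ennreal (1/2 * \<tau>\<^sup>2 * cc) * (\<integral>\<^sup>+x. (\<Sum>i. ennreal ((G x i)^2)) \<partial>P)"
proof -
  note h = is_grad_seq(1)[OF g] and G = is_grad_seq(2)[OF g] and En = is_grad_energy[OF g]
  obtain hs Ns s where hs: "!!k. hs k \<in> C0inf (Ns k)" and l: "(%k. l2 P (%x. hs k x - h x)) \<longlonglongrightarrow> 0" and s0: "s \<longlonglongrightarrow> 0"
    and s: "!!k n. (\<Sum>i<n. (l2 P (%x. partial i (hs k) x - G x i))^2) <= s k"
    using is_grad_seq(3)[OF g] by blast
  let ?g = "%i. (l2 P (%x. G x i))^2"
  define E where "E = (\<Sum>i. ?g i)"
  define c0 where "c0 = \<tau>\<^sup>2 / 2 * cc"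
  have c0: "0 <= c0" using cc_tau_pos by (simp add: c0_def)
  have c0': "c0 = 1/2 * \<tau>\<^sup>2 * cc" by (simp add: c0_def)
  have E0: "0 <= E" unfolding E_def by (rule suminf_nonneg[OF En(1)]) simp
  \<comment> \<open>With Young's parameter the square root of the error, the term
    \<open>(1 + 1 / \<theta> k) * (\<theta> k)\<^sup>2\<close> equals
    \<open>(\<theta> k)\<^sup>2 + \<theta> k\<close> and vanishes. The added inverse keeps the
    parameter positive.\<close>
  define \<theta> where "\<theta> k = sqrt (s k + inverse (real (Suc k)))" for k
  define E' where "E' k = (\<Sum>i<Ns k. (l2 P (partial i (hs k)))^2)" for k
  have sn: "0 <= s k" for k using s[of k 0] by simp
  have \<theta>: "0 < \<theta> k" for k using sn[of k] by (simp add: \<theta>_def add_nonneg_pos)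
  have \<theta>0: "\<theta> \<longlonglongrightarrow> 0"
    using tendsto_real_sqrt[OF tendsto_add[OF s0 LIMSEQ_inverse_real_of_nat]] by (simp add: \<theta>_def[abs_def])
  have E'b: "E' k <= (1 + \<theta> k) * E + ((\<theta> k)^2 + \<theta> k)" for k
  proof -
    let ?D = "%i. (l2 P (%x. partial i (hs k) x - G x i))^2"
    have "E' k <= (\<Sum>i<Ns k. (1 + \<theta> k) * ?g i + (1 + 1 / \<theta> k) * ?D i)"
      unfolding E'_def
    proof (rule sum_mono)
      fix i
      show "(l2 P (partial i (hs k)))^2 <= (1 + \<theta> k) * ?g i + (1 + 1 / \<theta> k) * ?D i"
        using l2_young[OF G sqi_diff[OF C0inf_sqi(2)[OF hs] G] \<theta>, of i i k i k] by simp
    qed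
    also have "... = (1 + \<theta> k) * (\<Sum>i<Ns k. ?g i) + (1 + 1 / \<theta> k) * (\<Sum>i<Ns k. ?D i)"
      by (simp only: sum.distrib sum_distrib_left)
    also have "... <= (1 + \<theta> k) * E + (1 + 1 / \<theta> k) * (\<theta> k)^2"
    proof (intro add_mono mult_left_mono)
      show "(\<Sum>i<Ns k. ?g i) <= E" unfolding E_def by (rule sum_le_suminf[OF En(1)]) auto
      have "(\<Sum>i<Ns k. ?D i) <= s k" by (rule s)
      also have "... <= (\<theta> k)^2" using sn[of k] by (simp add: \<theta>_def)
      finally show "(\<Sum>i<Ns k. ?D i) <= (\<theta> k)^2" .
    qed (use \<theta>[of k] in auto)
    also have "... = (1 + \<theta> k) * E + ((\<theta> k)^2 + \<theta> k)" using \<theta>[of k] by (simp add: field_simps power2_eq_square)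
    finally show ?thesis .
  qed
  \<comment> \<open>The extra inverse makes the comparison with the limit of the forms strict, so
    that it holds for all large n.\<close>
  define \<beta> where "\<beta> k = c0 * ((1 + \<theta> k) * E + ((\<theta> k)^2 + \<theta> k)) + inverse (real (Suc k))" for k
  have "\<beta> \<longlonglongrightarrow> c0 * ((1 + 0) * E + (0\<^sup>2 + 0)) + 0"
    unfolding \<beta>_def[abs_def] by (intro tendsto_intros \<theta>0 LIMSEQ_inverse_real_of_nat)
  then have \<beta>l: "\<beta> \<longlonglongrightarrow> c0 * E" by simp
  have "\<forall>k. \<exists>r. \<forall>n\<ge>r. Phi_n \<phi> \<tau> n (hs k) <= ennreal (\<beta> k)"
  proof
    fix k
    obtain C where C: "C1b (hs k) (Ns k) C" using C0inf_C1b[OF hs] by blast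
    have "(%n. Phi_n \<phi> \<tau> n (hs k)) \<longlonglongrightarrow> ennreal (c0 * E' k)"
      using Phi_n_smooth_lim[OF C] by (simp only: c0_def E'_def l2_sq)
    moreover have "c0 * E' k < \<beta> k" unfolding \<beta>_def
      by (rule order.strict_trans1[OF mult_left_mono[OF E'b c0]]) simp
    moreover have "0 <= c0 * E' k" unfolding E'_def by (intro mult_nonneg_nonneg c0 sum_nonneg) auto
    ultimately have "\<forall>\<^sub>F n in sequentially. Phi_n \<phi> \<tau> n (hs k) < ennreal (\<beta> k)"
      by (intro order_tendstoD(2)) (auto simp: ennreal_less_iff)
    then show "\<exists>r. \<forall>n\<ge>r. Phi_n \<phi> \<tau> n (hs k) <= ennreal (\<beta> k)"
      unfolding eventually_sequentially by (auto intro: less_imp_le)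
  qed
  from choice[OF this] obtain r where r: "!!k n. r k <= n ==> Phi_n \<phi> \<tau> n (hs k) <= ennreal (\<beta> k)" by blast
  obtain sel where sel: "filterlim sel at_top sequentially" "!!n. r 0 <= n ==> r (sel n) <= n"
    using diagonal_selection[of r] by blast
  have "(%n. ennreal ((l2 P (%x. hs (sel n) x - h x))^2)) \<longlonglongrightarrow> ennreal (0\<^sup>2)"
    by (intro tendsto_ennrealI tendsto_power filterlim_compose[OF l sel(1)])
  then have strong: "(%n. \<integral>\<^sup>+x. ennreal ((hs (sel n) x - h x)^2) \<partial>P) \<longlonglongrightarrow> 0"
    by (simp add: nn_integral_sq_eq[OF sqi_diff[OF C0inf_sqi(1)[OF hs] h]])
  have "limsup (%n. Phi_n \<phi> \<tau> n (hs (sel n))) <= limsup (%n. ennreal (\<beta> (sel n)))"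
    by (rule Limsup_mono) (use r sel(2) in \<open>auto simp: eventually_sequentially\<close>)
  also have "... = ennreal (c0 * E)"
    by (intro lim_imp_Limsup tendsto_ennrealI filterlim_compose[OF \<beta>l sel(1)]) simp
  also have "... = ennreal (1/2 * \<tau>\<^sup>2 * cc) * (\<integral>\<^sup>+x. (\<Sum>i. ennreal ((G x i)^2)) \<partial>P)"
    unfolding En(2) E_def[symmetric] c0' by (rule ennreal_mult) (use c0 c0' E0 in auto)
  finally have "limsup (%n. Phi_n \<phi> \<tau> n (hs (sel n))) <= ennreal (1/2 * \<tau>\<^sup>2 * cc) * (\<integral>\<^sup>+x. (\<Sum>i. ennreal ((G x i)^2)) \<partial>P)" .
  then show ?thesis
    by (intro exI[of _ "%n. hs (sel n)"] conjI allI strong C0inf_sqi(1)[OF hs])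
qed

lemma grad_energy_eq:
  assumes S: "inS \<phi> h"
  shows "is_grad \<phi> h (SOME G. is_grad \<phi> h G)"
    "Phi_lim \<phi> \<tau> h = ennreal (1/2 * \<tau>\<^sup>2 * cc) * (\<integral>\<^sup>+x. (\<Sum>i. ennreal (((SOME G. is_grad \<phi> h G) x i)^2)) \<partial>P)"
proof -
  show "is_grad \<phi> h (SOME G. is_grad \<phi> h G)" using S unfolding inS_def by (rule someI_ex)
  show "Phi_lim \<phi> \<tau> h = ennreal (1/2 * \<tau>\<^sup>2 * cc) * (\<integral>\<^sup>+x. (\<Sum>i. ennreal (((SOME G. is_grad \<phi> h G) x i)^2)) \<partial>P)"
    unfolding Phi_lim_def if_P[OF S] grad_energy_def P_eq cc_def ..
qed

text \<open>A finite lower limit first forces h into the Sobolev space and then yields the sharp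
  bound; for an infinite one the claim is trivial.\<close>

lemma mosco_liminf:
  assumes hs: "!!n. inH \<phi> (hs n)" and h: "inH \<phi> h" and wc: "weak_conv \<phi> hs h"
  shows "Phi_lim \<phi> \<tau> h <= liminf (%n. Phi_n \<phi> \<tau> n (hs n))"
proof (cases "liminf (%n. Phi_n \<phi> \<tau> n (hs n))")
  case (real L)
  have hs': "hs n \<in> sqi P" for n using hs by (simp add: inH_iff)
  have "inS \<phi> h" by (rule grad_exists[OF hs' _ wc real(1)]) (use h real in \<open>simp_all add: inH_iff\<close>)
  note g = grad_energy_eq[OF this]
  show ?thesis unfolding g(2) by (rule energy_lower[OF hs' wc g(1)])
qed simp

text \<open>Outside the Sobolev space the bound is infinite and the constant sequence h
  serves.\<close>

lemma mosco_limsup: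
  assumes h: "inH \<phi> h"
  shows "\<exists>us. (\<forall>n. inH \<phi> (us n)) \<and> strong_conv \<phi> us h \<and> limsup (%n. Phi_n \<phi> \<tau> n (us n)) <= Phi_lim \<phi> \<tau> h"
proof (cases "inS \<phi> h")
  case True
  show ?thesis using recovery_sequence[OF grad_energy_eq(1)[OF True]]
    unfolding grad_energy_eq(2)[OF True] inH_iff strong_conv_def P_eq .
next
  case False
  then show ?thesis using h by (intro exI[of _ "%n. h"]) (simp add: strong_conv_def Phi_lim_def)
qed

end

theorem mainTheorem1:
  fixes \<phi> :: "real \<Rightarrow> real" and \<tau> :: real
  assumes "continuous_on UNIV \<phi>"
    and "\<forall>x. \<phi> differentiable (at x)"
    and "prob_space (target \<phi>)"
    and "integrable lborel (\<lambda>x. (deriv \<phi> x)\<^sup>2 * exp (\<phi> x))"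
    and "condH \<phi>"
    and "\<tau> > 0"
  shows "(\<forall>hs h. (\<forall>n. inH \<phi> (hs n)) \<and> inH \<phi> h \<and> weak_conv \<phi> hs h \<longrightarrow>
            liminf (\<lambda>n. Phi_n \<phi> \<tau> n (hs n)) \<ge> Phi_lim \<phi> \<tau> h)
       \<and> (\<forall>h. inH \<phi> h \<longrightarrow> (\<exists>hs. (\<forall>n. inH \<phi> (hs n)) \<and> strong_conv \<phi> hs h \<and>
            limsup (\<lambda>n. Phi_n \<phi> \<tau> n (hs n)) \<le> Phi_lim \<phi> \<tau> h))"
proof -
  have "mh \<phi> \<tau>" using assms by (intro mh.intro)
  then obtain K p \<kappa> where "mh_rate \<phi> \<tau> K p \<kappa>" using mh.rate_exists by blast
  then interpret mh_rate \<phi> \<tau> K p \<kappa> .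
  show ?thesis using mosco_liminf mosco_limsup by blast
qed

end
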